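(* Fix $m_1,m_2\in\mathbb N$, $D,L>0$, $C>0$ and $\lambda\in(0,1)$. Given any $\varepsilon>0$, there are $C''_{\boldsymbol{\mathcal L}}>0$ and $\sigma_0>L$ such that for any $\sigma>\sigma_0$ and any skew-product $F(\omega,x)=(g(\omega),f(\omega,x))$ on $\mathbb T^{m_1}\times\mathbb T^{m_2}$ as in the context, with $g$ satisfying (E) with constant $\sigma$ and (D) with constant $D$, $f$ having Lipschitz constant $L$, and (H) holding with constants $C,\lambda$, one has: (i) $d_W(\Pi F_*^t\mu_1,\Pi F_*^t\mu_2)\le C''_{\boldsymbol{\mathcal L}}\lambda_{\boldsymbol{\mathcal L}}^t+\varepsilon$ for all $t\in\mathbb N$ and all $\mu_1,\mu_2\in\Gamma_{\ell_0,a_0}$; (ii) $d_W\Big(\Pi F_*^t\mu,\ \sum_{i=1}^d\bar\rho_i(\boldsymbol\eta_0)_i\Big)\le C''_{\boldsymbol{\mathcal L}}\lambda_{\boldsymbol{\mathcal L}}^t+\varepsilon$ for all $t\in\mathbb N$ and all $\mu\in\Gamma_{\ell_0,a_0}$. Here $\lambda_{\boldsymbol{\mathcal L}}\in(0,1)$, $\ell_0$, $a_0$, $\bar\rho_i$ and the fixed point $\boldsymbol\eta_0$ of $\boldsymbol{\mathcal L}$ are as defined in the context.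
   Context: $\mathbb T=\mathbb R/\mathbb Z$, with flat Euclidean distance $|\cdot|$ on $\mathbb T^N$; $\mathcal M_1(Y)$ is the set of Borel probability measures on $Y$; $d_W$ is the 1-Wasserstein distance and $d_{TV}(\mu,\nu)=\sup_A|\mu(A)-\nu(A)|$ the total variation distance. For a measure $\mu$ on $\mathbb T^{m_1}\times\mathbb T^{m_2}$, $\Pi\mu$ is the vertical marginal (push-forward under $(\omega,x)\mapsto x$) and the horizontal marginal is the push-forward under $(\omega,x)\mapsto\omega$. Base map: $g:\mathbb T^{m_1}\to\mathbb T^{m_1}$ is a $C^2$ local diffeomorphism. There are $d\in\mathbb N$ and a partition $\{I_i\}_{i=1}^d$ of $\mathbb T^{m_1}$, each $I_i$ equal to its interior modulo a null set, such that $g_i=g|_{I_i}:I_i\to\mathbb T^{m_1}$ is invertible (and $C^2$ on the interior of $I_i$), with inverse $h_i$; write $\omega_i=h_i(\omega)$. Conditions: (E) $\sigma>1$ and $\|Dg_\omega v\|\ge\sigma\|v\|$ for all $\omega\in\mathbb T^{m_1}$, $v\in\mathbb R^{m_1}$. (D) $\frac{|Dg_{h_i(\omega)}|}{|Dg_{h_i(\omega')}|}\le e^{D|\omega-\omega'|}$ for all $\omega,\omega'\in\mathbb T^{m_1}$ and all $i$, where $|Dg_\omega|$ is the absolute value of the determinant of the differential. $\nu_g$ is the unique absolutely continuous $g$-invariant probability measure and $\rho_g$ its density. Fiber maps: $f:\mathbb T^{m_1}\times\mathbb T^{m_2}\to\mathbb T^{m_2}$ is Lipschitz with Lipschitz constant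 $L$; $f_\omega=f(\omega,\cdot)$. (H): with $\mathcal P\mu=\int_{\mathbb T^{m_1}}\rho_g(\omega)f_{\omega*}\mu\,d\omega$, one has $d_{TV}(\mathcal P^n\mu,\mathcal P^n\nu)\le C\lambda^nd_{TV}(\mu,\nu)$ for all $\mu,\nu\in\mathcal M_1(\mathbb T^{m_2})$, $n\in\mathbb N$. Operator $\boldsymbol{\mathcal L}$: $\bar\rho_i:=\nu_g(I_i)$, $\mathcal F_i:=\bar\rho_i^{-1}\int_{I_i}\rho_g(\omega)f_{\omega*}\,d\omega$, $\mathcal L_{ij}:=\bar\rho_i^{-1}\Big(\int_{I_i}\frac{\rho_g(\omega_j)}{|Dg_{\omega_j}|}d\omega\Big)\mathcal F_j$, and $\boldsymbol{\mathcal L}:(\mathcal M_1(\mathbb T^{m_2}))^d\to(\mathcal M_1(\mathbb T^{m_2}))^d$, $(\boldsymbol{\mathcal L}\boldsymbol\mu)_i:=\sum_{j=1}^d\mathcal L_{ij}(\boldsymbol\mu)_j$. $\boldsymbol\eta_0\in(\mathcal M_1(\mathbb T^{m_2}))^d$ is the (unique) fixed point, $\boldsymbol{\mathcal L}\boldsymbol\eta_0=\boldsymbol\eta_0$. Constants: $C_1$ is the diameter of $\mathbb T^{m_1}$; $p:=e^{-C_1D[\frac{3}{1-\sigma^{-1}}+1]}$; $n_0>1$ is a fixed integer, chosen in terms of $C,\lambda$ only, with $C\lambda^{n_0-1}\le\frac12$; $\lambda_{\boldsymbol{\mathcal L}}:=(1-\frac12p^{n_0})^{1/n_0}$ (this is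 a contraction rate of $\boldsymbol{\mathcal L}$ in total variation). $a_0:=\frac{D}{1-\sigma^{-1}}$ and $\ell_0:=\frac{\sigma^{-1}L+C_{a_0}(1+D)}{1-\sigma^{-1}L}$ with $C_{a}:=e^{(a+\sigma^{-1}a+D)C_1}$. $\mathcal V_a:=\{\phi:\mathbb T^{m_1}\to\mathbb R^+:\ \phi(\omega)/\phi(\omega')\le e^{a|\omega-\omega'|}\ \forall\omega,\omega'\}$. A probability measure $\mu$ on $\mathbb T^{m_1}\times\mathbb T^{m_2}$ has Lipschitz disintegration if it has a disintegration $\{\mu_\omega\}_{\omega\in\mathbb T^{m_1}}$ with respect to the partition into vertical fibres $\{\omega\}\times\mathbb T^{m_2}$ such that $\omega\mapsto\mu_\omega$ is Lipschitz from $(\mathbb T^{m_1},|\cdot|)$ to $(\mathcal M_1(\mathbb T^{m_2}),d_W)$; then $\mathrm{Lip}(\mu)=\sup_{\omega_1\ne\omega_2}\frac{d_W(\mu_{\omega_1},\mu_{\omega_2})}{|\omega_1-\omega_2|}$. $\Gamma_{\ell,a}$ is the set of Borel probability measures $\mu$ on $\mathbb T^{m_1}\times\mathbb T^{m_2}$ having Lipschitz disintegration with $\mathrm{Lip}(\mu)\le\ell$ and horizontal marginal with density in $\mathcal V_a$.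
   Formalization: Part (ii) is proved only for partitions whose cells satisfy diam(I_i) ≤ K/σ, with K>0 fixed in advance (C'' and σ_0 may depend on K); for cells scattered over the torus (ii) fails as stated. Part (i) needs no such condition. *)

theory Defs
  imports "HOL-Probability.Probability"
begin

section \<open>The flat torus\<close>

quotient_type circle = real / "\<lambda>x y. x - y \<in> \<int>"
  morphisms rep_circle to_circle
proof (intro equivpI reflpI sympI transpI)
  show "x - x \<in> \<int>" for x :: real by simp
  show "y - x \<in> \<int>" if "x - y \<in> \<int>" for x y :: real
    using Ints_minus[OF that] by simp
  show "x - z \<in> \<int>" if "x - y \<in> \<int>" "y - z \<in> \<int>" for x y z :: real
    using Ints_add[OF that] by simp
qed

lemma dist_nearest_int_le: "\<bar>z - of_int (round z)\<bar> \<le> \<bar>z - of_int m\<bar>" for z :: real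
  using round_diff_minimal[of z m] by simp

text \<open>The distance of two points of the circle is the distance of the difference of any two lifts
  to the nearest integer.\<close>

instantiation circle :: metric_space
begin

lift_definition dist_circle :: "circle \<Rightarrow> circle \<Rightarrow> real"
  is "\<lambda>x y. \<bar>(x - y) - of_int (round (x - y))\<bar>"
proof -
  fix x x' y y' :: real
  assume "x - x' \<in> \<int>" "y - y' \<in> \<int>"
  then obtain m n where mn: "x - x' = of_int m" "y - y' = of_int n"
    by (auto elim!: Ints_cases)
  then have e: "x - y = (x' - y') + of_int (m - n)" by simp
  show "\<bar>x - y - of_int (round (x - y))\<bar> = \<bar>x' - y' - of_int (round (x' - y'))\<bar>"
  proof (rule antisym)
    show "\<bar>x - y - of_int (round (x - y))\<bar> \<le> \<bar>x' - y' - of_int (round (x' - y'))\<bar>"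
      using dist_nearest_int_le[of "x - y" "round (x' - y') + (m - n)"] e by simp
    show "\<bar>x' - y' - of_int (round (x' - y'))\<bar> \<le> \<bar>x - y - of_int (round (x - y))\<bar>"
      using dist_nearest_int_le[of "x' - y'" "round (x - y) - (m - n)"] e by simp
  qed
qed

definition uniformity_circle :: "(circle \<times> circle) filter"
  where "uniformity_circle = (INF e\<in>{0<..}. principal {(x, y). dist x y < e})"

definition open_circle :: "circle set \<Rightarrow> bool"
  where "open_circle U \<longleftrightarrow> (\<forall>x\<in>U. eventually (\<lambda>(x', y). x' = x \<longrightarrow> y \<in> U) uniformity)"

instance
proof
  show "uniformity = (INF e\<in>{0<..}. principal {(x::circle, y). dist x y < e})"
    by (rule uniformity_circle_def)
  show "open U \<longleftrightarrow> (\<forall>x\<in>U. eventually (\<lambda>(x', y). x' = x \<longrightarrow> y \<in> U) uniformity)"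
    for U :: "circle set" by (rule open_circle_def)
  show "dist x y = 0 \<longleftrightarrow> x = y" for x y :: circle
  proof (transfer, rule iffI)
    fix x y :: real
    assume "\<bar>x - y - of_int (round (x - y))\<bar> = 0"
    then have "x - y = of_int (round (x - y))" by simp
    then show "x - y \<in> \<int>" by (metis Ints_of_int)
  next
    fix x y :: real
    assume "x - y \<in> \<int>"
    then obtain m where "x - y = of_int m" by (auto elim: Ints_cases)
    then show "\<bar>x - y - of_int (round (x - y))\<bar> = 0" by simp
  qed
  show "dist x y \<le> dist x z + dist y z" for x y z :: circle
  proof transfer
    fix x y z :: real
    have "\<bar>x - y - of_int (round (x - y))\<bar>
        \<le> \<bar>(x - y) - of_int (round (x - z) - round (y - z))\<bar>"
      by (rule dist_nearest_int_le)
    then show "\<bar>x - y - of_int (round (x - y))\<bar>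
        \<le> \<bar>x - z - of_int (round (x - z))\<bar> + \<bar>y - z - of_int (round (y - z))\<bar>"
      by simp
  qed
qed

end

text \<open>The torus \<open>\<T>\<^sup>m\<close> is the type \<open>'m torus\<close> with \<open>m = CARD('m)\<close>: its library metric is the
  Euclidean combination of the coordinate distances, i.e. the flat distance. The same holds for
  the product \<open>'m torus \<times> 'n torus\<close>.\<close>

type_synonym 'm torus = "(circle, 'm) vec"

definition tproj :: "real ^ 'm::finite \<Rightarrow> 'm torus"
  where "tproj x = (\<chi> i. to_circle (x $ i))"

definition haar :: "'m::finite torus measure"
  where "haar = distr (restrict_space lborel (cbox 0 1)) borel tproj"


section \<open>Smooth maps of the torus\<close>

text \<open>Since \<open>tproj\<close> is a smooth covering, regularity and differentials of a map of the torus are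
  those of its continuous lifts to Euclidean space, any two of which differ by an integer vector.\<close>

definition torus_lift :: "(real ^ 'm::finite \<Rightarrow> real ^ 'm) \<Rightarrow> ('m torus \<Rightarrow> 'm torus) \<Rightarrow> bool"
  where "torus_lift G g \<longleftrightarrow> continuous_on UNIV G \<and> (\<forall>x. tproj (G x) = g (tproj x))"

definition C2_on :: "'a::real_normed_vector set \<Rightarrow> ('a \<Rightarrow> 'b::real_normed_vector) \<Rightarrow> bool"
  where "C2_on U G \<longleftrightarrow>
    (\<exists>(G' :: 'a \<Rightarrow> 'a \<Rightarrow>\<^sub>L 'b) (G'' :: 'a \<Rightarrow> 'a \<Rightarrow>\<^sub>L ('a \<Rightarrow>\<^sub>L 'b)).
      (\<forall>x\<in>U. (G has_derivative blinfun_apply (G' x)) (at x) \<and>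
             (G' has_derivative blinfun_apply (G'' x)) (at x)) \<and>
      continuous_on U G'')"

definition C2_local_diffeo :: "('a::real_normed_vector \<Rightarrow> 'a) \<Rightarrow> bool"
  where "C2_local_diffeo G \<longleftrightarrow>
    (\<forall>x. \<exists>U H. open U \<and> x \<in> U \<and> open (G ` U) \<and> C2_on U G \<and> C2_on (G ` U) H \<and>
      (\<forall>y\<in>U. H (G y) = y))"

definition torus_C2_local_diffeo :: "('m::finite torus \<Rightarrow> 'm torus) \<Rightarrow> bool"
  where "torus_C2_local_diffeo g \<longleftrightarrow> (\<exists>G. torus_lift G g \<and> C2_local_diffeo G)"

definition torus_deriv ::
    "('m::finite torus \<Rightarrow> 'm torus) \<Rightarrow> 'm torus \<Rightarrow> real ^ 'm \<Rightarrow> real ^ 'm"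
  where "torus_deriv g \<omega> =
    (THE A. \<exists>G x. torus_lift G g \<and> tproj x = \<omega> \<and> (G has_derivative A) (at x))"

definition torus_jac :: "('m::finite torus \<Rightarrow> 'm torus) \<Rightarrow> 'm torus \<Rightarrow> real"
  where "torus_jac g \<omega> = \<bar>det (matrix (torus_deriv g \<omega>))\<bar>"


section \<open>Probability measures and distances between them\<close>

definition prob_measures :: "'a::topological_space measure set"
  where "prob_measures = {\<mu>. sets \<mu> = sets borel \<and> prob_space \<mu>}"

definition couplings ::
    "'a::topological_space measure \<Rightarrow> 'a measure \<Rightarrow> ('a \<times> 'a) measure set"
  where "couplings \<mu> \<nu> =
    {\<pi> \<in> prob_measures. distr \<pi> borel fst = \<mu> \<and> distr \<pi> borel snd = \<nu>}"

definition wasserstein :: "'a::metric_space measure \<Rightarrow> 'a measure \<Rightarrow> real"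
  where "wasserstein \<mu> \<nu> = (INF \<pi>\<in>couplings \<mu> \<nu>. \<integral>z. dist (fst z) (snd z) \<partial>\<pi>)"

definition tv_dist :: "'a::topological_space measure \<Rightarrow> 'a measure \<Rightarrow> real"
  where "tv_dist \<mu> \<nu> = (SUP A\<in>sets borel. \<bar>measure \<mu> A - measure \<nu> A\<bar>)"


section \<open>The base map\<close>

definition expanding_map :: "real \<Rightarrow> ('m::finite torus \<Rightarrow> 'm torus) \<Rightarrow> bool"
  where "expanding_map \<sigma> g \<longleftrightarrow> \<sigma> > 1 \<and> (\<forall>\<omega> v. norm (torus_deriv g \<omega> v) \<ge> \<sigma> * norm v)"

text \<open>The cells are indexed by \<open>0, \<dots>, d - 1\<close>. They are only required to be Lebesgue measurable
  (which follows from the condition on the interior), so integrals over cells below are taken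
  with respect to the completion of Haar measure.\<close>

definition full_branch_partition ::
    "('m::finite torus \<Rightarrow> 'm torus) \<Rightarrow> nat \<Rightarrow> (nat \<Rightarrow> 'm torus set) \<Rightarrow> bool"
  where "full_branch_partition g d I \<longleftrightarrow>
    disjoint_family_on I {..<d} \<and> (\<Union>i<d. I i) = UNIV \<and>
    (\<forall>i<d. I i - interior (I i) \<in> null_sets (completion haar) \<and> bij_betw g (I i) UNIV)"

definition inv_branch :: "('a \<Rightarrow> 'a) \<Rightarrow> (nat \<Rightarrow> 'a set) \<Rightarrow> nat \<Rightarrow> 'a \<Rightarrow> 'a"
  where "inv_branch g I i = inv_into (I i) g"

definition bounded_distortion ::
    "real \<Rightarrow> ('m::finite torus \<Rightarrow> 'm torus) \<Rightarrow> nat \<Rightarrow> (nat \<Rightarrow> 'm torus set) \<Rightarrow> bool"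
  where "bounded_distortion D g d I \<longleftrightarrow>
    (\<forall>i<d. \<forall>\<omega> \<omega>'. torus_jac g (inv_branch g I i \<omega>) / torus_jac g (inv_branch g I i \<omega>')
      \<le> exp (D * dist \<omega> \<omega>'))"

text \<open>\<open>\<rho>\<close> is a density of an absolutely continuous invariant probability measure \<open>density haar \<rho>\<close>.
  For expanding maps this measure exists and is unique, so \<open>\<rho>\<close> is then determined up to null
  sets; nothing below depends on the version.\<close>

definition acip_density ::
    "('m::finite torus \<Rightarrow> 'm torus) \<Rightarrow> ('m torus \<Rightarrow> real) \<Rightarrow> bool"
  where "acip_density g \<rho> \<longleftrightarrow>
    \<rho> \<in> borel_measurable borel \<and> (\<forall>\<omega>. \<rho> \<omega> \<ge> 0) \<and> prob_space (density haar \<rho>) \<and>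
    distr (density haar \<rho>) borel g = density haar \<rho>"


section \<open>The averaged fibre dynamics\<close>

text \<open>\<open>fibre_average M f \<mu>\<close> is the mixture \<open>\<integral> (f\<^sub>\<omega>)\<^sub>* \<mu> dM(\<omega>)\<close>.\<close>

definition fibre_average ::
    "'a measure \<Rightarrow> ('a \<times> 'b \<Rightarrow> 'b) \<Rightarrow> 'b::topological_space measure \<Rightarrow> 'b measure"
  where "fibre_average M f \<mu> = M \<bind> (\<lambda>\<omega>. distr \<mu> borel (\<lambda>x. f (\<omega>, x)))"

definition averaged_op ::
    "('m::finite torus \<Rightarrow> real) \<Rightarrow> ('m torus \<times> 'b \<Rightarrow> 'b) \<Rightarrow>
     'b::topological_space measure \<Rightarrow> 'b measure"
  where "averaged_op \<rho> f = fibre_average (density haar \<rho>) f"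

definition tv_contracting ::
    "real \<Rightarrow> real \<Rightarrow> ('m::finite torus \<Rightarrow> real) \<Rightarrow>
     ('m torus \<times> 'b::topological_space \<Rightarrow> 'b) \<Rightarrow> bool"
  where "tv_contracting C lam \<rho> f \<longleftrightarrow>
    (\<forall>\<mu>\<in>prob_measures. \<forall>\<nu>\<in>prob_measures. \<forall>n\<ge>1.
      tv_dist ((averaged_op \<rho> f ^^ n) \<mu>) ((averaged_op \<rho> f ^^ n) \<nu>) \<le> C * lam ^ n * tv_dist \<mu> \<nu>)"

definition cell_mass :: "('m::finite torus \<Rightarrow> real) \<Rightarrow> (nat \<Rightarrow> 'm torus set) \<Rightarrow> nat \<Rightarrow> real"
  where "cell_mass \<rho> I i = measure (completion (density haar \<rho>)) (I i)"

definition cell_op ::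
    "('m::finite torus \<Rightarrow> real) \<Rightarrow> (nat \<Rightarrow> 'm torus set) \<Rightarrow>
     ('m torus \<times> 'b \<Rightarrow> 'b) \<Rightarrow> nat \<Rightarrow> 'b::topological_space measure \<Rightarrow> 'b measure"
  where "cell_op \<rho> I f i =
    fibre_average
      (density (completion haar) (\<lambda>\<omega>. ennreal (indicator (I i) \<omega> * \<rho> \<omega> / cell_mass \<rho> I i))) f"

definition cell_weight ::
    "('m::finite torus \<Rightarrow> 'm torus) \<Rightarrow> ('m torus \<Rightarrow> real) \<Rightarrow>
     (nat \<Rightarrow> 'm torus set) \<Rightarrow> nat \<Rightarrow> nat \<Rightarrow> real"
  where "cell_weight g \<rho> I i j =
    (LINT \<omega>:I i|completion haar. \<rho> (inv_branch g I j \<omega>) / torus_jac g (inv_branch g I j \<omega>))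
      / cell_mass \<rho> I i"

definition weighted_sum ::
    "nat \<Rightarrow> (nat \<Rightarrow> real) \<Rightarrow> (nat \<Rightarrow> 'b::topological_space measure) \<Rightarrow> 'b measure"
  where "weighted_sum d c M =
    measure_of UNIV (sets borel) (\<lambda>A. \<Sum>j<d. ennreal (c j) * emeasure (M j) A)"

text \<open>A vector in \<open>(\<M>\<^sub>1(Y))\<^sup>d\<close> is a function on \<open>nat\<close> of which only the values below \<open>d\<close> matter.\<close>

definition L_op ::
    "('m::finite torus \<Rightarrow> 'm torus) \<Rightarrow> ('m torus \<Rightarrow> real) \<Rightarrow> nat \<Rightarrow>
     (nat \<Rightarrow> 'm torus set) \<Rightarrow> ('m torus \<times> 'b \<Rightarrow> 'b) \<Rightarrow>
     (nat \<Rightarrow> 'b::topological_space measure) \<Rightarrow> nat \<Rightarrow> 'b measure"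
  where "L_op g \<rho> d I f \<mu> i =
    weighted_sum d (cell_weight g \<rho> I i) (\<lambda>j. cell_op \<rho> I f j (\<mu> j))"

definition L_fixed_point ::
    "('m::finite torus \<Rightarrow> 'm torus) \<Rightarrow> ('m torus \<Rightarrow> real) \<Rightarrow> nat \<Rightarrow>
     (nat \<Rightarrow> 'm torus set) \<Rightarrow> ('m torus \<times> 'b \<Rightarrow> 'b) \<Rightarrow>
     (nat \<Rightarrow> 'b::topological_space measure) \<Rightarrow> bool"
  where "L_fixed_point g \<rho> d I f \<eta> \<longleftrightarrow>
    (\<forall>i<d. \<eta> i \<in> prob_measures \<and> L_op g \<rho> d I f \<eta> i = \<eta> i)"


section \<open>Constants\<close>

text \<open>\<open>c\<^sub>1\<close> stands for the diameter of the base torus.\<close>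

definition p_const :: "real \<Rightarrow> real \<Rightarrow> real \<Rightarrow> real"
  where "p_const c\<^sub>1 D \<sigma> = exp (- c\<^sub>1 * D * (3 / (1 - inverse \<sigma>) + 1))"

definition lambda_L :: "real \<Rightarrow> real \<Rightarrow> real \<Rightarrow> nat \<Rightarrow> real"
  where "lambda_L c\<^sub>1 D \<sigma> n\<^sub>0 = (1 - 1/2 * p_const c\<^sub>1 D \<sigma> ^ n\<^sub>0) powr (1 / real n\<^sub>0)"

definition a0_const :: "real \<Rightarrow> real \<Rightarrow> real"
  where "a0_const D \<sigma> = D / (1 - inverse \<sigma>)"

definition Ca_const :: "real \<Rightarrow> real \<Rightarrow> real \<Rightarrow> real \<Rightarrow> real"
  where "Ca_const c\<^sub>1 D \<sigma> a = exp ((a + inverse \<sigma> * a + D) * c\<^sub>1)"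

definition l0_const :: "real \<Rightarrow> real \<Rightarrow> real \<Rightarrow> real \<Rightarrow> real"
  where "l0_const c\<^sub>1 D L \<sigma> =
    (inverse \<sigma> * L + Ca_const c\<^sub>1 D \<sigma> (a0_const D \<sigma>) * (1 + D)) / (1 - inverse \<sigma> * L)"


section \<open>Measures with Lipschitz disintegration\<close>

definition log_lipschitz :: "real \<Rightarrow> ('a::metric_space \<Rightarrow> real) set"
  where "log_lipschitz a =
    {\<phi>. (\<forall>\<omega>. \<phi> \<omega> > 0) \<and> (\<forall>\<omega> \<omega>'. \<phi> \<omega> / \<phi> \<omega>' \<le> exp (a * dist \<omega> \<omega>'))}"

text \<open>The conditional measure on \<open>{\<omega>} \<times> Y\<close> is identified with the measure \<open>\<kappa> \<omega>\<close> on \<open>Y\<close>.\<close>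

definition disintegration ::
    "('a::topological_space \<times> 'b::topological_space) measure \<Rightarrow> ('a \<Rightarrow> 'b measure) \<Rightarrow> bool"
  where "disintegration \<mu> \<kappa> \<longleftrightarrow>
    (\<forall>\<omega>. \<kappa> \<omega> \<in> prob_measures) \<and>
    (\<forall>B\<in>sets borel. (\<lambda>\<omega>. emeasure (\<kappa> \<omega>) B) \<in> borel_measurable borel) \<and>
    (\<forall>A\<in>sets borel. emeasure \<mu> A = (\<integral>\<^sup>+\<omega>. emeasure (\<kappa> \<omega>) (Pair \<omega> -` A) \<partial>distr \<mu> borel fst))"

definition Gamma_meas ::
    "real \<Rightarrow> real \<Rightarrow> ('m::finite torus \<times> 'b::metric_space) measure set"
  where "Gamma_meas l a =
    {\<mu> \<in> prob_measures.
      (\<exists>\<kappa>. disintegration \<mu> \<kappa> \<and>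
        (\<forall>\<omega>\<^sub>1 \<omega>\<^sub>2. wasserstein (\<kappa> \<omega>\<^sub>1) (\<kappa> \<omega>\<^sub>2) \<le> l * dist \<omega>\<^sub>1 \<omega>\<^sub>2)) \<and>
      (\<exists>\<phi>\<in>log_lipschitz a. distr \<mu> borel fst = density haar \<phi>)}"


section \<open>The skew product\<close>

definition skew_product :: "('a \<Rightarrow> 'a) \<Rightarrow> ('a \<times> 'b \<Rightarrow> 'b) \<Rightarrow> 'a \<times> 'b \<Rightarrow> 'a \<times> 'b"
  where "skew_product g f = (\<lambda>(\<omega>, x). (g \<omega>, f (\<omega>, x)))"

definition vertical_marginal ::
    "('a \<times> 'b::topological_space) measure \<Rightarrow> 'b measure"
  where "vertical_marginal \<mu> = distr \<mu> borel snd"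

definition push_iter ::
    "('a::topological_space \<Rightarrow> 'a) \<Rightarrow> nat \<Rightarrow> 'a measure \<Rightarrow> 'a measure"
  where "push_iter F t = (\<lambda>\<mu>. distr \<mu> borel F) ^^ t"

end

theory Submission
 imports Defs
begin

text \<open>Averaging \<open>\<Psi> (g v, f p)\<close> over the ball of radius \<open>\<delta>\<close> about the base point of \<open>p\<close> defines an operator \<open>U\<close>. For
 large \<open>\<sigma>\<close> the map \<open>g\<close> spreads such a ball evenly over the torus, so \<open>U\<^sup>n\<^sup>+\<^sup>1\<close> dominates a fixed fraction of the
 \<open>n\<close>-th power of the averaged operator of (H), and \<open>U\<close> contracts oscillations at a rate that depends neither on
 \<open>\<sigma>\<close> nor on \<open>\<delta>\<close>. A translation of the base lifts through \<open>g\<^sup>k\<close> to a map close to the identity whose Jacobian is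
 controlled by (D); hence the iterates of a measure in \<open>\<Gamma>\<close> change little under small translations of the base,
 and against such measures \<open>\<Psi> \<circ> F\<close> and \<open>U \<Psi>\<close> have the same integral up to \<open>O(\<delta>)\<close>. Following \<open>F\<close> by \<open>U\<close> during
 finitely many steps gives (i). For (ii), the marginal of the fixed point is also the vertical marginal of the mixture
 of the products of \<open>\<F>\<^sub>j \<eta>\<^sub>j\<close> with the image under \<open>g\<close> of normalised Haar measure on the cell \<open>I\<^sub>j\<close>; these
 products lie in \<open>\<Gamma>\<close>, and their mixture is invariant up to \<open>O(1/\<sigma>)\<close> because the cells have diameter
 \<open>O(1/\<sigma>)\<close>. Since \<open>\<lambda>\<^sub>L \<ge> 1/2\<close>, the finitely many initial times only affect the constant.\<close>

section \<open>The torus as a quotient of Euclidean space\<close>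

text \<open>The constants must be uniform over all admissible systems, although the number and the
  shape of the cells are uncontrolled; hence every estimate is in terms of \<open>D\<close>,
  \<open>L\<close>, the dimensions and the data of (H), and \<open>2 * D\<close> replaces
  \<open>a0_const D \<sigma>\<close>, which it bounds once \<sigma> is at least 2. The obstacle is
  that \<Psi> composed with \<open>F\<close> oscillates in the base at a scale that shrinks as
  \<sigma> grows. Test functions are therefore only measurable in the base and Lipschitz in the
  fibre, and all regularity in the base is asked of the measures. The quantifiers are resolved in a
  fixed order: \<epsilon> fixes finitely many Lipschitz tests, hence a Lipschitz constant and a
  tolerance; (H) fixes the contraction rate of \<open>U\<close>, hence a number \<open>T\<close> of
  steps; \<open>T\<close> fixes \<delta>; only then is \<sigma> taken large enough for
  \<open>g\<close> to spread a \<delta>-ball and for the cells to be small. The number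
  \<open>n\<^sub>0\<close> splits as \<open>n\<^sub>0 - 1\<close> steps of the averaged operator,
  which halve oscillations, and one step of \<open>U\<close> that forgets the base point.\<close>

lemma to_circle_rep [simp]: "to_circle (rep_circle c) = c"
 by (rule Quotient3_abs_rep[OF Quotient3_circle])

lemma to_circle_eq_iff: "to_circle x = to_circle y \<longleftrightarrow> x - y \<in> \<int>"
 by (rule circle.abs_eq_iff)

lemma dist_to_circle:
 "dist (to_circle x) (to_circle y) = \<bar>(x - y) - of_int (round (x - y))\<bar>"
 by (rule dist_circle.abs_eq)

lemma dist_circle_le_half: "dist (c :: circle) c' \<le> 1/2"
proof -
 have "dist (to_circle (rep_circle c)) (to_circle (rep_circle c')) \<le> 1/2"
  unfolding dist_to_circle by (metis abs_minus_commute of_int_round_abs_le)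
 then show ?thesis by simp
qed

text \<open>Moving a representative by the integer nearest to the difference realises the circle
  distance on the line, so metric questions can be settled on lifts.\<close>

lemma circle_lift_close:
 obtains y where "to_circle y = c" "\<bar>x - y\<bar> = dist (to_circle x) c"
proof -
 define r where "r = rep_circle c"
 have c: "to_circle r = c" by (simp add: r_def)
 show thesis
 proof (rule that[of "r + of_int (round (x - r))"])
  show "to_circle (r + of_int (round (x - r))) = c"
   by (simp add: c[symmetric] to_circle_eq_iff)
  show "\<bar>x - (r + of_int (round (x - r)))\<bar> = dist (to_circle x) c"
   by (simp add: c[symmetric] dist_to_circle algebra_simps)
 qed
qed

definition int_vecs :: "(real ^ 'm::finite) set" where
 "int_vecs = {n. \<forall>i. n $ i \<in> \<int>}"

lemma int_vecs_uminus: "a \<in> int_vecs ==> - a \<in> int_vecs"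
 and int_vecs_0 [simp]: "0 \<in> int_vecs"
 by (auto simp: int_vecs_def)

lemma countable_int_vecs: "countable (int_vecs :: (real ^ 'm::finite) set)"
proof -
 have "int_vecs \<subseteq> range (\<lambda>n :: int ^ 'm. (\<chi> i. real_of_int (n $ i)) :: real ^ 'm)"
 proof
  fix x :: "real ^ 'm" assume "x \<in> int_vecs"
  then have "\<forall>i. \<exists>k. x $ i = of_int k" by (auto simp: int_vecs_def elim: Ints_cases)
  then obtain k where "\<And>i. x $ i = of_int (k i)" by metis
  then show "x \<in> range (\<lambda>n :: int ^ 'm. (\<chi> i. real_of_int (n $ i)) :: real ^ 'm)"
   by (intro image_eqI[of _ _ "\<chi> i. k i"]) (auto simp: vec_eq_iff)
 qed
 then show ?thesis by (rule countable_subset) simp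
qed

lemma tproj_eq_iff: "tproj x = tproj y \<longleftrightarrow> x - y \<in> int_vecs"
 by (simp add: tproj_def vec_eq_iff to_circle_eq_iff int_vecs_def)

lemma tproj_add_int [simp]: "n \<in> int_vecs ==> tproj (x + n) = tproj x"
 by (simp add: tproj_eq_iff)

text \<open>A section of \<open>tproj\<close> without any continuity. Maps defined through it make
  sense on the torus because they are equivariant under \<open>int_vecs\<close>.\<close>

definition trep :: "'m::finite torus => real ^ 'm" where
 "trep \<o> = (\<chi> i. rep_circle (\<o> $ i))"

lemma tproj_trep [simp]: "tproj (trep \<o>) = \<o>"
 by (simp add: tproj_def trep_def vec_eq_iff)

text \<open>The coordinates can be lifted independently, and both metrics are the same Euclidean
  combination of the coordinate distances.\<close>

lemma tproj_lift_close:
 fixes x :: "real ^ 'm::finite"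
 obtains y where "tproj y = \<o>" "dist x y = dist (tproj x) \<o>"
proof -
 have "\<forall>i. \<exists>y. to_circle y = \<o> $ i \<and> \<bar>x $ i - y\<bar> = dist (to_circle (x $ i)) (\<o> $ i)"
  by (metis circle_lift_close)
 then obtain y where y: "\<And>i. to_circle (y i) = \<o> $ i"
  "\<And>i. \<bar>x $ i - y i\<bar> = dist (to_circle (x $ i)) (\<o> $ i)" by metis
 show thesis
 proof (rule that[of "\<chi> i. y i"])
  show "tproj (\<chi> i. y i) = \<o>" by (simp add: tproj_def vec_eq_iff y)
  show "dist x (\<chi> i. y i) = dist (tproj x) \<o>"
   unfolding dist_vec_def using y by (simp add: tproj_def dist_real_def)
 qed
qed

lemma dist_tproj_le: "dist (tproj x) (tproj y) \<le> dist x y"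
 unfolding dist_vec_def
proof (rule L2_set_mono)
 fix i
 show "dist (tproj x $ i) (tproj y $ i) \<le> dist (x $ i) (y $ i)"
  using dist_nearest_int_le[of "x $ i - y $ i" 0]
  by (simp add: tproj_def dist_to_circle dist_real_def)
qed simp

lemma continuous_on_tproj [continuous_intros]:
 fixes f :: "'a::topological_space => real ^ 'm::finite"
 shows "continuous_on S f ==> continuous_on S (\<lambda>x. tproj (f x))"
proof -
 have "continuous_on UNIV (tproj :: real ^ 'm => _)"
  unfolding continuous_on_iff
  by (metis dist_tproj_le le_less_trans dist_commute)
 then show "continuous_on S f ==> continuous_on S (\<lambda>x. tproj (f x))"
  using continuous_on_compose2[of UNIV tproj S f] by simp
qed

lemma measurable_tproj [measurable]: "tproj \<in> borel_measurable borel"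
 by (intro borel_measurable_continuous_onI continuous_on_tproj continuous_on_id)

lemma open_image_tproj:
 assumes "open U" shows "open (tproj ` U)"
 unfolding open_dist
proof safe
 fix x assume "x \<in> U"
 then obtain e where e: "e > 0" "ball x e \<subseteq> U" using assms openE by blast
 show "\<exists>e>0. \<forall>y. dist y (tproj x) < e \<longrightarrow> y \<in> tproj ` U"
 proof (intro exI[of _ e] conjI allI impI e)
  fix \<o> assume "dist \<o> (tproj x) < e"
  moreover obtain y where "tproj y = \<o>" "dist x y = dist (tproj x) \<o>" by (rule tproj_lift_close)
  ultimately show "\<o> \<in> tproj ` U"
   using e(2) by (auto simp: subset_eq dist_commute)
 qed
qed

lemma tproj_cube: "\<exists>n\<in>int_vecs. \<forall>i. 0 \<le> (x + n) $ i \<and> (x + n) $ i < 1" for x :: "real ^ 'm::finite"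
proof (intro bexI[of _ "\<chi> i. - of_int \<lfloor>x $ i\<rfloor>"] allI)
 show "(\<chi> i. - of_int \<lfloor>x $ i\<rfloor>) \<in> (int_vecs :: (real ^ 'm) set)"
  by (simp add: int_vecs_def)
 show "0 \<le> (x + (\<chi> i. - of_int \<lfloor>x $ i\<rfloor>)) $ i \<and> (x + (\<chi> i. - of_int \<lfloor>x $ i\<rfloor>)) $ i < 1" for i
  using floor_correct[of "x $ i"] by simp linarith
qed

lemma tproj_image_cbox: "tproj ` cbox 0 1 = (UNIV :: 'm::finite torus set)"
proof (rule UNIV_eq_I[symmetric])
 fix \<o> :: "'m torus"
 obtain n :: "real ^ 'm" where n: "n \<in> int_vecs" "\<And>i. 0 \<le> (trep \<o> + n) $ i \<and> (trep \<o> + n) $ i < 1"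
  using tproj_cube[of "trep \<o>"] by blast
 then have "trep \<o> + n \<in> cbox 0 1" by (simp add: mem_box_cart less_imp_le)
 moreover have "tproj (trep \<o> + n) = \<o>" using n(1) by simp
 ultimately show "\<o> \<in> tproj ` cbox 0 1" by (metis imageI)
qed

lemma compact_UNIV_torus: "compact (UNIV :: 'm::finite torus set)"
 unfolding tproj_image_cbox[symmetric]
 by (intro compact_continuous_image continuous_on_tproj continuous_on_id compact_cbox)

lemma dist_torus_le: "dist (\<o> :: 'm::finite torus) \<o>' \<le> CARD('m)"
proof -
 have "dist \<o> \<o>' \<le> (\<Sum>i\<in>UNIV. dist (\<o> $ i) (\<o>' $ i))"
  unfolding dist_vec_def by (rule L2_set_le_sum) simp
 also have "\<dots> \<le> (\<Sum>i\<in>(UNIV::'m set). 1)"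
  by (intro sum_mono order.trans[OF dist_circle_le_half]) simp
 finally show ?thesis by simp
qed

section \<open>Second countability of the torus\<close>

lemma topological_basis_open_image:
 fixes f :: "'a::topological_space => 'b::topological_space"
 assumes B: "topological_basis B" and f: "continuous_on UNIV f" "surj f"
  and op: "\<And>U. open U ==> open (f ` U)"
 shows "topological_basis ((`) f ` B)"
proof (rule topological_basisI)
 show "open B'" if "B' \<in> (`) f ` B" for B'
 proof -
  obtain A where "A \<in> B" "B' = f ` A" using \<open>B' \<in> (`) f ` B\<close> by (rule imageE) simp
  then show ?thesis using op[OF topological_basis_open[OF B]] by simp
 qed
 fix V :: "'b set" and y assume V: "open V" "y \<in> V"
 obtain x where x: "y = f x" using f(2) by (rule surjE)
 have "open (f -` V)" by (rule open_vimage[OF V(1) f(1)])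
 moreover have "x \<in> f -` V" using x V(2) by simp
 ultimately obtain A where "A \<in> B" "x \<in> A" "A \<subseteq> f -` V"
  by (rule topological_basisE[OF B])
 then show "\<exists>B'\<in>(`) f ` B. y \<in> B' \<and> B' \<subseteq> V"
  using x by (intro bexI[of _ "f ` A"]) auto
qed

text \<open>Second countability identifies the Borel sets of a product of tori with the product
  sigma-algebra; every use of Fubini below rests on this.\<close>

instance circle :: second_countable_topology
proof
 obtain B :: "real set set" where B: "countable B" "topological_basis B"
  using ex_countable_basis by blast
 have "topological_basis ((`) to_circle ` B)"
 proof (rule topological_basis_open_image[OF B(2)])
  have *: "dist (to_circle x) (to_circle y) \<le> dist x y" for x y
   using dist_nearest_int_le[of "x - y" 0] by (simp add: dist_to_circle dist_real_def)
  show "continuous_on UNIV to_circle"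
   unfolding continuous_on_iff by (metis * le_less_trans dist_commute)
  show "surj to_circle" by (metis surjI to_circle_rep)
  fix U :: "real set" assume "open U"
  show "open (to_circle ` U)"
   unfolding open_dist
  proof safe
   fix x assume "x \<in> U"
   then obtain e where e: "e > 0" "ball x e \<subseteq> U" using \<open>open U\<close> openE by blast
   have "c \<in> to_circle ` U" if "dist c (to_circle x) < e" for c
   proof -
    obtain y where "to_circle y = c" "\<bar>x - y\<bar> = dist (to_circle x) c"
     by (rule circle_lift_close)
    with that e(2) show ?thesis by (auto simp: subset_eq dist_real_def dist_commute)
   qed
   with e(1) show "\<exists>e>0. \<forall>y. dist y (to_circle x) < e \<longrightarrow> y \<in> to_circle ` U" by blast
  qed
 qed
 then have "open = generate_topology ((`) to_circle ` B)"
  by (rule topological_basis_imp_subbasis)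
 then show "\<exists>B::circle set set. countable B \<and> open = generate_topology B"
  using B(1) countable_image by blast
qed

instance vec :: ("{metric_space, second_countable_topology}", finite) second_countable_topology
proof
 obtain B :: "'a set set" where B: "countable B" "topological_basis B"
  using ex_countable_basis by blast
 define C where "C = (\<lambda>F :: 'b => 'a set. {x :: ('a, 'b) vec. \<forall>i. x $ i \<in> F i}) ` (PiE UNIV (\<lambda>_. B))"
 have "countable C"
  unfolding C_def by (intro countable_image countable_PiE) (use B in auto)
 moreover
 have "topological_basis C"
 proof (rule topological_basisI)
  show "open B'" if "B' \<in> C" for B'
  proof -
   obtain F where "F \<in> PiE UNIV (\<lambda>_. B)" and F2: "B' = {x. \<forall>i. x $ i \<in> F i}"
    using \<open>B' \<in> C\<close> unfolding C_def by (rule imageE) simp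
   then have F: "\<And>i. F i \<in> B" by (meson PiE_mem UNIV_I)
   have "\<forall>i. open (F i)" using F topological_basis_open[OF B(2)] by blast
   then have "open (\<Inter>i\<in>UNIV. (\<lambda>x :: ('a, 'b) vec. x $ i) -` F i)"
    by (intro open_INT finite_UNIV ballI open_vimage_vec_nth) auto
   also have "(\<Inter>i\<in>UNIV. (\<lambda>x :: ('a, 'b) vec. x $ i) -` F i) = B'" by (auto simp: F2)
   finally show ?thesis .
  qed
  fix V :: "('a, 'b) vec set" and y assume V: "open V" "y \<in> V"
  then obtain A where A: "\<And>i. open (A i) \<and> y $ i \<in> A i" "\<And>z. (\<forall>i. z $ i \<in> A i) ==> z \<in> V"
   unfolding open_vec_def by blast
  have D: "\<exists>D\<in>B. y $ i \<in> D \<and> D \<subseteq> A i" for i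
   proof -
   have "open (A i)" "y $ i \<in> A i" using A(1) by auto
   then obtain D where "D \<in> B" "y $ i \<in> D" "D \<subseteq> A i"
    by (rule topological_basisE[OF B(2)])
   then show ?thesis by auto
  qed
  define F where "F = (\<lambda>i. SOME D. D \<in> B \<and> y $ i \<in> D \<and> D \<subseteq> A i)"
  have F: "F i \<in> B \<and> y $ i \<in> F i \<and> F i \<subseteq> A i" for i
   unfolding F_def by (rule someI_ex) (use D[of i] in blast)
  have "F \<in> PiE UNIV (\<lambda>_. B)" using F by (simp add: PiE_UNIV_domain Pi_iff)
  then have "{x :: ('a, 'b) vec. \<forall>i. x $ i \<in> F i} \<in> C" unfolding C_def by (rule imageI)
  moreover have "y \<in> {x. \<forall>i. x $ i \<in> F i}"
  proof (intro CollectI allI)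
   show "y $ i \<in> F i" for i using F[of i] by simp
  qed
  moreover have "{x. \<forall>i. x $ i \<in> F i} \<subseteq> V"
  proof (intro subsetI A(2) allI)
   fix x i assume "x \<in> {x. \<forall>i. x $ i \<in> F i}"
   then have "x $ i \<in> F i" by simp
   then show "x $ i \<in> A i" using F[of i] by (meson subsetD)
  qed
  ultimately show "\<exists>B'\<in>C. y \<in> B' \<and> B' \<subseteq> V" by (intro bexI conjI)
 qed
 then have "open = generate_topology C"
  by (rule topological_basis_imp_subbasis)
 ultimately show "\<exists>B::('a, 'b) vec set set. countable B \<and> open = generate_topology B"
  by blast
qed

section \<open>Change of variables for diffeomorphisms of Euclidean space\<close>

text \<open>The library states the change of variables formula only for index types of class
 \<open>wellorder\<close>. Every finite type has a well-ordered copy, to which determinants and Lebesgue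
 measure are transported.\<close>

typedef 'm idx = "{..<CARD('m::finite)}"
 by (rule exI[of _ 0]) simp

instance idx :: (finite) finite
proof
 have "finite (Rep_idx -` {..<CARD('a)} :: 'a idx set)"
  by (rule finite_vimageI) (auto simp: inj_on_def Rep_idx_inject)
 moreover have "Rep_idx -` {..<CARD('a)} = (UNIV :: 'a idx set)"
  using Rep_idx by auto
 ultimately show "finite (UNIV :: 'a idx set)" by simp
qed

instantiation idx :: (finite) wellorder
begin

definition less_eq_idx :: "'a idx => 'a idx => bool" where "x \<le> y \<longleftrightarrow> Rep_idx x \<le> Rep_idx y"
definition less_idx :: "'a idx => 'a idx => bool" where "x < y \<longleftrightarrow> Rep_idx x < Rep_idx y"

instance
proof
 fix P :: "'a idx => bool" and a
 assume step: "\<And>x. (\<And>y. y < x ==> P y) ==> P x"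
 show "P a"
  by (induction a rule: measure_induct_rule[of Rep_idx]) (use step in "simp add: less_idx_def")
qed (auto simp: less_eq_idx_def less_idx_def Rep_idx_inject)

end

lemma card_idx: "CARD('m::finite idx) = CARD('m)"
 using type_definition.card[OF type_definition_idx] by simp

text \<open>Relabelling rows and columns by the same bijection conjugates the permutations in the
  Leibniz formula, and conjugation preserves the sign.\<close>

lemma det_reindex:
 fixes A :: "real ^ 'm::finite ^ 'm" and e :: "'k::finite => 'm"
 assumes e: "bij e"
 shows "det (\<chi> k l. A $ e k $ e l) = det A"
proof -
 have e': "bij_betw e UNIV UNIV" "inj e" using e by (auto simp: bij_is_inj)
 have inv_mp: "map_permutation UNIV (inv e) (map_permutation UNIV e p) = p" if "p permutes UNIV" for p
  by (rule map_permutation_compose_inv[OF e'(1) that]) (simp add: e'(2))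
 have inv_mp': "map_permutation UNIV e (map_permutation UNIV (inv e) p) = p" if "p permutes UNIV" for p
  by (rule map_permutation_compose_inv[OF _ that, of "inv e"])
   (use e in "auto simp: bij_imp_bij_inv surj_f_inv_f bij_is_surj")
 have perm: "map_permutation UNIV e p permutes UNIV" if "p permutes UNIV" for p
  by (rule map_permutation_permutes[OF e'(1) that])
 have perm': "map_permutation UNIV (inv e) p permutes UNIV" if "p permutes UNIV" for p
  by (rule map_permutation_permutes[OF _ that]) (use e in "simp add: bij_imp_bij_inv")
 have "det A = (\<Sum>p | p permutes UNIV. of_int (sign p) * (\<Prod>i\<in>UNIV. A $ i $ p i))"
  unfolding det_def ..
 also have "\<dots> = (\<Sum>p | p permutes (UNIV :: 'k set).
   of_int (sign (map_permutation UNIV e p)) * (\<Prod>i\<in>UNIV. A $ i $ (map_permutation UNIV e p) i))"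
  by (rule sum.reindex_bij_witness[where i = "map_permutation UNIV e" and j = "map_permutation UNIV (inv e)"])
   (auto simp: inv_mp inv_mp' perm perm')
 also have "\<dots> = (\<Sum>p | p permutes (UNIV :: 'k set).
   of_int (sign p) * (\<Prod>k\<in>UNIV. A $ e k $ e (p k)))"
 proof (rule sum.cong[OF refl])
  fix p assume "p \<in> {p. p permutes (UNIV :: 'k set)}"
  then have p: "p permutes UNIV" by simp
  have "sign (map_permutation UNIV e p) = sign p"
   using sign_map_permutation[OF e'(2) p] by simp
  moreover have "(\<Prod>i\<in>UNIV. A $ i $ (map_permutation UNIV e p) i)
    = (\<Prod>k\<in>UNIV. A $ e k $ (map_permutation UNIV e p) (e k))"
   by (rule prod.reindex_bij_betw[OF e'(1), symmetric])
  ultimately show "of_int (sign (map_permutation UNIV e p)) * (\<Prod>i\<in>UNIV. A $ i $ (map_permutation UNIV e p) i)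
    = of_int (sign p) * (\<Prod>k\<in>UNIV. A $ e k $ e (p k))"
   by (simp add: map_permutation_apply[OF e'(2)])
 qed
 finally show ?thesis by (simp add: det_def)
qed

text \<open>It suffices that the push-forward under \<open>G\<close> of the measure with density
  |det G'| gives each open box its volume. The preimage of a box is open and bounded, so the formula
  for the measure of an injective differentiable image applies to it.\<close>

lemma nn_integral_substitution_wellorder:
 fixes G H :: "real ^ 'n::{finite,wellorder} => real ^ 'n::{finite,wellorder}"
 assumes der: "\<And>x. (G has_derivative G' x) (at x)"
  and HG: "\<And>x. H (G x) = x" and GH: "\<And>y. G (H y) = y"
  and contH: "continuous_on UNIV H"
  and contd: "continuous_on UNIV (\<lambda>x. det (matrix (G' x)))"
  and chi: "\<phi> \<in> borel_measurable borel"
 shows "(\<integral>\<^sup>+x. ennreal \<bar>det (matrix (G' x))\<bar> * \<phi> (G x) \<partial>lborel) = (\<integral>\<^sup>+y. \<phi> y \<partial>lborel)"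
proof -
 define J where "J = (\<lambda>x. \<bar>det (matrix (G' x))\<bar>)"
 have contG: "continuous_on UNIV G"
  using der has_derivative_continuous by (metis continuous_at_imp_continuous_on)
 have contJ: "continuous_on S J" for S
  unfolding J_def by (intro continuous_on_rabs continuous_on_subset[OF contd]) auto
 have mJ [measurable]: "J \<in> borel_measurable borel"
  by (intro borel_measurable_continuous_onI contJ)
 have mG [measurable]: "G \<in> borel_measurable borel"
  by (intro borel_measurable_continuous_onI contG)
 have "lborel = distr (density lborel (\<lambda>x. ennreal (J x))) borel G"
 proof (rule lborel_eqI)
  fix l u :: "real ^ 'n::_" assume lu: "\<And>b. b \<in> Basis ==> l \<bullet> b \<le> u \<bullet> b"
  define S where "S = G -` box l u"
  have SH: "S = H ` box l u" unfolding S_def using HG GH by (auto simp: image_iff) (metis HG)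
  have GS: "G ` S = box l u" unfolding S_def using GH by (auto simp: image_iff) (metis GH)
  have oS: "open S" unfolding S_def by (rule open_vimage[OF open_box contG])
  have mS [measurable]: "S \<in> sets borel" using oS by simp
  \<comment> \<open>Boundedness of the preimage \<open>S\<close> comes from compactness of the image
    of the closed box under \<open>H\<close>; it makes the continuous Jacobian integrable on
    \<open>S\<close>.\<close>
  have "compact (H ` cbox l u)"
   by (rule compact_continuous_image[OF continuous_on_subset[OF contH]]) auto
  then obtain a b where ab: "H ` cbox l u \<subseteq> cbox a b"
   using bounded_subset_cbox_symmetric compact_imp_bounded by metis
  have "S \<subseteq> cbox a b" using ab box_subset_cbox[of l u] unfolding SH by blast
  then have "J absolutely_integrable_on S"
   by (intro set_integrable_subset[OF absolutely_integrable_continuous[OF contJ[of "cbox a b"]]])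
    (use oS in auto)
  then have intJ: "J integrable_on S" by (rule set_lebesgue_integral_eq_integral(1))
  have eq: "measure lebesgue (G ` S) = integral S (\<lambda>x. \<bar>det (matrix (G' x))\<bar>)"
  proof (rule measure_differentiable_image_eq)
   show "S \<in> sets lebesgue" using oS by (simp add: borel_open)
   show "(G has_derivative G' x) (at x within S)" for x
    by (rule has_derivative_at_withinI[OF der])
   show "inj_on G S" by (metis HG inj_onI)
   show "(\<lambda>x. \<bar>det (matrix (G' x))\<bar>) integrable_on S" using intJ by (simp add: J_def)
  qed
  have "emeasure (distr (density lborel (\<lambda>x. ennreal (J x))) borel G) (box l u)
    = (\<integral>\<^sup>+x. ennreal (J x) * indicator S x \<partial>lborel)"
  proof -
   have "emeasure (distr (density lborel (\<lambda>x. ennreal (J x))) borel G) (box l u)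
     = emeasure (density lborel (\<lambda>x. ennreal (J x))) S"
    by (subst emeasure_distr) (auto simp: S_def)
   also have "\<dots> = (\<integral>\<^sup>+x. ennreal (J x) * indicator S x \<partial>lborel)"
    by (rule emeasure_density) auto
   finally show ?thesis .
  qed
  also have "\<dots> = (\<integral>\<^sup>+x. ennreal (if x \<in> S then J x else 0) \<partial>lborel)"
   by (intro nn_integral_cong) (auto simp: indicator_def)
  also have "\<dots> = ennreal (integral S J)"
  proof (rule nn_integral_has_integral_lborel)
   have [measurable]: "S \<in> sets borel" using oS by simp
   show "(\<lambda>x. if x \<in> S then J x else 0) \<in> borel_measurable borel" by measurable
   show "0 \<le> (if x \<in> S then J x else 0)" for x by (simp add: J_def)
   show "((\<lambda>x. if x \<in> S then J x else 0) has_integral integral S J) UNIV"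
    unfolding has_integral_restrict_UNIV using intJ by (rule integrable_integral)
  qed
  also have "integral S J = measure lebesgue (box l u)" using eq GS by (simp add: J_def)
  also have "ennreal \<dots> = (\<Prod>b\<in>Basis. (u - l) \<bullet> b)"
   using lu by (simp add: measure_lborel_box_eq box_eq_empty)
  finally show "emeasure (distr (density lborel (\<lambda>x. ennreal (J x))) borel G) (box l u)
    = (\<Prod>b\<in>Basis. (u - l) \<bullet> b)" .
 qed simp
 then have "(\<integral>\<^sup>+y. \<phi> y \<partial>lborel) = (\<integral>\<^sup>+y. \<phi> y \<partial>distr (density lborel (\<lambda>x. ennreal (J x))) borel G)"
  by simp
 also have "\<dots> = (\<integral>\<^sup>+x. ennreal (J x) * \<phi> (G x) \<partial>lborel)"
  using chi by (subst nn_integral_distr) (auto simp: nn_integral_density)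
 finally show ?thesis by (simp add: J_def)
qed

lemma prod_Basis_vec: "(\<Prod>b\<in>Basis. (x :: real ^ 'm::finite) \<bullet> b) = (\<Prod>i\<in>UNIV. x $ i)"
proof -
 have "(Basis :: (real ^ 'm) set) = range (\<lambda>i. axis i 1)"
  by (auto simp: Basis_vec_def)
 moreover have "inj (\<lambda>i. axis i (1 :: real) :: real ^ 'm)" by (auto simp: inj_on_def axis_eq_axis)
 then have "(\<Prod>b\<in>range (\<lambda>i. axis i 1). x \<bullet> b) = (\<Prod>i\<in>UNIV. x \<bullet> axis i 1)"
  by (simp only: prod.reindex o_def)
 ultimately show ?thesis by (simp add: inner_axis)
qed

lemma mem_box_vec: "(x :: real ^ 'm::finite) \<in> box l u \<longleftrightarrow> (\<forall>i. l $ i < x $ i \<and> x $ i < u $ i)"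
 by (simp add: mem_box_cart)

text \<open>Relabelling coordinates maps boxes to boxes with the same side lengths, which
  characterises Lebesgue measure.\<close>

lemma nn_integral_lborel_reindex:
 fixes \<phi> :: "real ^ 'k::finite => ennreal"
 assumes e: "bij (e :: 'k => 'm::finite)" and [measurable]: "\<phi> \<in> borel_measurable borel"
 shows "(\<integral>\<^sup>+x. \<phi> (\<chi> k. x $ e k) \<partial>lborel) = (\<integral>\<^sup>+y. \<phi> y \<partial>lborel)"
proof -
 define R where "R = (\<lambda>x :: real ^ 'm. \<chi> k. x $ e k)"
 have "continuous_on UNIV R" unfolding R_def by (intro continuous_intros)
 then have [measurable]: "R \<in> borel_measurable borel" by (rule borel_measurable_continuous_onI)
 have "lborel = distr lborel borel R"
 proof (rule lborel_eqI)
  fix l u :: "real ^ 'k" assume lu: "\<And>b. b \<in> Basis ==> l \<bullet> b \<le> u \<bullet> b"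
  define l' u' where "l' = (\<chi> i. l $ inv e i)" and "u' = (\<chi> i. u $ inv e i)"
  have "l \<bullet> axis k 1 \<le> u \<bullet> axis k 1" for k by (rule lu) (auto simp: Basis_vec_def)
  then have lu': "l $ k \<le> u $ k" for k by (simp add: inner_axis)
  have "R -` box l u = box l' u'"
   using e by (auto simp: mem_box_vec R_def l'_def u'_def)
    (metis bij_inv_eq_iff)+
  then have "emeasure (distr lborel borel R) (box l u) = emeasure lborel (box l' u')"
   by (subst emeasure_distr) auto
  also have "\<dots> = (\<Prod>b\<in>Basis. (u' - l') \<bullet> b)"
   by (rule emeasure_lborel_box) (use lu' in "auto simp: Basis_vec_def inner_axis l'_def u'_def")
  also have "(\<Prod>b\<in>Basis. (u' - l') \<bullet> b) = (\<Prod>i\<in>UNIV. u $ inv e i - l $ inv e i)"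
   unfolding prod_Basis_vec by (simp add: l'_def u'_def)
  also have "\<dots> = (\<Prod>k\<in>UNIV. u $ k - l $ k)"
   by (rule prod.reindex_bij_betw) (use e bij_imp_bij_inv in blast)
  also have "\<dots> = (\<Prod>b\<in>Basis. (u - l) \<bullet> b)" unfolding prod_Basis_vec by simp
  finally show "emeasure (distr lborel borel R) (box l u) = (\<Prod>b\<in>Basis. (u - l) \<bullet> b)" .
 qed simp
 then have "(\<integral>\<^sup>+y. \<phi> y \<partial>lborel) = (\<integral>\<^sup>+y. \<phi> y \<partial>distr lborel borel R)" by simp
 also have "\<dots> = (\<integral>\<^sup>+x. \<phi> (R x) \<partial>lborel)" by (subst nn_integral_distr) auto
 finally show ?thesis by (simp add: R_def)
qed

lemma nn_integral_substitution_diffeo: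
 fixes G H :: "real ^ 'm::finite => real ^ 'm"
 assumes der: "\<And>x. (G has_derivative G' x) (at x)"
  and HG: "\<And>x. H (G x) = x" and GH: "\<And>y. G (H y) = y"
  and contH: "continuous_on UNIV H"
  and contd: "continuous_on UNIV (\<lambda>x. det (matrix (G' x)))"
  and chi [measurable]: "\<phi> \<in> borel_measurable borel"
 shows "(\<integral>\<^sup>+x. ennreal \<bar>det (matrix (G' x))\<bar> * \<phi> (G x) \<partial>lborel) = (\<integral>\<^sup>+y. \<phi> y \<partial>lborel)"
proof -
 obtain e :: "'m idx => 'm" where "bij_betw e UNIV UNIV"
  using finite_same_card_bij[of "UNIV :: 'm idx set" "UNIV :: 'm set"] card_idx[where 'm = 'm] by auto
 then have e: "bij e" .
 have ei [simp]: "e (inv e i) = i" "inv e (e k) = k" for i k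
  using e by (simp_all add: bij_is_inj bij_is_surj surj_f_inv_f)
 define R where "R = (\<lambda>x :: real ^ 'm. (\<chi> k. x $ e k) :: real ^ 'm idx)"
 define Ri where "Ri = (\<lambda>x :: real ^ 'm idx. (\<chi> i. x $ inv e i) :: real ^ 'm)"
 have RRi [simp]: "R (Ri x) = x" "Ri (R y) = y" for x y by (simp_all add: R_def Ri_def vec_eq_iff)
 have linR: "linear R" "linear Ri" by (auto simp: R_def Ri_def linear_iff vec_eq_iff)
 have bR: "bounded_linear R" "bounded_linear Ri" using linR by (simp_all add: linear_conv_bounded_linear)
 have contR: "continuous_on S R" "continuous_on S' Ri" for S S'
  using bR by (simp_all add: linear_continuous_on)
 have mR [measurable]: "R \<in> borel_measurable borel" "Ri \<in> borel_measurable borel"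
  by (intro borel_measurable_continuous_onI contR)+
 have contG: "continuous_on UNIV G"
  using der has_derivative_continuous by (metis continuous_at_imp_continuous_on)
 have mG [measurable]: "G \<in> borel_measurable borel"
  by (intro borel_measurable_continuous_onI contG)
 have md [measurable]: "(\<lambda>x. det (matrix (G' x))) \<in> borel_measurable borel"
  by (intro borel_measurable_continuous_onI contd)
 \<comment> \<open>\<open>Ri\<close> sends standard basis vectors to standard basis vectors, so the
   conjugated derivative has the relabelled matrix.\<close>
 have detR: "det (matrix (\<lambda>v. R (G' x (Ri v)))) = det (matrix (G' x))" for x
 proof -
  have axis: "Ri (axis l 1) = axis (e l) 1" for l
  proof -
   have "l = inv e i \<longleftrightarrow> e l = i" for i using ei by metis
   then show ?thesis by (auto simp: Ri_def vec_eq_iff axis_def)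
  qed
  have "matrix (\<lambda>v. R (G' x (Ri v))) = (\<chi> k l. matrix (G' x) $ e k $ e l)"
   by (simp add: matrix_def R_def axis vec_eq_iff)
  then show ?thesis by (simp add: det_reindex[OF e])
 qed
 have "(\<integral>\<^sup>+z. ennreal \<bar>det (matrix (\<lambda>v. R (G' (Ri z) (Ri v))))\<bar> * \<phi> (Ri (R (G (Ri z)))) \<partial>lborel)
   = (\<integral>\<^sup>+y. \<phi> (Ri y) \<partial>lborel)"
 proof (rule nn_integral_substitution_wellorder[where H = "\<lambda>y. R (H (Ri y))"])
  show "((\<lambda>z. R (G (Ri z))) has_derivative (\<lambda>v. R (G' (Ri z) (Ri v)))) (at z)" for z
  proof -
   have "(Ri has_derivative Ri) (at z)" by (rule bounded_linear_imp_has_derivative[OF bR(2)])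
   then have "((\<lambda>z. G (Ri z)) has_derivative (\<lambda>v. G' (Ri z) (Ri v))) (at z)"
    using has_derivative_compose[OF _ der, of Ri Ri z UNIV] by simp
   then show ?thesis by (rule bounded_linear.has_derivative[OF bR(1)])
  qed
  show "continuous_on UNIV (\<lambda>y. R (H (Ri y)))"
   by (intro continuous_on_compose2[OF contR(1), of UNIV] continuous_on_compose2[OF contH] contR) auto
  show "continuous_on UNIV (\<lambda>x. det (matrix (\<lambda>v. R (G' (Ri x) (Ri v)))))"
   unfolding detR by (intro continuous_on_compose2[OF contd] contR) auto
 qed (simp_all add: HG GH)
 then have "(\<integral>\<^sup>+z. ennreal \<bar>det (matrix (G' (Ri z)))\<bar> * \<phi> (G (Ri z)) \<partial>lborel) = (\<integral>\<^sup>+y. \<phi> (Ri y) \<partial>lborel)"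
  by (simp add: detR)
 moreover have Ri: "(\<integral>\<^sup>+y. f (Ri y) \<partial>lborel) = (\<integral>\<^sup>+x. f x \<partial>lborel)"
  if [measurable]: "f \<in> borel_measurable borel" for f
  using nn_integral_lborel_reindex[OF bij_imp_bij_inv[OF e], of f] by (simp add: Ri_def)
 have "(\<integral>\<^sup>+z. ennreal \<bar>det (matrix (G' (Ri z)))\<bar> * \<phi> (G (Ri z)) \<partial>lborel)
   = (\<integral>\<^sup>+x. ennreal \<bar>det (matrix (G' x))\<bar> * \<phi> (G x) \<partial>lborel)"
  by (rule Ri) measurable
 moreover have "(\<integral>\<^sup>+y. \<phi> (Ri y) \<partial>lborel) = (\<integral>\<^sup>+y. \<phi> y \<partial>lborel)"
  by (rule Ri) measurable
 ultimately show ?thesis by (simp only:)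
qed

section \<open>Integration over the torus\<close>

lemma sets_haar [simp, measurable_cong]: "sets (haar :: 'm::finite torus measure) = sets borel"
 by (simp add: haar_def)

lemma space_haar [simp]: "space haar = UNIV" by (simp add: haar_def)

lemma nn_integral_haar_cbox:
 assumes [measurable]: "\<phi> \<in> borel_measurable borel"
 shows "(\<integral>\<^sup>+\<o>. \<phi> \<o> \<partial>haar) = (\<integral>\<^sup>+x. \<phi> (tproj x) * indicator (cbox 0 1) x \<partial>lborel)"
proof -
 have "tproj \<in> restrict_space lborel (cbox 0 1) \<rightarrow>\<^sub>M borel"
  by (rule measurable_restrict_space1) simp
 then show ?thesis
  unfolding haar_def by (subst nn_integral_distr) (auto simp: nn_integral_restrict_space)
qed

text \<open>Half-open, so that every point has exactly one integer translate in it; it differs from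
  the closed cube in the definition of \<open>haar\<close> by a null set.\<close>

definition unit_cube :: "(real ^ 'm::finite) set" where
 "unit_cube = {x. \<forall>i. 0 \<le> x $ i \<and> x $ i < 1}"

lemma unit_cube_measurable [measurable]: "unit_cube \<in> sets borel"
 unfolding unit_cube_def by measurable

lemma AE_unit_cube: "AE x in lborel. x \<in> cbox 0 1 \<longleftrightarrow> x \<in> (unit_cube :: (real ^ 'm::finite) set)"
proof (rule AE_I)
 show "{x \<in> space lborel. \<not> (x \<in> cbox 0 1 \<longleftrightarrow> x \<in> unit_cube)} \<subseteq> cbox 0 1 - box (0 :: real ^ 'm) 1"
  by (auto simp: mem_box_cart unit_cube_def less_imp_le)
 have "emeasure lborel (cbox 0 1 - box (0 :: real ^ 'm) 1)
   = emeasure lborel (cbox 0 (1 :: real ^ 'm)) - emeasure lborel (box 0 (1 :: real ^ 'm))"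
  by (rule emeasure_Diff) (auto simp: emeasure_lborel_box_eq box_subset_cbox)
 then show "emeasure lborel (cbox 0 1 - box (0 :: real ^ 'm) 1) = 0"
  by (simp add: emeasure_lborel_box_eq emeasure_lborel_cbox_eq)
 show "cbox 0 1 - box (0 :: real ^ 'm) 1 \<in> sets lborel" by simp
qed

lemma nn_integral_haar:
 assumes [measurable]: "\<phi> \<in> borel_measurable borel"
 shows "(\<integral>\<^sup>+\<o>. \<phi> \<o> \<partial>haar) = (\<integral>\<^sup>+x. \<phi> (tproj x) * indicator unit_cube x \<partial>lborel)"
 unfolding nn_integral_haar_cbox[OF assms]
 by (rule nn_integral_cong_AE) (use AE_unit_cube in eventually_elim, simp add: indicator_def)

lemma emeasure_haar_UNIV: "emeasure haar (UNIV :: 'm::finite torus set) = 1"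
proof -
 have "emeasure haar (UNIV :: 'm torus set) = (\<integral>\<^sup>+\<o>. 1 \<partial>(haar :: 'm torus measure))" by simp
 also have "\<dots> = emeasure lborel (cbox 0 (1 :: real ^ 'm))"
  by (subst nn_integral_haar_cbox) auto
 also have "\<dots> = 1"
 proof -
  have "(1 :: real ^ 'm) \<bullet> b = 1" if "b \<in> Basis" for b
   using that by (auto simp: Basis_vec_def inner_axis)
  then show ?thesis by (simp add: emeasure_lborel_cbox_eq)
 qed
 finally show ?thesis .
qed

interpretation haar: prob_space haar
 by (rule prob_spaceI) (simp add: emeasure_haar_UNIV)

lemma unit_cube_unique_translate:
 "\<exists>!n. n \<in> int_vecs \<and> x + n \<in> (unit_cube :: (real ^ 'm::finite) set)"
proof -
 obtain n where n: "n \<in> int_vecs" "x + n \<in> unit_cube"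
  using tproj_cube[of x] by (auto simp: unit_cube_def)
 moreover have "n' = n" if "n' \<in> int_vecs" "x + n' \<in> unit_cube" for n'
 proof -
  have "n' $ i = n $ i" for i
  proof -
   have "n' $ i - n $ i \<in> \<int>" using n(1) that(1) by (auto simp: int_vecs_def)
   moreover have "\<bar>n' $ i - n $ i\<bar> < 1"
    using n(2) that(2) by (auto simp: unit_cube_def abs_less_iff algebra_simps)
     (smt (verit, best))+
   ultimately show ?thesis using Ints_nonzero_abs_ge1[of "n' $ i - n $ i"] by force
  qed
  then show ?thesis by (simp add: vec_eq_iff)
 qed
 ultimately show ?thesis by blast
qed

lemma nn_integral_lborel_translate:
 fixes \<phi> :: "'a::euclidean_space => ennreal"
 assumes [measurable]: "\<phi> \<in> borel_measurable borel"
 shows "(\<integral>\<^sup>+x. \<phi> (x + n) \<partial>lborel) = (\<integral>\<^sup>+x. \<phi> x \<partial>lborel)"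
proof -
 have "(\<integral>\<^sup>+x. \<phi> x \<partial>lborel) = (\<integral>\<^sup>+x. \<phi> x \<partial>distr lborel borel ((+) n))"
  by (simp add: lborel_distr_plus)
 also have "\<dots> = (\<integral>\<^sup>+x. \<phi> (n + x) \<partial>lborel)" by (subst nn_integral_distr) auto
 finally show ?thesis by (simp add: add.commute)
qed

lemma nn_integral_count_space_unique:
 assumes "\<exists>!n. n \<in> A \<and> P n"
 shows "(\<integral>\<^sup>+n. indicator {n. P n} n \<partial>count_space A) = 1"
proof -
 obtain n where n: "n \<in> A" "P n" "\<And>k. k \<in> A ==> P k ==> k = n" using assms by blast
 have "(\<integral>\<^sup>+k. indicator {n. P n} k \<partial>count_space A) = (\<integral>\<^sup>+k. indicator {n} k \<partial>count_space A)"
 proof (rule nn_integral_cong)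
  fix k assume "k \<in> space (count_space A)"
  then have "P k \<longleftrightarrow> k = n" using n(2) n(3)[of k] by auto
  then show "indicator {n. P n} k = (indicator {n} k :: ennreal)" by (simp add: indicator_def)
 qed
 also have "\<dots> = 1" using n(1) by (subst nn_integral_indicator) auto
 finally show ?thesis .
qed

lemma nn_integral_translates_unique:
 assumes "\<And>x :: real ^ 'm::finite. \<exists>!n. n \<in> int_vecs \<and> x + n \<in> S"
 shows "(\<integral>\<^sup>+n. indicator S (x + n) \<partial>count_space int_vecs) = (1 :: ennreal)"
proof -
 have "(\<integral>\<^sup>+n. indicator S (x + n) \<partial>count_space int_vecs) = (\<integral>\<^sup>+n. indicator {n. x + n \<in> S} n \<partial>count_space int_vecs)"
  by (rule nn_integral_cong) (simp add: indicator_def)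
 also have "\<dots> = 1" by (rule nn_integral_count_space_unique) (rule assms)
 finally show ?thesis .
qed

text \<open>Unfolding: insert the sum over integer translates of the indicator of the cube, which is
  1, exchange sum and integral and translate back. The factor \<open>\<phi> (tproj x)\<close> is
  periodic and stays, while \<open>\<psi>\<close> is replaced by the sum of its translates.\<close>

lemma nn_integral_haar_unfold:
 fixes \<phi> :: "'m::finite torus => ennreal" and \<psi> :: "real ^ 'm => ennreal"
 assumes [measurable]: "\<phi> \<in> borel_measurable borel" "\<psi> \<in> borel_measurable borel"
 shows "(\<integral>\<^sup>+x. \<phi> (tproj x) * \<psi> x \<partial>lborel)
  = (\<integral>\<^sup>+x. \<phi> (tproj x) * (\<integral>\<^sup>+n. \<psi> (x + n) \<partial>count_space int_vecs) * indicator unit_cube x \<partial>lborel)"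
proof -
 define Z where "Z = (int_vecs :: (real ^ 'm) set)"
 have cZ: "countable Z" unfolding Z_def by (rule countable_int_vecs)
 have bij: "bij_betw uminus Z Z"
  by (rule bij_betwI[where g = uminus]) (auto simp: Z_def int_vecs_uminus)
 have one: "(\<integral>\<^sup>+n. indicator unit_cube (x + n) \<partial>count_space Z) = 1" for x :: "real ^ 'm"
  unfolding Z_def by (rule nn_integral_translates_unique[OF unit_cube_unique_translate])
 have "(\<integral>\<^sup>+x. \<phi> (tproj x) * \<psi> x \<partial>lborel)
   = (\<integral>\<^sup>+x. \<integral>\<^sup>+n. \<phi> (tproj x) * \<psi> x * indicator unit_cube (x + n) \<partial>count_space Z \<partial>lborel)"
  by (simp add: nn_integral_cmult one)
 also have "\<dots> = (\<integral>\<^sup>+n. \<integral>\<^sup>+x. \<phi> (tproj x) * \<psi> x * indicator unit_cube (x + n) \<partial>lborel \<partial>count_space Z)"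
  by (rule nn_integral_count_space_nn_integral[OF cZ]) simp
 also have "\<dots> = (\<integral>\<^sup>+n. \<integral>\<^sup>+x. \<phi> (tproj x) * \<psi> (x + - n) * indicator unit_cube x \<partial>lborel \<partial>count_space Z)"
 proof (rule nn_integral_cong)
  fix n assume "n \<in> space (count_space Z)"
  then have n: "n \<in> int_vecs" by (simp add: Z_def)
  have "(\<integral>\<^sup>+x. \<phi> (tproj x) * \<psi> (x + - n) * indicator unit_cube x \<partial>lborel)
    = (\<integral>\<^sup>+x. \<phi> (tproj (x + n)) * \<psi> (x + n + - n) * indicator unit_cube (x + n) \<partial>lborel)"
   by (rule nn_integral_lborel_translate[symmetric]) simp
  then show "(\<integral>\<^sup>+x. \<phi> (tproj x) * \<psi> x * indicator unit_cube (x + n) \<partial>lborel)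
    = (\<integral>\<^sup>+x. \<phi> (tproj x) * \<psi> (x + - n) * indicator unit_cube x \<partial>lborel)"
   using n by simp
 qed
 also have "\<dots> = (\<integral>\<^sup>+n. \<integral>\<^sup>+x. \<phi> (tproj x) * \<psi> (x + n) * indicator unit_cube x \<partial>lborel \<partial>count_space Z)"
  using nn_integral_bij_count_space[OF bij,
    of "\<lambda>n. \<integral>\<^sup>+x. \<phi> (tproj x) * \<psi> (x + n) * indicator unit_cube x \<partial>lborel"]
  by simp
 also have "\<dots> = (\<integral>\<^sup>+x. \<integral>\<^sup>+n. \<phi> (tproj x) * \<psi> (x + n) * indicator unit_cube x \<partial>count_space Z \<partial>lborel)"
  by (rule nn_integral_count_space_nn_integral[OF cZ, symmetric]) simp
 also have "\<dots> = (\<integral>\<^sup>+x. \<phi> (tproj x) * (\<integral>\<^sup>+n. \<psi> (x + n) \<partial>count_space Z) * indicator unit_cube x \<partial>lborel)"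
  by (simp add: nn_integral_cmult nn_integral_multc)
 finally show ?thesis by (simp add: Z_def)
qed

text \<open>Any exact Borel fundamental domain computes Haar integrals. It is applied to translates
  of the cube and to images of the cube under equivariant homeomorphisms.\<close>

lemma nn_integral_fundamental_domain:
 fixes \<phi> :: "'m::finite torus => ennreal"
 assumes [measurable]: "\<phi> \<in> borel_measurable borel" "S \<in> sets borel"
  and S: "\<And>x. \<exists>!n. n \<in> int_vecs \<and> x + n \<in> S"
 shows "(\<integral>\<^sup>+x. \<phi> (tproj x) * indicator S x \<partial>lborel) = (\<integral>\<^sup>+\<o>. \<phi> \<o> \<partial>haar)"
 by (subst nn_integral_haar_unfold) (simp_all add: nn_integral_translates_unique[OF S] nn_integral_haar)

text \<open>A map commuting with integer translations sends the cube to another fundamental domain.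
  Changing variables costs the inverse Jacobian, which is at most \<open>exp s\<close>.\<close>

lemma nn_integral_haar_diffeo_le:
 fixes \<phi> :: "'m::finite torus => ennreal" and \<Theta> \<Theta>i :: "real ^ 'm => real ^ 'm"
 assumes der: "\<And>x. (\<Theta> has_derivative \<Theta>' x) (at x)"
  and inv: "\<And>x. \<Theta>i (\<Theta> x) = x" "\<And>y. \<Theta> (\<Theta>i y) = y"
  and conti: "continuous_on UNIV \<Theta>i"
  and contd: "continuous_on UNIV (\<lambda>x. det (matrix (\<Theta>' x)))"
  and per: "\<And>x n. n \<in> int_vecs ==> \<Theta> (x + n) = \<Theta> x + n"
  and low: "\<And>x. exp (- s) \<le> \<bar>det (matrix (\<Theta>' x))\<bar>"
  and \<theta>: "\<And>x. \<theta> (tproj x) = tproj (\<Theta> x)" and [measurable]: "\<theta> \<in> borel_measurable borel"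
  and chi [measurable]: "\<phi> \<in> borel_measurable borel"
 shows "(\<integral>\<^sup>+\<o>. \<phi> (\<theta> \<o>) \<partial>haar) \<le> ennreal (exp s) * (\<integral>\<^sup>+\<o>. \<phi> \<o> \<partial>haar)"
proof -
 have md [measurable]: "(\<lambda>x. det (matrix (\<Theta>' x))) \<in> borel_measurable borel"
  by (intro borel_measurable_continuous_onI contd)
 have mi [measurable]: "\<Theta>i \<in> borel_measurable borel"
  by (intro borel_measurable_continuous_onI conti)
 have contT: "continuous_on UNIV \<Theta>"
  using der has_derivative_continuous by (metis continuous_at_imp_continuous_on)
 have mT [measurable]: "\<Theta> \<in> borel_measurable borel"
  by (intro borel_measurable_continuous_onI contT)
 \<comment> \<open>This is the image of the cube under \<Theta>, written as a preimage under the
   inverse so that measurability is immediate.\<close>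
 define S where "S = \<Theta>i -` unit_cube"
 have mS [measurable]: "S \<in> sets borel"
  unfolding S_def using measurable_sets_borel[OF mi unit_cube_measurable] by simp
 have Si: "\<Theta> x \<in> S \<longleftrightarrow> x \<in> unit_cube" for x by (simp add: S_def inv)
 have "\<exists>!n. n \<in> int_vecs \<and> x + n \<in> S" for x
 proof -
  have "x + n \<in> S \<longleftrightarrow> \<Theta>i x + n \<in> unit_cube" if "n \<in> int_vecs" for n
   using Si[of "\<Theta>i x + n"] per[OF that, of "\<Theta>i x"] by (simp add: inv)
  then show ?thesis using unit_cube_unique_translate[of "\<Theta>i x"] by (simp cong: conj_cong)
 qed
 note fd = nn_integral_fundamental_domain[OF chi mS this]
 have "(\<integral>\<^sup>+\<o>. \<phi> (\<theta> \<o>) \<partial>haar) = (\<integral>\<^sup>+x. \<phi> (tproj (\<Theta> x)) * indicator unit_cube x \<partial>lborel)"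
  by (subst nn_integral_haar) (simp_all add: \<theta>)
 also have "\<dots> \<le> (\<integral>\<^sup>+x. ennreal (exp s) * (ennreal \<bar>det (matrix (\<Theta>' x))\<bar> *
   (\<phi> (tproj (\<Theta> x)) * indicator S (\<Theta> x))) \<partial>lborel)"
 proof (rule nn_integral_mono)
  fix x
  have "1 \<le> exp s * \<bar>det (matrix (\<Theta>' x))\<bar>"
   using mult_left_mono[OF low[of x], of "exp s"] by (simp add: exp_minus_inverse)
  then have "1 \<le> ennreal (exp s) * ennreal \<bar>det (matrix (\<Theta>' x))\<bar>"
   by (simp add: ennreal_mult[symmetric] flip: ennreal_1)
  from mult_right_mono[OF this, of "\<phi> (tproj (\<Theta> x)) * indicator unit_cube x"]
  show "\<phi> (tproj (\<Theta> x)) * indicator unit_cube x \<le> ennreal (exp s) * (ennreal \<bar>det (matrix (\<Theta>' x))\<bar> *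
   (\<phi> (tproj (\<Theta> x)) * indicator S (\<Theta> x)))"
   by (simp add: Si indicator_def mult.assoc)
 qed
 also have "\<dots> = ennreal (exp s) * (\<integral>\<^sup>+x. ennreal \<bar>det (matrix (\<Theta>' x))\<bar> *
   (\<phi> (tproj (\<Theta> x)) * indicator S (\<Theta> x)) \<partial>lborel)"
  by (rule nn_integral_cmult) simp
 also have "(\<integral>\<^sup>+x. ennreal \<bar>det (matrix (\<Theta>' x))\<bar> * (\<phi> (tproj (\<Theta> x)) * indicator S (\<Theta> x)) \<partial>lborel)
   = (\<integral>\<^sup>+y. \<phi> (tproj y) * indicator S y \<partial>lborel)"
  by (rule nn_integral_substitution_diffeo[OF der inv conti contd]) simp
 finally show ?thesis unfolding fd .
qed

section \<open>The lift of the base map\<close>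

text \<open>Discrete values on a connected space. This makes the difference of two lifts, and the
  effect of an integer translation on one lift, independent of the point.\<close>

lemma continuous_int_vecs_constant:
 fixes f :: "real ^ 'm::finite => real ^ 'k::finite"
 assumes "continuous_on UNIV f" "\<And>x. f x \<in> int_vecs"
 shows "f x = f y"
proof -
 have "(\<lambda>x. f x $ i) constant_on UNIV" for i
 proof (rule continuous_discrete_range_constant)
  show "continuous_on UNIV (\<lambda>x. f x $ i)" by (intro continuous_intros assms(1))
  fix x
  have "1 \<le> norm (f y $ i - f x $ i)" if "f y $ i \<noteq> f x $ i" for y
   using Ints_nonzero_abs_ge1[of "f y $ i - f x $ i"] assms(2)[of y] assms(2)[of x] that
   by (simp add: int_vecs_def)
  then show "\<exists>e>0. \<forall>y. y \<in> UNIV \<and> f y $ i \<noteq> f x $ i \<longrightarrow> e \<le> norm (f y $ i - f x $ i)"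
   by (intro exI[of _ 1]) auto
 qed (rule convex_connected[OF convex_UNIV])
 then have "f x $ i = f y $ i" for i unfolding constant_on_def by (metis UNIV_I)
 then show ?thesis by (simp add: vec_eq_iff)
qed

text \<open>The set of agreement is open because \<open>G\<close> is locally injective, the set of
  disagreement because the space is Hausdorff; connectedness of \<open>T\<close> leaves only one of
  them.\<close>

lemma sections_agree:
 fixes G :: "'a::t2_space => 'b::topological_space"
 assumes T: "open T" "connected T"
  and loc: "\<And>x. \<exists>U. open U \<and> x \<in> U \<and> inj_on G U"
  and h1: "continuous_on T h1" "\<And>y. y \<in> T ==> G (h1 y) = y"
  and h2: "continuous_on T h2" "\<And>y. y \<in> T ==> G (h2 y) = y"
  and y0: "y0 \<in> T" "h1 y0 = h2 y0" and y: "y \<in> T"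
 shows "h1 y = h2 y"
proof (rule ccontr)
 assume ne: "h1 y \<noteq> h2 y"
 define E where "E = {z \<in> T. h1 z = h2 z}"
 define N where "N = {z \<in> T. h1 z \<noteq> h2 z}"
 have "open E"
 proof (subst open_subopen, rule ballI)
  fix z assume z: "z \<in> E"
  obtain U where U: "open U" "h1 z \<in> U" "inj_on G U" using loc by blast
  define W where "W = (T \<inter> h1 -` U) \<inter> (T \<inter> h2 -` U)"
  have "open (T \<inter> h1 -` U)" "open (T \<inter> h2 -` U)"
   using continuous_open_preimage[OF h1(1) T(1) U(1)] continuous_open_preimage[OF h2(1) T(1) U(1)]
   by auto
  then have "open W" unfolding W_def by (rule open_Int)
  moreover have "z \<in> W" using z U(2) by (simp add: W_def E_def)
  moreover have "W \<subseteq> E"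
  proof
   fix w assume w: "w \<in> W"
   then have "G (h1 w) = G (h2 w)" using h1(2) h2(2) by (simp add: W_def)
   then have "h1 w = h2 w" using w inj_onD[OF U(3)] by (simp add: W_def)
   then show "w \<in> E" using w by (simp add: W_def E_def)
  qed
  ultimately show "\<exists>W. open W \<and> z \<in> W \<and> W \<subseteq> E" by blast
 qed
 moreover have "open N"
 proof (subst open_subopen, rule ballI)
  fix z assume z: "z \<in> N"
  then have "h1 z \<noteq> h2 z" by (simp add: N_def)
  from hausdorff[OF this] obtain A B
   where AB: "open A" "open B" "h1 z \<in> A" "h2 z \<in> B" "A \<inter> B = {}" by (elim exE conjE)
  define W where "W = (T \<inter> h1 -` A) \<inter> (T \<inter> h2 -` B)"
  have "open (T \<inter> h1 -` A)" "open (T \<inter> h2 -` B)"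
   using continuous_open_preimage[OF h1(1) T(1) AB(1)] continuous_open_preimage[OF h2(1) T(1) AB(2)]
   by auto
  then have "open W" unfolding W_def by (rule open_Int)
  moreover have "z \<in> W" using z AB by (simp add: W_def N_def)
  moreover have "W \<subseteq> N"
  proof
   fix w assume w: "w \<in> W"
   then have "h1 w \<in> A" "h2 w \<in> B" by (simp_all add: W_def)
   then have "h1 w \<noteq> h2 w" using AB(5) by auto
   then show "w \<in> N" using w by (simp add: W_def N_def)
  qed
  ultimately show "\<exists>W. open W \<and> z \<in> W \<and> W \<subseteq> N" by blast
 qed
 moreover have "E \<inter> N \<inter> T = {}" by (auto simp: E_def N_def)
 moreover have "T \<subseteq> E \<union> N" by (auto simp: E_def N_def)
 ultimately have "E \<inter> T = {} \<or> N \<inter> T = {}" by (rule connectedD[OF T(2)])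
 moreover have "y0 \<in> E \<inter> T" using y0 by (simp add: E_def)
 moreover have "y \<in> N \<inter> T" using y ne by (simp add: N_def)
 ultimately show False by auto
qed

text \<open>A local homeomorphism whose local inverses live on balls of a fixed radius is a covering of
 the simply connected space, hence a homeomorphism.\<close>

lemma uniform_local_inverses_imp_homeomorphism:
 fixes G :: "'a::euclidean_space => 'a"
 assumes contG: "continuous_on UNIV G"
  and inj: "\<And>x. \<exists>U. open U \<and> x \<in> U \<and> inj_on G U"
  and r: "r > 0"
  and sec: "\<And>x. \<exists>h. continuous_on (ball (G x) r) h \<and> h (G x) = x \<and> (\<forall>y\<in>ball (G x) r. G (h y) = y)"
 obtains H where "continuous_on UNIV H" "\<And>x. H (G x) = x" "\<And>y. G (H y) = y"
proof -
 obtain h where h: "\<And>x. continuous_on (ball (G x) r) (h x)" "\<And>x. h x (G x) = x"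
  "\<And>x y. y \<in> ball (G x) r ==> G (h x y) = y"
  using sec by metis
 \<comment> \<open>A ball of radius \<open>r\<close> about every value lies in the range; since
   \<open>r\<close> is uniform, the range also contains its limit points. Being open, closed and
   nonempty it is everything.\<close>
 have "open (range G)"
 proof (subst open_subopen, rule ballI)
  fix y assume "y \<in> range G"
  then obtain x where x: "y = G x" by blast
  have "z \<in> range G" if "z \<in> ball y r" for z
   using h(3)[of z x] that by (metis x rangeI)
  then show "\<exists>T. open T \<and> y \<in> T \<and> T \<subseteq> range G"
   using r by (intro exI[of _ "ball y r"]) auto
 qed
 moreover have "closed (range G)"
  unfolding closure_subset_eq[symmetric]
 proof
  fix y assume "y \<in> closure (range G)"
  then have "\<exists>z\<in>range G. dist z y < r" using r unfolding closure_approachable by blast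
  then obtain x where "dist (G x) y < r" by auto
  then have "G (h x y) = y" by (intro h(3)) simp
  then show "y \<in> range G" by (metis rangeI)
 qed
 ultimately have surjG: "range G = UNIV" using clopen[of "range G"] by auto
 have cov: "covering_space UNIV G UNIV"
 proof (rule covering_spaceI[OF contG surjG])
  fix y :: 'a
  \<comment> \<open>The sheets over the ball: one image of a local inverse for each preimage of the
    centre.\<close>
  define v where "v = (\<lambda>x. h x ` ball y r) ` (G -` {y})"
  have hy: "continuous_on (ball y r) (h x)" "h x y = x" "\<And>t. t \<in> ball y r ==> G (h x t) = t"
   if "G x = y" for x using h[of x] h(3)[of _ x] that by auto
  have "\<Union>v = UNIV \<inter> G -` ball y r"
  proof (intro equalityI subsetI)
   fix z assume "z \<in> \<Union>v"
   then obtain x t where "G x = y" "t \<in> ball y r" "z = h x t" by (auto simp: v_def)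
   then show "z \<in> UNIV \<inter> G -` ball y r" using hy(3) by simp
  next
   fix z assume "z \<in> UNIV \<inter> G -` ball y r"
   then have z: "G z \<in> ball y r" by simp
   define x where "x = h z y"
   have yz: "y \<in> ball (G z) r" using z by (simp add: dist_commute)
   have x: "G x = y" unfolding x_def by (rule h(3)[OF yz])
   \<comment> \<open>The overlap of two balls is convex, hence connected, and contains both centres.
     On it the local inverse at \<open>z\<close> and the one at \<open>x\<close> agree, so
     \<open>z\<close> lies on the sheet of \<open>x\<close>.\<close>
   define T where "T = ball y r \<inter> ball (G z) r"
   have "h x (G z) = h z (G z)"
   proof (rule sections_agree[where T = T and G = G and ?y0.0 = y and y = "G z" and ?h1.0 = "h x" and ?h2.0 = "h z"])
    show "open T" "connected T"
     unfolding T_def by (auto intro!: convex_connected convex_Int)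
    show "continuous_on T (h x)" "continuous_on T (h z)"
     using hy(1)[OF x] h(1)[of z] by (auto simp: T_def intro: continuous_on_subset)
    show "G (h x t) = t" "G (h z t) = t" if "t \<in> T" for t
     using that hy(3)[OF x] h(3)[of t z] by (auto simp: T_def)
    show "y \<in> T" "G z \<in> T" using z yz r by (auto simp: T_def)
    show "h x y = h z y" using hy(2)[OF x] by (simp add: x_def)
   qed (rule inj)
   then have "z = h x (G z)" using h(2) by simp
   then have "z \<in> h x ` ball y r" using z by (metis imageI)
   then show "z \<in> \<Union>v" using x by (auto simp: v_def)
  qed
  moreover have "\<forall>u\<in>v. openin (top_of_set UNIV) u \<and> (\<exists>q. homeomorphism u (ball y r) G q)"
  proof
   fix u assume "u \<in> v"
   then obtain x where x: "G x = y" "u = h x ` ball y r" by (auto simp: v_def)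
   have "inj_on (h x) (ball y r)" by (metis hy(3)[OF x(1)] inj_onI)
   then have "open u" unfolding x(2)
    using invariance_of_domain[OF hy(1)[OF x(1)] open_ball] by blast
   moreover have "homeomorphism u (ball y r) G (h x)"
   proof (rule homeomorphismI)
    show "continuous_on u G" using contG continuous_on_subset by blast
    show "continuous_on (ball y r) (h x)" by (rule hy(1)[OF x(1)])
   qed (use x hy(3)[OF x(1)] in auto)
   ultimately show "openin (top_of_set UNIV) u \<and> (\<exists>q. homeomorphism u (ball y r) G q)" by auto
  qed
  moreover have "pairwise disjnt v"
  proof (rule pairwiseI)
   fix u u' assume "u \<in> v" "u' \<in> v" "u \<noteq> u'"
   then obtain x x' where x: "G x = y" "u = h x ` ball y r" and x': "G x' = y" "u' = h x' ` ball y r"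
    by (auto simp: v_def)
   show "disjnt u u'"
   proof (rule ccontr)
    assume "\<not> disjnt u u'"
    then obtain t t' where t: "t \<in> ball y r" "t' \<in> ball y r" "h x t = h x' t'"
     unfolding x(2) x'(2) disjnt_def by blast
    then have tt: "t = t'" by (metis hy(3) x(1) x'(1))
    have "h x s = h x' s" if "s \<in> ball y r" for s
     by (rule sections_agree[where T = "ball y r" and G = G and ?y0.0 = t and y = s and ?h1.0 = "h x" and ?h2.0 = "h x'"])
      (use x(1) x'(1) t tt hy that inj in auto)
    then have "u = u'" unfolding x(2) x'(2) by (intro image_cong) auto
    then show False using \<open>u \<noteq> u'\<close> by simp
   qed
  qed
  ultimately show "\<exists>T. y \<in> T \<and> openin (top_of_set UNIV) T \<and> (\<exists>v. \<Union> v = UNIV \<inter> G -` T \<and>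
    (\<forall>u\<in>v. openin (top_of_set UNIV) u) \<and> pairwise disjnt v \<and> (\<forall>u\<in>v. \<exists>q. homeomorphism u T G q))"
   using r by (intro exI[of _ "ball y r"] conjI exI[of _ v]) auto
 qed
 \<comment> \<open>Lifting the identity through the covering gives a right inverse; uniqueness of
   lifts, applied to \<open>G\<close> itself, shows that it is also a left inverse.\<close>
 obtain H where H: "continuous_on UNIV H" "H (G 0) = 0" "\<And>y. G (H y) = y"
 proof (rule covering_space_lift_strong[OF cov, of 0 "G 0" UNIV "\<lambda>y. y"])
  show "simply_connected (UNIV :: 'a set)" by (rule convex_imp_simply_connected) simp
  show "locally path_connected (UNIV :: 'a set)" by (rule locally_path_connected_UNIV)
 qed auto
 have "H (G x) = x" for x
 proof (rule covering_space_lift_unique[OF cov, where f = G and ?g1.0 = "\<lambda>x. H (G x)" and ?g2.0 = "\<lambda>x. x" and T = UNIV and a = 0])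
  show "continuous_on UNIV (\<lambda>x. H (G x))"
   by (rule continuous_on_compose2[OF H(1) contG]) simp
 qed (use H contG in auto)
 with H show thesis using that by blast
qed

text \<open>\<open>tproj\<close> is an open surjection, hence a quotient map.\<close>

lemma continuous_torusI:
 fixes \<theta> :: "'m::finite torus => 'b::topological_space"
 assumes "continuous_on UNIV (\<lambda>x. \<theta> (tproj x))"
 shows "continuous_on UNIV \<theta>"
proof -
 have "open (\<theta> -` U)" if "open U" for U
 proof -
  have "\<theta> -` U = tproj ` ((\<lambda>x. \<theta> (tproj x)) -` U)"
  proof (intro equalityI subsetI)
   fix x assume "x \<in> \<theta> -` U"
   then show "x \<in> tproj ` ((\<lambda>x. \<theta> (tproj x)) -` U)"
    by (intro image_eqI[of _ _ "trep x"]) simp_all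
  qed auto
  then show ?thesis using open_image_tproj[OF open_vimage[OF that assms]] by simp
 qed
 then show ?thesis by (simp add: continuous_on_open_vimage)
qed

locale diffeo_lift =
 fixes g :: "'m::finite torus => 'm torus" and G :: "real ^ 'm => real ^ 'm"
 assumes lift: "torus_lift G g" and diffeo: "C2_local_diffeo G"
begin

lemma contG: "continuous_on UNIV G" and lift_eq: "g (tproj x) = tproj (G x)"
 using lift by (auto simp: torus_lift_def)

lemma contg: "continuous_on UNIV g"
 by (rule continuous_torusI) (simp add: lift_eq continuous_on_tproj contG)

lemma measurable_g [measurable]: "g \<in> borel_measurable borel"
 by (rule borel_measurable_continuous_onI[OF contg])

definition DG :: "real ^ 'm => real ^ 'm => real ^ 'm" where
 "DG x = frechet_derivative G (at x)"

lemma local_C2: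
 obtains U Hl G' G'' where "open U" "x \<in> U" "open (G ` U)"
  "\<And>y. y \<in> U ==> (G has_derivative blinfun_apply (G' y)) (at y)"
  "\<And>y. y \<in> U ==> (G' has_derivative blinfun_apply (G'' y)) (at y)"
  "continuous_on U G''" "\<And>y. y \<in> U ==> Hl (G y) = y"
  "\<And>z. z \<in> G ` U ==> Hl differentiable (at z)"
proof -
 obtain U Hl where U: "open U" "x \<in> U" "open (G ` U)" "C2_on U G" "C2_on (G ` U) Hl"
  "\<forall>y\<in>U. Hl (G y) = y"
  using diffeo unfolding C2_local_diffeo_def by blast
 obtain G' G'' where "\<forall>y\<in>U. (G has_derivative blinfun_apply (G' y)) (at y) \<and>
   (G' has_derivative blinfun_apply (G'' y)) (at y)" "continuous_on U G''"
  using U(4) unfolding C2_on_def by blast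
 moreover have "Hl differentiable (at z)" if "z \<in> G ` U" for z
  using U(5) that unfolding C2_on_def differentiable_def by blast
 ultimately show thesis using U by (intro that[of U G' G'' Hl]) auto
qed

lemma derG: "(G has_derivative DG x) (at x)"
proof -
 obtain U Hl G' G'' where "x \<in> U" "\<And>y. y \<in> U ==> (G has_derivative blinfun_apply (G' y)) (at y)"
  by (rule local_C2[of x]) blast
 then show ?thesis
  unfolding DG_def by (metis differentiable_def frechet_derivative_works)
qed

lemma DG_unique: "(G has_derivative A) (at x) ==> A = DG x"
 using derG has_derivative_unique by blast

text \<open>The increment of \<open>G\<close> under an integer translation is continuous with
  integer values, hence constant.\<close>

lemma periodG: "n \<in> int_vecs ==> G n - G 0 \<in> int_vecs"
 and G_add_int: "n \<in> int_vecs ==> G (x + n) = G x + (G n - G 0)"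
proof -
 assume n: "n \<in> int_vecs"
 have *: "G (x + n) - G x \<in> int_vecs" for x
  by (metis lift_eq n tproj_add_int tproj_eq_iff)
 have "continuous_on UNIV (\<lambda>x. G (x + n) - G x)"
  by (intro continuous_intros continuous_on_compose2[OF contG]) auto
 from continuous_int_vecs_constant[OF this *, of x 0]
 show "G (x + n) = G x + (G n - G 0)" by (simp add: algebra_simps)
 show "G n - G 0 \<in> int_vecs" using *[of 0] by simp
qed

text \<open>Two lifts differ by a constant, and two base points over the same torus point by an
  integer vector, along which a lift is equivariant. So the definite description has exactly one
  candidate.\<close>

lemma torus_deriv_tproj: "torus_deriv g (tproj x) = DG x"
 unfolding torus_deriv_def
proof (rule the_equality)
 show "\<exists>G' x'. torus_lift G' g \<and> tproj x' = tproj x \<and> (G' has_derivative DG x) (at x')"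
  using lift derG by blast
 fix A assume "\<exists>G' x'. torus_lift G' g \<and> tproj x' = tproj x \<and> (G' has_derivative A) (at x')"
 then obtain G' x' where A: "torus_lift G' g" "tproj x' = tproj x" "(G' has_derivative A) (at x')"
  by blast
 define n where "n = x' - x"
 have n: "n \<in> int_vecs" "x' = x + n" using A(2) by (auto simp: n_def tproj_eq_iff)
 have "continuous_on UNIV (\<lambda>z. G' z - G z)"
  using A(1) contG by (intro continuous_intros) (auto simp: torus_lift_def)
 moreover have "G' z - G z \<in> int_vecs" for z
  using A(1) lift by (metis tproj_eq_iff torus_lift_def)
 ultimately have "G' z - G z = G' 0 - G 0" for z
  by (rule continuous_int_vecs_constant)
 then have G': "G' z = G z + (G' 0 - G 0)" for z by (simp add: algebra_simps)
 have "G z = G' (z + n) - (G' 0 - G 0) - (G n - G 0)" for z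
  using G'[of "z + n"] G_add_int[OF n(1), of z] by simp
 moreover have "((\<lambda>z. G' (z + n) - (G' 0 - G 0) - (G n - G 0)) has_derivative A) (at x)"
 proof -
  have "((\<lambda>z. z + n) has_derivative (\<lambda>v. v)) (at x)"
   by (auto intro!: derivative_eq_intros)
  from has_derivative_compose[OF this, of G' A]
  have "((\<lambda>z. G' (z + n)) has_derivative A) (at x)" using A(3) n(2) by simp
  then show ?thesis by (auto intro!: derivative_eq_intros)
 qed
 ultimately have "(G has_derivative A) (at x)"
  by (metis (no_types, lifting) ext)
 then show "A = DG x" by (rule DG_unique)
qed

text \<open>The radius of the local inverses can be chosen uniformly: compactness gives one radius
  on the closed cube, and equivariance under integer translations carries the local inverses to all
  other points.\<close>

lemma homeomorphism_lift:
 obtains H where "continuous_on UNIV H" "\<And>x. H (G x) = x" "\<And>y. G (H y) = y"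
proof -
 have locinj: "\<exists>U. open U \<and> x \<in> U \<and> inj_on G U" for x
  by (rule local_C2[of x]) (metis inj_onI)
 define good where "good x r \<longleftrightarrow>
  (\<exists>h. continuous_on (ball (G x) r) h \<and> h (G x) = x \<and> (\<forall>y\<in>ball (G x) r. G (h y) = y))" for x r
 have good_mono: "good x r'" if "good x r" "r' \<le> r" for x r r'
  using that unfolding good_def
  by (metis (no_types, lifting) continuous_on_subset subset_ball subsetD)
 have "\<exists>W r. open W \<and> x \<in> W \<and> r > 0 \<and> (\<forall>x'\<in>W. good x' r)" for x
 proof -
  obtain U Hl where U: "open U" "x \<in> U" "open (G ` U)" "\<And>y. y \<in> U ==> Hl (G y) = y"
   "\<And>z. z \<in> G ` U ==> Hl differentiable (at z)"
   by (rule local_C2[of x]) blast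
  obtain r where r: "r > 0" "ball (G x) r \<subseteq> G ` U"
   using U(2,3) by (metis imageI openE)
  \<comment> \<open>Halving the radius leaves room for the centre to move: balls of radius
    \<open>r/2\<close> around nearby values stay inside the image of \<open>U\<close>.\<close>
  define W where "W = U \<inter> G -` ball (G x) (r/2)"
  have "open W" unfolding W_def using U(1) open_vimage[OF open_ball contG] by (rule open_Int)
  moreover have "x \<in> W" using U r by (simp add: W_def)
  moreover have "good x' (r/2)" if "x' \<in> W" for x'
  proof -
   have sub: "ball (G x') (r/2) \<subseteq> G ` U"
   proof
    fix z assume z: "z \<in> ball (G x') (r/2)"
    have "dist (G x) z \<le> dist (G x) (G x') + dist (G x') z" by (rule dist_triangle)
    then have "z \<in> ball (G x) r" using z that by (simp add: W_def)
    then show "z \<in> G ` U" using r(2) by blast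
   qed
   have "continuous_on (ball (G x') (r/2)) Hl"
    using U(5) sub by (meson continuous_at_imp_continuous_on differentiable_imp_continuous_within subsetD)
   moreover have "Hl (G x') = x'" using U(4) that by (simp add: W_def)
   moreover have "G (Hl y) = y" if y: "y \<in> ball (G x') (r/2)" for y
   proof -
    obtain u where "u \<in> U" "y = G u" using sub y by blast
    then show ?thesis using U(4) by simp
   qed
   ultimately show ?thesis unfolding good_def by blast
  qed
  ultimately show ?thesis using r(1) by (intro exI[of _ W] exI[of _ "r/2"]) auto
 qed
 then obtain W r where W: "\<And>x. open (W x)" "\<And>x. x \<in> W x" "\<And>x. r x > (0::real)"
  "\<And>x x'. x' \<in> W x ==> good x' (r x)" by metis
 obtain C where C: "finite C" "cbox (0 :: real ^ 'm) 1 \<subseteq> (\<Union>x\<in>C. W x)"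
 proof -
  have "cbox (0 :: real ^ 'm) 1 \<subseteq> (\<Union>x\<in>UNIV. W x)" using W(2) by blast
  then show thesis
   using compactE_image[OF compact_cbox[of "0 :: real ^ 'm" 1], of UNIV W] W(1) that by metis
 qed
 \<comment> \<open>The element 1 makes the minimum meaningful without showing that \<open>C\<close>
   is nonempty.\<close>
 define r0 where "r0 = Min (insert 1 (r ` C))"
 have r0: "r0 > 0" using C(1) W(3) by (auto simp: r0_def)
 have cube: "good x r0" if "x \<in> cbox 0 1" for x
 proof -
  have "x \<in> (\<Union>c\<in>C. W c)" using C(2) that by (rule subsetD)
  then obtain c where c: "c \<in> C" "x \<in> W c" by (rule UN_E)
  have "r0 \<le> r c" unfolding r0_def using C(1) c(1) by (intro Min_le) auto
  then show ?thesis using good_mono[OF W(4)[OF c(2)]] by simp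
 qed
 have good: "good x r0" for x
 proof -
  obtain n where n: "n \<in> int_vecs" "\<forall>i. 0 \<le> (x + n) $ i \<and> (x + n) $ i < 1"
   using tproj_cube[of x] by blast
  then have "x + n \<in> cbox 0 1" by (simp add: mem_box_cart less_imp_le)
  then obtain h where h: "continuous_on (ball (G (x + n)) r0) h" "h (G (x + n)) = x + n"
   "\<And>y. y \<in> ball (G (x + n)) r0 ==> G (h y) = y"
   using cube unfolding good_def by blast
  define p where "p = G n - G 0"
  have Gxn: "G (x + n) = G x + p" using G_add_int[OF n(1)] by (simp add: p_def)
  have in_ball: "y + p \<in> ball (G (x + n)) r0" if "y \<in> ball (G x) r0" for y
   using that by (simp add: Gxn dist_norm)
  have "continuous_on (ball (G x) r0) (\<lambda>y. h (y + p) - n)"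
   by (intro continuous_on_diff continuous_on_const continuous_on_compose2[OF h(1)] continuous_on_add continuous_on_id)
    (use in_ball in auto)
  moreover have "h (G x + p) - n = x" using h(2) by (simp add: Gxn)
  moreover have "G (h (y + p) - n) = y" if "y \<in> ball (G x) r0" for y
   using G_add_int[OF n(1), of "h (y + p) - n"] h(3)[OF in_ball[OF that]] by (simp add: p_def)
  ultimately show ?thesis unfolding good_def by (intro exI[of _ "\<lambda>y. h (y + p) - n"]) auto
 qed
 show thesis
  by (rule uniform_local_inverses_imp_homeomorphism[OF contG locinj r0])
   (use good that in "auto simp: good_def")
qed

end

text \<open>Compare difference quotients along \<open>x + t v\<close>. It will turn the distortion
  bound, which measures the logarithmic Jacobian against distances between image points, into a
  bound for its differential against that of \<open>G\<close>.\<close>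

lemma derivative_comparison:
 fixes u :: "'a::real_normed_vector => real" and G :: "'a => 'b::real_normed_vector"
 assumes u: "(u has_derivative u') (at x)" and G: "(G has_derivative A) (at x)"
  and c: "c \<ge> 0" and ev: "open W" "x \<in> W" "\<And>z. z \<in> W ==> \<bar>u z - u x\<bar> \<le> c * norm (G z - G x)"
 shows "\<bar>u' v\<bar> \<le> c * norm (A v)"
proof (rule field_le_epsilon)
 fix e :: real assume e: "e > 0"
 \<comment> \<open>The linearisation errors of \<open>u\<close> and \<open>G\<close> add up to at
   most \<open>(c + 1) * norm v * e'\<close>; the extra 1 in each factor keeps the denominator
   positive.\<close>
 define e' where "e' = e / ((c + 1) * (norm v + 1))"
 have cv: "(c + 1) * (norm v + 1) > 0" using c by (intro mult_pos_pos) (auto intro: add_nonneg_pos)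
 have e': "e' > 0" using e cv by (simp add: e'_def)
 have lin: "linear u'" "linear A" using u G has_derivative_linear by blast+
 obtain d1 where d1: "d1 > 0" "\<And>y. norm (y - x) < d1 ==> norm (u y - u x - u' (y - x)) \<le> e' * norm (y - x)"
  using u e' unfolding has_derivative_at_alt by blast
 obtain d2 where d2: "d2 > 0" "\<And>y. norm (y - x) < d2 ==> norm (G y - G x - A (y - x)) \<le> e' * norm (y - x)"
  using G e' unfolding has_derivative_at_alt by blast
 obtain d3 where d3: "d3 > 0" "ball x d3 \<subseteq> W" using ev(1,2) openE by blast
 define t where "t = min d1 (min d2 d3) / (norm v + 1)"
 have nv: "norm v + 1 > 0" by (rule add_nonneg_pos) auto
 have t: "t > 0" using d1 d2 d3 nv by (simp add: t_def)
 have "t * norm v < t * (norm v + 1)" using t by simp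
 also have "\<dots> = min d1 (min d2 d3)" using nv by (simp add: t_def)
 finally have tv: "t * norm v < d1" "t * norm v < d2" "t * norm v < d3" by auto
 define y where "y = x + t *\<^sub>R v"
 have yx: "y - x = t *\<^sub>R v" "norm (y - x) = t * norm v" using t by (simp_all add: y_def)
 have "y \<in> W" using tv(3) yx(2) d3(2) by (auto simp: dist_norm norm_minus_commute)
 have "t * \<bar>u' v\<bar> = \<bar>u' (y - x)\<bar>" using t lin(1) by (simp add: yx linear_cmul abs_mult)
 also have "\<dots> \<le> \<bar>u y - u x\<bar> + e' * (t * norm v)"
  using d1(2)[of y] tv(1) t by (simp add: yx)
 also have "\<bar>u y - u x\<bar> \<le> c * norm (G y - G x)" by (rule ev(3)[OF \<open>y \<in> W\<close>])
 also have "norm (G y - G x) \<le> norm (A (y - x)) + e' * (t * norm v)"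
  using d2(2)[of y] tv(2) t norm_triangle_sub[of "G y - G x" "A (y - x)"] by (simp add: yx)
 also have "norm (A (y - x)) = t * norm (A v)" using t lin(2) by (simp add: yx linear_cmul)
 finally have "t * \<bar>u' v\<bar> \<le> c * (t * norm (A v) + e' * (t * norm v)) + e' * (t * norm v)"
  using c by (simp add: mult_left_mono)
 also have "\<dots> = t * (c * norm (A v) + (c + 1) * norm v * e')" by (simp add: algebra_simps)
 finally have "\<bar>u' v\<bar> \<le> c * norm (A v) + (c + 1) * norm v * e'" using t by simp
 also have "(c + 1) * norm v * e' \<le> e"
 proof -
  have "(c + 1) * norm v * e' \<le> (c + 1) * (norm v + 1) * e'"
   using c e' by (intro mult_right_mono mult_left_mono) auto
  also have "\<dots> = e"
   using cv unfolding e'_def times_divide_eq_right by (metis less_irrefl nonzero_mult_div_cancel_left)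
  finally show ?thesis .
 qed
 finally show "\<bar>u' v\<bar> \<le> c * norm (A v) + e" by simp
qed

text \<open>A translated cube is again a fundamental domain. This is translation invariance, stated
  with the translation as the variable of integration.\<close>

lemma nn_integral_haar_shift:
 fixes \<phi> :: "'m::finite torus => ennreal"
 assumes [measurable]: "\<phi> \<in> borel_measurable borel"
 shows "(\<integral>\<^sup>+y. \<phi> (tproj (c + y)) * indicator unit_cube y \<partial>lborel) = (\<integral>\<^sup>+\<o>. \<phi> \<o> \<partial>haar)"
proof -
 define S where "S = {z. z + - c \<in> unit_cube}"
 have [measurable]: "S \<in> sets borel" unfolding S_def by measurable
 have "\<exists>!n. n \<in> int_vecs \<and> x + n \<in> S" for x
  using unit_cube_unique_translate[of "x + - c"] by (simp add: S_def algebra_simps)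
 then have "(\<integral>\<^sup>+x. \<phi> (tproj x) * indicator S x \<partial>lborel) = (\<integral>\<^sup>+\<o>. \<phi> \<o> \<partial>haar)"
  by (intro nn_integral_fundamental_domain) auto
 moreover have "(\<integral>\<^sup>+x. \<phi> (tproj (x + c)) * indicator S (x + c) \<partial>lborel) = (\<integral>\<^sup>+x. \<phi> (tproj x) * indicator S x \<partial>lborel)"
  by (rule nn_integral_lborel_translate) simp
 moreover have "indicator S (x + c) = (indicator unit_cube x :: ennreal)" for x
  by (simp add: S_def indicator_def)
 ultimately show ?thesis by (simp add: add.commute)
qed

lemma emeasure_haar_open_pos:
 fixes U :: "'m::finite torus set"
 assumes U: "open U" "U \<noteq> {}"
 shows "emeasure haar U > 0"
proof (rule ccontr)
 assume "\<not> ?thesis"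
 then have 0: "emeasure haar U = 0" by simp
 have [measurable]: "U \<in> sets borel" using U(1) by simp
 obtain \<o> where \<o>: "\<o> \<in> U" using U(2) by blast
 \<comment> \<open>Centres the cube at a lift of the chosen point, which then lies in the open
   cube.\<close>
 define c where "c = trep \<o> - (\<chi> i. 1/2)"
 define W where "W = (\<lambda>y. tproj (c + y)) -` U \<inter> box 0 1"
 have cont: "continuous_on UNIV (\<lambda>y. tproj (c + y))" by (intro continuous_intros)
 have oW: "open W" unfolding W_def by (intro open_Int open_box open_vimage[OF U(1) cont])
 have "(\<chi> i. 1/2) \<in> W" using \<o> by (simp add: W_def c_def mem_box_cart)
 then have "W \<noteq> {}" by blast
 have [measurable]: "W \<in> sets borel" using oW by simp
 have "emeasure lborel W = (\<integral>\<^sup>+y. indicator W y \<partial>lborel)" by simp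
 also have "\<dots> \<le> (\<integral>\<^sup>+y. indicator U (tproj (c + y)) * indicator unit_cube y \<partial>lborel)"
  by (rule nn_integral_mono)
   (auto simp: indicator_def W_def unit_cube_def mem_box_cart less_imp_le)
 also have "\<dots> = (\<integral>\<^sup>+\<o>. indicator U \<o> \<partial>haar)" by (rule nn_integral_haar_shift) simp
 also have "\<dots> = 0" using 0 by simp
 finally have "emeasure lborel W = 0" by simp
 then have "W \<in> null_sets lborel" by (simp add: null_sets_def)
 then have "negligible W" using completion.complete negligible_iff_null_sets null_sets_completionI by blast
 then show False using open_not_negligible[OF oW \<open>W \<noteq> {}\<close>] by simp
qed

locale expanding_lift = diffeo_lift g G
 for g :: "'m::finite torus => 'm torus" and G :: "real ^ 'm => real ^ 'm" +
 fixes H :: "real ^ 'm => real ^ 'm" and \<sigma> :: real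
 assumes contH: "continuous_on UNIV H" and HG [simp]: "H (G x) = x" and GH [simp]: "G (H y) = y"
  and expand: "expanding_map \<sigma> g"
begin

lemma \<sigma>_gt_1: "\<sigma> > 1" using expand by (simp add: expanding_map_def)

lemma norm_DG: "\<sigma> * norm v \<le> norm (DG x v)"
 using expand unfolding expanding_map_def by (metis torus_deriv_tproj)

definition DH :: "real ^ 'm => real ^ 'm => real ^ 'm" where
 "DH y = frechet_derivative H (at y)"

lemma derH: "(H has_derivative DH y) (at y)"
proof -
 obtain U Hl where U: "H y \<in> U" "open (G ` U)" "\<And>y. y \<in> U ==> Hl (G y) = y"
  "\<And>z. z \<in> G ` U ==> Hl differentiable (at z)"
  by (rule local_C2[of "H y"]) blast
 have y: "y \<in> G ` U" using U(1) GH by (metis imageI)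
 then obtain B where "(Hl has_derivative B) (at y)" using U(4) unfolding differentiable_def by blast
 then have "(H has_derivative B) (at y)"
  by (rule has_derivative_transform_within_open[OF _ U(2) y]) (use U(3) in auto)
 then show ?thesis unfolding DH_def by (metis differentiable_def frechet_derivative_works)
qed

lemma linear_DG: "linear (DG x)" and linear_DH: "linear (DH y)"
 using derG derH has_derivative_linear by blast+

lemma DG_DH: "DG (H y) (DH y w) = w"
proof -
 have "((\<lambda>y. G (H y)) has_derivative (\<lambda>w. DG (H y) (DH y w))) (at y)"
  by (rule has_derivative_compose[OF derH derG])
 then have "((\<lambda>y. y) has_derivative (\<lambda>w. DG (H y) (DH y w))) (at y)" by simp
 from has_derivative_unique[OF this has_derivative_ident] show ?thesis by metis
qed

lemma norm_DH: "norm (DH y w) \<le> norm w / \<sigma>"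
 using norm_DG[of "DH y w" "H y"] \<sigma>_gt_1 by (simp add: DG_DH field_simps)

lemma H_lipschitz: "norm (H y - H y') \<le> norm (y - y') / \<sigma>"
proof -
 have "norm (H y - H y') \<le> (1 / \<sigma>) * norm (y - y')"
 proof (rule differentiable_bound[where S = UNIV and f' = DH])
  show "onorm (DH x) \<le> 1 / \<sigma>" for x
   by (rule onorm_le) (use norm_DH in simp)
 qed (auto simp: derH)
 then show ?thesis by simp
qed

definition Jdet :: "real ^ 'm => real" where "Jdet x = det (matrix (DG x))"

lemma det_DH: "det (matrix (DH y)) * Jdet (H y) = 1"
proof -
 have "DG (H y) o DH y = id" by (rule ext) (simp add: DG_DH)
 then have "matrix (DG (H y)) ** matrix (DH y) = mat 1"
  using matrix_compose[OF linear_DH linear_DG, of "H y" y] matrix_id_mat_1 by metis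
 then have "det (matrix (DG (H y))) * det (matrix (DH y)) = 1" by (metis det_I det_mul)
 then show ?thesis by (simp add: Jdet_def mult.commute)
qed

lemma Jdet_nz: "Jdet x \<noteq> 0"
 using det_DH[of "G x"] by auto

text \<open>The determinant is a polynomial in the entries of the C1 map DG. The continuity of its
  derivative serves to extend an inequality from a dense set in
  \<open>ln_J_distortion\<close>.\<close>

lemma Jdet_local_derivative:
 obtains U J' where "open U" "x \<in> U" "\<And>y. y \<in> U ==> (Jdet has_derivative J' y) (at y)"
  "\<And>v. continuous_on U (\<lambda>y. J' y v)"
proof -
 obtain U Hl G' G'' where U: "open U" "x \<in> U"
  "\<And>y. y \<in> U ==> (G has_derivative blinfun_apply (G' y)) (at y)"
  "\<And>y. y \<in> U ==> (G' has_derivative blinfun_apply (G'' y)) (at y)"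
  "continuous_on U G''"
  by (rule local_C2[of x]) blast
 define En where "En = (\<lambda>y i j. blinfun_apply (G' y) (axis j 1) $ i)"
 define En' where "En' = (\<lambda>y i j v. blinfun_apply (blinfun_apply (G'' y) v) (axis j 1) $ i)"
 have bl: "bounded_linear (\<lambda>A :: (real ^ 'm) \<Rightarrow>\<^sub>L (real ^ 'm). blinfun_apply A a $ i)" for a i
  by (intro bounded_linear_compose[OF bounded_linear_vec_nth] blinfun.bounded_linear_left)
 have dE: "((\<lambda>y. En y i j) has_derivative (\<lambda>v. En' y i j v)) (at y)" if "y \<in> U" for y i j
  unfolding En_def En'_def by (rule bounded_linear.has_derivative[OF bl U(4)[OF that]])
 have cE: "continuous_on U (\<lambda>y. En y i j)" for i j
  by (intro continuous_at_imp_continuous_on ballI has_derivative_continuous[OF dE])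
 have cE': "continuous_on U (\<lambda>y. En' y i j v)" for i j v
  unfolding En'_def
  by (rule bounded_linear.continuous_on[OF bl])
   (rule bounded_linear.continuous_on[OF blinfun.bounded_linear_left U(5)])
 define P where "P = {p. p permutes (UNIV :: 'm set)}"
 define J' where "J' = (\<lambda>y v. \<Sum>p\<in>P. of_int (sign p) * (\<Sum>i\<in>UNIV. En' y i (p i) v * (\<Prod>j\<in>UNIV - {i}. En y j (p j))))"
 have eq: "Jdet y = (\<Sum>p\<in>P. of_int (sign p) * (\<Prod>i\<in>UNIV. En y i (p i)))" if "y \<in> U" for y
  using DG_unique[OF U(3)[OF that]] unfolding Jdet_def det_def P_def
  by (simp add: matrix_def En_def)
 have "(Jdet has_derivative J' y) (at y)" if y: "y \<in> U" for y
 proof -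
  have "((\<lambda>y. \<Sum>p\<in>P. of_int (sign p) * (\<Prod>i\<in>UNIV. En y i (p i))) has_derivative J' y) (at y)"
   unfolding J'_def
   by (intro has_derivative_sum has_derivative_mult_right has_derivative_prod dE y)
  then show ?thesis
   by (rule has_derivative_transform_within_open[OF _ U(1) y]) (simp add: eq)
 qed
 moreover have "continuous_on U (\<lambda>y. J' y v)" for v
  unfolding J'_def by (intro continuous_intros cE cE')
 ultimately show thesis using that U(1,2) by blast
qed

lemma cont_Jdet: "continuous_on UNIV Jdet"
proof (rule continuous_at_imp_continuous_on, rule ballI)
 fix x
 show "isCont Jdet x"
  by (rule Jdet_local_derivative[of x]) (use has_derivative_continuous in blast)
qed

definition J :: "real ^ 'm => real" where "J x = \<bar>Jdet x\<bar>"

lemma J_pos: "J x > 0" using Jdet_nz by (simp add: J_def)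

lemma torus_jac_tproj: "torus_jac g (tproj x) = J x"
 by (simp add: torus_jac_def torus_deriv_tproj J_def Jdet_def)

text \<open>(D) compares only points on the same branch, so the ratio of Jacobians is controlled
  inside a single cell. It yields a differential inequality on the interiors of the cells; these are
  dense, and both sides are continuous, so the inequality holds everywhere. Integrated along
  \<open>H\<close> it becomes a Lipschitz bound on all of Euclidean space, across the boundaries of
  cells.\<close>

lemma ln_J_distortion:
 assumes part: "full_branch_partition g d I" and bd: "bounded_distortion D g d I" and D: "D \<ge> 0"
 shows "\<bar>ln (J (H y)) - ln (J (H y'))\<bar> \<le> D * norm (y - y')"
proof -
 \<comment> \<open>The logarithm of the square is differentiable whatever the sign of the
   determinant; hence the factors 2 below.\<close>
 define l where "l = (\<lambda>x. ln ((Jdet x)\<^sup>2))"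
 have l: "l x = 2 * ln (J x)" for x
 proof -
  have "(Jdet x)\<^sup>2 = (J x)\<^sup>2" by (simp add: J_def)
  then show ?thesis using ln_realpow[of "J x" 2] by (simp add: l_def)
 qed
 have l_der: "(l has_derivative (\<lambda>v. 2 * J' v / Jdet x)) (at x)" if "(Jdet has_derivative J') (at x)" for x J'
 proof -
  have "((\<lambda>x. (Jdet x)\<^sup>2) has_derivative (\<lambda>v. 2 * Jdet x * J' v)) (at x)"
   using that by (auto intro!: derivative_eq_intros)
  moreover have "(ln has_real_derivative 1 / (Jdet x)\<^sup>2) (at ((Jdet x)\<^sup>2))"
   using Jdet_nz[of x] by (auto intro!: derivative_eq_intros)
  ultimately have "(l has_derivative (\<lambda>v. 2 * Jdet x * J' v * (1 / (Jdet x)\<^sup>2))) (at x)"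
   unfolding l_def by (rule DERIV_compose_FDERIV[rotated])
  then show ?thesis using Jdet_nz[of x] by (simp add: power2_eq_square)
 qed
 define V where "V = tproj -` (\<Union>i<d. interior (I i))"
 have on_V: "\<bar>2 * J' v / Jdet x\<bar> \<le> 2 * D * norm (DG x v)"
  if x: "x \<in> V" and J': "(Jdet has_derivative J') (at x)" for x v J'
 proof -
  obtain i where i: "i < d" "tproj x \<in> interior (I i)" using x by (auto simp: V_def)
  define W where "W = tproj -` interior (I i)"
  have "open W" unfolding W_def by (intro open_vimage continuous_on_tproj continuous_on_id) auto
  have inj: "inj_on g (I i)"
   using part i(1) by (auto simp: full_branch_partition_def bij_betw_def)
  have inv: "inv_branch g I i (tproj (G z)) = tproj z" if "z \<in> W" for z
   using that interior_subset[of "I i"]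
   by (auto simp: inv_branch_def W_def lift_eq[symmetric] intro!: inv_into_f_f[OF inj])
  have ratio: "ln (J z) - ln (J z') \<le> D * norm (G z - G z')" if "z \<in> W" "z' \<in> W" for z z'
  proof -
   have "J z / J z' \<le> exp (D * dist (tproj (G z)) (tproj (G z')))"
    using bd i(1) inv[OF that(1)] inv[OF that(2)] unfolding bounded_distortion_def
    by (metis torus_jac_tproj)
   also have "\<dots> \<le> exp (D * norm (G z - G z'))"
    using D dist_tproj_le[of "G z" "G z'"] by (simp add: dist_norm mult_left_mono)
   finally have "ln (J z / J z') \<le> D * norm (G z - G z')"
    using J_pos by (metis divide_pos_pos ln_exp ln_le_cancel_iff exp_gt_zero)
   then show ?thesis using J_pos[of z] J_pos[of z'] by (simp add: ln_div)
  qed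
  have lb: "\<bar>l z - l x\<bar> \<le> 2 * D * norm (G z - G x)" if "z \<in> W" for z
   using ratio[of z x] ratio[of x z] that i(2)
   by (simp add: l abs_le_iff W_def norm_minus_commute)
  show ?thesis
   by (rule derivative_comparison[OF l_der[OF J'] derG _ \<open>open W\<close> _ lb])
    (use D i(2) in "auto simp: W_def")
 qed
 \<comment> \<open>Off the interiors only the null boundaries of the cells remain, and nonempty open
   sets of the torus have positive measure.\<close>
 have dense: "W \<inter> V \<noteq> {}" if W: "open W" "W \<noteq> {}" for W
 proof
  assume e: "W \<inter> V = {}"
  have "tproj ` W \<subseteq> (\<Union>i<d. I i - interior (I i))"
  proof
   fix \<o> assume "\<o> \<in> tproj ` W"
   then obtain x where x: "x \<in> W" "\<o> = tproj x" by blast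
   then have "\<o> \<notin> (\<Union>i<d. interior (I i))" using e by (auto simp: V_def)
   moreover have "\<o> \<in> (\<Union>i<d. I i)" using part by (simp add: full_branch_partition_def)
   ultimately show "\<o> \<in> (\<Union>i<d. I i - interior (I i))" by blast
  qed
  moreover have "(\<Union>i<d. I i - interior (I i)) \<in> null_sets (completion haar)"
   using part by (intro null_sets_UN') (auto simp: full_branch_partition_def)
  ultimately have "tproj ` W \<in> null_sets (completion haar)"
   by (rule null_sets_completion_subset)
  moreover have o: "open (tproj ` W)" by (rule open_image_tproj[OF W(1)])
  ultimately have "emeasure haar (tproj ` W) = 0"
   by (subst (asm) null_sets_completion_iff) (auto simp: null_sets_def)
  then show False using emeasure_haar_open_pos[OF o] W(2) by simp
 qed
 \<comment> \<open>A strict violation at one point would persist on an open neighbourhood, which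
   meets the dense set where the inequality is known.\<close>
 have bound: "\<bar>2 * J' v / Jdet x\<bar> \<le> 2 * D * norm (DG x v)"
  if J'x: "(Jdet has_derivative J') (at x)" for x v J'
 proof (rule ccontr)
  assume neg: "\<not> ?thesis"
  obtain U J'' where U: "open U" "x \<in> U" "\<And>y. y \<in> U ==> (Jdet has_derivative J'' y) (at y)"
   "\<And>v. continuous_on U (\<lambda>y. J'' y v)" by (rule Jdet_local_derivative[of x]) blast
  obtain U2 Hl G' G'' where U2: "open U2" "x \<in> U2"
   "\<And>y. y \<in> U2 ==> (G has_derivative blinfun_apply (G' y)) (at y)"
   "\<And>y. y \<in> U2 ==> (G' has_derivative blinfun_apply (G'' y)) (at y)"
   by (rule local_C2[of x]) blast
  have "J' = J'' x" using has_derivative_unique[OF J'x U(3)[OF U(2)]] .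
  define U3 where "U3 = U \<inter> U2"
  have U3: "open U3" "x \<in> U3" using U U2 by (auto simp: U3_def)
  have "continuous_on U2 G'"
   by (intro continuous_at_imp_continuous_on ballI has_derivative_continuous[OF U2(4)])
  then have "continuous_on U2 (\<lambda>y. blinfun_apply (G' y) v)"
   by (rule bounded_linear.continuous_on[OF blinfun.bounded_linear_left])
  then have "continuous_on U2 (\<lambda>y. DG y v)"
   by (rule continuous_on_eq) (use DG_unique[OF U2(3)] in simp)
  then have "continuous_on U3 (\<lambda>y. \<bar>2 * J'' y v / Jdet y\<bar> - 2 * D * norm (DG y v))"
   by (intro continuous_intros continuous_on_subset[OF U(4)] continuous_on_subset[OF cont_Jdet])
    (auto simp: U3_def Jdet_nz intro: continuous_on_subset)
  note oN = continuous_open_preimage[OF this U3(1) open_greaterThan[of 0]]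
  define N where "N = {y \<in> U3. \<bar>2 * J'' y v / Jdet y\<bar> - 2 * D * norm (DG y v) > 0}"
  have "N = U3 \<inter> (\<lambda>y. \<bar>2 * J'' y v / Jdet y\<bar> - 2 * D * norm (DG y v)) -` {0<..}"
   by (auto simp: N_def)
  then have oN: "open N" using oN by simp
  have "x \<in> N" using neg U3(2) by (simp add: N_def \<open>J' = J'' x\<close>)
  then have "N \<inter> V \<noteq> {}" using dense[OF oN] by blast
  then obtain y where y: "y \<in> N" "y \<in> V" by blast
  then have "y \<in> U3" "\<bar>2 * J'' y v / Jdet y\<bar> > 2 * D * norm (DG y v)"
   by (simp_all add: N_def)
  moreover have "\<bar>2 * J'' y v / Jdet y\<bar> \<le> 2 * D * norm (DG y v)"
   by (rule on_V[OF y(2) U(3)]) (use \<open>y \<in> U3\<close> in "simp add: U3_def")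
  ultimately show False by simp
 qed
 have "\<exists>k'. ((\<lambda>y. l (H y)) has_derivative k') (at y) \<and> onorm k' \<le> 2 * D" for y
 proof -
  obtain J' where J': "(Jdet has_derivative J') (at (H y))"
   by (rule Jdet_local_derivative[of "H y"]) blast
  have "((\<lambda>y. l (H y)) has_derivative (\<lambda>w. 2 * J' (DH y w) / Jdet (H y))) (at y)"
   by (rule has_derivative_compose[OF derH l_der[OF J']])
  moreover have "onorm (\<lambda>w. 2 * J' (DH y w) / Jdet (H y)) \<le> 2 * D"
  proof (rule onorm_le)
   show "norm (2 * J' (DH y w) / Jdet (H y)) \<le> 2 * D * norm w" for w
    using bound[OF J', of "DH y w"] by (simp add: DG_DH)
  qed
  ultimately show ?thesis by blast
 qed
 then obtain k' where k': "\<And>y. ((\<lambda>y. l (H y)) has_derivative k' y) (at y)" "\<And>y. onorm (k' y) \<le> 2 * D"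
  by metis
 have "norm (l (H y) - l (H y')) \<le> 2 * D * norm (y - y')"
  by (rule differentiable_bound[where S = UNIV and f' = k']) (use k' in auto)
 then show ?thesis by (simp add: l abs_le_iff)
qed

end

section \<open>Translations of the torus, indexed by vectors so that the norm measures their
  size\<close>

definition tshift :: "real ^ 'm::finite => 'm torus => 'm torus" where
 "tshift w \<o> = tproj (trep \<o> + w)"

lemma tshift_tproj: "tshift w (tproj x) = tproj (x + w)"
proof -
 have "trep (tproj x) - x \<in> int_vecs" unfolding tproj_eq_iff[symmetric] by simp
 then show ?thesis unfolding tshift_def tproj_eq_iff by (simp add: algebra_simps)
qed

lemma tshift_add: "tshift v (tshift w \<o>) = tshift (w + v) \<o>"
 by (simp add: tshift_def[of w] tshift_def[of "w + v"] tshift_tproj add.assoc)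

lemma tshift_0 [simp]: "tshift 0 \<o> = \<o>" by (simp add: tshift_def)

lemma dist_tshift_le: "dist (tshift w \<o>) \<o> \<le> norm w"
 using dist_tproj_le[of "trep \<o> + w" "trep \<o>"] by (simp add: tshift_def dist_norm)

lemma tshift_connects: obtains w where "tshift w \<o> = \<o>'" "norm w = dist \<o> \<o>'"
proof -
 obtain y where "tproj y = \<o>'" "dist (trep \<o>) y = dist (tproj (trep \<o>)) \<o>'"
  by (rule tproj_lift_close)
 then show thesis
  by (intro that[of "y - trep \<o>"]) (simp_all add: tshift_def dist_norm norm_minus_commute)
qed

lemma continuous_tshift2: "continuous_on UNIV (\<lambda>p. tshift (fst p) (snd p :: 'm::finite torus))"
 unfolding continuous_on_iff
proof (intro ballI allI impI)
 fix p :: "(real ^ 'm) \<times> 'm torus" and e :: real assume e: "e > 0"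
 have "dist (tshift (fst q) (snd q)) (tshift (fst p) (snd p)) \<le> norm (fst q - fst p) + dist (snd q) (snd p)" for q
 proof -
  obtain v where v: "tshift v (snd p) = snd q" "norm v = dist (snd p) (snd q)"
   by (rule tshift_connects)
  have "tshift (fst q) (snd q) = tshift ((fst q - fst p) + v) (tshift (fst p) (snd p))"
   by (simp add: v(1)[symmetric] tshift_add algebra_simps)
  then have "dist (tshift (fst q) (snd q)) (tshift (fst p) (snd p)) \<le> norm ((fst q - fst p) + v)"
   by (simp add: dist_tshift_le)
  also have "\<dots> \<le> norm (fst q - fst p) + norm v" by (rule norm_triangle_ineq)
  finally show ?thesis using v(2) by (simp add: dist_commute)
 qed
 moreover have "norm (fst q - fst p) + dist (snd q) (snd p) < e" if "dist q p < e/2" for q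
  using dist_fst_le[of q p] dist_snd_le[of q p] that by (simp add: dist_norm)
 ultimately show "\<exists>d>0. \<forall>q\<in>UNIV. dist q p < d \<longrightarrow> dist (tshift (fst q) (snd q)) (tshift (fst p) (snd p)) < e"
  using e by (intro exI[of _ "e/2"]) (meson half_gt_zero le_less_trans)
qed

lemma measurable_tshift [measurable (raw)]:
 fixes h :: "'a => real ^ 'm::finite"
 assumes [measurable]: "h \<in> borel_measurable M" "k \<in> borel_measurable M"
 shows "(\<lambda>x. tshift (h x) (k x)) \<in> borel_measurable M"
proof -
 have "(\<lambda>x. tshift (fst (h x, k x)) (snd (h x, k x))) \<in> borel_measurable M"
  by (rule measurable_compose[OF _ borel_measurable_continuous_onI[OF continuous_tshift2]])
   (simp add: borel_prod[symmetric])
 then show ?thesis by simp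
qed

text \<open>The second form says that from any starting point a translation chosen uniformly in the
  cube leads to a Haar distributed point. It converts estimates for single translations into
  comparisons with Haar measure.\<close>

lemma nn_integral_haar_tshift:
 fixes \<phi> :: "'m::finite torus => ennreal"
 assumes [measurable]: "\<phi> \<in> borel_measurable borel"
 shows "(\<integral>\<^sup>+\<o>. \<phi> (tshift w \<o>) \<partial>haar) = (\<integral>\<^sup>+\<o>. \<phi> \<o> \<partial>haar)"
  and "(\<integral>\<^sup>+w. \<phi> (tshift w \<o>) * indicator unit_cube w \<partial>lborel) = (\<integral>\<^sup>+\<o>. \<phi> \<o> \<partial>haar)"
proof -
 have "(\<integral>\<^sup>+\<o>. \<phi> (tshift w \<o>) \<partial>haar) = (\<integral>\<^sup>+y. \<phi> (tproj (w + y)) * indicator unit_cube y \<partial>lborel)"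
  by (subst nn_integral_haar) (simp_all add: tshift_tproj add.commute[of w])
 then show "(\<integral>\<^sup>+\<o>. \<phi> (tshift w \<o>) \<partial>haar) = (\<integral>\<^sup>+\<o>. \<phi> \<o> \<partial>haar)"
  by (simp only: nn_integral_haar_shift[OF assms])
 show "(\<integral>\<^sup>+w. \<phi> (tshift w \<o>) * indicator unit_cube w \<partial>lborel) = (\<integral>\<^sup>+\<o>. \<phi> \<o> \<partial>haar)"
  unfolding tshift_def by (rule nn_integral_haar_shift[OF assms])
qed

lemma (in diffeo_lift) funpow_lift_eq: "(g ^^ k) (tproj x) = tproj ((G ^^ k) x)"
 by (induction k) (simp_all add: lift_eq)

lemma det_matrix_compose:
 fixes A B :: "real ^ 'm::finite => real ^ 'm"
 assumes "linear A" "linear B"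
 shows "det (matrix (\<lambda>v. B (A v))) = det (matrix B) * det (matrix A)"
 using matrix_compose[OF assms] by (simp add: o_def det_mul)

context expanding_lift
begin

text \<open>Logarithm of the Jacobian of \<open>G ^^ k\<close> at the point that it maps to
  \<open>y\<close>.\<close>

definition log_jac :: "nat => real ^ 'm => real" where
 "log_jac k y = (\<Sum>j<k. ln (J ((H ^^ Suc j) y)))"

lemma cont_funpow_G: "continuous_on UNIV (G ^^ k)" and cont_funpow_H: "continuous_on UNIV (H ^^ k)"
 by (induction k) (auto intro!: continuous_on_compose2[OF contG] continuous_on_compose2[OF contH] simp: id_def o_def)

lemma HGk [simp]: "(H ^^ k) ((G ^^ k) x) = x" and GHk [simp]: "(G ^^ k) ((H ^^ k) y) = y"
proof -
 show "(H ^^ k) ((G ^^ k) x) = x" by (induction k arbitrary: x) (simp_all add: funpow_swap1)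
 show "(G ^^ k) ((H ^^ k) y) = y" by (induction k arbitrary: y) (simp_all add: funpow_swap1)
qed

lemma GHk_le: "j \<le> k ==> (G ^^ j) ((H ^^ k) y) = (H ^^ (k - j)) y"
 using GHk[of j "(H ^^ (k - j)) y"] by (metis comp_apply funpow_add le_add_diff_inverse)

lemma HGk_le: "j \<le> k ==> (H ^^ (k - j)) ((G ^^ k) x) = (G ^^ j) x"
 using HGk[of "k - j" "(G ^^ j) x"] by (metis comp_apply funpow_add le_add_diff_inverse2)

lemma funpow_H_lipschitz: "norm ((H ^^ k) y - (H ^^ k) y') \<le> norm (y - y') / \<sigma> ^ k"
proof (induction k)
 case (Suc k)
 have "norm ((H ^^ Suc k) y - (H ^^ Suc k) y') \<le> norm ((H ^^ k) y - (H ^^ k) y') / \<sigma>"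
  by (simp add: H_lipschitz)
 also have "\<dots> \<le> norm (y - y') / \<sigma> ^ k / \<sigma>"
  using Suc \<sigma>_gt_1 by (intro divide_right_mono) auto
 finally show ?case by (simp add: mult.commute)
qed simp

lemma funpow_G_add_int: "n \<in> int_vecs ==> \<exists>p\<in>int_vecs. \<forall>x. (G ^^ k) (x + n) = (G ^^ k) x + p"
proof (induction k)
 case (Suc k)
 then obtain p where p: "p \<in> int_vecs" "\<And>x. (G ^^ k) (x + n) = (G ^^ k) x + p" by blast
 then show ?case by (intro bexI[of _ "G p - G 0"]) (auto simp: G_add_int periodG)
qed auto

lemma funpow_H_derivative:
 "\<exists>A. (\<forall>y. ((H ^^ k) has_derivative A y) (at y)) \<and> continuous_on UNIV (\<lambda>y. det (matrix (A y))) \<and>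
   (\<forall>y. \<bar>det (matrix (A y))\<bar> = exp (- log_jac k y))"
proof (induction k)
 case 0
 have "det (matrix (\<lambda>x :: real ^ 'm. x)) = 1" by (simp add: matrix_id_mat_1[unfolded id_def])
 then show ?case
  by (intro exI[of _ "\<lambda>y v. v"]) (simp add: log_jac_def id_def)
next
 case (Suc k)
 then obtain A where A: "\<And>y. ((H ^^ k) has_derivative A y) (at y)"
  "continuous_on UNIV (\<lambda>y. det (matrix (A y)))" "\<And>y. \<bar>det (matrix (A y))\<bar> = exp (- log_jac k y)"
  by blast
 define B where "B = (\<lambda>y v. DH ((H ^^ k) y) (A y v))"
 have "((H ^^ Suc k) has_derivative B y) (at y)" for y
  using has_derivative_compose[OF A(1) derH] by (simp add: B_def o_def)
 moreover have det: "det (matrix (B y)) = det (matrix (A y)) / Jdet ((H ^^ Suc k) y)" for y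
 proof -
  have "det (matrix (DH ((H ^^ k) y))) = 1 / Jdet ((H ^^ Suc k) y)"
   using det_DH[of "(H ^^ k) y"] Jdet_nz[of "(H ^^ Suc k) y"] by (simp add: field_simps)
  moreover have "det (matrix (B y)) = det (matrix (DH ((H ^^ k) y))) * det (matrix (A y))"
   unfolding B_def by (rule det_matrix_compose[OF has_derivative_linear[OF A(1)] linear_DH])
  ultimately show ?thesis by simp
 qed
 moreover have "continuous_on UNIV (\<lambda>y. det (matrix (B y)))"
  unfolding det
  by (intro continuous_on_divide A(2) continuous_on_compose2[OF cont_Jdet cont_funpow_H])
   (auto simp: Jdet_nz)
 moreover have "\<bar>det (matrix (B y))\<bar> = exp (- log_jac (Suc k) y)" for y
 proof -
  have "\<bar>det (matrix (B y))\<bar> = exp (- log_jac k y) / J ((H ^^ Suc k) y)"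
   by (simp only: det abs_divide A(3) J_def)
  also have "\<dots> = exp (- log_jac k y) / exp (ln (J ((H ^^ Suc k) y)))"
   using J_pos[of "(H ^^ Suc k) y"] by (simp only: exp_ln)
  also have "\<dots> = exp (- log_jac k y - ln (J ((H ^^ Suc k) y)))" by (simp only: exp_diff)
  also have "- log_jac k y - ln (J ((H ^^ Suc k) y)) = - log_jac (Suc k) y"
   unfolding log_jac_def sum.lessThan_Suc by simp
  finally show ?thesis .
 qed
 ultimately show ?case by blast
qed

lemma funpow_G_derivative:
 "\<exists>A. (\<forall>x. ((G ^^ k) has_derivative A x) (at x)) \<and> continuous_on UNIV (\<lambda>x. det (matrix (A x))) \<and>
   (\<forall>x. \<bar>det (matrix (A x))\<bar> = exp (log_jac k ((G ^^ k) x)))"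
proof (induction k)
 case 0
 have "det (matrix (\<lambda>x :: real ^ 'm. x)) = 1" by (simp add: matrix_id_mat_1[unfolded id_def])
 then show ?case
  by (intro exI[of _ "\<lambda>y v. v"]) (simp add: log_jac_def id_def)
next
 case (Suc k)
 then obtain A where A: "\<And>y. ((G ^^ k) has_derivative A y) (at y)"
  "continuous_on UNIV (\<lambda>y. det (matrix (A y)))" "\<And>y. \<bar>det (matrix (A y))\<bar> = exp (log_jac k ((G ^^ k) y))"
  by blast
 define B where "B = (\<lambda>y v. DG ((G ^^ k) y) (A y v))"
 have "((G ^^ Suc k) has_derivative B y) (at y)" for y
  using has_derivative_compose[OF A(1) derG] by (simp add: B_def o_def)
 moreover have det: "det (matrix (B y)) = Jdet ((G ^^ k) y) * det (matrix (A y))" for y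
  unfolding B_def Jdet_def by (rule det_matrix_compose[OF has_derivative_linear[OF A(1)] linear_DG])
 moreover have "continuous_on UNIV (\<lambda>y. det (matrix (B y)))"
  unfolding det
  by (intro continuous_on_mult A(2) continuous_on_compose2[OF cont_Jdet cont_funpow_G]) auto
 moreover have "\<bar>det (matrix (B y))\<bar> = exp (log_jac (Suc k) ((G ^^ Suc k) y))" for y
 proof -
  have "log_jac (Suc k) ((G ^^ Suc k) y) = ln (J ((G ^^ k) y)) + log_jac k ((G ^^ k) y)"
  proof -
   define z where "z = (G ^^ k) y"
   have H: "(H ^^ Suc j) (G z) = (H ^^ j) z" for j
    by (simp add: funpow_Suc_right del: funpow.simps)
   have "log_jac (Suc k) (G z) = (\<Sum>j<Suc k. ln (J ((H ^^ j) z)))"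
    unfolding log_jac_def H ..
   also have "\<dots> = ln (J z) + log_jac k z"
    unfolding log_jac_def sum.lessThan_Suc_shift by simp
   finally show ?thesis by (simp add: z_def)
  qed
  then show ?thesis
   using J_pos[of "(G ^^ k) y"] by (simp add: det abs_mult A(3) J_def exp_add)
 qed
 ultimately show ?case by blast
qed

text \<open>Backward orbits approach each other like powers of \<open>inverse \<sigma>\<close>, so
  the distortions of the successive steps form a geometric series. Its sum is the origin of
  \<open>a0_const\<close>, and the bound is uniform in \<open>k\<close>.\<close>

lemma log_jac_lipschitz:
 assumes dist: "\<And>y y'. \<bar>ln (J (H y)) - ln (J (H y'))\<bar> \<le> D * norm (y - y')" and D: "D \<ge> 0"
 shows "\<bar>log_jac k y - log_jac k y'\<bar> \<le> a0_const D \<sigma> * norm (y - y')"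
proof -
 have si: "0 < inverse \<sigma>" "inverse \<sigma> < 1" using \<sigma>_gt_1 by (auto simp: inverse_less_1_iff)
 have "\<bar>log_jac k y - log_jac k y'\<bar>
   \<le> (\<Sum>j<k. \<bar>ln (J (H ((H ^^ j) y))) - ln (J (H ((H ^^ j) y')))\<bar>)"
  unfolding log_jac_def sum_subtractf[symmetric] by (simp add: sum_abs)
 also have "\<dots> \<le> (\<Sum>j<k. D * (norm (y - y') / \<sigma> ^ j))"
  by (intro sum_mono order.trans[OF dist] mult_left_mono funpow_H_lipschitz D)
 also have "\<dots> = D * norm (y - y') * (\<Sum>j<k. inverse \<sigma> ^ j)"
  by (simp add: sum_distrib_left divide_inverse power_inverse mult.assoc)
 also have "\<dots> \<le> D * norm (y - y') * (1 / (1 - inverse \<sigma>))"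
 proof (rule mult_left_mono)
  have "(\<Sum>j<k. inverse \<sigma> ^ j) = (1 - inverse \<sigma> ^ k) / (1 - inverse \<sigma>)"
   using si \<sigma>_gt_1 by (simp add: sum_gp_strict)
  also have "\<dots> \<le> 1 / (1 - inverse \<sigma>)" using si by (intro divide_right_mono) auto
  finally show "(\<Sum>j<k. inverse \<sigma> ^ j) \<le> 1 / (1 - inverse \<sigma>)" .
 qed (use D in simp)
 finally show ?thesis by (simp add: a0_const_def)
qed

text \<open>The map \<open>\<theta>\<close> is the lift through \<open>g ^^ k\<close> of the rotation by \<open>w\<close> that is close to the
 identity.\<close>

lemma lifted_rotation:
 assumes dist: "\<And>y y'. \<bar>ln (J (H y)) - ln (J (H y'))\<bar> \<le> D * norm (y - y')" and D: "D \<ge> 0"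
 obtains \<theta> where "\<theta> \<in> borel_measurable borel" "\<And>\<o>. (g ^^ k) (\<theta> \<o>) = tshift w ((g ^^ k) \<o>)"
  "\<And>\<o> j. j \<le> k ==> dist ((g ^^ j) (\<theta> \<o>)) ((g ^^ j) \<o>) \<le> norm w / \<sigma> ^ (k - j)"
  "\<And>\<phi>. \<phi> \<in> borel_measurable borel ==>
   (\<integral>\<^sup>+\<o>. \<phi> (\<theta> \<o>) \<partial>haar) \<le> ennreal (exp (a0_const D \<sigma> * norm w)) * (\<integral>\<^sup>+\<o>. \<phi> \<o> \<partial>haar)"
proof -
 obtain A where A: "\<And>y. ((H ^^ k) has_derivative A y) (at y)"
  "continuous_on UNIV (\<lambda>y. det (matrix (A y)))" "\<And>y. \<bar>det (matrix (A y))\<bar> = exp (- log_jac k y)"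
  using funpow_H_derivative by blast
 obtain B where B: "\<And>y. ((G ^^ k) has_derivative B y) (at y)"
  "continuous_on UNIV (\<lambda>y. det (matrix (B y)))" "\<And>y. \<bar>det (matrix (B y))\<bar> = exp (log_jac k ((G ^^ k) y))"
  using funpow_G_derivative by blast
 \<comment> \<open>Go forward \<open>k\<close> times, translate, and come back along the same
   branch.\<close>
 define T where "T = (\<lambda>x. (H ^^ k) ((G ^^ k) x + w))"
 define Ti where "Ti = (\<lambda>x. (H ^^ k) ((G ^^ k) x - w))"
 define T' where "T' = (\<lambda>x v. A ((G ^^ k) x + w) (B x v))"
 \<comment> \<open>\<open>G ^^ k\<close> turns an integer translation into another integer
   translation, which commutes with adding \<open>w\<close>; going back restores the original one.
   So \<open>T\<close> descends to the torus.\<close>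
 have T_int: "T (x + n) = T x + n" if n: "n \<in> int_vecs" for x n
 proof -
  obtain p where p: "\<And>x. (G ^^ k) (x + n) = (G ^^ k) x + p" using funpow_G_add_int[OF n] by blast
  have "(G ^^ k) (T x + n) = (G ^^ k) (x + n) + w"
   unfolding p by (simp add: T_def algebra_simps)
  then have "(H ^^ k) ((G ^^ k) (T x + n)) = T (x + n)" unfolding T_def by (simp only:)
  then show ?thesis by simp
 qed
 define \<theta> where "\<theta> = (\<lambda>\<o>. tproj (T (trep \<o>)))"
 have \<theta>: "\<theta> (tproj x) = tproj (T x)" for x
 proof -
  define n where "n = trep (tproj x) - x"
  have "n \<in> int_vecs" unfolding n_def tproj_eq_iff[symmetric] by simp
  moreover have "trep (tproj x) = x + n" by (simp add: n_def)
  ultimately show ?thesis by (simp add: \<theta>_def T_int)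
 qed
 have contT: "continuous_on UNIV T" "continuous_on UNIV Ti"
  unfolding T_def Ti_def
  by (intro continuous_on_compose2[OF cont_funpow_H] continuous_intros cont_funpow_G subset_UNIV)+
 have m\<theta>: "\<theta> \<in> borel_measurable borel"
  by (rule borel_measurable_continuous_onI[OF continuous_torusI])
   (simp add: \<theta> continuous_on_tproj contT)
 show thesis
 proof (rule that[OF m\<theta>])
  fix \<o> :: "'m torus"
  define x where "x = trep \<o>"
  have x: "\<o> = tproj x" by (simp add: x_def)
  show "(g ^^ k) (\<theta> \<o>) = tshift w ((g ^^ k) \<o>)"
   by (simp add: x \<theta> funpow_lift_eq tshift_tproj T_def)
  show "dist ((g ^^ j) (\<theta> \<o>)) ((g ^^ j) \<o>) \<le> norm w / \<sigma> ^ (k - j)" if j: "j \<le> k" for j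
  proof -
   have "dist ((g ^^ j) (\<theta> \<o>)) ((g ^^ j) \<o>) \<le> norm ((G ^^ j) (T x) - (G ^^ j) x)"
    using dist_tproj_le[of "(G ^^ j) (T x)" "(G ^^ j) x"] by (simp add: x \<theta> funpow_lift_eq dist_norm)
   also have "(G ^^ j) (T x) - (G ^^ j) x = (H ^^ (k - j)) ((G ^^ k) x + w) - (H ^^ (k - j)) ((G ^^ k) x)"
    unfolding T_def GHk_le[OF j] HGk_le[OF j] ..
   also have "norm \<dots> \<le> norm w / \<sigma> ^ (k - j)"
    using funpow_H_lipschitz[of "k - j" "(G ^^ k) x + w" "(G ^^ k) x"] by simp
   finally show ?thesis .
  qed
 next
  fix \<phi> :: "'m torus => ennreal" assume \<phi>: "\<phi> \<in> borel_measurable borel"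
  have detT: "det (matrix (T' x)) = det (matrix (A ((G ^^ k) x + w))) * det (matrix (B x))" for x
   unfolding T'_def
   by (rule det_matrix_compose[OF has_derivative_linear[OF B(1)] has_derivative_linear[OF A(1)]])
  show "(\<integral>\<^sup>+\<o>. \<phi> (\<theta> \<o>) \<partial>haar) \<le> ennreal (exp (a0_const D \<sigma> * norm w)) * (\<integral>\<^sup>+\<o>. \<phi> \<o> \<partial>haar)"
  proof (rule nn_integral_haar_diffeo_le[where \<Theta> = T and \<Theta>i = Ti and \<Theta>' = T'])
   show "(T has_derivative T' x) (at x)" for x
   proof -
    have "((\<lambda>x. (G ^^ k) x + w) has_derivative B x) (at x)"
     using B(1) by (auto intro!: derivative_eq_intros)
    from has_derivative_compose[OF this A(1)] show ?thesis by (simp add: T_def T'_def)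
   qed
   show "Ti (T x) = x" "T (Ti x) = x" for x by (simp_all add: T_def Ti_def)
   show "continuous_on UNIV (\<lambda>x. det (matrix (T' x)))"
    unfolding detT
    by (intro continuous_on_mult B(2) continuous_on_compose2[OF A(2)] continuous_on_add cont_funpow_G
      continuous_on_const subset_UNIV)
   \<comment> \<open>The Jacobian of \<open>T\<close> is a quotient of Jacobians of
     \<open>G ^^ k\<close> belonging to two image points at distance \<open>norm w\<close>.\<close>
   show "exp (- (a0_const D \<sigma> * norm w)) \<le> \<bar>det (matrix (T' x))\<bar>" for x
   proof -
    have "\<bar>det (matrix (T' x))\<bar> = exp (- log_jac k ((G ^^ k) x + w) + log_jac k ((G ^^ k) x))"
     by (simp only: detT abs_mult A(3) B(3) exp_add)
    then show ?thesis
     using log_jac_lipschitz[OF dist D, of k "(G ^^ k) x + w" "(G ^^ k) x"] by simp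
   qed
  qed (use contT T_int \<theta> m\<theta> \<phi> in auto)
 qed
qed

end

section \<open>Approximation and averaging\<close>

lemma prob_integrable_bounded:
 fixes f :: "'a => real"
 assumes "prob_space M" "f \<in> borel_measurable M" "\<And>x. \<bar>f x\<bar> \<le> B"
 shows "integrable M f"
proof -
 interpret prob_space M by fact
 show ?thesis by (rule integrable_const_bound[of _ B]) (use assms in auto)
qed

lemma prob_integral_le_const:
 fixes f :: "'a => real"
 assumes "prob_space M" "integrable M f" "\<And>x. f x \<le> B"
 shows "(\<integral>x. f x \<partial>M) \<le> B"
proof -
 interpret prob_space M by fact
 show ?thesis by (rule integral_le_const) (use assms in auto)
qed

lemma prob_integral_ge_const:
 fixes f :: "'a => real"
 assumes "prob_space M" "integrable M f" "\<And>x. B \<le> f x"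
 shows "B \<le> (\<integral>x. f x \<partial>M)"
proof -
 interpret prob_space M by fact
 show ?thesis by (rule integral_ge_const) (use assms in auto)
qed

lemma prob_Fubini_bounded:
 fixes h :: "'a => 'b => real"
 assumes M: "prob_space M" "prob_space N" and h: "case_prod h \<in> borel_measurable (M \<Otimes>\<^sub>M N)"
  and B: "\<And>x y. \<bar>h x y\<bar> \<le> B"
 shows "(\<integral>x. \<integral>y. h x y \<partial>N \<partial>M) = (\<integral>y. \<integral>x. h x y \<partial>M \<partial>N)"
proof -
 interpret M: prob_space M by fact
 interpret N: prob_space N by fact
 interpret pair_prob_space M N ..
 have "integrable (M \<Otimes>\<^sub>M N) (case_prod h)"
  by (rule prob_integrable_bounded[OF _ h, of B]) (use B P.prob_space_axioms in auto)
 from Fubini_integral[OF this] show ?thesis by simp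
qed

text \<open>Density of continuous functions in L1, phrased as a property of one function so that the
  induction rules for Borel sets and for integrable functions apply to it.\<close>

definition L1_approximable :: "'a::metric_space measure => ('a => real) => bool" where
 "L1_approximable M f \<longleftrightarrow> integrable M f \<and>
   (\<forall>e>0. \<exists>\<phi>. continuous_on UNIV \<phi> \<and> integrable M \<phi> \<and> (\<integral>x. \<bar>f x - \<phi> x\<bar> \<partial>M) < e)"

lemma L1_approximable_add:
 assumes "L1_approximable M f" "L1_approximable M h"
 shows "L1_approximable M (\<lambda>x. f x + h x)"
 unfolding L1_approximable_def
proof (intro conjI allI impI)
 have int: "integrable M f" "integrable M h" using assms by (auto simp: L1_approximable_def)
 then show "integrable M (\<lambda>x. f x + h x)" by simp
 fix e :: real assume "e > 0"
 then have e2: "e / 2 > 0" by simp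
 obtain \<phi> where \<phi>: "continuous_on UNIV \<phi>" "integrable M \<phi>" "(\<integral>x. \<bar>f x - \<phi> x\<bar> \<partial>M) < e / 2"
  using assms(1) e2 unfolding L1_approximable_def by blast
 obtain \<psi> where \<psi>: "continuous_on UNIV \<psi>" "integrable M \<psi>" "(\<integral>x. \<bar>h x - \<psi> x\<bar> \<partial>M) < e / 2"
  using assms(2) e2 unfolding L1_approximable_def by blast
 have "(\<integral>x. \<bar>(f x + h x) - (\<phi> x + \<psi> x)\<bar> \<partial>M) \<le> (\<integral>x. \<bar>f x - \<phi> x\<bar> + \<bar>h x - \<psi> x\<bar> \<partial>M)"
  by (rule integral_mono) (use int \<phi> \<psi> in auto)
 also have "\<dots> = (\<integral>x. \<bar>f x - \<phi> x\<bar> \<partial>M) + (\<integral>x. \<bar>h x - \<psi> x\<bar> \<partial>M)"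
  by (rule Bochner_Integration.integral_add) (use int \<phi> \<psi> in auto)
 also have "\<dots> < e" using \<phi> \<psi> by simp
 finally show "\<exists>\<phi>. continuous_on UNIV \<phi> \<and> integrable M \<phi> \<and> (\<integral>x. \<bar>(f x + h x) - \<phi> x\<bar> \<partial>M) < e"
  using \<phi> \<psi> by (intro exI[of _ "\<lambda>x. \<phi> x + \<psi> x"]) (auto intro: continuous_on_add)
qed

lemma L1_approximable_scale:
 assumes "L1_approximable M f" shows "L1_approximable M (\<lambda>x. f x * c)"
 unfolding L1_approximable_def
proof (intro conjI allI impI)
 have int: "integrable M f" using assms by (auto simp: L1_approximable_def)
 then show "integrable M (\<lambda>x. f x * c)" by simp
 fix e :: real assume "e > 0"
 then have "e / (\<bar>c\<bar> + 1) > 0" by (intro divide_pos_pos) auto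
 then obtain \<phi> where \<phi>: "continuous_on UNIV \<phi>" "integrable M \<phi>" "(\<integral>x. \<bar>f x - \<phi> x\<bar> \<partial>M) < e / (\<bar>c\<bar> + 1)"
  using assms unfolding L1_approximable_def by blast
 have "(\<integral>x. \<bar>f x * c - \<phi> x * c\<bar> \<partial>M) = (\<integral>x. \<bar>f x - \<phi> x\<bar> * \<bar>c\<bar> \<partial>M)"
  by (intro Bochner_Integration.integral_cong) (auto simp: abs_mult[symmetric] algebra_simps)
 also have "\<dots> = (\<integral>x. \<bar>f x - \<phi> x\<bar> \<partial>M) * \<bar>c\<bar>" by simp
 also have "\<dots> \<le> (\<integral>x. \<bar>f x - \<phi> x\<bar> \<partial>M) * (\<bar>c\<bar> + 1)"
  by (intro mult_left_mono integral_nonneg_AE) auto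
 also have "\<dots> < e" using \<phi>(3) by (simp add: pos_less_divide_eq)
 finally show "\<exists>\<phi>. continuous_on UNIV \<phi> \<and> integrable M \<phi> \<and> (\<integral>x. \<bar>f x * c - \<phi> x\<bar> \<partial>M) < e"
  using \<phi> by (intro exI[of _ "\<lambda>x. \<phi> x * c"]) (auto intro: continuous_on_mult_right)
qed

text \<open>The domination by twice the limit is the form in which \<open>integrable_induct\<close>
  presents its approximations; it makes three times |f| a majorant of the error.\<close>

lemma L1_approximable_lim:
 assumes s: "\<And>i. L1_approximable M (s i)" and lim: "\<And>x. (\<lambda>i. s i x) \<longlonglongrightarrow> f x"
  and bd: "\<And>i x. \<bar>s i x\<bar> \<le> 2 * \<bar>f x\<bar>" and f: "integrable M f"
 shows "L1_approximable M f"
 unfolding L1_approximable_def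
proof (intro conjI allI impI f)
 have int: "integrable M (s i)" for i using s by (auto simp: L1_approximable_def)
 have "(\<lambda>i. \<integral>x. \<bar>f x - s i x\<bar> \<partial>M) \<longlonglongrightarrow> (\<integral>x. 0 \<partial>M)"
 proof (rule integral_dominated_convergence[where w = "\<lambda>x. 3 * \<bar>f x\<bar>"])
  show "AE x in M. (\<lambda>i. \<bar>f x - s i x\<bar>) \<longlonglongrightarrow> 0"
  proof (rule AE_I2)
   fix x
   have "(\<lambda>i. \<bar>f x - s i x\<bar>) \<longlonglongrightarrow> \<bar>f x - f x\<bar>" by (intro tendsto_intros lim)
   then show "(\<lambda>i. \<bar>f x - s i x\<bar>) \<longlonglongrightarrow> 0" by simp
  qed
  show "AE x in M. norm \<bar>f x - s i x\<bar> \<le> 3 * \<bar>f x\<bar>" for i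
  proof (rule AE_I2)
   fix x show "norm \<bar>f x - s i x\<bar> \<le> 3 * \<bar>f x\<bar>" using bd[of i x] by simp
  qed
  show "(\<lambda>x. \<bar>f x - s i x\<bar>) \<in> borel_measurable M" for i
   using f int by (intro borel_measurable_abs borel_measurable_diff) auto
 qed (use f in auto)
 then have lim0: "(\<lambda>i. \<integral>x. \<bar>f x - s i x\<bar> \<partial>M) \<longlonglongrightarrow> 0" by simp
 fix e :: real assume "e > 0"
 then have e2: "e / 2 > 0" by simp
 obtain i where i: "(\<integral>x. \<bar>f x - s i x\<bar> \<partial>M) < e / 2"
  using order_tendstoD(2)[OF lim0 e2] by (auto simp: eventually_sequentially)
 obtain \<phi> where \<phi>: "continuous_on UNIV \<phi>" "integrable M \<phi>" "(\<integral>x. \<bar>s i x - \<phi> x\<bar> \<partial>M) < e / 2"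
  using s[of i] e2 unfolding L1_approximable_def by blast
 have "(\<integral>x. \<bar>f x - \<phi> x\<bar> \<partial>M) \<le> (\<integral>x. \<bar>f x - s i x\<bar> + \<bar>s i x - \<phi> x\<bar> \<partial>M)"
  by (rule integral_mono) (use int[of i] f \<phi> in auto)
 also have "\<dots> = (\<integral>x. \<bar>f x - s i x\<bar> \<partial>M) + (\<integral>x. \<bar>s i x - \<phi> x\<bar> \<partial>M)"
  by (rule Bochner_Integration.integral_add) (use int[of i] f \<phi> in auto)
 also have "\<dots> < e" using \<phi> i by simp
 finally show "\<exists>\<phi>. continuous_on UNIV \<phi> \<and> integrable M \<phi> \<and> (\<integral>x. \<bar>f x - \<phi> x\<bar> \<partial>M) < e"
  using \<phi> by blast
qed

lemma L1_approximable_continuous: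
 "continuous_on UNIV f ==> integrable M f ==> L1_approximable M f"
 by (auto simp: L1_approximable_def intro!: exI[of _ f])

text \<open>Dynkin induction from the open sets. The indicator of an open set is the increasing
  limit of truncated multiples of the distance to its complement.\<close>

lemma L1_approximable_indicator:
 fixes A :: "'a::metric_space set"
 assumes M: "prob_space M" "sets M = sets borel" and A: "A \<in> sets borel"
 shows "L1_approximable M (indicator A)"
proof -
 note [measurable_cong] = M(2)
 have int_ind: "integrable M (indicator A :: 'a => real)" if "A \<in> sets borel" for A
  by (rule prob_integrable_bounded[OF M(1), of _ 1]) (use that M(2) in "auto simp: indicator_def")
 have "Int_stable {S :: 'a set. open S}" by (auto simp: Int_stable_def)
 moreover have "{S :: 'a set. open S} \<subseteq> Pow UNIV" by simp
 moreover have "A \<in> sigma_sets UNIV {S. open S}" using A by (simp add: sets_borel)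
 ultimately show ?thesis
 proof (induction rule: sigma_sets_induct_disjoint)
  case (basic U)
  then have U: "open U" by simp
  show ?case
  \<comment> \<open>For the whole space the complement is empty and \<open>infdist\<close> takes its
    default value 0, so the approximating functions would vanish.\<close>
  proof (cases "U = UNIV")
   case True
   then show ?thesis
    using int_ind[of UNIV] by (intro L1_approximable_continuous) (auto simp: indicator_def)
  next
   case False
   define s where "s = (\<lambda>n x. min 1 (real n * infdist x (- U)))"
   have cont: "continuous_on UNIV (s n)" for n
    unfolding s_def by (intro continuous_intros)
   have s0: "s n x = 0" if "x \<notin> U" for n x using that by (simp add: s_def)
   have bd: "0 \<le> s n x" "s n x \<le> 1" for n x by (auto simp: s_def infdist_nonneg)
   show ?thesis
   proof (rule L1_approximable_lim[of M s])
    show "L1_approximable M (s i)" for i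
    proof (rule L1_approximable_continuous[OF cont])
     have "s i \<in> borel_measurable borel" by (rule borel_measurable_continuous_onI[OF cont])
     then show "integrable M (s i)"
      by (intro prob_integrable_bounded[OF M(1), of _ 1]) (use bd in auto)
    qed
    show "(\<lambda>i. s i x) \<longlonglongrightarrow> indicator U x" for x
    proof (cases "x \<in> U")
     case True
     have pos: "infdist x (- U) > 0"
      using True U False by (intro infdist_pos_not_in_closed) (auto simp: closed_def)
     obtain N where N: "real N * infdist x (- U) \<ge> 1"
      using reals_Archimedean3[OF pos] less_imp_le by metis
     have "s n x = 1" if "n \<ge> N" for n
     proof -
      have "1 \<le> real n * infdist x (- U)"
       using N mult_right_mono[of "real N" "real n" "infdist x (- U)"] that pos by linarith
      then show ?thesis by (simp add: s_def)
     qed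
     then have "eventually (\<lambda>n. s n x = indicator U x) sequentially"
      using True by (auto simp: eventually_sequentially)
     then show ?thesis by (rule tendsto_eventually)
    qed (simp add: s0)
    show "\<bar>s i x\<bar> \<le> 2 * \<bar>indicator U x\<bar>" for i x
     using s0[of x i] bd[of i x] by (cases "x \<in> U") auto
    show "integrable M (indicator U :: 'a => real)" using U by (intro int_ind) simp
   qed
  qed
 next
  case empty
  then show ?case by (intro L1_approximable_continuous) (auto simp: continuous_on_const)
 next
  case (compl A)
  have one: "L1_approximable M (\<lambda>x. 1)"
   using int_ind[of UNIV] by (intro L1_approximable_continuous) auto
  have "L1_approximable M (\<lambda>x. 1 + indicator A x * (-1))"
   by (intro L1_approximable_add one L1_approximable_scale compl)
  moreover have "(\<lambda>x. 1 + indicator A x * (-1)) = (indicator (UNIV - A) :: 'a => real)"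
   by (auto simp: indicator_def fun_eq_iff)
  ultimately show ?case by simp
 next
  case (union A)
  have mA: "A i \<in> sets borel" for i using union(2) by (auto simp: sets_borel)
  have fin: "L1_approximable M (\<lambda>x. \<Sum>i<n. indicator (A i) x)" for n :: nat
  proof (induction n)
   case 0 then show ?case by (intro L1_approximable_continuous) auto
  next
   case (Suc n) then show ?case using union(3) by (auto intro: L1_approximable_add)
  qed
  have eq: "(\<Sum>i<n. indicator (A i) x :: real) = indicator (\<Union>i<n. A i) x" for n x
   by (rule indicator_UN_disjoint[symmetric]) (use union(1) in "auto simp: disjoint_family_on_def")
  show ?case
  proof (rule L1_approximable_lim)
   show "L1_approximable M (\<lambda>x. indicator (\<Union>i<n. A i) x)" for n
    using fin[of n] unfolding eq .
   show "(\<lambda>n. indicator (\<Union>i<n. A i) x) \<longlonglongrightarrow> (indicator (\<Union>i. A i) x :: real)" for x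
    by (rule LIMSEQ_indicator_UN)
   show "\<bar>indicator (\<Union>i<n. A i) x\<bar> \<le> 2 * \<bar>indicator (\<Union>i. A i) x :: real\<bar>" for n x
    by (auto simp: indicator_def)
   show "integrable M (indicator (\<Union>i. A i) :: 'a => real)" using mA by (intro int_ind) auto
  qed
 qed
qed

lemma integrable_L1_approximable:
 fixes f :: "'a::metric_space => real"
 assumes M: "prob_space M" "sets M = sets borel" and f: "integrable M f"
 shows "L1_approximable M f"
 using f
proof (induction rule: integrable_induct)
 case (base A c)
 then show ?case
  using L1_approximable_scale[OF L1_approximable_indicator[OF M]] M(2) by simp
next
 case (add f g) then show ?case by (intro L1_approximable_add)
next
 case (lim f s)
 have "space M = UNIV" using sets_eq_imp_space_eq[OF M(2)] by simp
 show ?case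
 proof (rule L1_approximable_lim[of M s f])
  show "(\<lambda>i. s i x) \<longlonglongrightarrow> f x" for x using lim(2)[of x] \<open>space M = UNIV\<close> by simp
  show "\<bar>s i x\<bar> \<le> 2 * \<bar>f x\<bar>" for i x using lim(3)[of x i] \<open>space M = UNIV\<close> by simp
 qed (fact lim)+
qed

text \<open>A uniformly random translation vector; translating any fixed point by it gives Haar
  measure.\<close>

definition ucube :: "(real ^ 'm::finite) measure" where
 "ucube = density lborel (indicator unit_cube)"

lemma sets_ucube [simp, measurable_cong]: "sets ucube = sets borel" by (simp add: ucube_def)

lemma space_ucube [simp]: "space ucube = UNIV" by (simp add: ucube_def)

lemma nn_integral_ucube_tshift:
 fixes \<phi> :: "'m::finite torus => ennreal"
 assumes [measurable]: "\<phi> \<in> borel_measurable borel"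
 shows "(\<integral>\<^sup>+w. \<phi> (tshift w \<o>) \<partial>ucube) = (\<integral>\<^sup>+\<o>. \<phi> \<o> \<partial>haar)"
 unfolding ucube_def
 by (subst nn_integral_density)
  (simp_all add: nn_integral_haar_tshift(2)[OF assms, symmetric, of \<o>] mult.commute)

lemma prob_ucube: "prob_space (ucube :: (real ^ 'm::finite) measure)"
proof (rule prob_spaceI)
 have "emeasure ucube (space (ucube :: (real ^ 'm) measure)) = (\<integral>\<^sup>+w. (\<lambda>_::'m torus. 1) (tshift w (undefined :: 'm torus)) \<partial>(ucube :: (real ^ 'm) measure))"
  by simp
 also have "\<dots> = (\<integral>\<^sup>+\<o>. 1 \<partial>(haar :: 'm torus measure))" by (rule nn_integral_ucube_tshift) simp
 also have "\<dots> = 1" by (simp add: emeasure_haar_UNIV)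
 finally show "emeasure ucube (space (ucube :: (real ^ 'm) measure)) = 1" .
qed

lemma AE_ucube: "AE w in (ucube :: (real ^ 'm::finite) measure). norm w \<le> real CARD('m)"
proof -
 have "norm w \<le> real CARD('m)" if "w \<in> unit_cube" for w :: "real ^ 'm"
 proof -
  have "norm w \<le> (\<Sum>i\<in>UNIV. \<bar>w $ i\<bar>)" by (rule norm_le_l1_cart)
  also have "\<dots> \<le> (\<Sum>i\<in>(UNIV :: 'm set). 1)"
   by (rule sum_mono) (use that in "auto simp: unit_cube_def abs_le_iff less_imp_le intro: order.trans[of _ 0]")
  finally show ?thesis by simp
 qed
 then show ?thesis unfolding ucube_def by (subst AE_density) (auto simp: indicator_def)
qed

lemma integral_nn_cong:
 fixes f :: "'a => real" and h :: "'b => real"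
 assumes "f \<in> borel_measurable M" "h \<in> borel_measurable N" "\<And>x. 0 \<le> f x" "\<And>x. 0 \<le> h x"
  and "(\<integral>\<^sup>+x. ennreal (f x) \<partial>M) = (\<integral>\<^sup>+y. ennreal (h y) \<partial>N)"
 shows "(\<integral>x. f x \<partial>M) = (\<integral>y. h y \<partial>N)"
 using assms by (simp add: integral_eq_nn_integral)

lemma integral_ucube_tshift:
 fixes \<phi> :: "'m::finite torus => real"
 assumes [measurable]: "\<phi> \<in> borel_measurable borel" and B: "\<And>\<o>. 0 \<le> \<phi> \<o>"
 shows "(\<integral>w. \<phi> (tshift w \<o>) \<partial>ucube) = (\<integral>\<o>. \<phi> \<o> \<partial>haar)"
 by (rule integral_nn_cong) (use B nn_integral_ucube_tshift[of "\<lambda>\<o>. ennreal (\<phi> \<o>)"] in auto)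

lemma integral_haar_tshift:
 fixes \<phi> :: "'m::finite torus => real"
 assumes [measurable]: "\<phi> \<in> borel_measurable borel" and B: "\<And>\<o>. 0 \<le> \<phi> \<o>"
 shows "(\<integral>\<o>. \<phi> (tshift w \<o>) \<partial>haar) = (\<integral>\<o>. \<phi> \<o> \<partial>haar)"
 by (rule integral_nn_cong) (use B nn_integral_haar_tshift(1)[of "\<lambda>\<o>. ennreal (\<phi> \<o>)"] in auto)

section \<open>Regularity of the invariant density\<close>

text \<open>What the dynamical estimates keep of expansion and distortion: every translation after
  \<open>k\<close> steps comes from a map \<theta> that is close to the identity along the orbit and
  enlarges Haar integrals at most by \<open>exp (a * norm w)\<close>, with \<open>a\<close>
  independent of \<open>k\<close>.\<close>

locale lifted_rotations =
 fixes g :: "'m::finite torus => 'm torus" and \<sigma> a :: real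
 assumes g_meas [measurable]: "g \<in> borel_measurable borel" and sigma_gt_1: "\<sigma> > 1" and a_nonneg: "a \<ge> 0"
  and rot: "\<And>k w. \<exists>\<theta>. \<theta> \<in> borel_measurable borel \<and> (\<forall>\<o>. (g ^^ k) (\<theta> \<o>) = tshift w ((g ^^ k) \<o>)) \<and>
   (\<forall>\<o> j. j \<le> k \<longrightarrow> dist ((g ^^ j) (\<theta> \<o>)) ((g ^^ j) \<o>) \<le> norm w / \<sigma> ^ (k - j)) \<and>
   (\<forall>\<phi> \<in> borel_measurable borel.
    (\<integral>\<^sup>+\<o>. \<phi> (\<theta> \<o>) \<partial>haar) \<le> ennreal (exp (a * norm w)) * (\<integral>\<^sup>+\<o>. \<phi> \<o> \<partial>haar))"
begin

lemma rotE:
 obtains \<theta> where "\<theta> \<in> borel_measurable borel" "\<And>\<o>. (g ^^ k) (\<theta> \<o>) = tshift w ((g ^^ k) \<o>)"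
  "\<And>\<o> j. j \<le> k ==> dist ((g ^^ j) (\<theta> \<o>)) ((g ^^ j) \<o>) \<le> norm w / \<sigma> ^ (k - j)"
  "\<And>(\<phi> :: 'm torus => real) B. \<phi> \<in> borel_measurable borel ==> (\<And>\<o>. 0 \<le> \<phi> \<o>) ==> (\<And>\<o>. \<phi> \<o> \<le> B) ==>
   (\<integral>\<o>. \<phi> (\<theta> \<o>) \<partial>haar) \<le> exp (a * norm w) * (\<integral>\<o>. \<phi> \<o> \<partial>haar)"
proof -
 obtain \<theta> where \<theta>: "\<theta> \<in> borel_measurable borel" "\<And>\<o>. (g ^^ k) (\<theta> \<o>) = tshift w ((g ^^ k) \<o>)"
  "\<And>\<o> j. j \<le> k ==> dist ((g ^^ j) (\<theta> \<o>)) ((g ^^ j) \<o>) \<le> norm w / \<sigma> ^ (k - j)"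
  "\<And>\<phi>. \<phi> \<in> borel_measurable borel ==>
    (\<integral>\<^sup>+\<o>. \<phi> (\<theta> \<o>) \<partial>haar) \<le> ennreal (exp (a * norm w)) * (\<integral>\<^sup>+\<o>. \<phi> \<o> \<partial>haar)"
  using rot[of k w] by blast
 note [measurable] = \<theta>(1)
 show thesis
 proof (rule that[OF \<theta>(1,2,3)])
  fix \<phi> :: "'m torus => real" and B
  assume \<phi>: "\<phi> \<in> borel_measurable borel" "\<And>\<o>. 0 \<le> \<phi> \<o>" "\<And>\<o>. \<phi> \<o> \<le> B"
  note [measurable] = \<phi>(1)
  have int: "integrable haar \<phi>" "integrable haar (\<lambda>\<o>. \<phi> (\<theta> \<o>))"
   by (rule prob_integrable_bounded[OF haar.prob_space_axioms, of _ B]; use \<phi> in "auto simp: abs_le_iff intro: order.trans[of _ 0]")+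
  have "ennreal (\<integral>\<o>. \<phi> (\<theta> \<o>) \<partial>haar) = (\<integral>\<^sup>+\<o>. ennreal (\<phi> (\<theta> \<o>)) \<partial>haar)"
   using int \<phi>(2) by (simp add: nn_integral_eq_integral)
  also have "\<dots> \<le> ennreal (exp (a * norm w)) * (\<integral>\<^sup>+\<o>. ennreal (\<phi> \<o>) \<partial>haar)"
   by (rule \<theta>(4)) simp
  also have "(\<integral>\<^sup>+\<o>. ennreal (\<phi> \<o>) \<partial>haar) = ennreal (\<integral>\<o>. \<phi> \<o> \<partial>haar)"
   using int \<phi>(2) by (simp add: nn_integral_eq_integral)
  finally show "(\<integral>\<o>. \<phi> (\<theta> \<o>) \<partial>haar) \<le> exp (a * norm w) * (\<integral>\<o>. \<phi> \<o> \<partial>haar)"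
   using \<phi>(2) by (simp add: ennreal_mult[symmetric] integral_nonneg_AE)
 qed
qed

lemma measurable_funpow_g [measurable]: "(g ^^ k) \<in> borel_measurable borel"
 by (induction k) (auto simp: id_def)

end

lemma acip_integral_eq:
 fixes \<chi>' :: "'m::finite torus => real"
 assumes "acip_density g \<rho>" and [measurable]: "g \<in> borel_measurable borel" "\<chi>' \<in> borel_measurable borel"
 shows "(\<integral>\<o>. \<rho> \<o> * \<chi>' (g \<o>) \<partial>haar) = (\<integral>\<o>. \<rho> \<o> * \<chi>' \<o> \<partial>haar)"
proof -
 have [measurable]: "\<rho> \<in> borel_measurable borel" and \<rho>0: "\<And>\<o>. 0 \<le> \<rho> \<o>"
  and inv: "distr (density haar \<rho>) borel g = density haar \<rho>"
  using assms(1) by (auto simp: acip_density_def)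
 have d: "(\<integral>\<o>. \<rho> \<o> * h \<o> \<partial>haar) = (\<integral>\<o>. h \<o> \<partial>density haar \<rho>)" if [measurable]: "h \<in> borel_measurable borel" for h :: "'m torus => real"
  using \<rho>0 by (subst integral_density) auto
 have "(\<integral>\<o>. \<chi>' \<o> \<partial>density haar \<rho>) = (\<integral>\<o>. \<chi>' \<o> \<partial>distr (density haar \<rho>) borel g)"
  by (simp only: inv)
 also have "\<dots> = (\<integral>\<o>. \<chi>' (g \<o>) \<partial>density haar \<rho>)" by (subst integral_distr) auto
 finally show ?thesis by (simp add: d)
qed

lemma acip_density_integrable:
 assumes "acip_density g \<rho>"
 shows "integrable haar \<rho>" "(\<integral>\<o>. \<rho> \<o> \<partial>haar) = 1"
proof -
 have [measurable]: "\<rho> \<in> borel_measurable borel" and \<rho>0: "\<And>\<o>. 0 \<le> \<rho> \<o>"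
  and P: "prob_space (density haar \<rho>)"
  using assms by (auto simp: acip_density_def)
 have "(\<integral>\<^sup>+\<o>. ennreal (\<rho> \<o>) \<partial>haar) = 1"
  using prob_space.emeasure_space_1[OF P] by (simp add: emeasure_density)
 then show "integrable haar \<rho>" "(\<integral>\<o>. \<rho> \<o> \<partial>haar) = 1"
  using \<rho>0 by (auto intro!: integrableI_nonneg simp: integral_eq_nn_integral)
qed

context lifted_rotations
begin

text \<open>In effect, ln \<rho> is Lipschitz with constant \<open>a\<close>, stated weakly because
  \<rho> is only measurable. By invariance, a translation may be applied after \<open>k\<close>
  steps; pulled back it is \<theta>, which moves points by at most
  \<open>norm w / \<sigma> ^ k\<close>. A continuous approximation of \<rho> is hardly changed by
  this, so only the Jacobian of \<theta> remains.\<close>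

lemma acip_shift_le:
 assumes ac: "acip_density g \<rho>" and \<chi>m: "h \<in> borel_measurable borel"
  and h01: "\<And>\<o>. 0 \<le> h \<o>" "\<And>\<o>. h \<o> \<le> 1"
 shows "(\<integral>\<o>. \<rho> \<o> * h (tshift w \<o>) \<partial>haar) \<le> exp (a * norm w) * (\<integral>\<o>. \<rho> \<o> * h \<o> \<partial>haar)"
proof -
 note [measurable] = \<chi>m
 have [measurable]: "\<rho> \<in> borel_measurable borel" and \<rho>0: "\<And>\<o>. 0 \<le> \<rho> \<o>"
  using ac by (auto simp: acip_density_def)
 note int\<rho> = acip_density_integrable[OF ac]
 have inv: "(\<integral>\<o>. \<rho> \<o> * h' ((g ^^ k) \<o>) \<partial>haar) = (\<integral>\<o>. \<rho> \<o> * h' \<o> \<partial>haar)"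
  if [measurable]: "h' \<in> borel_measurable borel" for h' :: "'m torus => real" and k
 proof (induction k)
  case (Suc k)
  then show ?case
   using acip_integral_eq[OF ac g_meas, of "\<lambda>\<o>. h' ((g ^^ k) \<o>)"] by (simp add: funpow_swap1)
 qed simp
 define X where "X = (\<integral>\<o>. \<rho> \<o> * h (tshift w \<o>) \<partial>haar)"
 define Y where "Y = (\<integral>\<o>. \<rho> \<o> * h \<o> \<partial>haar)"
 define c where "c = exp (a * norm w)"
 have c: "c \<ge> 1" using a_nonneg by (simp add: c_def)
 have Y0: "Y \<ge> 0" unfolding Y_def using \<rho>0 h01 by (intro integral_nonneg_AE) auto
 \<comment> \<open>The inequality up to errors of order \<open>e\<close>; the summands multiplying
   \<open>e\<close> come from the two replacements of \<rho> by its approximation and from the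
   factor \<open>1 + e\<close>.\<close>
 have key: "X \<le> c * Y + e * (c * Y + 4 * c + 2)" if e: "0 < e" "e \<le> 1" for e
 proof -
  obtain \<phi> where \<phi>: "continuous_on UNIV \<phi>" "integrable haar \<phi>" "(\<integral>\<o>. \<bar>\<rho> \<o> - \<phi> \<o>\<bar> \<partial>haar) < e"
   using integrable_L1_approximable[OF haar.prob_space_axioms sets_haar int\<rho>(1)] e(1)
   unfolding L1_approximable_def by blast
  \<comment> \<open>The lower bound \<open>e\<close> turns a uniform modulus of size
    \<open>e * e\<close> into a ratio of at most \<open>1 + e\<close>.\<close>
  define \<psi> where "\<psi> = (\<lambda>\<o>. max 0 (\<phi> \<o>) + e)"
  have cont\<psi>: "continuous_on UNIV \<psi>" unfolding \<psi>_def by (intro continuous_intros \<phi>(1))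
  have [measurable]: "\<psi> \<in> borel_measurable borel" by (rule borel_measurable_continuous_onI[OF cont\<psi>])
  have \<psi>e: "\<psi> \<o> \<ge> e" for \<o> by (simp add: \<psi>_def)
  have int\<psi>: "integrable haar \<psi>" unfolding \<psi>_def using \<phi>(2) by simp
  have dist\<psi>: "(\<integral>\<o>. \<bar>\<rho> \<o> - \<psi> \<o>\<bar> \<partial>haar) \<le> 2 * e"
  proof -
   have "(\<integral>\<o>. \<bar>\<rho> \<o> - \<psi> \<o>\<bar> \<partial>haar) \<le> (\<integral>\<o>. \<bar>\<rho> \<o> - \<phi> \<o>\<bar> + e \<partial>haar)"
   proof (rule integral_mono)
    show "\<bar>\<rho> \<o> - \<psi> \<o>\<bar> \<le> \<bar>\<rho> \<o> - \<phi> \<o>\<bar> + e" for \<o>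
     using \<rho>0[of \<o>] e(1) by (auto simp: \<psi>_def)
   qed (use int\<rho> int\<psi> \<phi>(2) in auto)
   also have "\<dots> = (\<integral>\<o>. \<bar>\<rho> \<o> - \<phi> \<o>\<bar> \<partial>haar) + e"
    using int\<rho> \<phi>(2) haar.prob_space by (subst Bochner_Integration.integral_add) auto
   finally show ?thesis using \<phi>(3) by simp
  qed
  have swap: "\<bar>(\<integral>\<o>. \<rho> \<o> * u \<o> \<partial>haar) - (\<integral>\<o>. \<psi> \<o> * u \<o> \<partial>haar)\<bar> \<le> 2 * e"
   "integrable haar (\<lambda>\<o>. \<psi> \<o> * u \<o>)"
   if [measurable]: "u \<in> borel_measurable borel" and u: "\<And>\<o>. 0 \<le> u \<o>" "\<And>\<o>. u \<o> \<le> 1" for u :: "'m torus => real"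
  proof -
   have i1: "integrable haar (\<lambda>\<o>. \<rho> \<o> * u \<o>)"
    by (rule Bochner_Integration.integrable_bound[OF int\<rho>(1)]) (use u in "auto simp: abs_mult mult_left_le")
   show i2: "integrable haar (\<lambda>\<o>. \<psi> \<o> * u \<o>)"
    by (rule Bochner_Integration.integrable_bound[OF int\<psi>]) (use u in "auto simp: abs_mult mult_left_le")
   have "\<bar>(\<integral>\<o>. \<rho> \<o> * u \<o> \<partial>haar) - (\<integral>\<o>. \<psi> \<o> * u \<o> \<partial>haar)\<bar> = \<bar>\<integral>\<o>. \<rho> \<o> * u \<o> - \<psi> \<o> * u \<o> \<partial>haar\<bar>"
    using i1 i2 by simp
   also have "\<dots> \<le> (\<integral>\<o>. \<bar>\<rho> \<o> * u \<o> - \<psi> \<o> * u \<o>\<bar> \<partial>haar)" by (rule integral_abs_bound)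
   also have "\<dots> \<le> (\<integral>\<o>. \<bar>\<rho> \<o> - \<psi> \<o>\<bar> \<partial>haar)"
   proof (rule integral_mono)
    show "integrable haar (\<lambda>\<o>. \<bar>\<rho> \<o> * u \<o> - \<psi> \<o> * u \<o>\<bar>)"
     by (intro integrable_abs Bochner_Integration.integrable_diff i1 i2)
    show "integrable haar (\<lambda>\<o>. \<bar>\<rho> \<o> - \<psi> \<o>\<bar>)"
     by (intro integrable_abs Bochner_Integration.integrable_diff int\<rho> int\<psi>)
    show "\<bar>\<rho> \<o> * u \<o> - \<psi> \<o> * u \<o>\<bar> \<le> \<bar>\<rho> \<o> - \<psi> \<o>\<bar>" for \<o>
     using u[of \<o>] by (simp add: left_diff_distrib[symmetric] abs_mult mult_left_le)
   qed
   finally show "\<bar>(\<integral>\<o>. \<rho> \<o> * u \<o> \<partial>haar) - (\<integral>\<o>. \<psi> \<o> * u \<o> \<partial>haar)\<bar> \<le> 2 * e" using dist\<psi> by simp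
  qed
  obtain B where B: "\<And>\<o>. \<psi> \<o> \<le> B"
  proof -
   have "bounded (range \<psi>)"
    using compact_imp_bounded[OF compact_continuous_image[OF cont\<psi> compact_UNIV_torus]] .
   then obtain B where "\<And>\<o>. \<bar>\<psi> \<o>\<bar> \<le> B" by (auto simp: bounded_iff)
   then show thesis by (intro that[of B]) (auto simp: abs_le_iff)
  qed
  have "uniformly_continuous_on UNIV \<psi>"
   by (rule compact_uniformly_continuous[OF cont\<psi> compact_UNIV_torus])
  moreover have "e * e > 0" using e by simp
  ultimately obtain d where d: "d > 0" "\<And>\<o> \<o>'. dist \<o>' \<o> < d ==> dist (\<psi> \<o>') (\<psi> \<o>) < e * e"
   unfolding uniformly_continuous_on_def by (metis UNIV_I)
  have "(\<lambda>k. norm w * inverse (\<sigma> ^ k)) \<longlonglongrightarrow> norm w * 0"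
   by (intro tendsto_intros LIMSEQ_inverse_realpow_zero sigma_gt_1)
  then have "(\<lambda>k. norm w / \<sigma> ^ k) \<longlonglongrightarrow> 0" by (simp add: divide_inverse)
  from order_tendstoD(2)[OF this d(1)] obtain k where k: "norm w / \<sigma> ^ k < d"
   by (auto simp: eventually_sequentially)
  obtain \<theta> where \<theta>: "\<theta> \<in> borel_measurable borel" "\<And>\<o>. (g ^^ k) (\<theta> \<o>) = tshift w ((g ^^ k) \<o>)"
   "\<And>\<o> j. j \<le> k ==> dist ((g ^^ j) (\<theta> \<o>)) ((g ^^ j) \<o>) \<le> norm w / \<sigma> ^ (k - j)"
   "\<And>(\<phi> :: 'm torus => real) B. \<phi> \<in> borel_measurable borel ==> (\<And>\<o>. 0 \<le> \<phi> \<o>) ==> (\<And>\<o>. \<phi> \<o> \<le> B) ==>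
    (\<integral>\<o>. \<phi> (\<theta> \<o>) \<partial>haar) \<le> exp (a * norm w) * (\<integral>\<o>. \<phi> \<o> \<partial>haar)"
   by (rule rotE[of k w]) blast
  note [measurable] = \<theta>(1)
  have ratio: "\<psi> \<o> \<le> (1 + e) * \<psi> (\<theta> \<o>)" for \<o>
  proof -
   have "dist (\<theta> \<o>) \<o> < d" using \<theta>(3)[of 0 \<o>] k by simp
   then have "\<psi> \<o> \<le> \<psi> (\<theta> \<o>) + e * e" using d(2)[of "\<theta> \<o>" \<o>] by (simp add: dist_real_def)
   also have "\<dots> \<le> \<psi> (\<theta> \<o>) + e * \<psi> (\<theta> \<o>)"
    using \<psi>e[of "\<theta> \<o>"] e by (intro add_left_mono mult_left_mono) auto
   finally show ?thesis by (simp add: algebra_simps)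
  qed
  have \<psi>0: "\<psi> \<o> \<ge> 0" for \<o> using \<psi>e[of \<o>] e by simp
  \<comment> \<open>Invariance of \<rho> inserts \<open>g ^^ k\<close>, after which the translation
    can be replaced by \<theta> acting before these \<open>k\<close> steps.\<close>
  have "X = (\<integral>\<o>. \<rho> \<o> * h (tshift w ((g ^^ k) \<o>)) \<partial>haar)"
   unfolding X_def by (rule inv[symmetric]) simp
  also have "\<dots> \<le> (\<integral>\<o>. \<psi> \<o> * h (tshift w ((g ^^ k) \<o>)) \<partial>haar) + 2 * e"
   using swap(1)[of "\<lambda>\<o>. h (tshift w ((g ^^ k) \<o>))"] h01 by (simp add: abs_le_iff)
  also have "(\<integral>\<o>. \<psi> \<o> * h (tshift w ((g ^^ k) \<o>)) \<partial>haar)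
    \<le> (\<integral>\<o>. (1 + e) * (\<psi> (\<theta> \<o>) * h ((g ^^ k) (\<theta> \<o>))) \<partial>haar)"
  proof (rule integral_mono)
   show "integrable haar (\<lambda>\<o>. \<psi> \<o> * h (tshift w ((g ^^ k) \<o>)))"
    by (rule swap(2)) (use h01 in auto)
   have "integrable haar (\<lambda>\<o>. \<psi> (\<theta> \<o>) * h ((g ^^ k) (\<theta> \<o>)))"
    by (rule prob_integrable_bounded[OF haar.prob_space_axioms, of _ B])
     (use h01 \<psi>0 B in "auto simp: abs_mult intro: order.trans[OF mult_left_le]")
   then show "integrable haar (\<lambda>\<o>. (1 + e) * (\<psi> (\<theta> \<o>) * h ((g ^^ k) (\<theta> \<o>))))" by simp
   show "\<psi> \<o> * h (tshift w ((g ^^ k) \<o>)) \<le> (1 + e) * (\<psi> (\<theta> \<o>) * h ((g ^^ k) (\<theta> \<o>)))" for \<o>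
    using mult_right_mono[OF ratio h01(1)] by (simp add: \<theta>(2) mult.assoc)
  qed
  also have "(\<integral>\<o>. (1 + e) * (\<psi> (\<theta> \<o>) * h ((g ^^ k) (\<theta> \<o>))) \<partial>haar)
    = (1 + e) * (\<integral>\<o>. \<psi> (\<theta> \<o>) * h ((g ^^ k) (\<theta> \<o>)) \<partial>haar)" by simp
  also have "(\<integral>\<o>. \<psi> (\<theta> \<o>) * h ((g ^^ k) (\<theta> \<o>)) \<partial>haar) \<le> c * (\<integral>\<o>. \<psi> \<o> * h ((g ^^ k) \<o>) \<partial>haar)"
   unfolding c_def
   by (rule \<theta>(4)[of "\<lambda>\<o>. \<psi> \<o> * h ((g ^^ k) \<o>)" B])
    (use h01 \<psi>0 B in "auto intro: order.trans[OF mult_left_le]")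
  also have "(\<integral>\<o>. \<psi> \<o> * h ((g ^^ k) \<o>) \<partial>haar) \<le> (\<integral>\<o>. \<rho> \<o> * h ((g ^^ k) \<o>) \<partial>haar) + 2 * e"
   using swap(1)[of "\<lambda>\<o>. h ((g ^^ k) \<o>)"] h01 by (simp add: abs_le_iff)
  also have "(\<integral>\<o>. \<rho> \<o> * h ((g ^^ k) \<o>) \<partial>haar) = Y"
   unfolding Y_def by (rule inv) simp
  finally have "X \<le> (1 + e) * (c * (Y + 2 * e)) + 2 * e" using e c by simp
  also have "\<dots> = c * Y + e * (c * Y + 2 * c + 2 * e * c + 2)" by (simp add: algebra_simps)
  also have "\<dots> \<le> c * Y + e * (c * Y + 4 * c + 2)"
   using e c by (intro add_left_mono mult_left_mono) auto
  finally show ?thesis .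
 qed
 have "X \<le> c * Y"
 proof (rule ccontr)
  assume "\<not> X \<le> c * Y"
  then have pos: "X - c * Y > 0" by simp
  define K where "K = c * Y + 4 * c + 2"
  have "0 \<le> c * Y" using c Y0 by simp
  then have K: "K > 0" using c unfolding K_def by linarith
  \<comment> \<open>Makes the error at most half of the supposed gap.\<close>
  define e where "e = min 1 ((X - c * Y) / (2 * K))"
  have e: "0 < e" "e \<le> 1" using pos K by (auto simp: e_def)
  have "e * K \<le> (X - c * Y) / (2 * K) * K" using K by (intro mult_right_mono) (auto simp: e_def)
  also have "\<dots> = (X - c * Y) / 2" using K by simp
  finally show False using key[OF e] pos by (simp add: K_def)
 qed
 then show ?thesis by (simp add: X_def Y_def c_def)
qed

end

section \<open>Regularity of the iterated measures\<close>

lemma prob_measuresD: "\<mu> \<in> prob_measures ==> prob_space \<mu>" "\<mu> \<in> prob_measures ==> sets \<mu> = sets borel"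
 by (auto simp: prob_measures_def)

lemma space_prob_measures: "\<mu> \<in> prob_measures ==> space \<mu> = UNIV"
 using sets_eq_imp_space_eq[OF prob_measuresD(2)] by simp

lemma distr_prob_measures:
 "\<mu> \<in> prob_measures ==> h \<in> borel_measurable borel ==> distr \<mu> borel h \<in> prob_measures"
 unfolding prob_measures_def
 by (auto intro!: prob_space.prob_space_distr simp: measurable_def dest: sets_eq_imp_space_eq)

lemma integral_distr_prob:
 fixes u :: "'b::topological_space => real"
 assumes "\<mu> \<in> prob_measures" "h \<in> borel_measurable borel" "u \<in> borel_measurable borel"
 shows "(\<integral>x. u x \<partial>distr \<mu> borel h) = (\<integral>x. u (h x) \<partial>\<mu>)"
proof (rule integral_distr)
 show "h \<in> borel_measurable \<mu>"
  using assms(2) measurable_cong_sets[OF prob_measuresD(2)[OF assms(1)] refl] by blast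
qed (fact assms(3))

lemma prob_measures_integrable:
 fixes u :: "'b::topological_space => real"
 assumes "\<mu> \<in> prob_measures" "u \<in> borel_measurable borel" "\<And>x. \<bar>u x\<bar> \<le> B"
 shows "integrable \<mu> u"
proof (rule prob_integrable_bounded[OF prob_measuresD(1)[OF assms(1)]])
 show "u \<in> borel_measurable \<mu>"
  using assms(2) measurable_cong_sets[OF prob_measuresD(2)[OF assms(1)] refl] by blast
qed (fact assms(3))

lemma push_iter_eq:
 assumes F: "F \<in> borel_measurable borel" and \<mu>: "\<mu> \<in> prob_measures"
 shows "push_iter F k \<mu> = distr \<mu> borel (F ^^ k)"
  and "F ^^ k \<in> borel_measurable borel" and "push_iter F k \<mu> \<in> prob_measures"
proof -
 note [measurable_cong] = prob_measuresD(2)[OF \<mu>]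
 note [measurable] = F
 show Fk: "F ^^ k \<in> borel_measurable borel" by (induction k) (auto simp: id_def)
 have *: "F ^^ k \<in> borel_measurable borel" for k by (induction k) (auto simp: id_def)
 show eq: "push_iter F k \<mu> = distr \<mu> borel (F ^^ k)"
 proof (induction k)
  case 0
  show ?case
   using distr_id2[OF prob_measuresD(2)[OF \<mu>, symmetric]] by (simp add: push_iter_def id_def)
 next
  case (Suc k)
  note [measurable] = *[of k]
  have "push_iter F (Suc k) \<mu> = distr (distr \<mu> borel (F ^^ k)) borel F"
   using Suc by (simp add: push_iter_def)
  also have "\<dots> = distr \<mu> borel (F \<circ> (F ^^ k))" by (rule distr_distr) auto
  finally show ?case by (simp add: o_def)
 qed
 show "push_iter F k \<mu> \<in> prob_measures"
  unfolding eq by (rule distr_prob_measures[OF \<mu> Fk])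
qed

lemma measurable_borel_pair [measurable (raw)]:
 fixes \<Psi> :: "'a::second_countable_topology \<times> 'b::second_countable_topology => 'c::topological_space"
 assumes \<Psi>: "\<Psi> \<in> borel_measurable borel" and [measurable]: "u \<in> borel_measurable M" "v \<in> borel_measurable M"
 shows "(\<lambda>x. \<Psi> (u x, v x)) \<in> borel_measurable M"
proof -
 have "\<Psi> \<in> borel_measurable (borel \<Otimes>\<^sub>M borel)" using \<Psi> by (simp only: borel_prod)
 then show ?thesis by (rule measurable_compose[rotated]) measurable
qed

lemma measurable_fst_borel [measurable]: "(fst :: 'a::second_countable_topology \<times> 'b::second_countable_topology => 'a) \<in> borel_measurable borel"
 and measurable_snd_borel [measurable]: "(snd :: 'a \<times> 'b => 'b) \<in> borel_measurable borel"
 by (simp_all add: borel_prod[symmetric])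

text \<open>A density against the product measure whose integral in each variable is 1 has the right
  marginals. The constant density is the independent coupling; a better one is built from a
  partition of unity later.\<close>

lemma density_coupling:
 fixes \<mu> \<nu> :: "'n::finite torus measure"
 assumes \<mu>: "\<mu> \<in> prob_measures" and \<nu>: "\<nu> \<in> prob_measures"
  and w [measurable]: "w \<in> borel_measurable (\<mu> \<Otimes>\<^sub>M \<nu>)" and w0: "\<And>z. 0 \<le> w z" and wB: "\<And>z. w z \<le> B"
  and w1: "\<And>x. (\<integral>y. w (x, y) \<partial>\<nu>) = 1" and w2: "\<And>y. (\<integral>x. w (x, y) \<partial>\<mu>) = 1"
 shows "density (\<mu> \<Otimes>\<^sub>M \<nu>) (\<lambda>z. ennreal (w z)) \<in> couplings \<mu> \<nu>"
proof -
 interpret M: prob_space \<mu> by (rule prob_measuresD(1)[OF \<mu>])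
 interpret N: prob_space \<nu> by (rule prob_measuresD(1)[OF \<nu>])
 interpret P: pair_prob_space \<mu> \<nu> ..
 note [measurable_cong] = prob_measuresD(2)[OF \<mu>] prob_measuresD(2)[OF \<nu>]
 have "sets (\<mu> \<Otimes>\<^sub>M \<nu>) = sets (borel \<Otimes>\<^sub>M borel)"
  by (rule sets_pair_measure_cong[OF prob_measuresD(2)[OF \<mu>] prob_measuresD(2)[OF \<nu>]])
 then have s: "sets (\<mu> \<Otimes>\<^sub>M \<nu>) = sets borel" unfolding borel_prod .
 define \<pi> where "\<pi> = density (\<mu> \<Otimes>\<^sub>M \<nu>) (\<lambda>z. ennreal (w z))"
 have s\<pi>: "sets \<pi> = sets borel" unfolding \<pi>_def using s by simp
 have i1: "integrable \<nu> (\<lambda>y. w (x, y))" and i2: "integrable \<mu> (\<lambda>x. w (x, y))" for x y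
  by (rule prob_integrable_bounded[of _ _ B]; use w0 wB M.prob_space_axioms N.prob_space_axioms in "auto simp: space_prob_measures[OF \<mu>] space_prob_measures[OF \<nu>]")+
 have n1: "(\<integral>\<^sup>+y. ennreal (w (x, y)) \<partial>\<nu>) = 1" for x
  using nn_integral_eq_integral[OF i1, of x] w0 w1 by simp
 have n2: "(\<integral>\<^sup>+x. ennreal (w (x, y)) \<partial>\<mu>) = 1" for y
  using nn_integral_eq_integral[OF i2, of y] w0 w2 by simp
 have e1: "(\<integral>\<^sup>+z. h (fst z) \<partial>\<pi>) = (\<integral>\<^sup>+x. h x \<partial>\<mu>)" if [measurable]: "h \<in> borel_measurable borel" for h
 proof -
  have "(\<integral>\<^sup>+z. h (fst z) \<partial>\<pi>) = (\<integral>\<^sup>+z. ennreal (w z) * h (fst z) \<partial>(\<mu> \<Otimes>\<^sub>M \<nu>))"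
   unfolding \<pi>_def by (rule nn_integral_density) measurable
  also have "\<dots> = (\<integral>\<^sup>+x. \<integral>\<^sup>+y. ennreal (w (x, y)) * h x \<partial>\<nu> \<partial>\<mu>)"
   by (subst N.nn_integral_fst[symmetric]) auto
  also have "\<dots> = (\<integral>\<^sup>+x. h x \<partial>\<mu>)"
   by (rule nn_integral_cong) (simp add: nn_integral_multc n1)
  finally show ?thesis .
 qed
 have e2: "(\<integral>\<^sup>+z. h (snd z) \<partial>\<pi>) = (\<integral>\<^sup>+y. h y \<partial>\<nu>)" if [measurable]: "h \<in> borel_measurable borel" for h
 proof -
  have "(\<integral>\<^sup>+z. h (snd z) \<partial>\<pi>) = (\<integral>\<^sup>+z. ennreal (w z) * h (snd z) \<partial>(\<mu> \<Otimes>\<^sub>M \<nu>))"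
   unfolding \<pi>_def by (rule nn_integral_density) measurable
  also have "\<dots> = (\<integral>\<^sup>+y. \<integral>\<^sup>+x. ennreal (w (x, y)) * h y \<partial>\<mu> \<partial>\<nu>)"
   by (subst P.nn_integral_snd[symmetric]) auto
  also have "\<dots> = (\<integral>\<^sup>+y. h y \<partial>\<nu>)"
   by (rule nn_integral_cong) (simp add: nn_integral_multc n2)
  finally show ?thesis .
 qed
 note [measurable_cong] = s\<pi>
 have d1: "distr \<pi> borel fst = \<mu>"
 proof (rule measure_eqI)
  fix A assume "A \<in> sets (distr \<pi> borel (fst :: 'n torus \<times> 'n torus => _))"
  then have A [measurable]: "A \<in> sets borel" by simp
  have "emeasure (distr \<pi> borel fst) A = (\<integral>\<^sup>+x. indicator A x \<partial>distr \<pi> borel fst)" by simp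
  also have "\<dots> = (\<integral>\<^sup>+z. indicator A (fst z) \<partial>\<pi>)" by (rule nn_integral_distr) auto
  also have "\<dots> = (\<integral>\<^sup>+x. indicator A x \<partial>\<mu>)" by (rule e1) simp
  finally show "emeasure (distr \<pi> borel fst) A = emeasure \<mu> A" using A prob_measuresD(2)[OF \<mu>] by simp
 qed (simp add: prob_measuresD(2)[OF \<mu>])
 have d2: "distr \<pi> borel snd = \<nu>"
 proof (rule measure_eqI)
  fix A assume "A \<in> sets (distr \<pi> borel (snd :: 'n torus \<times> 'n torus => _))"
  then have A [measurable]: "A \<in> sets borel" by simp
  have "emeasure (distr \<pi> borel snd) A = (\<integral>\<^sup>+x. indicator A x \<partial>distr \<pi> borel snd)" by simp
  also have "\<dots> = (\<integral>\<^sup>+z. indicator A (snd z) \<partial>\<pi>)" by (rule nn_integral_distr) auto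
  also have "\<dots> = (\<integral>\<^sup>+x. indicator A x \<partial>\<nu>)" by (rule e2) simp
  finally show "emeasure (distr \<pi> borel snd) A = emeasure \<nu> A" using A prob_measuresD(2)[OF \<nu>] by simp
 qed (simp add: prob_measuresD(2)[OF \<nu>])
 have "prob_space \<pi>"
 proof (rule prob_spaceI)
  have "emeasure \<pi> (space \<pi>) = (\<integral>\<^sup>+z. 1 \<partial>\<pi>)" by simp
  also have "\<dots> = (\<integral>\<^sup>+x. 1 \<partial>\<mu>)" by (rule e1) simp
  also have "\<dots> = 1" using M.emeasure_space_1 by simp
  finally show "emeasure \<pi> (space \<pi>) = 1" .
 qed
 then show ?thesis using s\<pi> d1 d2 by (simp add: couplings_def prob_measures_def \<pi>_def)
qed

text \<open>The elementary half of Kantorovich duality: integrate the Lipschitz bound against an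
  arbitrary coupling and take the infimum. The case of constant 0 is separate because of the
  division.\<close>

lemma lipschitz_integral_le_wasserstein:
 fixes \<psi> :: "'n::finite torus => real"
 assumes \<mu>: "\<mu> \<in> prob_measures" and \<nu>: "\<nu> \<in> prob_measures"
  and \<psi>m [measurable]: "\<psi> \<in> borel_measurable borel" and B: "\<And>x. \<bar>\<psi> x\<bar> \<le> B"
  and lip: "\<And>x x'. \<bar>\<psi> x - \<psi> x'\<bar> \<le> \<Lambda> * dist x x'" and \<Lambda>: "\<Lambda> \<ge> 0"
 shows "\<bar>(\<integral>x. \<psi> x \<partial>\<mu>) - (\<integral>x. \<psi> x \<partial>\<nu>)\<bar> \<le> \<Lambda> * wasserstein \<mu> \<nu>"
proof (cases "\<Lambda> = 0")
 case True
 obtain x0 :: "'n torus" where True by blast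
 have "\<psi> x = \<psi> x0" for x using lip[of x x0] True by simp
 then have "\<psi> = (\<lambda>x. \<psi> x0)" by blast
 moreover have "(\<integral>x. \<psi> x0 \<partial>\<mu>) = \<psi> x0" "(\<integral>x. \<psi> x0 \<partial>\<nu>) = \<psi> x0"
  using prob_space.prob_space[OF prob_measuresD(1)[OF \<mu>]] prob_space.prob_space[OF prob_measuresD(1)[OF \<nu>]]
  by simp_all
 ultimately show ?thesis using True by (metis abs_zero diff_self mult_zero_left order_refl)
next
 case False
 then have L: "\<Lambda> > 0" using \<Lambda> by simp
 define d where "d = \<bar>(\<integral>x. \<psi> x \<partial>\<mu>) - (\<integral>x. \<psi> x \<partial>\<nu>)\<bar>"
 have "d / \<Lambda> \<le> wasserstein \<mu> \<nu>"
  unfolding wasserstein_def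
 proof (rule cINF_greatest)
  \<comment> \<open>The infimum bounds from below only over a nonempty set; the independent coupling
    witnesses this.\<close>
  have "density (\<mu> \<Otimes>\<^sub>M \<nu>) (\<lambda>z. ennreal 1) \<in> couplings \<mu> \<nu>"
   by (rule density_coupling[OF \<mu> \<nu>, of "\<lambda>_. 1" 1])
    (simp_all add: prob_space.prob_space[OF prob_measuresD(1)[OF \<mu>]] prob_space.prob_space[OF prob_measuresD(1)[OF \<nu>]])
  then show "couplings \<mu> \<nu> \<noteq> {}" by blast
  fix \<pi> assume "\<pi> \<in> couplings \<mu> \<nu>"
  then have \<pi>: "\<pi> \<in> prob_measures" "distr \<pi> borel fst = \<mu>" "distr \<pi> borel snd = \<nu>"
   by (auto simp: couplings_def)
  have i: "integrable \<pi> (\<lambda>z. \<psi> (fst z))" "integrable \<pi> (\<lambda>z. \<psi> (snd z))"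
   by (rule prob_measures_integrable[OF \<pi>(1), of _ B]; use B in simp)+
  have id: "integrable \<pi> (\<lambda>z. dist (fst z) (snd z))"
   by (rule prob_measures_integrable[OF \<pi>(1), of _ "CARD('n)"]) (use dist_torus_le in auto)
  have "(\<integral>x. \<psi> x \<partial>\<mu>) = (\<integral>z. \<psi> (fst z) \<partial>\<pi>)" "(\<integral>x. \<psi> x \<partial>\<nu>) = (\<integral>z. \<psi> (snd z) \<partial>\<pi>)"
   unfolding \<pi>(2)[symmetric] \<pi>(3)[symmetric] by (rule integral_distr_prob[OF \<pi>(1)]; simp)+
  then have "d = \<bar>\<integral>z. \<psi> (fst z) - \<psi> (snd z) \<partial>\<pi>\<bar>" using i by (simp add: d_def)
  also have "\<dots> \<le> (\<integral>z. \<bar>\<psi> (fst z) - \<psi> (snd z)\<bar> \<partial>\<pi>)" by (rule integral_abs_bound)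
  also have "\<dots> \<le> (\<integral>z. \<Lambda> * dist (fst z) (snd z) \<partial>\<pi>)"
   by (rule integral_mono) (use i id lip in auto)
  finally show "d / \<Lambda> \<le> (\<integral>z. dist (fst z) (snd z) \<partial>\<pi>)" using L by (simp add: field_simps)
 qed
 then show ?thesis using L by (simp add: d_def field_simps)
qed

lemma disintegration_kernel:
 assumes "disintegration \<mu> \<kappa>"
 shows "\<kappa> \<in> borel \<rightarrow>\<^sub>M subprob_algebra borel"
 using assms unfolding disintegration_def prob_measures_def
 by (intro measurable_subprob_algebra) (auto intro: prob_space_imp_subprob_space)

lemma kernel_integral_measurable:
 fixes h :: "'a::second_countable_topology \<times> 'b::second_countable_topology => real"
 assumes [measurable]: "\<kappa> \<in> borel \<rightarrow>\<^sub>M subprob_algebra borel" and h: "h \<in> borel_measurable borel"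
 shows "(\<lambda>\<o>. \<integral>x. h (\<o>, x) \<partial>\<kappa> \<o>) \<in> borel_measurable borel"
proof -
 have hm [measurable]: "h \<in> borel_measurable (borel \<Otimes>\<^sub>M borel)" using h by (simp add: borel_prod)
 have "(\<lambda>\<o>. distr (\<kappa> \<o>) (borel \<Otimes>\<^sub>M borel) (\<lambda>x. (\<o>, x))) \<in> borel \<rightarrow>\<^sub>M subprob_algebra (borel \<Otimes>\<^sub>M borel)"
  by (rule measurable_distr2[where M = borel]) (simp_all add: assms(1))
 from measurable_compose[OF this integral_measurable_subprob_algebra[OF hm]]
 have "(\<lambda>\<o>. \<integral>z. h z \<partial>distr (\<kappa> \<o>) (borel \<Otimes>\<^sub>M borel) (\<lambda>x. (\<o>, x))) \<in> borel_measurable borel" .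
 moreover have "(\<integral>z. h z \<partial>distr (\<kappa> \<o>) (borel \<Otimes>\<^sub>M borel) (\<lambda>x. (\<o>, x))) = (\<integral>x. h (\<o>, x) \<partial>\<kappa> \<o>)" for \<o>
 proof (rule integral_distr)
  have "sets (\<kappa> \<o>) = sets borel" using sets_kernel[OF assms(1), of \<o>] by simp
  then show "(\<lambda>x. (\<o>, x)) \<in> \<kappa> \<o> \<rightarrow>\<^sub>M borel \<Otimes>\<^sub>M borel" by (simp cong: measurable_cong_sets)
 qed (rule hm)
 ultimately show ?thesis by simp
qed

text \<open>The defining formula for sets says that \<mu> is the bind of its base marginal with the
  kernel placing the conditional measures on the fibres; integrals of functions then follow.\<close>

lemma disintegration_integral:
 fixes \<mu> :: "('a::second_countable_topology \<times> 'b::second_countable_topology) measure" and h :: "'a \<times> 'b => real"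
 assumes \<mu>: "\<mu> \<in> prob_measures" and dis: "disintegration \<mu> \<kappa>"
  and hm: "h \<in> borel_measurable borel" and h0: "\<And>z. 0 \<le> h z" and hB: "\<And>z. h z \<le> B"
 shows "(\<integral>z. h z \<partial>\<mu>) = (\<integral>\<o>. \<integral>x. h (\<o>, x) \<partial>\<kappa> \<o> \<partial>distr \<mu> borel fst)"
proof -
 define \<mu>1 where "\<mu>1 = distr \<mu> borel fst"
 note [measurable_cong] = prob_measuresD(2)[OF \<mu>]
 have s\<mu>1 [simp, measurable_cong]: "sets \<mu>1 = sets borel" and sp: "space \<mu>1 = UNIV" by (simp_all add: \<mu>1_def)
 have K: "\<kappa> \<in> borel \<rightarrow>\<^sub>M subprob_algebra borel" by (rule disintegration_kernel[OF dis])
 note [measurable] = K hm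
 have \<kappa>P: "\<kappa> \<o> \<in> prob_measures" for \<o> using dis by (simp add: disintegration_def)
 define K2 where "K2 = (\<lambda>\<o>. distr (\<kappa> \<o>) borel (\<lambda>x. (\<o>, x)))"
 have pm: "(\<lambda>x :: 'b. (\<o>, x)) \<in> borel_measurable borel" for \<o> :: 'a
 proof -
  have "(\<lambda>x :: 'b. (\<o>, x)) \<in> borel \<rightarrow>\<^sub>M borel \<Otimes>\<^sub>M borel" by simp
  then show ?thesis by (simp only: borel_prod)
 qed
 have "K2 \<in> borel \<rightarrow>\<^sub>M subprob_algebra borel"
  unfolding K2_def by (rule measurable_distr2[where M = borel]) (simp_all add: borel_prod)
 then have K2m: "K2 \<in> \<mu>1 \<rightarrow>\<^sub>M subprob_algebra borel" by (simp only: measurable_cong_sets[OF s\<mu>1 refl])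
 have pm': "(\<lambda>x. (\<o>, x)) \<in> borel_measurable (\<kappa> \<o>')" for \<o> \<o>' :: 'a
  unfolding measurable_cong_sets[OF prob_measuresD(2)[OF \<kappa>P] refl] by (rule pm)
 have "\<mu> = \<mu>1 \<bind> K2"
 proof (rule measure_eqI)
  show "sets \<mu> = sets (\<mu>1 \<bind> K2)"
   using sets_bind[of \<mu>1 K2 borel] K2m sp by (simp add: prob_measuresD(2)[OF \<mu>] K2_def)
  fix A assume "A \<in> sets \<mu>"
  then have A: "A \<in> sets borel" by (simp add: prob_measuresD(2)[OF \<mu>])
  have "emeasure \<mu> A = (\<integral>\<^sup>+\<o>. emeasure (\<kappa> \<o>) (Pair \<o> -` A) \<partial>\<mu>1)"
   using dis A by (simp add: disintegration_def \<mu>1_def)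
  also have "\<dots> = (\<integral>\<^sup>+\<o>. emeasure (K2 \<o>) A \<partial>\<mu>1)"
   unfolding K2_def by (subst emeasure_distr[OF pm' A]) (simp add: space_prob_measures[OF \<kappa>P])
  also have "\<dots> = emeasure (\<mu>1 \<bind> K2) A"
   using emeasure_bind[OF _ K2m, of A] A sp by simp
  finally show "emeasure \<mu> A = emeasure (\<mu>1 \<bind> K2) A" .
 qed
 then have "(\<integral>\<^sup>+z. ennreal (h z) \<partial>\<mu>) = (\<integral>\<^sup>+\<o>. \<integral>\<^sup>+z. ennreal (h z) \<partial>K2 \<o> \<partial>\<mu>1)"
  using nn_integral_bind[OF _ K2m, of "\<lambda>z. ennreal (h z)"] by simp
 also have "\<dots> = (\<integral>\<^sup>+\<o>. ennreal (\<integral>x. h (\<o>, x) \<partial>\<kappa> \<o>) \<partial>\<mu>1)"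
 proof (rule nn_integral_cong)
  fix \<o>
  have m: "(\<lambda>x. h (\<o>, x)) \<in> borel_measurable borel" using measurable_compose[OF pm hm] .
  have "integrable (\<kappa> \<o>) (\<lambda>x. h (\<o>, x))"
   by (rule prob_measures_integrable[OF \<kappa>P m, of B]) (use h0 hB in "simp add: abs_le_iff order.trans[of _ 0]")
  then have "(\<integral>\<^sup>+x. ennreal (h (\<o>, x)) \<partial>\<kappa> \<o>) = ennreal (\<integral>x. h (\<o>, x) \<partial>\<kappa> \<o>)"
   using h0 by (intro nn_integral_eq_integral) auto
  moreover have "(\<integral>\<^sup>+z. ennreal (h z) \<partial>K2 \<o>) = (\<integral>\<^sup>+x. ennreal (h (\<o>, x)) \<partial>\<kappa> \<o>)"
   unfolding K2_def by (rule nn_integral_distr[OF pm']) simp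
  ultimately show "(\<integral>\<^sup>+z. ennreal (h z) \<partial>K2 \<o>) = ennreal (\<integral>x. h (\<o>, x) \<partial>\<kappa> \<o>)" by simp
 qed
 finally have "(\<integral>\<^sup>+z. ennreal (h z) \<partial>\<mu>) = (\<integral>\<^sup>+\<o>. ennreal (\<integral>x. h (\<o>, x) \<partial>\<kappa> \<o>) \<partial>\<mu>1)" .
 then show ?thesis
  unfolding \<mu>1_def[symmetric]
  by (intro integral_nn_cong integral_nonneg_AE)
   (use kernel_integral_measurable[OF K hm] h0 in "auto cong: measurable_cong_sets")
qed

lemma log_lipschitz_facts:
 fixes \<phi> :: "'m::finite torus => real"
 assumes "\<phi> \<in> log_lipschitz b" "b \<ge> 0"
 shows "\<And>\<o>. \<phi> \<o> > 0" "\<And>\<o> \<o>'. \<phi> \<o> \<le> exp (b * dist \<o> \<o>') * \<phi> \<o>'"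
  "\<phi> \<in> borel_measurable borel" "\<exists>B. \<forall>\<o>. \<phi> \<o> \<le> B"
proof -
 show pos: "\<phi> \<o> > 0" for \<o> using assms by (simp add: log_lipschitz_def)
 show le: "\<phi> \<o> \<le> exp (b * dist \<o> \<o>') * \<phi> \<o>'" for \<o> \<o>'
 proof -
  have "\<phi> \<o> / \<phi> \<o>' \<le> exp (b * dist \<o> \<o>')" using assms(1) by (simp add: log_lipschitz_def)
  then show ?thesis using pos[of \<o>'] by (simp add: pos_divide_le_eq)
 qed
 have "ln (\<phi> \<o>) - ln (\<phi> \<o>') \<le> b * dist \<o> \<o>'" for \<o> \<o>'
 proof -
  have "ln (\<phi> \<o>) \<le> ln (exp (b * dist \<o> \<o>') * \<phi> \<o>')" using le pos by simp
  then show ?thesis using pos[of \<o>'] by (simp add: ln_mult)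
 qed
 then have "\<bar>ln (\<phi> \<o>) - ln (\<phi> \<o>')\<bar> \<le> b * dist \<o> \<o>'" for \<o> \<o>'
  by (metis abs_le_iff dist_commute minus_diff_eq)
 then have "b-lipschitz_on UNIV (\<lambda>\<o>. ln (\<phi> \<o>))"
  using assms(2) by (intro lipschitz_onI) (auto simp: dist_real_def)
 then have "continuous_on UNIV (\<lambda>\<o>. exp (ln (\<phi> \<o>)))"
  by (intro continuous_on_exp lipschitz_on_continuous_on)
 then show "\<phi> \<in> borel_measurable borel"
  using pos by (intro borel_measurable_continuous_onI) simp
 have "\<phi> \<o> \<le> exp (b * CARD('m)) * \<phi> undefined" for \<o>
  using le[of \<o> undefined] dist_torus_le[of \<o> undefined] pos[of undefined] assms(2)
  by (meson exp_le_cancel_iff less_imp_le mult_left_mono mult_right_mono order_trans)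
 then show "\<exists>B. \<forall>\<o>. \<phi> \<o> \<le> B" by blast
qed

text \<open>Near-invariance under small translations of the base. Tests are arbitrary measurable
  functions of the base point, because later they have the form \<Psi> composed with
  \<open>F\<close>, whose modulus in the base deteriorates with \<sigma>. A one-sided bound
  suffices, since \<open>1 - \<Phi>\<close> is again a test.\<close>

definition regular :: "real => ('m::finite torus \<times> 'b::metric_space) measure => bool" where
 "regular C \<mu> \<longleftrightarrow> \<mu> \<in> prob_measures \<and>
  (\<forall>\<Phi> \<Lambda> w. \<Phi> \<in> borel_measurable borel \<longrightarrow> (\<forall>p. 0 \<le> \<Phi> p \<and> \<Phi> p \<le> 1) \<longrightarrow> 0 \<le> \<Lambda> \<longrightarrow>
    (\<forall>\<o> x x'. \<bar>\<Phi> (\<o>, x) - \<Phi> (\<o>, x')\<bar> \<le> \<Lambda> * dist x x') \<longrightarrow> norm w \<le> 1 \<longrightarrow>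
    (\<integral>p. \<Phi> (tshift w (fst p), snd p) \<partial>\<mu>) \<le> (\<integral>p. \<Phi> p \<partial>\<mu>) + C * (1 + \<Lambda>) * norm w)"

locale skew_system = lifted_rotations g \<sigma> a
 for g :: "'m::finite torus => 'm torus" and \<sigma> a :: real +
 fixes f :: "'m torus \<times> 'n::finite torus => 'n torus" and L :: real
 assumes f_lip: "L-lipschitz_on UNIV f" and L_pos: "L > 0" and L_sigma: "2 * L \<le> \<sigma>"
begin

lemma f_meas [measurable]: "f \<in> borel_measurable borel"
 by (rule borel_measurable_continuous_onI[OF lipschitz_on_continuous_on[OF f_lip]])

lemma f_meas_pair [measurable]: "f \<in> borel_measurable (borel \<Otimes>\<^sub>M borel)"
 by (simp add: borel_prod)

abbreviation F :: "'m torus \<times> 'n torus => 'm torus \<times> 'n torus" where "F \<equiv> skew_product g f"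

lemma F_meas [measurable]: "F \<in> borel_measurable borel"
 unfolding skew_product_def borel_prod[symmetric] by measurable

lemma funpow_F_meas [measurable]: "F ^^ k \<in> borel_measurable borel"
 by (induction k) (auto simp: id_def)

lemma fst_funpow_F: "fst ((F ^^ k) p) = (g ^^ k) (fst p)"
 by (induction k) (auto simp: skew_product_def split: prod.split)

lemma snd_funpow_F_Suc: "snd ((F ^^ Suc k) p) = f ((F ^^ k) p)"
 by (simp add: skew_product_def case_prod_beta)

lemma f_lip_le: "dist (f p) (f q) \<le> L * (dist (fst p) (fst q) + dist (snd p) (snd q))"
proof -
 have "dist (f p) (f q) \<le> L * dist p q" using lipschitz_onD[OF f_lip] by simp
 also have "dist p q \<le> dist (fst p) (fst q) + dist (snd p) (snd q)"
  unfolding dist_prod_def by (rule sqrt_sum_squares_le_sum) auto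
 finally show ?thesis using L_pos by simp
qed

lemma f_lip_snd: "dist (f (\<o>, x)) (f (\<o>, x')) \<le> L * dist x x'"
 using f_lip_le[of "(\<o>, x)" "(\<o>, x')"] by simp

lemma fibre_lipschitz: "dist (snd ((F ^^ k) (\<o>, x))) (snd ((F ^^ k) (\<o>, x'))) \<le> L ^ k * dist x x'"
proof (induction k)
 case (Suc k)
 have "dist (snd ((F ^^ Suc k) (\<o>, x))) (snd ((F ^^ Suc k) (\<o>, x')))
   \<le> L * dist (snd ((F ^^ k) (\<o>, x))) (snd ((F ^^ k) (\<o>, x')))"
  using f_lip_le[of "(F ^^ k) (\<o>, x)" "(F ^^ k) (\<o>, x')"] unfolding snd_funpow_F_Suc
  by (simp add: fst_funpow_F)
 also have "\<dots> \<le> L * (L ^ k * dist x x')" using Suc L_pos by simp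
 finally show ?case by simp
qed simp

text \<open>Base error and fibre error at time \<open>j\<close> are both at most
  \<open>s / \<sigma> ^ (k - j)\<close>. One step multiplies their sum by \<open>L\<close>, while
  the bound itself grows by \<sigma>; this is the origin of
  \<open>2 * L \<le> \<sigma>\<close>.\<close>

lemma fibre_shadow:
 assumes "\<And>j. j \<le> k ==> dist ((g ^^ j) \<o>') ((g ^^ j) \<o>) \<le> s / \<sigma> ^ (k - j)" "s \<ge> 0" "j \<le> k"
 shows "dist (snd ((F ^^ j) (\<o>', x))) (snd ((F ^^ j) (\<o>, x))) \<le> s / \<sigma> ^ (k - j)"
 using assms(3)
proof (induction j)
 case 0 show ?case using assms(2) sigma_gt_1 by simp
next
 case (Suc j)
 have e: "k - j = Suc (k - Suc j)" using Suc.prems by simp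
 have "dist (snd ((F ^^ Suc j) (\<o>', x))) (snd ((F ^^ Suc j) (\<o>, x)))
   \<le> L * (s / \<sigma> ^ (k - j) + s / \<sigma> ^ (k - j))"
 proof -
  have "dist ((g ^^ j) \<o>') ((g ^^ j) \<o>) + dist (snd ((F ^^ j) (\<o>', x))) (snd ((F ^^ j) (\<o>, x)))
    \<le> s / \<sigma> ^ (k - j) + s / \<sigma> ^ (k - j)"
   using Suc assms(1)[of j] by (intro add_mono) auto
  from mult_left_mono[OF this, of L] show ?thesis
   using f_lip_le[of "(F ^^ j) (\<o>', x)" "(F ^^ j) (\<o>, x)"] L_pos
   unfolding snd_funpow_F_Suc fst_funpow_F by (simp only: fst_conv less_imp_le order.trans)
 qed
 also have "\<dots> = (2 * L / \<sigma>) * (s / \<sigma> ^ (k - Suc j))"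
  using sigma_gt_1 unfolding e by (simp add: field_simps)
 also have "\<dots> \<le> 1 * (s / \<sigma> ^ (k - Suc j))"
  using L_sigma sigma_gt_1 assms(2) by (intro mult_right_mono) auto
 finally show ?case by simp
qed

text \<open>The translation by \<open>w\<close> at time \<open>k\<close> is pulled back to \<theta>
  at time 0. The cost consists of the Jacobian of \<theta>, the variation of the density of the base
  marginal, the drift of the fibre coordinate (\<open>fibre_shadow\<close>) and the change of the
  conditional measures. Each is of order \<open>norm w\<close> uniformly in \<open>k\<close>, so the
  whole orbit of a measure is regular with one constant.\<close>

lemma Gamma_regular:
 assumes \<mu>: "\<mu> \<in> Gamma_meas l b" and l: "l \<ge> 0" and b: "b \<ge> 0"
 shows "regular (1 + l + (a + b) * exp (a + b)) (push_iter F k \<mu>)"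
 unfolding regular_def
proof (intro conjI allI impI)
 have \<mu>P: "\<mu> \<in> prob_measures" using \<mu> by (simp add: Gamma_meas_def)
 note [measurable_cong] = prob_measuresD(2)[OF \<mu>P]
 show "push_iter F k \<mu> \<in> prob_measures" by (rule push_iter_eq(3)[OF F_meas \<mu>P])
 obtain \<kappa> \<phi> where \<kappa>: "disintegration \<mu> \<kappa>"
  "\<And>\<o>\<^sub>1 \<o>\<^sub>2. wasserstein (\<kappa> \<o>\<^sub>1) (\<kappa> \<o>\<^sub>2) \<le> l * dist \<o>\<^sub>1 \<o>\<^sub>2"
  and \<phi>: "\<phi> \<in> log_lipschitz b" "distr \<mu> borel fst = density haar \<phi>"
  using \<mu> by (auto simp: Gamma_meas_def)
 have \<kappa>P: "\<kappa> \<o> \<in> prob_measures" for \<o> using \<kappa>(1) by (simp add: disintegration_def)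
 note \<phi>f = log_lipschitz_facts[OF \<phi>(1) b]
 note [measurable] = \<phi>f(3)
 obtain B where B: "\<And>\<o>. \<phi> \<o> \<le> B" using \<phi>f(4) by blast
 have int\<phi>: "integrable haar \<phi>"
  by (rule prob_integrable_bounded[OF haar.prob_space_axioms, of _ B])
   (use B \<phi>f(1) in "auto simp: abs_of_pos")
 have \<phi>1: "(\<integral>\<o>. \<phi> \<o> \<partial>haar) = 1"
 proof -
  have "(fst :: 'm torus \<times> 'n torus => _) \<in> borel_measurable borel" by (simp add: borel_prod[symmetric])
  from distr_prob_measures[OF \<mu>P this] have "prob_space (distr \<mu> borel fst)" by (rule prob_measuresD(1))
  then have "emeasure (density haar \<phi>) UNIV = 1"
   using prob_space.emeasure_space_1 unfolding \<phi>(2) by fastforce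
  then have "(\<integral>\<^sup>+\<o>. ennreal (\<phi> \<o>) \<partial>haar) = 1" by (simp add: emeasure_density)
  then show ?thesis using \<phi>f(1) by (simp add: integral_eq_nn_integral less_imp_le)
 qed
 have dis: "(\<integral>p. h p \<partial>\<mu>) = (\<integral>\<o>. \<phi> \<o> * (\<integral>x. h (\<o>, x) \<partial>\<kappa> \<o>) \<partial>haar)"
  and dism: "(\<lambda>\<o>. \<integral>x. h (\<o>, x) \<partial>\<kappa> \<o>) \<in> borel_measurable borel"
  and dis0: "\<And>\<o>. 0 \<le> (\<integral>x. h (\<o>, x) \<partial>\<kappa> \<o>)" and dis1: "\<And>\<o>. (\<integral>x. h (\<o>, x) \<partial>\<kappa> \<o>) \<le> 1"
  if h: "h \<in> borel_measurable borel" "\<And>p. 0 \<le> h p" "\<And>p. h p \<le> 1" for h :: "'m torus \<times> 'n torus => real"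
 proof -
  show m: "(\<lambda>\<o>. \<integral>x. h (\<o>, x) \<partial>\<kappa> \<o>) \<in> borel_measurable borel"
   by (rule kernel_integral_measurable[OF disintegration_kernel[OF \<kappa>(1)] h(1)])
  have "(\<integral>p. h p \<partial>\<mu>) = (\<integral>\<o>. \<integral>x. h (\<o>, x) \<partial>\<kappa> \<o> \<partial>density haar \<phi>)"
   using disintegration_integral[OF \<mu>P \<kappa>(1) h] by (simp add: \<phi>(2))
  also have "\<dots> = (\<integral>\<o>. \<phi> \<o> * (\<integral>x. h (\<o>, x) \<partial>\<kappa> \<o>) \<partial>haar)"
   using m \<phi>f(1) by (subst integral_density) (auto simp: less_imp_le)
  finally show "(\<integral>p. h p \<partial>\<mu>) = (\<integral>\<o>. \<phi> \<o> * (\<integral>x. h (\<o>, x) \<partial>\<kappa> \<o>) \<partial>haar)" .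
  show "0 \<le> (\<integral>x. h (\<o>, x) \<partial>\<kappa> \<o>)" for \<o> by (rule integral_nonneg_AE) (use h in auto)
  show "(\<integral>x. h (\<o>, x) \<partial>\<kappa> \<o>) \<le> 1" for \<o>
  proof (rule prob_integral_le_const[OF prob_measuresD(1)[OF \<kappa>P]])
   show "integrable (\<kappa> \<o>) (\<lambda>x. h (\<o>, x))"
    by (rule prob_measures_integrable[OF \<kappa>P, of _ 1])
     (use h in "auto intro!: measurable_compose[OF _ h(1)] simp: borel_prod[symmetric]")
  qed (use h in auto)
 qed
 fix \<Phi> :: "'m torus \<times> 'n torus => real" and \<Lambda> :: real and w :: "real ^ 'm"
 assume \<Phi>m [measurable]: "\<Phi> \<in> borel_measurable borel" and \<Phi>01: "\<forall>p. 0 \<le> \<Phi> p \<and> \<Phi> p \<le> 1" and \<Lambda>: "0 \<le> \<Lambda>"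
  and \<Phi>lip: "\<forall>\<o> x x'. \<bar>\<Phi> (\<o>, x) - \<Phi> (\<o>, x')\<bar> \<le> \<Lambda> * dist x x'" and w: "norm w \<le> 1"
 obtain \<theta> where \<theta>: "\<theta> \<in> borel_measurable borel" "\<And>\<o>. (g ^^ k) (\<theta> \<o>) = tshift w ((g ^^ k) \<o>)"
  "\<And>\<o> j. j \<le> k ==> dist ((g ^^ j) (\<theta> \<o>)) ((g ^^ j) \<o>) \<le> norm w / \<sigma> ^ (k - j)"
  "\<And>(\<phi> :: 'm torus => real) B. \<phi> \<in> borel_measurable borel ==> (\<And>\<o>. 0 \<le> \<phi> \<o>) ==> (\<And>\<o>. \<phi> \<o> \<le> B) ==>
   (\<integral>\<o>. \<phi> (\<theta> \<o>) \<partial>haar) \<le> exp (a * norm w) * (\<integral>\<o>. \<phi> \<o> \<partial>haar)"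
  by (rule rotE[of k w]) blast
 note [measurable] = \<theta>(1)
 define \<Xi> where "\<Xi> = (\<lambda>p. \<Phi> ((F ^^ k) p))"
 have \<Xi>m [measurable]: "\<Xi> \<in> borel_measurable borel" unfolding \<Xi>_def by measurable
 have \<Xi>01: "0 \<le> \<Xi> p" "\<Xi> p \<le> 1" for p
  unfolding \<Xi>_def using spec[OF \<Phi>01, of "(F ^^ k) p"] by blast+
 have \<Xi>eq: "\<Xi> (\<o>, x) = \<Phi> ((g ^^ k) \<o>, snd ((F ^^ k) (\<o>, x)))" for \<o> x
  using fst_funpow_F[of k "(\<o>, x)"] unfolding \<Xi>_def by (metis fst_conv prod.collapse)
 define N where "N = (\<lambda>\<o>. \<integral>x. \<Xi> (\<o>, x) \<partial>\<kappa> \<o>)"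
 have N: "N \<in> borel_measurable borel" "\<And>\<o>. 0 \<le> N \<o>" "\<And>\<o>. N \<o> \<le> 1"
  unfolding N_def by (rule dism dis0 dis1; use \<Xi>01 in simp)+
 note [measurable] = N(1)
 define \<Psi> where "\<Psi> = (\<lambda>p. \<Phi> (tshift w (fst ((F ^^ k) p)), snd ((F ^^ k) p)))"
 have \<Psi>m [measurable]: "\<Psi> \<in> borel_measurable borel"
 proof -
  have [measurable]: "F ^^ k \<in> borel \<rightarrow>\<^sub>M borel \<Otimes>\<^sub>M borel" "\<Phi> \<in> borel_measurable (borel \<Otimes>\<^sub>M borel)"
   by (simp_all add: borel_prod)
  show ?thesis unfolding \<Psi>_def by measurable
 qed
 have \<Psi>01: "0 \<le> \<Psi> p" "\<Psi> p \<le> 1" for p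
  unfolding \<Psi>_def using spec[OF \<Phi>01, of "(tshift w (fst ((F ^^ k) p)), snd ((F ^^ k) p))"] by blast+
 define t where "t = norm w"
 have t: "0 \<le> t" "t \<le> 1" using w by (auto simp: t_def)
 have \<theta>d: "dist (\<theta> \<o>) \<o> \<le> t / \<sigma> ^ k" "dist (\<theta> \<o>) \<o> \<le> t" for \<o>
 proof -
  show *: "dist (\<theta> \<o>) \<o> \<le> t / \<sigma> ^ k" using \<theta>(3)[of 0 \<o>] by (simp add: t_def)
  have "t / \<sigma> ^ k \<le> t" using t sigma_gt_1 by (simp add: divide_le_eq mult_left_le one_le_power mult_le_cancel_left1)
  with * show "dist (\<theta> \<o>) \<o> \<le> t" by simp
 qed
 have secm: "(\<lambda>x. h (\<o>, x)) \<in> borel_measurable borel" if "h \<in> borel_measurable borel" for h :: "'m torus \<times> 'n torus => real" and \<o>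
  by (rule measurable_compose[OF _ that]) (unfold borel_prod[symmetric], rule measurable_Pair1', simp)
 \<comment> \<open>First the starting point in the base is changed to its image under \<theta> with
   the fibre point kept, then the conditional measure is changed as well.\<close>
 have point: "(\<integral>x. \<Psi> (\<o>, x) \<partial>\<kappa> \<o>) \<le> N (\<theta> \<o>) + \<Lambda> * (1 + l) * t" for \<o>
 proof -
  have i: "integrable (\<kappa> \<o>') (\<lambda>x. \<Psi> (\<o>, x))" "integrable (\<kappa> \<o>') (\<lambda>x. \<Xi> (\<theta> \<o>, x))" for \<o>'
   by (rule prob_measures_integrable[OF \<kappa>P secm, where B = 1]; use \<Psi>01 \<Xi>01 in "simp add: abs_of_nonneg")+
  have le: "\<Psi> (\<o>, x) \<le> \<Xi> (\<theta> \<o>, x) + \<Lambda> * t" for x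
  proof -
   have "dist (snd ((F ^^ k) (\<theta> \<o>, x))) (snd ((F ^^ k) (\<o>, x))) \<le> t / \<sigma> ^ (k - k)"
    by (rule fibre_shadow) (use \<theta>(3) t in "auto simp: t_def")
   then have "\<Lambda> * dist (snd ((F ^^ k) (\<o>, x))) (snd ((F ^^ k) (\<theta> \<o>, x))) \<le> \<Lambda> * t"
    using \<Lambda> by (intro mult_left_mono) (auto simp: dist_commute)
   moreover have "\<Psi> (\<o>, x) = \<Phi> ((g ^^ k) (\<theta> \<o>), snd ((F ^^ k) (\<o>, x)))"
    by (simp add: \<Psi>_def fst_funpow_F \<theta>(2))
   moreover have "\<bar>\<Phi> ((g ^^ k) (\<theta> \<o>), snd ((F ^^ k) (\<o>, x))) - \<Xi> (\<theta> \<o>, x)\<bar>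
     \<le> \<Lambda> * dist (snd ((F ^^ k) (\<o>, x))) (snd ((F ^^ k) (\<theta> \<o>, x)))"
    unfolding \<Xi>eq using \<Phi>lip by blast
   ultimately show ?thesis by (simp add: abs_le_iff)
  qed
  have "(\<integral>x. \<Psi> (\<o>, x) \<partial>\<kappa> \<o>) \<le> (\<integral>x. \<Xi> (\<theta> \<o>, x) + \<Lambda> * t \<partial>\<kappa> \<o>)"
  proof (rule integral_mono)
   interpret prob_space "\<kappa> \<o>" by (rule prob_measuresD(1)[OF \<kappa>P])
   show "integrable (\<kappa> \<o>) (\<lambda>x. \<Xi> (\<theta> \<o>, x) + \<Lambda> * t)" using i(2) by simp
  qed (use i le in auto)
  also have "\<dots> = (\<integral>x. \<Xi> (\<theta> \<o>, x) \<partial>\<kappa> \<o>) + \<Lambda> * t"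
  proof -
   interpret prob_space "\<kappa> \<o>" by (rule prob_measuresD(1)[OF \<kappa>P])
   show ?thesis using i(2) prob_space by simp
  qed
  also have "(\<integral>x. \<Xi> (\<theta> \<o>, x) \<partial>\<kappa> \<o>) \<le> N (\<theta> \<o>) + \<Lambda> * L ^ k * (l * (t / \<sigma> ^ k))"
  proof -
   have "\<bar>(\<integral>x. \<Xi> (\<theta> \<o>, x) \<partial>\<kappa> \<o>) - (\<integral>x. \<Xi> (\<theta> \<o>, x) \<partial>\<kappa> (\<theta> \<o>))\<bar>
     \<le> \<Lambda> * L ^ k * wasserstein (\<kappa> \<o>) (\<kappa> (\<theta> \<o>))"
   proof (rule lipschitz_integral_le_wasserstein[OF \<kappa>P \<kappa>P secm[OF \<Xi>m], of _ 1])
    show "\<bar>\<Xi> (\<theta> \<o>, x) - \<Xi> (\<theta> \<o>, x')\<bar> \<le> \<Lambda> * L ^ k * dist x x'" for x x'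
    proof -
     have "\<bar>\<Xi> (\<theta> \<o>, x) - \<Xi> (\<theta> \<o>, x')\<bar> \<le> \<Lambda> * dist (snd ((F ^^ k) (\<theta> \<o>, x))) (snd ((F ^^ k) (\<theta> \<o>, x')))"
      unfolding \<Xi>eq using \<Phi>lip by blast
     also have "\<dots> \<le> \<Lambda> * (L ^ k * dist x x')" by (intro mult_left_mono fibre_lipschitz \<Lambda>)
     finally show ?thesis by simp
    qed
   qed (use \<Lambda> L_pos \<Xi>01 in "auto simp: abs_of_nonneg")
   also have "\<dots> \<le> \<Lambda> * L ^ k * (l * (t / \<sigma> ^ k))"
   proof (intro mult_left_mono)
    have "wasserstein (\<kappa> \<o>) (\<kappa> (\<theta> \<o>)) \<le> l * dist \<o> (\<theta> \<o>)" by (rule \<kappa>(2))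
    also have "\<dots> \<le> l * (t / \<sigma> ^ k)" using \<theta>d(1)[of \<o>] l by (intro mult_left_mono) (auto simp: dist_commute)
    finally show "wasserstein (\<kappa> \<o>) (\<kappa> (\<theta> \<o>)) \<le> l * (t / \<sigma> ^ k)" .
   qed (use \<Lambda> L_pos in auto)
   finally show ?thesis by (simp add: N_def abs_le_iff)
  qed
  also have "\<Lambda> * L ^ k * (l * (t / \<sigma> ^ k)) = \<Lambda> * l * t * (L / \<sigma>) ^ k"
   by (simp add: power_divide)
  \<comment> \<open>The fibre maps may expand by \<open>L\<close> at each step, but \<theta>
    displaces the base only by \<open>t / \<sigma> ^ k\<close>; the quotient
    \<open>L / \<sigma>\<close> is below 1.\<close>
  also have "\<dots> \<le> \<Lambda> * l * t * 1"
   using \<Lambda> l t L_pos L_sigma sigma_gt_1 by (intro mult_left_mono power_le_one) auto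
  finally show ?thesis by (simp add: algebra_simps)
 qed
 have \<phi>N: "0 \<le> \<phi> \<o> * N \<o>" "\<phi> \<o> * N \<o> \<le> B" for \<o>
 proof -
  show "0 \<le> \<phi> \<o> * N \<o>" using \<phi>f(1)[of \<o>] N(2)[of \<o>] by simp
  have "\<phi> \<o> * N \<o> \<le> \<phi> \<o> * 1" using \<phi>f(1)[of \<o>] N(3)[of \<o>] by (intro mult_left_mono) auto
  then show "\<phi> \<o> * N \<o> \<le> B" using B[of \<o>] by linarith
 qed
 have iN: "integrable haar (\<lambda>\<o>. \<phi> (\<theta> \<o>) * N (\<theta> \<o>))"
 proof (rule prob_integrable_bounded[OF haar.prob_space_axioms, of _ B])
  show "\<bar>\<phi> (\<theta> \<o>) * N (\<theta> \<o>)\<bar> \<le> B" for \<o>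
   using \<phi>N[of "\<theta> \<o>"] by (simp add: abs_of_nonneg)
 qed simp
 have i\<Psi>: "integrable haar (\<lambda>\<o>. \<phi> \<o> * (\<integral>x. \<Psi> (\<o>, x) \<partial>\<kappa> \<o>))"
 proof (rule Bochner_Integration.integrable_bound[OF int\<phi>])
  note [measurable] = dism[OF \<Psi>m \<Psi>01]
  show "(\<lambda>\<o>. \<phi> \<o> * (\<integral>x. \<Psi> (\<o>, x) \<partial>\<kappa> \<o>)) \<in> borel_measurable haar" by measurable
  show "AE \<o> in haar. norm (\<phi> \<o> * (\<integral>x. \<Psi> (\<o>, x) \<partial>\<kappa> \<o>)) \<le> norm (\<phi> \<o>)"
   using dis0[OF \<Psi>m \<Psi>01] dis1[OF \<Psi>m \<Psi>01] \<phi>f(1) by (simp add: abs_mult mult_left_le)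
 qed
 have ratio: "\<phi> \<o> \<le> exp (b * t) * \<phi> (\<theta> \<o>)" for \<o>
 proof -
  have "\<phi> \<o> \<le> exp (b * dist \<o> (\<theta> \<o>)) * \<phi> (\<theta> \<o>)" by (rule \<phi>f(2))
  also have "\<dots> \<le> exp (b * t) * \<phi> (\<theta> \<o>)"
   using \<theta>d(2)[of \<o>] b \<phi>f(1)[of "\<theta> \<o>"] by (intro mult_right_mono) (auto simp: dist_commute mult_left_mono)
  finally show ?thesis .
 qed
 have "(\<integral>p. \<Phi> (tshift w (fst p), snd p) \<partial>push_iter F k \<mu>) = (\<integral>p. \<Psi> p \<partial>\<mu>)"
  unfolding push_iter_eq(1)[OF F_meas \<mu>P] \<Psi>_def
 proof (rule integral_distr_prob[OF \<mu>P funpow_F_meas])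
  have [measurable]: "\<Phi> \<in> borel_measurable (borel \<Otimes>\<^sub>M borel)" by (simp add: borel_prod)
  show "(\<lambda>p. \<Phi> (tshift w (fst p), snd p)) \<in> borel_measurable borel"
   unfolding borel_prod[symmetric] by measurable
 qed
 also have "\<dots> = (\<integral>\<o>. \<phi> \<o> * (\<integral>x. \<Psi> (\<o>, x) \<partial>\<kappa> \<o>) \<partial>haar)" by (rule dis[OF \<Psi>m \<Psi>01])
 also have "\<dots> \<le> (\<integral>\<o>. exp (b * t) * (\<phi> (\<theta> \<o>) * N (\<theta> \<o>)) + \<Lambda> * (1 + l) * t * \<phi> \<o> \<partial>haar)"
 proof (rule integral_mono[OF i\<Psi>])
  show "integrable haar (\<lambda>\<o>. exp (b * t) * (\<phi> (\<theta> \<o>) * N (\<theta> \<o>)) + \<Lambda> * (1 + l) * t * \<phi> \<o>)"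
   using iN int\<phi> by simp
  fix \<o>
  have "\<phi> \<o> * (\<integral>x. \<Psi> (\<o>, x) \<partial>\<kappa> \<o>) \<le> \<phi> \<o> * (N (\<theta> \<o>) + \<Lambda> * (1 + l) * t)"
   by (intro mult_left_mono point less_imp_le \<phi>f(1))
  also have "\<dots> \<le> exp (b * t) * \<phi> (\<theta> \<o>) * N (\<theta> \<o>) + \<Lambda> * (1 + l) * t * \<phi> \<o>"
   using mult_right_mono[OF ratio N(2), of \<o> "\<theta> \<o>"] by (simp add: algebra_simps)
  finally show "\<phi> \<o> * (\<integral>x. \<Psi> (\<o>, x) \<partial>\<kappa> \<o>) \<le> exp (b * t) * (\<phi> (\<theta> \<o>) * N (\<theta> \<o>)) + \<Lambda> * (1 + l) * t * \<phi> \<o>"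
   by (simp add: mult.assoc)
 qed
 also have "\<dots> = exp (b * t) * (\<integral>\<o>. \<phi> (\<theta> \<o>) * N (\<theta> \<o>) \<partial>haar) + \<Lambda> * (1 + l) * t"
  using iN int\<phi> \<phi>1 by simp
 also have "(\<integral>\<o>. \<phi> (\<theta> \<o>) * N (\<theta> \<o>) \<partial>haar) \<le> exp (a * t) * (\<integral>\<o>. \<phi> \<o> * N \<o> \<partial>haar)"
  unfolding t_def
 proof (rule \<theta>(4)[of "\<lambda>\<o>. \<phi> \<o> * N \<o>" B])
  show "0 \<le> \<phi> \<o> * N \<o>" "\<phi> \<o> * N \<o> \<le> B" for \<o>
   by (rule \<phi>N)+
 qed simp
 also have "(\<integral>\<o>. \<phi> \<o> * N \<o> \<partial>haar) = (\<integral>p. \<Xi> p \<partial>\<mu>)" unfolding N_def by (rule dis[OF \<Xi>m \<Xi>01, symmetric])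
 finally have main: "(\<integral>p. \<Phi> (tshift w (fst p), snd p) \<partial>push_iter F k \<mu>)
   \<le> exp (b * t) * (exp (a * t) * (\<integral>p. \<Xi> p \<partial>\<mu>)) + \<Lambda> * (1 + l) * t" by simp
 have I: "(\<integral>p. \<Xi> p \<partial>\<mu>) = (\<integral>p. \<Phi> p \<partial>push_iter F k \<mu>)"
  unfolding push_iter_eq(1)[OF F_meas \<mu>P] \<Xi>_def
  by (rule integral_distr_prob[OF \<mu>P funpow_F_meas, symmetric]) simp
 have X01: "0 \<le> (\<integral>p. \<Xi> p \<partial>\<mu>)" "(\<integral>p. \<Xi> p \<partial>\<mu>) \<le> 1"
 proof -
  have "integrable \<mu> \<Xi>" by (rule prob_measures_integrable[OF \<mu>P \<Xi>m, where B = 1]) (use \<Xi>01 in "simp add: abs_of_nonneg")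
  then show "0 \<le> (\<integral>p. \<Xi> p \<partial>\<mu>)" "(\<integral>p. \<Xi> p \<partial>\<mu>) \<le> 1"
   using \<Xi>01 prob_integral_le_const[OF prob_measuresD(1)[OF \<mu>P], of \<Xi> 1]
    prob_integral_ge_const[OF prob_measuresD(1)[OF \<mu>P], of \<Xi> 0] by auto
 qed
 \<comment> \<open>Linearises the multiplicative loss \<open>exp ((a + b) * t)\<close>, using that
   the integral is at most 1 and that \<open>t\<close> is at most 1.\<close>
 have e: "exp (b * t) * (exp (a * t) * X) \<le> X + (a + b) * exp (a + b) * t" if "0 \<le> X" "X \<le> 1" for X
 proof -
  define c where "c = (a + b) * t"
  have c: "0 \<le> c" "c \<le> a + b" using t a_nonneg b by (auto simp: c_def mult_left_le)
  have "1 - c \<le> exp (- c)" using exp_ge_add_one_self[of "- c"] by simp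
  then have "exp c * (1 - c) \<le> 1"
   using mult_left_mono[of "1 - c" "exp (- c)" "exp c"] by (simp add: exp_minus_inverse)
  then have "exp c - 1 \<le> c * exp c" by (simp add: algebra_simps)
  also have "\<dots> \<le> c * exp (a + b)" using c by (intro mult_left_mono) auto
  finally have *: "exp c - 1 \<le> c * exp (a + b)" .
  have "(exp c - 1) * X \<le> (exp c - 1) * 1" using that c by (intro mult_left_mono) auto
  then have "exp c * X \<le> X + c * exp (a + b)" using * by (simp add: algebra_simps)
  moreover have "exp (b * t) * (exp (a * t) * X) = exp c * X"
  proof -
   have "c = b * t + a * t" by (simp add: c_def algebra_simps)
   then show ?thesis by (simp only: exp_add mult.assoc)
  qed
  moreover have "c * exp (a + b) = (a + b) * exp (a + b) * t" by (simp add: c_def)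
  ultimately show ?thesis by metis
 qed
 have "(\<integral>p. \<Phi> (tshift w (fst p), snd p) \<partial>push_iter F k \<mu>)
   \<le> (\<integral>p. \<Xi> p \<partial>\<mu>) + ((a + b) * exp (a + b) + \<Lambda> * (1 + l)) * t"
  using add_mono[OF e[OF X01] order.refl[of "\<Lambda> * (1 + l) * t"]] main by (simp only: distrib_right add.assoc)
 also have "\<dots> \<le> (\<integral>p. \<Xi> p \<partial>\<mu>) + (1 + l + (a + b) * exp (a + b)) * (1 + \<Lambda>) * t"
 proof (intro add_left_mono mult_right_mono)
  have "0 \<le> (a + b) * exp (a + b) * \<Lambda>" using a_nonneg b \<Lambda> by simp
  then show "(a + b) * exp (a + b) + \<Lambda> * (1 + l) \<le> (1 + l + (a + b) * exp (a + b)) * (1 + \<Lambda>)"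
   using l by (simp add: algebra_simps)
 qed (use t in simp)
 finally show "(\<integral>p. \<Phi> (tshift w (fst p), snd p) \<partial>push_iter F k \<mu>)
   \<le> (\<integral>p. \<Phi> p \<partial>push_iter F k \<mu>) + (1 + l + (a + b) * exp (a + b)) * (1 + \<Lambda>) * norm w"
  by (simp add: I t_def)
qed

end

section \<open>The averaged operator\<close>

lemma dist_tshift_tshift: "dist (tshift w x) (tshift w y) = dist x y"
proof (rule antisym)
 have le: "dist (tshift w x) (tshift w y) \<le> dist x y" for w x y
 proof -
  obtain v where v: "tshift v x = y" "norm v = dist x y" by (rule tshift_connects)
  have "tshift w y = tshift v (tshift w x)"
   by (simp add: v(1)[symmetric] tshift_add add.commute)
  then show ?thesis using dist_tshift_le[of v "tshift w x"] v(2) by (simp add: dist_commute)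
 qed
 show "dist (tshift w x) (tshift w y) \<le> dist x y" by (rule le)
 show "dist x y \<le> dist (tshift w x) (tshift w y)"
  using le[of "- w" "tshift w x" "tshift w y"] by (simp add: tshift_add)
qed

section \<open>Lengths of translations and Haar mass of balls\<close>

definition torus_norm :: "real ^ 'm::finite => real" where
 "torus_norm w = dist (tproj 0) (tproj w)"

lemma torus_norm_eq: "dist x (tshift w x) = torus_norm w"
proof -
 have "x = tshift (trep x) (tproj 0)" by (simp add: tshift_tproj)
 moreover have "tshift w x = tshift (trep x) (tproj w)" unfolding tshift_tproj by (simp add: tshift_def add.commute)
 ultimately show ?thesis unfolding torus_norm_def using dist_tshift_tshift by metis
qed

lemma torus_norm_measurable [measurable]: "torus_norm \<in> borel_measurable borel"
 unfolding torus_norm_def by measurable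

text \<open>A vector drawn from the cube may be long although its translation is short; the
  regularity estimates need the shortest vector.\<close>

lemma torus_norm_representative:
 obtains w' where "tshift w = tshift w'" "norm w' = torus_norm w"
proof -
 obtain y where y: "tproj y = tproj w" "dist 0 y = dist (tproj 0) (tproj w)" by (rule tproj_lift_close)
 have "tshift w x = tshift y x" for x
 proof -
  have "(trep x + y) - (trep x + w) \<in> int_vecs" using y(1) by (simp add: tproj_eq_iff)
  then show ?thesis unfolding tshift_def by (metis tproj_eq_iff)
 qed
 then show thesis using y(2) by (intro that[of y]) (auto simp: torus_norm_def)
qed

text \<open>The centre is immaterial by translation invariance. The mass is written as an integral
  of the same conditional as in \<open>avg_op\<close>, which it normalises.\<close>

definition ball_mass :: "'m::finite itself => real => real" where
 "ball_mass _ r = (\<integral>v. (if dist (tproj 0 :: 'm torus) v < r then 1 else 0) \<partial>haar)"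

lemma ball_mass_eq:
 "(\<integral>v. (if dist (u :: 'm::finite torus) v < r then 1 else 0) \<partial>haar) = ball_mass TYPE('m) r"
proof -
 have "(\<integral>v. (if dist u v < r then 1 else 0 :: real) \<partial>haar)
   = (\<integral>v. (if dist u (tshift (trep u) v) < r then 1 else 0) \<partial>haar)"
  by (rule integral_haar_tshift[symmetric]) auto
 also have "\<dots> = (\<integral>v. (if dist (tproj 0 :: 'm torus) v < r then 1 else 0) \<partial>haar)"
 proof (rule Bochner_Integration.integral_cong[OF refl])
  fix v
  have "u = tshift (trep u) (tproj 0)" by (simp add: tshift_tproj)
  then have "dist u (tshift (trep u) v) = dist (tproj 0) v" by (metis dist_tshift_tshift)
  then show "(if dist u (tshift (trep u) v) < r then 1 else 0 :: real) = (if dist (tproj 0) v < r then 1 else 0)"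
   by simp
 qed
 finally show ?thesis by (simp add: ball_mass_def)
qed

lemma ball_mass_measure: "ball_mass TYPE('m::finite) r = measure haar (ball (tproj 0 :: 'm torus) r)"
proof -
 have "ball_mass TYPE('m) r = (\<integral>v. indicator (ball (tproj 0 :: 'm torus) r) v \<partial>haar)"
  unfolding ball_mass_def by (rule Bochner_Integration.integral_cong) (auto simp: indicator_def)
 then show ?thesis by simp
qed

lemma ball_mass_pos: "r > 0 ==> ball_mass TYPE('m::finite) r > 0"
 using emeasure_haar_open_pos[of "ball (tproj 0 :: 'm torus) r"]
 by (simp add: ball_mass_measure haar.emeasure_eq_measure)

text \<open>Continuity of measure along the increasing balls of radius
  \<open>r - r / (n + 2)\<close>; this provides the margin by which a ball may shrink at the cost of
  at most half of its mass.\<close>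

lemma ball_mass_half:
 assumes "r > 0"
 obtains s where "0 < s" "s < r" "ball_mass TYPE('m::finite) (r - s) \<ge> ball_mass TYPE('m) r / 2"
proof -
 define A where "A = (\<lambda>n. ball (tproj 0 :: 'm torus) (r - r / real (n + 2)))"
 have "(\<lambda>n. measure haar (A n)) \<longlonglongrightarrow> measure haar (\<Union>n. A n)"
 proof (rule haar.finite_Lim_measure_incseq)
  show "range A \<subseteq> sets haar" by (auto simp: A_def)
  show "incseq A"
   unfolding A_def using assms by (intro incseq_SucI subset_ball) (simp add: frac_le)
 qed
 moreover have "(\<Union>n. A n) = ball (tproj 0) r"
 proof (intro equalityI subsetI)
  fix v :: "'m torus" assume "v \<in> ball (tproj 0) r"
  then have e: "r - dist (tproj 0) v > 0" by simp
  obtain n where n: "real n > r / (r - dist (tproj 0) v)" using reals_Archimedean2 by blast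
  have "real (n + 2) > r / (r - dist (tproj 0) v)" using n by simp
  then have "r / real (n + 2) < r - dist (tproj 0) v"
   using e by (simp add: field_simps)
  then have "v \<in> A n" by (simp add: A_def)
  then show "v \<in> (\<Union>n. A n)" by blast
 next
  fix v assume "v \<in> (\<Union>n. A n)"
  then obtain n where "dist (tproj 0) v < r - r / real (n + 2)" by (auto simp: A_def)
  moreover have "r / real (n + 2) > 0" using assms by simp
  ultimately show "v \<in> ball (tproj 0) r" by simp
 qed
 ultimately have lim: "(\<lambda>n. measure haar (A n)) \<longlonglongrightarrow> ball_mass TYPE('m) r" by (simp add: ball_mass_measure)
 have "ball_mass TYPE('m) r / 2 < ball_mass TYPE('m) r" using ball_mass_pos[OF assms, where 'm = 'm] by simp
 from order_tendstoD(1)[OF lim this] obtain n where "ball_mass TYPE('m) r / 2 < measure haar (A n)"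
  by (auto simp: eventually_sequentially)
 moreover have "r / real (n + 2) < r / 1" using assms by (intro divide_strict_left_mono) auto
 ultimately show thesis
  using assms by (intro that[of "r / real (n + 2)"]) (auto simp: A_def ball_mass_measure)
qed

lemma ball_mass_mono: "r \<le> s ==> ball_mass TYPE('m::finite) r \<le> ball_mass TYPE('m) s"
 unfolding ball_mass_measure by (rule haar.finite_measure_mono) auto

text \<open>Averaging \<open>acip_shift_le\<close> over all translations in the cube replaces the
  shifted function by its Haar mean. The dimension enters through the size of the cube.\<close>

lemma (in lifted_rotations) acip_le_haar:
 assumes ac: "acip_density g \<rho>" and hm [measurable]: "h \<in> borel_measurable borel"
  and h0: "\<And>\<o>. 0 \<le> h \<o>" and hB: "\<And>\<o>. h \<o> \<le> B"
 shows "(\<integral>\<o>. \<rho> \<o> * h \<o> \<partial>haar) \<le> exp (a * CARD('m)) * (\<integral>\<o>. h \<o> \<partial>haar)"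
proof -
 have [measurable]: "\<rho> \<in> borel_measurable borel" and \<rho>0: "\<And>\<o>. 0 \<le> \<rho> \<o>"
  and P: "prob_space (density haar \<rho>)"
  using ac by (auto simp: acip_density_def)
 define \<nu> where "\<nu> = density haar \<rho>"
 have [measurable_cong]: "sets \<nu> = sets borel" by (simp add: \<nu>_def)
 have P\<nu>: "prob_space \<nu>" using P by (simp add: \<nu>_def)
 have d: "(\<integral>\<o>. \<rho> \<o> * u \<o> \<partial>haar) = (\<integral>\<o>. u \<o> \<partial>\<nu>)" if [measurable]: "u \<in> borel_measurable borel" for u :: "'m torus => real"
  unfolding \<nu>_def using \<rho>0 by (subst integral_density) auto
 define E where "E = exp (a * CARD('m))"
 have B0: "0 \<le> B" using h0 hB order.trans by blast
 have shift: "(\<integral>\<o>. h \<o> \<partial>\<nu>) \<le> E * (\<integral>\<o>. h (tshift w \<o>) \<partial>\<nu>)" if w: "norm w \<le> CARD('m)" for w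
 proof -
  \<comment> \<open>Rescales into the unit interval as \<open>acip_shift_le\<close> requires; adding
    1 keeps the denominator positive.\<close>
  define h' where "h' = (\<lambda>\<o>. h (tshift w \<o>) / (B + 1))"
  have [measurable]: "h' \<in> borel_measurable borel" unfolding h'_def by measurable
  have "(\<integral>\<o>. \<rho> \<o> * h' (tshift (- w) \<o>) \<partial>haar) \<le> exp (a * norm (- w)) * (\<integral>\<o>. \<rho> \<o> * h' \<o> \<partial>haar)"
  proof (rule acip_shift_le[OF ac])
   show "0 \<le> h' \<o>" for \<o> using h0 B0 by (simp add: h'_def)
   show "h' \<o> \<le> 1" for \<o> using hB[of "tshift w \<o>"] B0 by (simp add: h'_def)
  qed simp
  also have "\<dots> \<le> E * (\<integral>\<o>. \<rho> \<o> * h' \<o> \<partial>haar)"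
   unfolding E_def using w a_nonneg \<rho>0 h0 B0
   by (intro mult_right_mono integral_nonneg_AE) (auto simp: h'_def mult_left_mono)
  finally have "(\<integral>\<o>. h \<o> / (B + 1) \<partial>\<nu>) \<le> E * (\<integral>\<o>. h (tshift w \<o>) / (B + 1) \<partial>\<nu>)"
   by (simp add: d h'_def tshift_add)
  then have "(\<integral>\<o>. h \<o> \<partial>\<nu>) / (B + 1) \<le> (E * (\<integral>\<o>. h (tshift w \<o>) \<partial>\<nu>)) / (B + 1)" by simp
  then show ?thesis using B0 by (auto simp: divide_le_cancel)
 qed
 have i2: "integrable ucube (\<lambda>w. \<integral>\<o>. h (tshift w \<o>) \<partial>\<nu>)"
 proof (rule prob_integrable_bounded[OF prob_ucube, of _ B])
  interpret \<nu>: prob_space \<nu> by (rule P\<nu>)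
  show "(\<lambda>w. \<integral>\<o>. h (tshift w \<o>) \<partial>\<nu>) \<in> borel_measurable ucube" by measurable
  show "\<bar>\<integral>\<o>. h (tshift w \<o>) \<partial>\<nu>\<bar> \<le> B" for w
  proof -
   have "integrable \<nu> (\<lambda>\<o>. h (tshift w \<o>))"
    by (rule prob_integrable_bounded[OF P\<nu>, of _ B]) (use h0 hB in "auto simp: abs_of_nonneg")
   then have "(\<integral>\<o>. h (tshift w \<o>) \<partial>\<nu>) \<le> B" "0 \<le> (\<integral>\<o>. h (tshift w \<o>) \<partial>\<nu>)"
    using prob_integral_le_const[OF P\<nu>, of "\<lambda>\<o>. h (tshift w \<o>)" B] hB h0 by auto
   then show ?thesis by simp
  qed
 qed
 interpret uc: prob_space "ucube :: (real ^ 'm) measure" by (rule prob_ucube)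
 have "(\<integral>\<o>. h \<o> \<partial>\<nu>) = (\<integral>w. (\<integral>\<o>. h \<o> \<partial>\<nu>) \<partial>(ucube :: (real ^ 'm) measure))"
  using uc.prob_space by simp
 also have "\<dots> \<le> (\<integral>w. E * (\<integral>\<o>. h (tshift w \<o>) \<partial>\<nu>) \<partial>ucube)"
 proof (rule integral_mono_AE)
  show "AE w in ucube. (\<integral>\<o>. h \<o> \<partial>\<nu>) \<le> E * (\<integral>\<o>. h (tshift w \<o>) \<partial>\<nu>)"
   using AE_ucube by eventually_elim (rule shift)
 qed (use i2 in auto)
 also have "\<dots> = E * (\<integral>w. \<integral>\<o>. h (tshift w \<o>) \<partial>\<nu> \<partial>ucube)" by simp
 also have "(\<integral>w. \<integral>\<o>. h (tshift w \<o>) \<partial>\<nu> \<partial>ucube) = (\<integral>\<o>. \<integral>w. h (tshift w \<o>) \<partial>ucube \<partial>\<nu>)"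
  by (rule prob_Fubini_bounded[OF prob_ucube P\<nu>, of _ B]) (use h0 hB in "auto simp: abs_of_nonneg")
 also have "\<dots> = (\<integral>\<o>. \<integral>\<o>. h \<o> \<partial>haar \<partial>\<nu>)" using h0 by (simp add: integral_ucube_tshift)
 also have "\<dots> = (\<integral>\<o>. h \<o> \<partial>haar)" using prob_space.prob_space[OF P\<nu>] by simp
 finally show ?thesis by (simp add: d E_def)
qed

definition bounded_borel :: "('a::topological_space => real) => bool" where
 "bounded_borel h \<longleftrightarrow> h \<in> borel_measurable borel \<and> (\<exists>B. \<forall>x. \<bar>h x\<bar> \<le> B)"

lemma bounded_borelD: "bounded_borel h ==> h \<in> borel_measurable borel"
 by (simp add: bounded_borel_def)

lemma bounded_borelI: "h \<in> borel_measurable borel ==> (\<And>x. lo \<le> h x) ==> (\<And>x. h x \<le> hi) ==> bounded_borel h"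
 unfolding bounded_borel_def
 by (intro conjI exI[of _ "\<bar>lo\<bar> + \<bar>hi\<bar>"] allI) (auto simp: abs_le_iff, (smt (verit, best))+)

lemma bounded_borel_affine: "bounded_borel h ==> bounded_borel (\<lambda>x. \<alpha> * h x + \<gamma>)"
proof -
 assume "bounded_borel h"
 then obtain B where B: "h \<in> borel_measurable borel" "\<And>x. \<bar>h x\<bar> \<le> B" by (auto simp: bounded_borel_def)
 have "\<bar>\<alpha> * h x + \<gamma>\<bar> \<le> \<bar>\<alpha>\<bar> * B + \<bar>\<gamma>\<bar>" for x
 proof -
  have "\<bar>\<alpha> * h x + \<gamma>\<bar> \<le> \<bar>\<alpha>\<bar> * \<bar>h x\<bar> + \<bar>\<gamma>\<bar>" using abs_triangle_ineq[of "\<alpha> * h x" \<gamma>] by (simp add: abs_mult)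
  also have "\<dots> \<le> \<bar>\<alpha>\<bar> * B + \<bar>\<gamma>\<bar>" using B(2) by (simp add: mult_left_mono)
  finally show ?thesis .
 qed
 then show ?thesis using B(1) unfolding bounded_borel_def by auto
qed

lemma bounded_borel_integrable:
 assumes "bounded_borel h" "prob_space M" "u \<in> borel_measurable M"
 shows "integrable M (\<lambda>x. h (u x))"
proof -
 obtain B where B: "h \<in> borel_measurable borel" "\<And>x. \<bar>h x\<bar> \<le> B" using assms(1) by (auto simp: bounded_borel_def)
 show ?thesis
  by (rule prob_integrable_bounded[OF assms(2) measurable_compose[OF assms(3) B(1)], of B]) (rule B(2))
qed

context skew_system
begin

text \<open>Only the next base point is randomised, while the fibre coordinate \<open>f p\<close>
  uses the true base point. Hence the fibre Lipschitz constant grows by \<open>L\<close> at each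
  application, with no reference to regularity in the base.\<close>

definition avg_op :: "real => ('m torus \<times> 'n torus => real) => 'm torus \<times> 'n torus => real" where
 "avg_op \<delta> \<Psi> p = (\<integral>v. (if dist (fst p) v < \<delta> then \<Psi> (g v, f p) else 0) \<partial>haar) / ball_mass TYPE('m) \<delta>"

lemma if_integrable:
 fixes \<Psi> :: "'m torus \<times> 'n torus => real"
 assumes "bounded_borel \<Psi>"
 shows "integrable haar (\<lambda>v. if dist u v < \<delta> then \<Psi> (g v, y) else (0 :: real))"
proof -
 note [measurable] = bounded_borelD[OF assms]
 obtain B where B: "\<And>x. \<bar>\<Psi> x\<bar> \<le> B" using assms unfolding bounded_borel_def by blast
 have "0 \<le> B" using B abs_ge_zero order.trans by blast
 then show ?thesis
  by (intro prob_integrable_bounded[OF haar.prob_space_axioms, of _ B]) (measurable, use B in auto)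
qed

lemma ball_integrable: "integrable haar (\<lambda>v. if dist (u :: 'm torus) v < \<delta> then (1 :: real) else 0)"
 by (rule prob_integrable_bounded[OF haar.prob_space_axioms, of _ 1]) auto

lemma avg_op_measurable:
 assumes "bounded_borel \<Psi>" shows "avg_op \<delta> \<Psi> \<in> borel_measurable borel"
proof -
 note [measurable] = bounded_borelD[OF assms]
 show ?thesis unfolding avg_op_def by measurable
qed

lemma avg_op_affine:
 assumes \<Psi>: "bounded_borel \<Psi>" and \<delta>: "\<delta> > 0"
 shows "avg_op \<delta> (\<lambda>p. \<alpha> * \<Psi> p + \<gamma>) = (\<lambda>p. \<alpha> * avg_op \<delta> \<Psi> p + \<gamma>)"
proof
 fix p
 have "(\<integral>v. (if dist (fst p) v < \<delta> then \<alpha> * \<Psi> (g v, f p) + \<gamma> else 0) \<partial>haar)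
   = (\<integral>v. \<alpha> * (if dist (fst p) v < \<delta> then \<Psi> (g v, f p) else 0) + \<gamma> * (if dist (fst p) v < \<delta> then 1 else 0) \<partial>haar)"
  by (rule Bochner_Integration.integral_cong) auto
 also have "\<dots> = \<alpha> * (\<integral>v. (if dist (fst p) v < \<delta> then \<Psi> (g v, f p) else 0) \<partial>haar) + \<gamma> * ball_mass TYPE('m) \<delta>"
  using if_integrable[OF \<Psi>] ball_integrable by (simp add: ball_mass_eq)
 finally show "avg_op \<delta> (\<lambda>p. \<alpha> * \<Psi> p + \<gamma>) p = \<alpha> * avg_op \<delta> \<Psi> p + \<gamma>"
  using ball_mass_pos[OF \<delta>, where 'm = 'm] by (simp add: avg_op_def add_divide_distrib)
qed

lemma avg_op_mono:
 assumes "bounded_borel \<Psi>" "bounded_borel \<Psi>'" "\<And>p. \<Psi> p \<le> \<Psi>' p" "\<delta> > 0"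
 shows "avg_op \<delta> \<Psi> p \<le> avg_op \<delta> \<Psi>' p"
 unfolding avg_op_def
proof (intro divide_right_mono integral_mono if_integrable assms)
 show "0 \<le> ball_mass TYPE('m) \<delta>" using ball_mass_pos[OF assms(4), where 'm = 'm] by simp
qed (use assms(3) in auto)

lemma avg_op_const: "\<delta> > 0 ==> avg_op \<delta> (\<lambda>p. c) p = c"
proof -
 assume \<delta>: "\<delta> > 0"
 have "bounded_borel (\<lambda>p :: 'm torus \<times> 'n torus. 0)" by (auto simp: bounded_borel_def intro: exI[of _ 0])
 from fun_cong[OF avg_op_affine[OF this \<delta>, of 0 c], of p] show ?thesis by simp
qed

lemma avg_op_bounds:
 assumes \<Psi>: "\<Psi> \<in> borel_measurable borel" "\<And>p. lo \<le> \<Psi> p" "\<And>p. \<Psi> p \<le> hi" and \<delta>: "\<delta> > 0"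
 shows "lo \<le> avg_op \<delta> \<Psi> p" "avg_op \<delta> \<Psi> p \<le> hi"
proof -
 have c: "bounded_borel (\<lambda>p. c)" for c :: real by (simp add: bounded_borel_def exI[of _ "\<bar>c\<bar>"])
 note b = bounded_borelI[OF \<Psi>]
 show "lo \<le> avg_op \<delta> \<Psi> p" using avg_op_mono[OF c b \<Psi>(2) \<delta>] avg_op_const[OF \<delta>] by metis
 show "avg_op \<delta> \<Psi> p \<le> hi" using avg_op_mono[OF b c \<Psi>(3) \<delta>] avg_op_const[OF \<delta>] by metis
qed

lemma funpow_avg_op_bounds:
 assumes \<Psi>: "\<Psi> \<in> borel_measurable borel" "\<And>p. lo \<le> \<Psi> p" "\<And>p. \<Psi> p \<le> hi" and \<delta>: "\<delta> > 0"
 shows "(avg_op \<delta> ^^ k) \<Psi> \<in> borel_measurable borel" "lo \<le> (avg_op \<delta> ^^ k) \<Psi> p" "(avg_op \<delta> ^^ k) \<Psi> p \<le> hi"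
proof -
 have "(avg_op \<delta> ^^ k) \<Psi> \<in> borel_measurable borel \<and> (\<forall>p. lo \<le> (avg_op \<delta> ^^ k) \<Psi> p \<and> (avg_op \<delta> ^^ k) \<Psi> p \<le> hi)"
 proof (induction k)
  case (Suc k)
  then have *: "(avg_op \<delta> ^^ k) \<Psi> \<in> borel_measurable borel" "\<And>p. lo \<le> (avg_op \<delta> ^^ k) \<Psi> p" "\<And>p. (avg_op \<delta> ^^ k) \<Psi> p \<le> hi"
   by blast+
  show ?case
   using avg_op_measurable[OF bounded_borelI[OF *]] avg_op_bounds[OF * \<delta>] by simp
 qed (use \<Psi> in auto)
 then show "(avg_op \<delta> ^^ k) \<Psi> \<in> borel_measurable borel" "lo \<le> (avg_op \<delta> ^^ k) \<Psi> p" "(avg_op \<delta> ^^ k) \<Psi> p \<le> hi"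
  by blast+
qed

lemma avg_op_lipschitz:
 assumes \<Psi>: "bounded_borel \<Psi>" and lip: "\<And>\<o> x x'. \<bar>\<Psi> (\<o>, x) - \<Psi> (\<o>, x')\<bar> \<le> \<Lambda> * dist x x'"
  and \<Lambda>: "\<Lambda> \<ge> 0" and \<delta>: "\<delta> > 0"
 shows "\<bar>avg_op \<delta> \<Psi> (\<o>, x) - avg_op \<delta> \<Psi> (\<o>, x')\<bar> \<le> L * \<Lambda> * dist x x'"
proof -
 have one: "avg_op \<delta> \<Psi> (\<o>, x) - avg_op \<delta> \<Psi> (\<o>, x') \<le> L * \<Lambda> * dist x x'" for x x'
 proof -
  define D where "D = L * \<Lambda> * dist x x'"
  have le: "\<Psi> (u, f (\<o>, x)) \<le> \<Psi> (u, f (\<o>, x')) + D" for u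
  proof -
   have "\<Psi> (u, f (\<o>, x)) \<le> \<Psi> (u, f (\<o>, x')) + \<Lambda> * dist (f (\<o>, x)) (f (\<o>, x'))"
    using lip[of u "f (\<o>, x)" "f (\<o>, x')"] by (simp add: abs_le_iff)
   also have "\<Lambda> * dist (f (\<o>, x)) (f (\<o>, x')) \<le> \<Lambda> * (L * dist x x')"
    by (intro mult_left_mono f_lip_snd \<Lambda>)
   finally show ?thesis by (simp add: D_def mult_ac)
  qed
  have "(\<integral>v. (if dist \<o> v < \<delta> then \<Psi> (g v, f (\<o>, x)) else 0) \<partial>haar)
    \<le> (\<integral>v. (if dist \<o> v < \<delta> then \<Psi> (g v, f (\<o>, x')) else 0) + D * (if dist \<o> v < \<delta> then 1 else 0) \<partial>haar)"
   by (rule integral_mono) (use if_integrable[OF \<Psi>] ball_integrable le in auto)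
  also have "\<dots> = (\<integral>v. (if dist \<o> v < \<delta> then \<Psi> (g v, f (\<o>, x')) else 0) \<partial>haar) + D * ball_mass TYPE('m) \<delta>"
   using if_integrable[OF \<Psi>] ball_integrable by (simp add: ball_mass_eq)
  finally have "avg_op \<delta> \<Psi> (\<o>, x) \<le> ((\<integral>v. (if dist \<o> v < \<delta> then \<Psi> (g v, f (\<o>, x')) else 0) \<partial>haar) + D * ball_mass TYPE('m) \<delta>) / ball_mass TYPE('m) \<delta>"
   unfolding avg_op_def using ball_mass_pos[OF \<delta>, where 'm = 'm] by (simp add: divide_right_mono)
  also have "\<dots> = avg_op \<delta> \<Psi> (\<o>, x') + D"
   unfolding avg_op_def using ball_mass_pos[OF \<delta>, where 'm = 'm] by (simp add: add_divide_distrib)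
  finally show ?thesis by (simp add: D_def)
 qed
 show ?thesis using one[of x x'] one[of x' x] by (simp add: abs_le_iff dist_commute)
qed

text \<open>A translation by \<open>y\<close> in the cube lifts through one step of \<open>g\<close>
  to a displacement of at most \<open>CARD('m) / \<sigma>\<close>, so it maps the ball of radius
  \<open>\<delta> - CARD('m) / \<sigma>\<close> into the \<delta>-ball. Averaging over
  \<open>y\<close> turns the values after \<open>g\<close> into a Haar mean, at the price of the
  Jacobian bound.\<close>

lemma ball_avg_ge:
 assumes [measurable]: "h \<in> borel_measurable borel" and h: "\<And>\<o>. 0 \<le> h \<o>" "\<And>\<o>. h \<o> \<le> B"
 shows "ball_mass TYPE('m) (\<delta> - CARD('m) / \<sigma>) * (\<integral>\<o>. h \<o> \<partial>haar)
  \<le> exp (a * CARD('m)) * (\<integral>v. (if dist u v < \<delta> then h (g v) else 0) \<partial>haar)"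
proof -
 define r where "r = \<delta> - CARD('m) / \<sigma>"
 define E where "E = exp (a * CARD('m))"
 define X where "X = (\<integral>v. (if dist u v < \<delta> then h (g v) else 0) \<partial>haar)"
 have X0: "0 \<le> X" unfolding X_def using h by (intro integral_nonneg_AE) auto
 have B0: "0 \<le> B" using h order.trans by blast
 have hb: "\<bar>h \<o>\<bar> \<le> B" for \<o> using h by (simp add: abs_of_nonneg)
 have shift: "(\<integral>v. (if dist u v < r then h (tshift y (g v)) else 0) \<partial>haar) \<le> E * X" if y: "norm y \<le> CARD('m)" for y
 proof -
  obtain \<theta> where \<theta>: "\<theta> \<in> borel_measurable borel" "\<And>\<o>. (g ^^ 1) (\<theta> \<o>) = tshift y ((g ^^ 1) \<o>)"
   "\<And>\<o> j. j \<le> 1 ==> dist ((g ^^ j) (\<theta> \<o>)) ((g ^^ j) \<o>) \<le> norm y / \<sigma> ^ (1 - j)"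
   "\<And>(\<phi> :: 'm torus => real) B. \<phi> \<in> borel_measurable borel ==> (\<And>\<o>. 0 \<le> \<phi> \<o>) ==> (\<And>\<o>. \<phi> \<o> \<le> B) ==>
    (\<integral>\<o>. \<phi> (\<theta> \<o>) \<partial>haar) \<le> exp (a * norm y) * (\<integral>\<o>. \<phi> \<o> \<partial>haar)"
   by (rule rotE[of 1 y]) blast
  note [measurable] = \<theta>(1)
  have "(\<integral>v. (if dist u v < r then h (tshift y (g v)) else 0) \<partial>haar)
    \<le> (\<integral>v. (if dist u (\<theta> v) < \<delta> then h (g (\<theta> v)) else 0) \<partial>haar)"
  proof (rule integral_mono)
   show "integrable haar (\<lambda>v. if dist u v < r then h (tshift y (g v)) else 0)"
    "integrable haar (\<lambda>v. if dist u (\<theta> v) < \<delta> then h (g (\<theta> v)) else 0)"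
    by (rule prob_integrable_bounded[OF haar.prob_space_axioms, of _ B]; use hb B0 in auto)+
   fix v
   have "dist (\<theta> v) v \<le> norm y / \<sigma>" using \<theta>(3)[of 0 v] by simp
   also have "\<dots> \<le> CARD('m) / \<sigma>" using y sigma_gt_1 by (intro divide_right_mono) auto
   finally have "dist u (\<theta> v) < \<delta>" if "dist u v < r"
    using that dist_triangle[of u "\<theta> v" v] by (simp add: r_def dist_commute)
   then show "(if dist u v < r then h (tshift y (g v)) else 0) \<le> (if dist u (\<theta> v) < \<delta> then h (g (\<theta> v)) else 0)"
    using \<theta>(2)[of v] h by auto
  qed
  also have "\<dots> \<le> exp (a * norm y) * X"
   unfolding X_def by (rule \<theta>(4)[of "\<lambda>v. if dist u v < \<delta> then h (g v) else 0" B]) (use h B0 in auto)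
  also have "\<dots> \<le> E * X"
   unfolding E_def using y a_nonneg X0 by (intro mult_right_mono) (auto simp: mult_left_mono)
  finally show ?thesis .
 qed
 interpret uc: prob_space "ucube :: (real ^ 'm) measure" by (rule prob_ucube)
 have i: "integrable ucube (\<lambda>y. \<integral>v. (if dist u v < r then h (tshift y (g v)) else 0) \<partial>haar)"
 proof (rule prob_integrable_bounded[OF prob_ucube, of _ B])
  show "(\<lambda>y. \<integral>v. (if dist u v < r then h (tshift y (g v)) else 0) \<partial>haar) \<in> borel_measurable ucube"
   by measurable
  fix y :: "real ^ 'm"
  have "integrable haar (\<lambda>v. if dist u v < r then h (tshift y (g v)) else 0)"
   by (rule prob_integrable_bounded[OF haar.prob_space_axioms, of _ B]) (use hb B0 in auto)
  then have "(\<integral>v. (if dist u v < r then h (tshift y (g v)) else 0) \<partial>haar) \<le> B"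
   by (rule prob_integral_le_const[OF haar.prob_space_axioms]) (use h B0 in auto)
  moreover have "0 \<le> (\<integral>v. (if dist u v < r then h (tshift y (g v)) else 0) \<partial>haar)"
   by (rule integral_nonneg_AE) (use h in auto)
  ultimately show "\<bar>\<integral>v. (if dist u v < r then h (tshift y (g v)) else 0) \<partial>haar\<bar> \<le> B" by simp
 qed
 have "ball_mass TYPE('m) r * (\<integral>\<o>. h \<o> \<partial>haar) = (\<integral>v. (if dist u v < r then 1 else 0) * (\<integral>\<o>. h \<o> \<partial>haar) \<partial>haar)"
  by (simp add: ball_mass_eq)
 also have "\<dots> = (\<integral>v. \<integral>y. (if dist u v < r then h (tshift y (g v)) else 0) \<partial>ucube \<partial>haar)"
  by (rule Bochner_Integration.integral_cong) (auto simp: integral_ucube_tshift h)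
 also have "\<dots> = (\<integral>y. \<integral>v. (if dist u v < r then h (tshift y (g v)) else 0) \<partial>haar \<partial>ucube)"
  by (rule prob_Fubini_bounded[OF haar.prob_space_axioms prob_ucube, of _ B]) (use hb B0 in auto)
 also have "\<dots> \<le> (\<integral>y. E * X \<partial>(ucube :: (real ^ 'm) measure))"
 proof (rule integral_mono_AE[OF i])
  show "AE y in ucube. (\<integral>v. (if dist u v < r then h (tshift y (g v)) else 0) \<partial>haar) \<le> E * X"
   using AE_ucube by eventually_elim (rule shift)
 qed auto
 also have "\<dots> = E * X" using uc.prob_space by simp
 finally show ?thesis by (simp add: r_def E_def X_def)
qed

text \<open>The ball average is an average over translations shorter than \<delta>. Regularity,
  applied to \<Psi> composed with \<open>F\<close>, absorbs the translation of the base point; the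
  term \<open>L * \<Lambda> * \<delta>\<close> repairs the fibre coordinate, which
  \<open>avg_op\<close> computes at the untranslated point.\<close>

lemma avg_op_integral_le:
 assumes reg: "regular C \<nu>" and C: "C \<ge> 0" and \<Psi>m [measurable]: "\<Psi> \<in> borel_measurable borel" and \<Psi>01: "\<And>p. 0 \<le> \<Psi> p" "\<And>p. \<Psi> p \<le> 1"
  and lip: "\<And>\<o> x x'. \<bar>\<Psi> (\<o>, x) - \<Psi> (\<o>, x')\<bar> \<le> \<Lambda> * dist x x'"
  and \<Lambda>: "\<Lambda> \<ge> 0" and \<delta>: "0 < \<delta>" "\<delta> \<le> 1"
 shows "(\<integral>p. avg_op \<delta> \<Psi> p \<partial>\<nu>) \<le> (\<integral>p. \<Psi> (F p) \<partial>\<nu>) + (C * (1 + L * \<Lambda>) + L * \<Lambda>) * \<delta>"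
proof -
 have \<nu>: "\<nu> \<in> prob_measures" using reg by (simp add: regular_def)
 note P = prob_measuresD(1)[OF \<nu>]
 interpret prob_space \<nu> by (rule P)
 note [measurable_cong] = prob_measuresD(2)[OF \<nu>]
 define e where "e = (C * (1 + L * \<Lambda>) + L * \<Lambda>) * \<delta>"
 define \<beta> where "\<beta> = ball_mass TYPE('m) \<delta>"
 have \<beta>: "\<beta> > 0" using ball_mass_pos[OF \<delta>(1)] by (simp add: \<beta>_def)
 define \<Phi> where "\<Phi> = (\<lambda>p. \<Psi> (F p))"
 have \<Phi>m [measurable]: "\<Phi> \<in> borel_measurable borel" unfolding \<Phi>_def by measurable
 have \<Phi>01: "0 \<le> \<Phi> p" "\<Phi> p \<le> 1" for p using \<Psi>01 by (auto simp: \<Phi>_def)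
 define X where "X = (\<integral>p. \<Phi> p \<partial>\<nu>)"
 have X0: "0 \<le> X" unfolding X_def using \<Phi>01 by (intro integral_nonneg_AE) auto
 have e0: "0 \<le> e" unfolding e_def using \<Lambda> L_pos \<delta> C by simp
 have Lip\<Phi>: "\<bar>\<Phi> (\<o>, x) - \<Phi> (\<o>, x')\<bar> \<le> L * \<Lambda> * dist x x'" for \<o> x x'
 proof -
  have "\<bar>\<Phi> (\<o>, x) - \<Phi> (\<o>, x')\<bar> \<le> \<Lambda> * dist (f (\<o>, x)) (f (\<o>, x'))"
   unfolding \<Phi>_def skew_product_def using lip by simp
  also have "\<dots> \<le> \<Lambda> * (L * dist x x')" by (intro mult_left_mono f_lip_snd \<Lambda>)
  finally show ?thesis by (simp add: mult_ac)
 qed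
 have inner: "(\<integral>p. \<Psi> (g (tshift w (fst p)), f p) \<partial>\<nu>) \<le> X + e" if w: "torus_norm w < \<delta>" for w
 proof -
  obtain w' where w': "tshift w = tshift w'" "norm w' = torus_norm w" by (rule torus_norm_representative)
  have nw: "norm w' \<le> \<delta>" using w w'(2) by simp
  have "(\<integral>p. \<Psi> (g (tshift w (fst p)), f p) \<partial>\<nu>) \<le> (\<integral>p. \<Phi> (tshift w' (fst p), snd p) + L * \<Lambda> * \<delta> \<partial>\<nu>)"
  proof (rule integral_mono)
   show "integrable \<nu> (\<lambda>p. \<Psi> (g (tshift w (fst p)), f p))"
    by (rule prob_integrable_bounded[OF P, of _ 1]) (use \<Psi>01 in "auto simp: abs_of_nonneg")
   have "integrable \<nu> (\<lambda>p. \<Phi> (tshift w' (fst p), snd p))"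
    by (rule prob_integrable_bounded[OF P, of _ 1]) (use \<Phi>01 in "auto simp: abs_of_nonneg")
   then show "integrable \<nu> (\<lambda>p. \<Phi> (tshift w' (fst p), snd p) + L * \<Lambda> * \<delta>)" by simp
   fix p :: "'m torus \<times> 'n torus"
   define q where "q = (tshift w' (fst p), snd p)"
   have "dist (f p) (f q) \<le> L * dist (fst p) (tshift w' (fst p))"
    using f_lip_le[of p q] by (simp add: q_def)
   also have "\<dots> \<le> L * \<delta>"
    using dist_tshift_le[of w' "fst p"] nw L_pos by (intro mult_left_mono) (auto simp: dist_commute)
   finally have "\<Lambda> * dist (f p) (f q) \<le> \<Lambda> * (L * \<delta>)" by (intro mult_left_mono \<Lambda>)
   moreover have "\<Phi> q = \<Psi> (g (tshift w (fst p)), f q)" by (simp add: \<Phi>_def skew_product_def q_def w'(1))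
   moreover have "\<bar>\<Psi> (g (tshift w (fst p)), f p) - \<Psi> (g (tshift w (fst p)), f q)\<bar> \<le> \<Lambda> * dist (f p) (f q)"
    by (rule lip)
   ultimately show "\<Psi> (g (tshift w (fst p)), f p) \<le> \<Phi> (tshift w' (fst p), snd p) + L * \<Lambda> * \<delta>"
    unfolding q_def[symmetric] by (simp add: abs_le_iff mult_ac)
  qed
  also have "\<dots> = (\<integral>p. \<Phi> (tshift w' (fst p), snd p) \<partial>\<nu>) + L * \<Lambda> * \<delta>"
  proof -
   have "integrable \<nu> (\<lambda>p. \<Phi> (tshift w' (fst p), snd p))"
    by (rule prob_integrable_bounded[OF P, of _ 1]) (use \<Phi>01 in "auto simp: abs_of_nonneg")
   then show ?thesis using prob_space by simp
  qed
  also have "(\<integral>p. \<Phi> (tshift w' (fst p), snd p) \<partial>\<nu>) \<le> X + C * (1 + L * \<Lambda>) * norm w'"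
   using reg \<Phi>m \<Phi>01 Lip\<Phi> \<Lambda> L_pos nw \<delta>(2) unfolding regular_def X_def by (simp del: split_paired_All)
  also have "C * (1 + L * \<Lambda>) * norm w' \<le> C * (1 + L * \<Lambda>) * \<delta>"
   using C \<Lambda> L_pos nw by (intro mult_left_mono) auto
  finally show ?thesis by (simp add: e_def algebra_simps)
 qed
 have "(\<integral>p. avg_op \<delta> \<Psi> p \<partial>\<nu>)
   = (\<integral>p. (\<integral>w. (if torus_norm w < \<delta> then \<Psi> (g (tshift w (fst p)), f p) else 0) \<partial>ucube) / \<beta> \<partial>\<nu>)"
 proof (rule Bochner_Integration.integral_cong[OF refl])
  fix p :: "'m torus \<times> 'n torus"
  have "(\<integral>w. (if dist (fst p) (tshift w (fst p)) < \<delta> then \<Psi> (g (tshift w (fst p)), f p) else 0) \<partial>ucube)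
    = (\<integral>v. (if dist (fst p) v < \<delta> then \<Psi> (g v, f p) else 0) \<partial>haar)"
   by (rule integral_ucube_tshift[of "\<lambda>v. if dist (fst p) v < \<delta> then \<Psi> (g v, f p) else 0" "fst p"])
    (use \<Psi>01 in auto)
  then show "avg_op \<delta> \<Psi> p = (\<integral>w. (if torus_norm w < \<delta> then \<Psi> (g (tshift w (fst p)), f p) else 0) \<partial>ucube) / \<beta>"
   by (simp add: avg_op_def \<beta>_def torus_norm_eq)
 qed
 also have "\<dots> = (\<integral>p. \<integral>w. (if torus_norm w < \<delta> then \<Psi> (g (tshift w (fst p)), f p) else 0) \<partial>ucube \<partial>\<nu>) / \<beta>"
  by simp
 also have "(\<integral>p. \<integral>w. (if torus_norm w < \<delta> then \<Psi> (g (tshift w (fst p)), f p) else 0) \<partial>ucube \<partial>\<nu>)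
   = (\<integral>w. \<integral>p. (if torus_norm w < \<delta> then \<Psi> (g (tshift w (fst p)), f p) else 0) \<partial>\<nu> \<partial>ucube)"
  by (rule prob_Fubini_bounded[OF P prob_ucube, of _ 1]) (use \<Psi>01 in "auto simp: abs_of_nonneg")
 also have "\<dots> \<le> (\<integral>w. (X + e) * (if torus_norm w < \<delta> then 1 else 0) \<partial>(ucube :: (real ^ 'm) measure))"
 proof (rule integral_mono)
  show "integrable ucube (\<lambda>w. \<integral>p. (if torus_norm w < \<delta> then \<Psi> (g (tshift w (fst p)), f p) else 0) \<partial>\<nu>)"
  proof (rule prob_integrable_bounded[OF prob_ucube, of _ "X + e"])
   show "(\<lambda>w. \<integral>p. (if torus_norm w < \<delta> then \<Psi> (g (tshift w (fst p)), f p) else 0) \<partial>\<nu>) \<in> borel_measurable ucube"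
    by measurable
   fix w :: "real ^ 'm"
   have "0 \<le> (\<integral>p. \<Psi> (g (tshift w (fst p)), f p) \<partial>\<nu>)" using \<Psi>01 by (intro integral_nonneg_AE) auto
   then show "\<bar>\<integral>p. (if torus_norm w < \<delta> then \<Psi> (g (tshift w (fst p)), f p) else 0) \<partial>\<nu>\<bar> \<le> X + e"
    using inner[of w] X0 e0 by (cases "torus_norm w < \<delta>") auto
  qed
  show "integrable ucube (\<lambda>w :: real ^ 'm. (X + e) * (if torus_norm w < \<delta> then 1 else 0))"
   by (intro integrable_mult_right prob_integrable_bounded[OF prob_ucube, of _ 1]) auto
  show "(\<integral>p. (if torus_norm w < \<delta> then \<Psi> (g (tshift w (fst p)), f p) else 0) \<partial>\<nu>)
    \<le> (X + e) * (if torus_norm w < \<delta> then 1 else 0)" for w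
   using inner[of w] by auto
 qed
 also have "\<dots> = (X + e) * \<beta>"
 proof -
  have "(\<integral>w. (if torus_norm w < \<delta> then 1 else 0 :: real) \<partial>(ucube :: (real ^ 'm) measure)) = \<beta>"
   using integral_ucube_tshift[of "\<lambda>v. if dist (tproj 0 :: 'm torus) v < \<delta> then 1 else 0" "tproj 0"]
   by (simp add: torus_norm_eq \<beta>_def ball_mass_eq)
  then show ?thesis by simp
 qed
 finally have "(\<integral>p. avg_op \<delta> \<Psi> p \<partial>\<nu>) \<le> (X + e) * \<beta> / \<beta>" using \<beta> by (simp add: divide_right_mono)
 then show ?thesis using \<beta> by (simp add: X_def \<Phi>_def e_def)
qed

end

section \<open>Contraction of the averaged operator\<close>

lemma prob_integral_affine:
 fixes h :: "'a => real"
 assumes "prob_space M" "integrable M h"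
 shows "(\<integral>x. \<alpha> * h x + \<gamma> \<partial>M) = \<alpha> * (\<integral>x. h x \<partial>M) + \<gamma>"
proof -
 interpret prob_space M by fact
 show ?thesis using assms(2) prob_space by simp
qed

definition unif01 :: "real measure" where "unif01 = density lborel (indicator {0..1})"

lemma sets_unif01 [simp, measurable_cong]: "sets unif01 = sets borel" by (simp add: unif01_def)

lemma prob_unif01: "prob_space unif01"
 by (rule prob_spaceI) (simp add: unif01_def emeasure_density)

lemma integral_unif01_less:
 assumes "0 \<le> s" "s \<le> 1" shows "(\<integral>t. (if t < s then 1 else 0) \<partial>unif01) = (s :: real)"
proof -
 have "(\<integral>t. (if t < s then 1 else 0) \<partial>unif01) = (\<integral>t. indicator {0..1} t * (if t < s then 1 else 0 :: real) \<partial>lborel)"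
  using integral_density[of "\<lambda>t. if t < s then 1 else 0 :: real" lborel "indicator {0..1}"]
  by (simp add: unif01_def ennreal_indicator)
 also have "\<dots> = (\<integral>t. indicator {0..<s} t \<partial>lborel)"
  by (rule Bochner_Integration.integral_cong) (use assms in "auto simp: indicator_def")
 also have "\<dots> = s" using assms by simp
 finally show ?thesis .
qed

lemma tv_dist_le_1:
 assumes "\<mu> \<in> prob_measures" "\<nu> \<in> prob_measures" shows "tv_dist \<mu> \<nu> \<le> 1"
  and "A \<in> sets borel ==> \<bar>measure \<mu> A - measure \<nu> A\<bar> \<le> tv_dist \<mu> \<nu>"
proof -
 have le: "\<bar>measure \<mu> A - measure \<nu> A\<bar> \<le> 1" for A
  using prob_space.prob_le_1[OF prob_measuresD(1)[OF assms(1)], of A] prob_space.prob_le_1[OF prob_measuresD(1)[OF assms(2)], of A]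
   measure_nonneg[of \<mu> A] measure_nonneg[of \<nu> A] by linarith
 show "tv_dist \<mu> \<nu> \<le> 1" unfolding tv_dist_def
  by (rule cSUP_least) (use le sets.empty_sets in blast)+
 show "A \<in> sets borel ==> \<bar>measure \<mu> A - measure \<nu> A\<bar> \<le> tv_dist \<mu> \<nu>"
  unfolding tv_dist_def by (rule cSUP_upper) (use le in "auto intro!: bdd_aboveI[of _ 1]")
qed

text \<open>Layer-cake representation.\<close>

lemma integral_diff_le_tv_dist:
 fixes \<psi> :: "'b::topological_space => real"
 assumes \<mu>: "\<mu> \<in> prob_measures" and \<nu>: "\<nu> \<in> prob_measures" and \<psi>: "\<psi> \<in> borel_measurable borel"
  and b: "\<And>x. lo \<le> \<psi> x" "\<And>x. \<psi> x \<le> lo + s" and s: "s > 0"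
 shows "\<bar>(\<integral>x. \<psi> x \<partial>\<mu>) - (\<integral>x. \<psi> x \<partial>\<nu>)\<bar> \<le> s * tv_dist \<mu> \<nu>"
proof -
 define h where "h = (\<lambda>x. (\<psi> x - lo) / s)"
 have hm: "h \<in> borel_measurable borel" unfolding h_def using \<psi> by measurable
 have h01: "0 \<le> h x" "h x \<le> 1" for x using b(1)[of x] b(2)[of x] s by (auto simp: h_def)
 have \<psi>h: "\<psi> x = s * h x + lo" for x using s by (simp add: h_def)
 have layer: "(\<integral>x. h x \<partial>\<kappa>) = (\<integral>t. measure \<kappa> {x. t < h x} \<partial>unif01)"
  "(\<lambda>t. measure \<kappa> {x. t < h x}) \<in> borel_measurable borel"
  "(\<integral>x. \<psi> x \<partial>\<kappa>) = s * (\<integral>x. h x \<partial>\<kappa>) + lo" if \<kappa>: "\<kappa> \<in> prob_measures" for \<kappa>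
 proof -
  interpret prob_space \<kappa> by (rule prob_measuresD(1)[OF \<kappa>])
  note [measurable_cong] = prob_measuresD(2)[OF \<kappa>]
  note [measurable] = hm
  have e: "(\<integral>x. (if t < h x then 1 else 0) \<partial>\<kappa>) = measure \<kappa> {x. t < h x}" for t
  proof -
   have "(\<integral>x. (if t < h x then 1 else 0) \<partial>\<kappa>) = (\<integral>x. indicator {x. t < h x} x \<partial>\<kappa>)"
    by (rule Bochner_Integration.integral_cong) (auto simp: indicator_def)
   also have "\<dots> = measure \<kappa> ({x. t < h x} \<inter> space \<kappa>)" by simp
   also have "\<dots> = measure \<kappa> {x. t < h x}" by (simp only: space_prob_measures[OF \<kappa>] Int_UNIV_right)
   finally show ?thesis .
  qed
  have "(\<integral>x. h x \<partial>\<kappa>) = (\<integral>x. \<integral>t. (if t < h x then 1 else 0) \<partial>unif01 \<partial>\<kappa>)"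
   by (simp add: integral_unif01_less h01)
  also have "\<dots> = (\<integral>t. \<integral>x. (if t < h x then 1 else 0) \<partial>\<kappa> \<partial>unif01)"
   by (rule prob_Fubini_bounded[OF prob_space_axioms prob_unif01, of _ 1]) auto
  also have "\<dots> = (\<integral>t. measure \<kappa> {x. t < h x} \<partial>unif01)" by (simp only: e)
  finally show "(\<integral>x. h x \<partial>\<kappa>) = (\<integral>t. measure \<kappa> {x. t < h x} \<partial>unif01)" .
  have "(\<lambda>t. \<integral>x. (if t < h x then 1 else 0 :: real) \<partial>\<kappa>) \<in> borel_measurable borel" by measurable
  then show "(\<lambda>t. measure \<kappa> {x. t < h x}) \<in> borel_measurable borel" by (simp add: e)
  have "integrable \<kappa> h" by (rule prob_measures_integrable[OF \<kappa> hm, where B = 1]) (use h01 in "simp add: abs_of_nonneg")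
  then show "(\<integral>x. \<psi> x \<partial>\<kappa>) = s * (\<integral>x. h x \<partial>\<kappa>) + lo" by (simp add: \<psi>h prob_space)
 qed
 have i: "integrable unif01 (\<lambda>t. measure \<kappa> {x. t < h x})" if "\<kappa> \<in> prob_measures" for \<kappa>
  by (rule prob_integrable_bounded[OF prob_unif01, of _ 1])
   (use layer(2)[OF that] prob_space.prob_le_1[OF prob_measuresD(1)[OF that]] in "auto cong: measurable_cong_sets")
 have "\<bar>(\<integral>x. h x \<partial>\<mu>) - (\<integral>x. h x \<partial>\<nu>)\<bar> = \<bar>\<integral>t. measure \<mu> {x. t < h x} - measure \<nu> {x. t < h x} \<partial>unif01\<bar>"
  using i[OF \<mu>] i[OF \<nu>] by (simp add: layer(1)[OF \<mu>] layer(1)[OF \<nu>])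
 also have "\<dots> \<le> (\<integral>t. \<bar>measure \<mu> {x. t < h x} - measure \<nu> {x. t < h x}\<bar> \<partial>unif01)"
  by (rule integral_abs_bound)
 also have "\<dots> \<le> tv_dist \<mu> \<nu>"
 proof (rule prob_integral_le_const[OF prob_unif01])
  show "\<bar>measure \<mu> {x. t < h x} - measure \<nu> {x. t < h x}\<bar> \<le> tv_dist \<mu> \<nu>" for t
  proof (rule tv_dist_le_1(2)[OF \<mu> \<nu>])
   show "{x. t < h x} \<in> sets borel" using hm by measurable
  qed
 qed (use i[OF \<mu>] i[OF \<nu>] in auto)
 finally have "s * \<bar>(\<integral>x. h x \<partial>\<mu>) - (\<integral>x. h x \<partial>\<nu>)\<bar> \<le> s * tv_dist \<mu> \<nu>" using s by simp
 moreover have "\<bar>(\<integral>x. \<psi> x \<partial>\<mu>) - (\<integral>x. \<psi> x \<partial>\<nu>)\<bar> = s * \<bar>(\<integral>x. h x \<partial>\<mu>) - (\<integral>x. h x \<partial>\<nu>)\<bar>"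
  using s by (simp add: layer(3)[OF \<mu>] layer(3)[OF \<nu>] abs_mult right_diff_distrib[symmetric])
 ultimately show ?thesis by simp
qed

lemma return_prob_measures: "return borel y \<in> prob_measures"
 by (simp add: prob_measures_def prob_space_return)

section \<open>Following the dynamics by \<open>avg_op\<close>\<close>

context skew_system
begin

text \<open>The opposite inequality is the previous estimate for \<open>1 - \<Psi>\<close>.\<close>

lemma avg_op_error:
 assumes reg: "regular C \<nu>" and C: "C \<ge> 0" and \<Psi>m: "\<Psi> \<in> borel_measurable borel" and \<Psi>01: "\<And>p. 0 \<le> \<Psi> p" "\<And>p. \<Psi> p \<le> 1"
  and lip: "\<And>\<o> x x'. \<bar>\<Psi> (\<o>, x) - \<Psi> (\<o>, x')\<bar> \<le> \<Lambda> * dist x x'"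
  and \<Lambda>: "\<Lambda> \<ge> 0" and \<delta>: "0 < \<delta>" "\<delta> \<le> 1"
 shows "\<bar>(\<integral>p. \<Psi> (F p) \<partial>\<nu>) - (\<integral>p. avg_op \<delta> \<Psi> p \<partial>\<nu>)\<bar> \<le> (C * (1 + L * \<Lambda>) + L * \<Lambda>) * \<delta>"
proof -
 have \<nu>: "\<nu> \<in> prob_measures" using reg by (simp add: regular_def)
 interpret prob_space \<nu> by (rule prob_measuresD(1)[OF \<nu>])
 have bb: "bounded_borel \<Psi>" by (rule bounded_borelI[OF \<Psi>m \<Psi>01])
 define \<Psi>' where "\<Psi>' = (\<lambda>p. (- 1) * \<Psi> p + 1)"
 have m': "\<Psi>' \<in> borel_measurable borel" unfolding \<Psi>'_def using \<Psi>m by measurable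
 have b': "0 \<le> \<Psi>' p" "\<Psi>' p \<le> 1" for p using \<Psi>01[of p] by (auto simp: \<Psi>'_def)
 have lip': "\<bar>\<Psi>' (\<o>, x) - \<Psi>' (\<o>, x')\<bar> \<le> \<Lambda> * dist x x'" for \<o> x x'
  using lip[of \<o> x x'] by (simp add: \<Psi>'_def abs_minus_commute)
 have "integrable \<nu> (avg_op \<delta> \<Psi>)"
  by (rule prob_measures_integrable[OF \<nu> avg_op_measurable[OF bb], where B = 1])
   (use avg_op_bounds[OF \<Psi>m \<Psi>01 \<delta>(1)] in "simp add: abs_of_nonneg")
 then have 1: "(\<integral>p. avg_op \<delta> \<Psi>' p \<partial>\<nu>) = 1 - (\<integral>p. avg_op \<delta> \<Psi> p \<partial>\<nu>)"
  unfolding \<Psi>'_def avg_op_affine[OF bb \<delta>(1)] by (simp add: prob_space)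
 have "integrable \<nu> (\<lambda>p. \<Psi> (F p))"
  by (rule prob_measures_integrable[OF \<nu> measurable_compose[OF F_meas \<Psi>m], where B = 1])
   (use \<Psi>01 in "simp add: abs_of_nonneg")
 then have 2: "(\<integral>p. \<Psi>' (F p) \<partial>\<nu>) = 1 - (\<integral>p. \<Psi> (F p) \<partial>\<nu>)"
  unfolding \<Psi>'_def by (simp add: prob_space)
 show ?thesis
  using avg_op_integral_le[OF reg C \<Psi>m \<Psi>01 lip \<Lambda> \<delta>] avg_op_integral_le[OF reg C m' b' lip' \<Lambda> \<delta>]
  unfolding 1 2 by (simp add: abs_le_iff)
qed

text \<open>One iterate of \<open>F\<close> is exchanged for \<open>avg_op\<close> at a time. The
  error is measured against a different push-forward of \<mu> each time, so regularity must hold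
  along the whole orbit; \<open>\<Lambda>s\<close> dominates the fibre Lipschitz constants of all
  intermediate functions.\<close>

lemma avg_op_telescope:
 assumes \<mu>: "\<mu> \<in> prob_measures" and reg: "\<And>k. regular C (push_iter F k \<mu>)" and C: "C \<ge> 0"
  and \<delta>: "0 < \<delta>" "\<delta> \<le> 1"
  and \<Psi>: "\<Psi> \<in> borel_measurable borel" "\<And>p. 0 \<le> \<Psi> p" "\<And>p. \<Psi> p \<le> 1"
  and lip: "\<And>\<o> x x'. \<bar>\<Psi> (\<o>, x) - \<Psi> (\<o>, x')\<bar> \<le> \<Lambda> * dist x x'"
  and \<Lambda>: "\<Lambda> \<ge> 0" "\<Lambda> * max 1 L ^ T \<le> \<Lambda>s"
 shows "\<bar>(\<integral>p. \<Psi> p \<partial>push_iter F (k + T) \<mu>) - (\<integral>p. (avg_op \<delta> ^^ T) \<Psi> p \<partial>push_iter F k \<mu>)\<bar>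
  \<le> real T * ((C * (1 + L * \<Lambda>s) + L * \<Lambda>s) * \<delta>)"
 using \<Psi> lip \<Lambda>
proof (induction T arbitrary: \<Psi> \<Lambda>)
 case (Suc T)
 note bb = bounded_borelI[OF Suc.prems(1-3)]
 define M where "M = max 1 L"
 have M: "1 \<le> M" "L \<le> M" by (auto simp: M_def)
 define E where "E = (C * (1 + L * \<Lambda>s) + L * \<Lambda>s) * \<delta>"
 have IH: "\<bar>(\<integral>p. avg_op \<delta> \<Psi> p \<partial>push_iter F (k + T) \<mu>) - (\<integral>p. (avg_op \<delta> ^^ T) (avg_op \<delta> \<Psi>) p \<partial>push_iter F k \<mu>)\<bar> \<le> real T * E"
  unfolding E_def
 proof (rule Suc.IH[of "avg_op \<delta> \<Psi>" "L * \<Lambda>"])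
  show "L * \<Lambda> * max 1 L ^ T \<le> \<Lambda>s"
  proof -
   have "L * \<Lambda> * M ^ T \<le> M * \<Lambda> * M ^ T"
    using M Suc.prems(5) by (intro mult_right_mono) auto
   also have "\<dots> = \<Lambda> * M ^ Suc T" by simp
   finally show ?thesis using Suc.prems(6) by (simp add: M_def)
  qed
 qed (use avg_op_measurable[OF bb] avg_op_bounds[OF Suc.prems(1-3) \<delta>(1)]
   avg_op_lipschitz[OF bb Suc.prems(4,5) \<delta>(1)] Suc.prems(5) L_pos in auto)
 have Fm: "(\<integral>p. \<Psi> p \<partial>push_iter F (k + Suc T) \<mu>) = (\<integral>p. \<Psi> (F p) \<partial>push_iter F (k + T) \<mu>)"
 proof -
  have "push_iter F (k + Suc T) \<mu> = distr (push_iter F (k + T) \<mu>) borel F" by (simp add: push_iter_def)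
  then show ?thesis
   using integral_distr_prob[OF push_iter_eq(3)[OF F_meas \<mu>] F_meas Suc.prems(1)] by simp
 qed
 have "\<Lambda> \<le> \<Lambda>s"
 proof -
  have "\<Lambda> * 1 \<le> \<Lambda> * M ^ Suc T" using M Suc.prems(5) by (intro mult_left_mono one_le_power) auto
  then show ?thesis using Suc.prems(6) by (simp add: M_def)
 qed
 then have "L * \<Lambda> \<le> L * \<Lambda>s" using L_pos by simp
 then have E': "(C * (1 + L * \<Lambda>) + L * \<Lambda>) * \<delta> \<le> E"
 proof -
  assume le: "L * \<Lambda> \<le> L * \<Lambda>s"
  then have "C * (1 + L * \<Lambda>) \<le> C * (1 + L * \<Lambda>s)" using C by (intro mult_left_mono) auto
  then show ?thesis unfolding E_def using le \<delta> by (intro mult_right_mono) auto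
 qed
 have "\<bar>(\<integral>p. \<Psi> (F p) \<partial>push_iter F (k + T) \<mu>) - (\<integral>p. avg_op \<delta> \<Psi> p \<partial>push_iter F (k + T) \<mu>)\<bar> \<le> E"
  by (rule order.trans[OF avg_op_error[OF reg C Suc.prems(1-5) \<delta>] E'])
 moreover have "(avg_op \<delta> ^^ Suc T) \<Psi> = (avg_op \<delta> ^^ T) (avg_op \<delta> \<Psi>)" by (simp add: funpow_swap1)
 ultimately show ?case using IH unfolding Fm E_def[symmetric] by (simp add: algebra_simps)
qed simp

text \<open>The dual of \<open>averaged_op\<close>: contraction is proved on test functions, where
  the comparison with \<open>avg_op\<close> is pointwise.\<close>

definition koop :: "('m torus => real) => ('n torus => real) => 'n torus => real" where
 "koop \<rho> \<psi> y = (\<integral>\<o>. \<rho> \<o> * \<psi> (f (\<o>, y)) \<partial>haar)"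

definition base_avg :: "('m torus \<times> 'n torus => real) => 'n torus => real" where
 "base_avg \<Psi> y = (\<integral>\<o>. \<Psi> (\<o>, y) \<partial>haar)"

lemma bounded_borel_section:
 fixes \<Psi> :: "'m torus \<times> 'n torus => real"
 assumes "bounded_borel \<Psi>" shows "integrable haar (\<lambda>\<o>. \<Psi> (\<o>, y))"
proof (rule bounded_borel_integrable[OF assms haar.prob_space_axioms])
 show "(\<lambda>\<o>. (\<o>, y)) \<in> borel_measurable (haar :: 'm torus measure)" by (simp add: borel_prod[symmetric])
qed

lemma base_avg_affine:
 "bounded_borel \<Psi> ==> base_avg (\<lambda>p. \<alpha> * \<Psi> p + \<gamma>) = (\<lambda>y. \<alpha> * base_avg \<Psi> y + \<gamma>)"
 unfolding base_avg_def
 by (rule ext) (rule prob_integral_affine[OF haar.prob_space_axioms bounded_borel_section])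

lemma base_avg_measurable: "bounded_borel \<Psi> ==> base_avg \<Psi> \<in> borel_measurable borel"
proof -
 assume "bounded_borel \<Psi>"
 note [measurable] = bounded_borelD[OF this]
 show ?thesis unfolding base_avg_def by measurable
qed

lemma base_avg_bounds:
 assumes "\<Psi> \<in> borel_measurable borel" "\<And>p. lo \<le> \<Psi> p" "\<And>p. \<Psi> p \<le> hi"
 shows "lo \<le> base_avg \<Psi> y" "base_avg \<Psi> y \<le> hi"
 unfolding base_avg_def using bounded_borel_section[OF bounded_borelI[OF assms]] assms(2,3)
  prob_integral_le_const[OF haar.prob_space_axioms] prob_integral_ge_const[OF haar.prob_space_axioms] by blast+

context
 fixes \<rho> assumes ac: "acip_density g \<rho>"
begin

lemma rho_measurable [measurable]: "\<rho> \<in> borel_measurable borel" and rho_nonneg: "0 \<le> \<rho> \<o>"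
 and prob_rho: "prob_space (density haar \<rho>)"
 using ac by (auto simp: acip_density_def)

lemma koop_eq:
 assumes [measurable]: "\<psi> \<in> borel_measurable borel"
 shows "koop \<rho> \<psi> y = (\<integral>\<o>. \<psi> (f (\<o>, y)) \<partial>density haar \<rho>)"
 unfolding koop_def using rho_nonneg by (subst integral_density) auto

lemma koop_integrable:
 "bounded_borel \<psi> ==> integrable (density haar \<rho>) (\<lambda>\<o>. \<psi> (f (\<o>, y)))"
 by (rule bounded_borel_integrable[OF _ prob_rho]) auto

lemma koop_affine:
 assumes "bounded_borel \<psi>"
 shows "koop \<rho> (\<lambda>y. \<alpha> * \<psi> y + \<gamma>) = (\<lambda>y. \<alpha> * koop \<rho> \<psi> y + \<gamma>)"
 by (rule ext) (simp only: koop_eq[OF bounded_borelD[OF assms]]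
  koop_eq[OF bounded_borelD[OF bounded_borel_affine[OF assms]]] prob_integral_affine[OF prob_rho koop_integrable[OF assms]])

lemma koop_measurable: "bounded_borel \<psi> ==> koop \<rho> \<psi> \<in> borel_measurable borel"
proof -
 assume "bounded_borel \<psi>"
 note [measurable] = bounded_borelD[OF this]
 show ?thesis unfolding koop_def by measurable
qed

lemma koop_bounds:
 assumes "\<psi> \<in> borel_measurable borel" "\<And>p. lo \<le> \<psi> p" "\<And>p. \<psi> p \<le> hi"
 shows "lo \<le> koop \<rho> \<psi> y" "koop \<rho> \<psi> y \<le> hi"
 unfolding koop_eq[OF assms(1)] using koop_integrable[OF bounded_borelI[OF assms]] assms(2,3)
  prob_integral_le_const[OF prob_rho] prob_integral_ge_const[OF prob_rho] by blast+

lemma funpow_koop_bounds: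
 assumes "\<psi> \<in> borel_measurable borel" "\<And>p. lo \<le> \<psi> p" "\<And>p. \<psi> p \<le> hi"
 shows "(koop \<rho> ^^ k) \<psi> \<in> borel_measurable borel" "lo \<le> (koop \<rho> ^^ k) \<psi> y" "(koop \<rho> ^^ k) \<psi> y \<le> hi"
proof -
 have "(koop \<rho> ^^ k) \<psi> \<in> borel_measurable borel \<and> (\<forall>y. lo \<le> (koop \<rho> ^^ k) \<psi> y \<and> (koop \<rho> ^^ k) \<psi> y \<le> hi)"
 proof (induction k)
  case (Suc k)
  then have *: "(koop \<rho> ^^ k) \<psi> \<in> borel_measurable borel" "\<And>y. lo \<le> (koop \<rho> ^^ k) \<psi> y" "\<And>y. (koop \<rho> ^^ k) \<psi> y \<le> hi"
   by blast+
  show ?case using koop_measurable[OF bounded_borelI[OF *]] koop_bounds[OF *] by simp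
 qed (use assms in auto)
 then show "(koop \<rho> ^^ k) \<psi> \<in> borel_measurable borel" "lo \<le> (koop \<rho> ^^ k) \<psi> y" "(koop \<rho> ^^ k) \<psi> y \<le> hi" by blast+
qed

lemma funpow_koop_affine:
 assumes "bounded_borel \<psi>"
 shows "(koop \<rho> ^^ k) (\<lambda>y. \<alpha> * \<psi> y + \<gamma>) = (\<lambda>y. \<alpha> * (koop \<rho> ^^ k) \<psi> y + \<gamma>)"
proof (induction k)
 case (Suc k)
 obtain B where "\<psi> \<in> borel_measurable borel" "\<And>x. - B \<le> \<psi> x" "\<And>x. \<psi> x \<le> B"
  using assms by (auto simp: bounded_borel_def abs_le_iff) (metis minus_le_iff)
 note * = funpow_koop_bounds[OF this, of k]
 show ?case using Suc koop_affine[OF bounded_borelI[OF *]] by simp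
qed simp

lemma funpow_avg_op_affine:
 assumes "bounded_borel \<Psi>" "\<delta> > 0"
 shows "(avg_op \<delta> ^^ k) (\<lambda>y. \<alpha> * \<Psi> y + \<gamma>) = (\<lambda>y. \<alpha> * (avg_op \<delta> ^^ k) \<Psi> y + \<gamma>)"
proof (induction k)
 case (Suc k)
 obtain B where B: "\<And>x. \<bar>\<Psi> x\<bar> \<le> B" using assms(1) unfolding bounded_borel_def by blast
 have "- B \<le> \<Psi> x" "\<Psi> x \<le> B" for x using B[of x] by linarith+
 note * = funpow_avg_op_bounds[OF bounded_borelD[OF assms(1)] this assms(2), of k]
 show ?case using Suc avg_op_affine[OF bounded_borelI[OF *] assms(2)] by simp
qed simp

section \<open>Duality and the use of (H)\<close>

lemma averaged_op_integral:
 assumes \<mu>: "\<mu> \<in> prob_measures"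
 shows "averaged_op \<rho> f \<mu> \<in> prob_measures"
  and "\<psi> \<in> borel_measurable borel ==> (\<And>x. 0 \<le> \<psi> x) ==> (\<And>x. \<psi> x \<le> B) ==>
   (\<integral>y. \<psi> y \<partial>averaged_op \<rho> f \<mu>) = (\<integral>x. koop \<rho> \<psi> x \<partial>\<mu>)"
proof -
 define \<nu> where "\<nu> = density haar \<rho>"
 have P: "prob_space \<nu>" using prob_rho by (simp add: \<nu>_def)
 have s\<nu> [measurable_cong]: "sets \<nu> = sets borel" and sp: "space \<nu> \<noteq> {}" by (simp_all add: \<nu>_def)
 note [measurable_cong] = prob_measuresD(2)[OF \<mu>]
 define K where "K = (\<lambda>\<o>. distr \<mu> borel (\<lambda>x. f (\<o>, x)))"
 have "\<mu> \<in> space (subprob_algebra borel)"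
  using \<mu> by (simp add: space_subprob_algebra prob_measures_def prob_space_imp_subprob_space)
 then have "(\<lambda>_. \<mu>) \<in> \<nu> \<rightarrow>\<^sub>M subprob_algebra borel" by (rule measurable_const)
 then have K: "K \<in> \<nu> \<rightarrow>\<^sub>M subprob_algebra borel"
  unfolding K_def by (rule measurable_distr2[rotated]) (simp, measurable)
 have eq: "averaged_op \<rho> f \<mu> = \<nu> \<bind> K"
  by (simp add: averaged_op_def fibre_average_def \<nu>_def K_def)
 have fm: "(\<lambda>x. f (\<o>, x)) \<in> borel_measurable \<mu>" for \<o> by measurable
 have nn: "(\<integral>\<^sup>+y. h y \<partial>averaged_op \<rho> f \<mu>) = (\<integral>\<^sup>+\<o>. \<integral>\<^sup>+x. h (f (\<o>, x)) \<partial>\<mu> \<partial>\<nu>)" if "h \<in> borel_measurable borel" for h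
  unfolding eq nn_integral_bind[OF that K] unfolding K_def by (simp add: nn_integral_distr fm that)
 have sets: "sets (averaged_op \<rho> f \<mu>) = sets borel"
  unfolding eq by (rule sets_bind[OF _ sp]) (simp add: K_def)
 have "emeasure (averaged_op \<rho> f \<mu>) (space (averaged_op \<rho> f \<mu>)) = (\<integral>\<^sup>+y. 1 \<partial>averaged_op \<rho> f \<mu>)" by simp
 also have "\<dots> = 1"
  unfolding nn[OF borel_measurable_const]
  by (simp add: prob_space.emeasure_space_1[OF P] prob_space.emeasure_space_1[OF prob_measuresD(1)[OF \<mu>]])
 finally have "prob_space (averaged_op \<rho> f \<mu>)" by (rule prob_spaceI)
 then show PM: "averaged_op \<rho> f \<mu> \<in> prob_measures" using sets by (simp add: prob_measures_def)
 assume \<psi> [measurable]: "\<psi> \<in> borel_measurable borel" and b: "\<And>x. 0 \<le> \<psi> x" "\<And>x. \<psi> x \<le> B"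
 have "(\<integral>y. \<psi> y \<partial>averaged_op \<rho> f \<mu>) = (\<integral>\<o>. \<integral>x. \<psi> (f (\<o>, x)) \<partial>\<mu> \<partial>\<nu>)"
 proof (rule integral_nn_cong)
  show "\<psi> \<in> borel_measurable (averaged_op \<rho> f \<mu>)" using \<psi> by (simp cong: measurable_cong_sets add: sets)
  interpret prob_space \<mu> by (rule prob_measuresD(1)[OF \<mu>])
  show "(\<lambda>\<o>. \<integral>x. \<psi> (f (\<o>, x)) \<partial>\<mu>) \<in> borel_measurable \<nu>" by measurable
  show "0 \<le> (\<integral>x. \<psi> (f (\<o>, x)) \<partial>\<mu>)" for \<o> by (rule integral_nonneg_AE) (simp add: b)
  have "(\<integral>\<^sup>+x. ennreal (\<psi> (f (\<o>, x))) \<partial>\<mu>) = ennreal (\<integral>x. \<psi> (f (\<o>, x)) \<partial>\<mu>)" for \<o>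
   by (rule nn_integral_eq_integral[OF bounded_borel_integrable[OF bounded_borelI[OF \<psi> b] prob_measuresD(1)[OF \<mu>] fm]])
    (simp add: b)
  then show "(\<integral>\<^sup>+y. ennreal (\<psi> y) \<partial>averaged_op \<rho> f \<mu>) = (\<integral>\<^sup>+\<o>. ennreal (\<integral>x. \<psi> (f (\<o>, x)) \<partial>\<mu>) \<partial>\<nu>)"
   by (subst nn) simp_all
 qed (rule b)
 also have "\<dots> = (\<integral>x. \<integral>\<o>. \<psi> (f (\<o>, x)) \<partial>\<nu> \<partial>\<mu>)"
  by (rule prob_Fubini_bounded[OF P prob_measuresD(1)[OF \<mu>], of _ B]) (use b in "auto simp: abs_of_nonneg")
 also have "\<dots> = (\<integral>x. koop \<rho> \<psi> x \<partial>\<mu>)" by (simp add: koop_eq \<nu>_def)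
 finally show "(\<integral>y. \<psi> y \<partial>averaged_op \<rho> f \<mu>) = (\<integral>x. koop \<rho> \<psi> x \<partial>\<mu>)" .
qed

lemma funpow_averaged_op:
 assumes \<mu>: "\<mu> \<in> prob_measures"
 shows "(averaged_op \<rho> f ^^ k) \<mu> \<in> prob_measures"
  and "\<psi> \<in> borel_measurable borel ==> (\<And>x. 0 \<le> \<psi> x) ==> (\<And>x. \<psi> x \<le> B) ==>
   (\<integral>y. \<psi> y \<partial>(averaged_op \<rho> f ^^ k) \<mu>) = (\<integral>x. (koop \<rho> ^^ k) \<psi> x \<partial>\<mu>)"
proof -
 show P: "(averaged_op \<rho> f ^^ k) \<mu> \<in> prob_measures" for k
  by (induction k) (auto simp: \<mu> averaged_op_integral(1))
 show "\<psi> \<in> borel_measurable borel ==> (\<And>x. 0 \<le> \<psi> x) ==> (\<And>x. \<psi> x \<le> B) ==>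
   (\<integral>y. \<psi> y \<partial>(averaged_op \<rho> f ^^ k) \<mu>) = (\<integral>x. (koop \<rho> ^^ k) \<psi> x \<partial>\<mu>)"
 proof (induction k arbitrary: \<psi>)
  case (Suc k)
  have "(\<integral>y. \<psi> y \<partial>(averaged_op \<rho> f ^^ Suc k) \<mu>) = (\<integral>y. koop \<rho> \<psi> y \<partial>(averaged_op \<rho> f ^^ k) \<mu>)"
   using averaged_op_integral(2)[OF P Suc.prems] by simp
  also have "\<dots> = (\<integral>y. (koop \<rho> ^^ k) (koop \<rho> \<psi>) y \<partial>\<mu>)"
   by (rule Suc.IH) (use koop_measurable[OF bounded_borelI[OF Suc.prems]] koop_bounds[OF Suc.prems] in auto)
  finally show ?case by (simp add: funpow_swap1)
 qed simp
qed

text \<open>A value of \<open>(koop \<rho> ^^ n) \<psi>\<close> is the integral of \<psi> against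
  the \<open>n\<close>-th image of a point mass. Two point masses have total variation distance at
  most 1, which (H) brings down to one half.\<close>

lemma koop_osc:
 assumes tv: "tv_contracting C lam \<rho> f" and n: "n \<ge> 1" and half: "C * lam ^ n \<le> 1/2"
  and \<psi>: "\<psi> \<in> borel_measurable borel" "\<And>x. lo \<le> \<psi> x" "\<And>x. \<psi> x \<le> lo + s" and s: "s > 0"
 shows "(koop \<rho> ^^ n) \<psi> y - (koop \<rho> ^^ n) \<psi> y' \<le> s / 2"
proof -
 define h where "h = (\<lambda>x. 1 * \<psi> x + (- lo))"
 have hm: "h \<in> borel_measurable borel" unfolding h_def using \<psi>(1) by measurable
 have h: "0 \<le> h x" "h x \<le> s" "h x \<le> 0 + s" for x using \<psi>(2)[of x] \<psi>(3)[of x] by (auto simp: h_def)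
 have ev: "(\<integral>x. h x \<partial>(averaged_op \<rho> f ^^ n) (return borel z)) = (koop \<rho> ^^ n) \<psi> z - lo" for z
 proof -
  have "(\<integral>x. h x \<partial>(averaged_op \<rho> f ^^ n) (return borel z)) = (\<integral>x. (koop \<rho> ^^ n) h x \<partial>return borel z)"
   by (rule funpow_averaged_op(2)[OF return_prob_measures hm h(1,2)])
  also have "\<dots> = (koop \<rho> ^^ n) h z"
   using funpow_koop_bounds(1)[OF hm h(1,2)] by (simp add: integral_return)
  also have "\<dots> = (koop \<rho> ^^ n) \<psi> z - lo"
   unfolding h_def funpow_koop_affine[OF bounded_borelI[OF \<psi>]] by simp
  finally show ?thesis .
 qed
 define \<tau> where "\<tau> = tv_dist ((averaged_op \<rho> f ^^ n) (return borel y)) ((averaged_op \<rho> f ^^ n) (return borel y'))"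
 have "\<bar>((koop \<rho> ^^ n) \<psi> y - lo) - ((koop \<rho> ^^ n) \<psi> y' - lo)\<bar> \<le> s * \<tau>"
  unfolding \<tau>_def ev[symmetric]
  by (rule integral_diff_le_tv_dist[OF funpow_averaged_op(1) funpow_averaged_op(1) hm h(1,3) s])
   (rule return_prob_measures)+
 also have "\<dots> \<le> s * (1/2)"
 proof (rule mult_left_mono)
  define t where "t = tv_dist (return borel y) (return borel y')"
  have t: "0 \<le> t" "t \<le> 1"
   using tv_dist_le_1(1)[OF return_prob_measures[of y] return_prob_measures[of y']]
    tv_dist_le_1(2)[OF return_prob_measures[of y] return_prob_measures[of y'] sets.empty_sets]
   by (auto simp: t_def)
  have "\<tau> \<le> C * lam ^ n * t"
   using tv n return_prob_measures unfolding tv_contracting_def \<tau>_def t_def by blast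
  also have "\<dots> \<le> (1/2) * t" using half t by (intro mult_right_mono) auto
  finally show "\<tau> \<le> 1/2" using t by simp
 qed (use s in simp)
 finally show ?thesis by linarith
qed

text \<open>One step nearly forgets the base point: up to a fixed factor it dominates a function of
  the fibre point alone. The factor 1/2 is the loss of ball mass in
  \<open>ball_avg_ge\<close>.\<close>

lemma avg_op_ge_base_avg:
 assumes \<delta>: "\<delta> > 0" and half: "ball_mass TYPE('m) \<delta> / 2 \<le> ball_mass TYPE('m) (\<delta> - CARD('m) / \<sigma>)"
  and \<Psi>: "\<Psi> \<in> borel_measurable borel" "\<And>p. 0 \<le> \<Psi> p" "\<And>p. \<Psi> p \<le> B"
 shows "exp (- (a * CARD('m))) / 2 * base_avg \<Psi> (f p) \<le> avg_op \<delta> \<Psi> p"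
proof -
 define \<beta> where "\<beta> = ball_mass TYPE('m) \<delta>"
 have \<beta>: "\<beta> > 0" using ball_mass_pos[OF \<delta>] by (simp add: \<beta>_def)
 define X where "X = (\<integral>v. (if dist (fst p) v < \<delta> then \<Psi> (g v, f p) else 0) \<partial>haar)"
 have A0: "0 \<le> base_avg \<Psi> (f p)" using base_avg_bounds(1)[OF \<Psi>] .
 note [measurable] = \<Psi>(1)
 have bdef: "base_avg \<Psi> (f p) = (\<integral>\<o>. \<Psi> (\<o>, f p) \<partial>haar)" by (rule base_avg_def)
 have "\<beta> / 2 * base_avg \<Psi> (f p) \<le> ball_mass TYPE('m) (\<delta> - CARD('m) / \<sigma>) * (\<integral>\<o>. \<Psi> (\<o>, f p) \<partial>haar)"
  unfolding bdef[symmetric] \<beta>_def by (rule mult_right_mono[OF half A0])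
 also have "\<dots> \<le> exp (a * CARD('m)) * X"
  unfolding X_def by (rule ball_avg_ge[of "\<lambda>\<o>. \<Psi> (\<o>, f p)" B]) (use \<Psi> in auto)
 finally have "exp (- (a * CARD('m))) * (\<beta> / 2 * base_avg \<Psi> (f p)) \<le> exp (- (a * CARD('m))) * (exp (a * CARD('m)) * X)"
  by (rule mult_left_mono) simp
 also have "\<dots> = X" by (simp add: mult.assoc[symmetric] exp_add[symmetric])
 finally have "exp (- (a * CARD('m))) / 2 * base_avg \<Psi> (f p) * \<beta> \<le> X" by (simp add: mult_ac)
 then show ?thesis using \<beta> by (simp add: avg_op_def X_def[symmetric] \<beta>_def[symmetric] pos_le_divide_eq)
qed

text \<open>Each of the \<open>n + 1\<close> steps of \<open>avg_op\<close> loses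
  \<open>exp (- (a * CARD('m))) / 2\<close>; each of the \<open>n\<close> exchanges of Haar measure
  for \<rho> loses another exponential. With \<open>a\<close> fixed, the value depends neither on
  \<sigma> nor on \<delta>.\<close>

definition minor_const :: "nat => real" where
 "minor_const n = exp (- (a * CARD('m))) / 2 * (exp (- (a * CARD('m))) / 2 * exp (- (a * CARD('m)))) ^ n"

text \<open>Each application of \<open>avg_op\<close> is followed by a Haar average over the base,
  and Haar measure dominates a multiple of \<rho>; so a step of \<open>avg_op\<close> is bounded
  below by a step of \<open>koop\<close>. The additional application removes the dependence on the
  initial base point.\<close>

lemma funpow_avg_op_minorization:
 assumes \<delta>: "\<delta> > 0" and half: "ball_mass TYPE('m) \<delta> / 2 \<le> ball_mass TYPE('m) (\<delta> - CARD('m) / \<sigma>)"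
  and \<Psi>: "\<Psi> \<in> borel_measurable borel" "\<And>p. 0 \<le> \<Psi> p" "\<And>p. \<Psi> p \<le> B"
 shows "minor_const n * (koop \<rho> ^^ n) (base_avg \<Psi>) (f p) \<le> (avg_op \<delta> ^^ Suc n) \<Psi> p"
proof -
 define c where "c = exp (- (a * CARD('m))) / 2"
 define c' where "c' = exp (- (a * CARD('m)))"
 have c: "c > 0" "c' > 0" by (auto simp: c_def c'_def)
 note bA = base_avg_measurable[OF bounded_borelI[OF \<Psi>]] base_avg_bounds[OF \<Psi>]
 have step: "(c * c') ^ j * (koop \<rho> ^^ j) (base_avg \<Psi>) y \<le> base_avg ((avg_op \<delta> ^^ j) \<Psi>) y" for j y
 proof (induction j arbitrary: y)
  case (Suc j)
  note \<Psi>j = funpow_avg_op_bounds[OF \<Psi> \<delta>, of j]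
  define \<phi> where "\<phi> = base_avg ((avg_op \<delta> ^^ j) \<Psi>)"
  have \<phi>: "\<phi> \<in> borel_measurable borel" "\<And>y. 0 \<le> \<phi> y" "\<And>y. \<phi> y \<le> B"
   using base_avg_measurable[OF bounded_borelI[OF \<Psi>j]] base_avg_bounds[OF \<Psi>j] by (auto simp: \<phi>_def)
  note [measurable] = \<phi>(1)
  define \<xi> where "\<xi> = (koop \<rho> ^^ j) (base_avg \<Psi>)"
  have \<xi>: "\<xi> \<in> borel_measurable borel" "\<And>y. 0 \<le> \<xi> y" "\<And>y. \<xi> y \<le> B"
   using funpow_koop_bounds[OF bA] by (auto simp: \<xi>_def)
  have "(c * c') ^ Suc j * (koop \<rho> ^^ Suc j) (base_avg \<Psi>) y = c * c' * ((c * c') ^ j * koop \<rho> \<xi> y)"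
   by (simp add: \<xi>_def)
  also have "(c * c') ^ j * koop \<rho> \<xi> y = koop \<rho> (\<lambda>y. (c * c') ^ j * \<xi> y + 0) y"
   using fun_cong[OF koop_affine[OF bounded_borelI[OF \<xi>], of "(c * c') ^ j" 0], of y] by (simp only: add_0_right)
  also have "koop \<rho> (\<lambda>y. (c * c') ^ j * \<xi> y + 0) y \<le> koop \<rho> \<phi> y"
  proof -
   have m: "(\<lambda>y. (c * c') ^ j * \<xi> y + 0) \<in> borel_measurable borel"
    using bounded_borelD[OF bounded_borel_affine[OF bounded_borelI[OF \<xi>]]] .
   show ?thesis unfolding koop_eq[OF m] koop_eq[OF \<phi>(1)]
   proof (rule integral_mono)
    show "integrable (density haar \<rho>) (\<lambda>\<o>. (c * c') ^ j * \<xi> (f (\<o>, y)) + 0)"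
     by (rule koop_integrable[OF bounded_borel_affine[OF bounded_borelI[OF \<xi>]]])
    show "integrable (density haar \<rho>) (\<lambda>\<o>. \<phi> (f (\<o>, y)))"
     by (rule koop_integrable[OF bounded_borelI[OF \<phi>]])
    show "(c * c') ^ j * \<xi> (f (\<o>, y)) + 0 \<le> \<phi> (f (\<o>, y))" for \<o>
     using Suc[of "f (\<o>, y)"] by (simp add: \<xi>_def \<phi>_def)
   qed
  qed
  \<comment> \<open>The factor \<open>c'\<close> pays for passing from the invariant density to Haar
    measure by \<open>acip_le_haar\<close>.\<close>
  also have "c * c' * koop \<rho> \<phi> y \<le> c * c' * (exp (a * CARD('m)) * (\<integral>\<o>. \<phi> (f (\<o>, y)) \<partial>haar))"
  proof (rule mult_left_mono)
   show "koop \<rho> \<phi> y \<le> exp (a * CARD('m)) * (\<integral>\<o>. \<phi> (f (\<o>, y)) \<partial>haar)"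
    unfolding koop_def by (rule acip_le_haar[OF ac, of "\<lambda>\<o>. \<phi> (f (\<o>, y))" B]) (use \<phi> in auto)
  qed (use c in simp)
  also have "\<dots> = (\<integral>\<o>. c * \<phi> (f (\<o>, y)) \<partial>haar)"
   by (simp add: c'_def exp_minus)
  also have "\<dots> \<le> base_avg ((avg_op \<delta> ^^ Suc j) \<Psi>) y"
   unfolding base_avg_def
  proof (rule integral_mono)
   show "integrable haar (\<lambda>\<o>. c * \<phi> (f (\<o>, y)))"
    by (intro integrable_mult_right bounded_borel_integrable[OF bounded_borelI[OF \<phi>] haar.prob_space_axioms]) measurable
   show "integrable haar (\<lambda>\<o>. (avg_op \<delta> ^^ Suc j) \<Psi> (\<o>, y))"
    by (rule bounded_borel_section[OF bounded_borelI[OF funpow_avg_op_bounds[OF \<Psi> \<delta>]]])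
   show "c * \<phi> (f (\<o>, y)) \<le> (avg_op \<delta> ^^ Suc j) \<Psi> (\<o>, y)" for \<o>
    using avg_op_ge_base_avg[OF \<delta> half \<Psi>j, of "(\<o>, y)"] by (simp add: c_def \<phi>_def)
  qed
  finally show ?case using c by (simp add: mult_left_mono)
 qed simp
 have "minor_const n * (koop \<rho> ^^ n) (base_avg \<Psi>) (f p) = c * ((c * c') ^ n * (koop \<rho> ^^ n) (base_avg \<Psi>) (f p))"
  by (simp add: minor_const_def c_def c'_def)
 also have "\<dots> \<le> c * base_avg ((avg_op \<delta> ^^ n) \<Psi>) (f p)"
  using c by (intro mult_left_mono step) auto
 also have "\<dots> \<le> (avg_op \<delta> ^^ Suc n) \<Psi> p"
  using avg_op_ge_base_avg[OF \<delta> half funpow_avg_op_bounds[OF \<Psi> \<delta>, of n], of p] by (simp add: c_def)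
 finally show ?thesis .
qed

text \<open>A Doeblin argument: the minorization is applied to the distance of \<Psi> from its lower
  and from its upper bound. The minorizing function \<open>h\<close> is not constant, but by (H) it
  oscillates by at most \<open>s / 2\<close>, so a fraction \<open>minor_const n / 2\<close> of the
  oscillation is gained.\<close>

lemma avg_op_contraction:
 assumes \<delta>: "\<delta> > 0" and half: "ball_mass TYPE('m) \<delta> / 2 \<le> ball_mass TYPE('m) (\<delta> - CARD('m) / \<sigma>)"
  and tv: "tv_contracting C lam \<rho> f" and n: "n \<ge> 1" and Cn: "C * lam ^ n \<le> 1/2"
  and \<Psi>: "\<Psi> \<in> borel_measurable borel" "\<And>p. lo \<le> \<Psi> p" "\<And>p. \<Psi> p \<le> lo + s" and s: "s > 0"
 shows "\<exists>lo'. \<forall>p. lo' \<le> (avg_op \<delta> ^^ Suc n) \<Psi> p \<and> (avg_op \<delta> ^^ Suc n) \<Psi> p \<le> lo' + (1 - minor_const n / 2) * s"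
proof -
 define q where "q = minor_const n"
 have q: "q > 0" by (simp add: q_def minor_const_def)
 define h where "h = (koop \<rho> ^^ n) (base_avg \<Psi>)"
 note bb = bounded_borelI[OF \<Psi>]
 note bA = base_avg_measurable[OF bb] base_avg_bounds[OF \<Psi>]
 note bbA = bounded_borelI[OF bA]
 have osc: "h y - h y' \<le> s / 2" for y y' unfolding h_def by (rule koop_osc[OF tv n Cn bA s])
 have hb: "lo \<le> h y" for y unfolding h_def by (rule funpow_koop_bounds(2)[OF bA])
 define m where "m = (INF y. h y)"
 have m1: "m \<le> h y" for y unfolding m_def by (rule cINF_lower) (use hb in "auto intro: bdd_belowI[of _ lo]")
 have m2: "h y \<le> m + s / 2" for y
 proof -
  have "h y - s / 2 \<le> m" unfolding m_def
  proof (rule cINF_greatest)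
   show "h y - s / 2 \<le> h y'" for y' using osc[of y y'] by linarith
  qed simp
  then show ?thesis by simp
 qed
 have low: "lo + q * (h (f p) - lo) \<le> (avg_op \<delta> ^^ Suc n) \<Psi> p" for p
 proof -
  define \<Psi>' where "\<Psi>' = (\<lambda>p. 1 * \<Psi> p + (- lo))"
  have m': "\<Psi>' \<in> borel_measurable borel"
   unfolding \<Psi>'_def by (rule bounded_borelD[OF bounded_borel_affine[OF bb]])
  have b': "0 \<le> \<Psi>' p" "\<Psi>' p \<le> s" for p
   using \<Psi>(2)[of p] \<Psi>(3)[of p] by (simp_all add: \<Psi>'_def)
  have min: "q * (koop \<rho> ^^ n) (base_avg \<Psi>') (f p) \<le> (avg_op \<delta> ^^ Suc n) \<Psi>' p"
   unfolding q_def by (rule funpow_avg_op_minorization[OF \<delta> half m' b'])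
  have "base_avg \<Psi>' = (\<lambda>y. 1 * base_avg \<Psi> y + (- lo))"
   unfolding \<Psi>'_def by (rule base_avg_affine[OF bb])
  then have e1: "(koop \<rho> ^^ n) (base_avg \<Psi>') (f p) = 1 * h (f p) + (- lo)"
   unfolding h_def by (simp only: fun_cong[OF funpow_koop_affine[OF bbA]])
  have e2: "(avg_op \<delta> ^^ Suc n) \<Psi>' p = 1 * (avg_op \<delta> ^^ Suc n) \<Psi> p + (- lo)"
   unfolding \<Psi>'_def by (rule fun_cong[OF funpow_avg_op_affine[OF bb \<delta>]])
  have "q * (h (f p) - lo) \<le> (avg_op \<delta> ^^ Suc n) \<Psi> p - lo"
   using min unfolding e1 e2 by (simp del: funpow.simps)
  then show ?thesis by linarith
 qed
 \<comment> \<open>The same argument for the reflected function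
   \<open>lo + s - \<Psi>\<close>.\<close>
 have up: "(avg_op \<delta> ^^ Suc n) \<Psi> p \<le> lo + s - q * (lo + s - h (f p))" for p
 proof -
  define \<Psi>' where "\<Psi>' = (\<lambda>p. (- 1) * \<Psi> p + (lo + s))"
  have m': "\<Psi>' \<in> borel_measurable borel"
   unfolding \<Psi>'_def by (rule bounded_borelD[OF bounded_borel_affine[OF bb]])
  have b': "0 \<le> \<Psi>' p" "\<Psi>' p \<le> s" for p
   using \<Psi>(2)[of p] \<Psi>(3)[of p] by (simp_all add: \<Psi>'_def)
  have min: "q * (koop \<rho> ^^ n) (base_avg \<Psi>') (f p) \<le> (avg_op \<delta> ^^ Suc n) \<Psi>' p"
   unfolding q_def by (rule funpow_avg_op_minorization[OF \<delta> half m' b'])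
  have "base_avg \<Psi>' = (\<lambda>y. (- 1) * base_avg \<Psi> y + (lo + s))"
   unfolding \<Psi>'_def by (rule base_avg_affine[OF bb])
  then have e1: "(koop \<rho> ^^ n) (base_avg \<Psi>') (f p) = (- 1) * h (f p) + (lo + s)"
   unfolding h_def by (simp only: fun_cong[OF funpow_koop_affine[OF bbA]])
  have e2: "(avg_op \<delta> ^^ Suc n) \<Psi>' p = (- 1) * (avg_op \<delta> ^^ Suc n) \<Psi> p + (lo + s)"
   unfolding \<Psi>'_def by (rule fun_cong[OF funpow_avg_op_affine[OF bb \<delta>]])
  have "q * (lo + s - h (f p)) \<le> (lo + s) - (avg_op \<delta> ^^ Suc n) \<Psi> p"
   using min unfolding e1 e2 by (simp del: funpow.simps)
  then show ?thesis by linarith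
 qed
 have "lo + q * (m - lo) \<le> (avg_op \<delta> ^^ Suc n) \<Psi> p" for p
 proof -
  have "q * (m - lo) \<le> q * (h (f p) - lo)" using m1[of "f p"] q by (intro mult_left_mono) auto
  then show ?thesis using low[of p] by linarith
 qed
 moreover have "(avg_op \<delta> ^^ Suc n) \<Psi> p \<le> (lo + q * (m - lo)) + (1 - q / 2) * s" for p
 proof -
  have "q * (lo + s - (m + s / 2)) \<le> q * (lo + s - h (f p))"
   using m2[of "f p"] q by (intro mult_left_mono) auto
  moreover have "(lo + q * (m - lo)) + (1 - q / 2) * s = lo + s - q * (lo + s - (m + s / 2))"
   by (simp add: field_simps)
  ultimately show ?thesis using up[of p] by linarith
 qed
 ultimately show ?thesis unfolding q_def by blast
qed

lemma minor_const_range: "0 < minor_const n" "minor_const n \<le> 1"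
proof -
 have e: "0 < exp (- (a * CARD('m)))" "exp (- (a * CARD('m))) \<le> 1" using a_nonneg by auto
 have e2: "exp (- (a * CARD('m))) / 2 \<le> 1" using e by linarith
 have "exp (- (a * CARD('m))) / 2 * exp (- (a * CARD('m))) \<le> 1 * 1" using e by (intro mult_mono e2 e(2)) simp_all
 then have "(exp (- (a * CARD('m))) / 2 * exp (- (a * CARD('m)))) ^ n \<le> 1" by (intro power_le_one) simp_all
 then have "minor_const n \<le> 1 * 1" unfolding minor_const_def by (intro mult_mono e2) simp_all
 then show "minor_const n \<le> 1" by simp
 show "0 < minor_const n" by (simp add: minor_const_def)
qed

lemma avg_op_contraction_iter:
 assumes \<delta>: "\<delta> > 0" and half: "ball_mass TYPE('m) \<delta> / 2 \<le> ball_mass TYPE('m) (\<delta> - CARD('m) / \<sigma>)"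
  and tv: "tv_contracting C lam \<rho> f" and n: "n \<ge> 1" and Cn: "C * lam ^ n \<le> 1/2"
  and \<Psi>: "\<Psi> \<in> borel_measurable borel" "\<And>p. 0 \<le> \<Psi> p" "\<And>p. \<Psi> p \<le> 1"
 shows "\<exists>lo. \<forall>p. lo \<le> (avg_op \<delta> ^^ (Suc n * j)) \<Psi> p \<and> (avg_op \<delta> ^^ (Suc n * j)) \<Psi> p \<le> lo + (1 - minor_const n / 2) ^ j"
proof (induction j)
 case 0
 show ?case using \<Psi> by (intro exI[of _ 0]) auto
next
 case (Suc j)
 then obtain lo where lo: "\<And>p. lo \<le> (avg_op \<delta> ^^ (Suc n * j)) \<Psi> p"
  "\<And>p. (avg_op \<delta> ^^ (Suc n * j)) \<Psi> p \<le> lo + (1 - minor_const n / 2) ^ j" by blast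
 have pos: "(1 - minor_const n / 2) ^ j > 0" using minor_const_range[of n] by (intro zero_less_power) auto
 have "(avg_op \<delta> ^^ (Suc n * Suc j)) \<Psi> = (avg_op \<delta> ^^ Suc n) ((avg_op \<delta> ^^ (Suc n * j)) \<Psi>)"
  by (simp only: mult_Suc_right funpow_add o_apply)
 then show ?case
  using avg_op_contraction[OF \<delta> half tv n Cn funpow_avg_op_bounds(1)[OF \<Psi> \<delta>] lo pos] by simp
qed

end

end

section \<open>Wasserstein distance and Lipschitz test functions\<close>

lemma prob_integral_product:
 fixes u :: "'a => real" and v :: "'b => real"
 assumes M: "prob_space M" and N: "prob_space N"
  and [measurable]: "u \<in> borel_measurable M" "v \<in> borel_measurable N"
  and B: "\<And>x. \<bar>u x\<bar> \<le> B" "\<And>y. \<bar>v y\<bar> \<le> B'"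
 shows "integrable (M \<Otimes>\<^sub>M N) (\<lambda>z. u (fst z) * v (snd z))"
  and "(\<integral>z. u (fst z) * v (snd z) \<partial>(M \<Otimes>\<^sub>M N)) = (\<integral>x. u x \<partial>M) * (\<integral>y. v y \<partial>N)"
proof -
 interpret M: prob_space M by fact
 interpret N: prob_space N by fact
 interpret P: pair_prob_space M N ..
 have "\<bar>u (fst z) * v (snd z)\<bar> \<le> B * B'" for z
  unfolding abs_mult using B by (intro mult_mono) (auto intro: order.trans[OF abs_ge_zero])
 then show i: "integrable (M \<Otimes>\<^sub>M N) (\<lambda>z. u (fst z) * v (snd z))"
  by (intro prob_integrable_bounded[OF P.P.prob_space_axioms, of _ "B * B'"]) simp_all
 have "(\<integral>z. u (fst z) * v (snd z) \<partial>(M \<Otimes>\<^sub>M N)) = (\<integral>x. \<integral>y. u x * v y \<partial>N \<partial>M)"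
  using P.integral_fst'[OF i] by simp
 then show "(\<integral>z. u (fst z) * v (snd z) \<partial>(M \<Otimes>\<^sub>M N)) = (\<integral>x. u x \<partial>M) * (\<integral>y. v y \<partial>N)" by simp
qed

lemma prob_integral_one_minus_sum:
 fixes \<theta> :: "nat => 'a => real"
 assumes M: "prob_space M" and i: "\<And>k. k < N ==> integrable M (\<theta> k)"
 shows "(\<integral>x. 1 - (\<Sum>k<N. \<alpha> k * \<theta> k x) \<partial>M) = 1 - (\<Sum>k<N. \<alpha> k * (\<integral>x. \<theta> k x \<partial>M))"
proof -
 interpret prob_space M by fact
 have j: "integrable M (\<lambda>x. \<alpha> k * \<theta> k x)" if "k \<in> {..<N}" for k
  using i that by (intro integrable_mult_right) auto
 have "(\<integral>x. 1 - (\<Sum>k<N. \<alpha> k * \<theta> k x) \<partial>M) = (\<integral>x. 1 \<partial>M) - (\<integral>x. (\<Sum>k<N. \<alpha> k * \<theta> k x) \<partial>M)"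
  by (rule Bochner_Integration.integral_diff) (auto intro: j)
 also have "(\<integral>x. (\<Sum>k<N. \<alpha> k * \<theta> k x) \<partial>M) = (\<Sum>k<N. (\<integral>x. \<alpha> k * \<theta> k x \<partial>M))"
  by (rule Bochner_Integration.integral_sum) (rule j)
 finally show ?thesis using prob_space by simp
qed

text \<open>An explicit coupling: for each \<open>k\<close>, most of the common mass
  \<open>min (p k) (q k)\<close> is coupled inside the support of \<open>\<theta> k\<close>, where
  points are \<open>e\<close>-close; the remaining mass is coupled independently and pays the
  diameter bound. Letting \<tau> tend to 0 gives the claim.\<close>

lemma wasserstein_le_partition_of_unity:
 fixes \<mu> \<nu> :: "'n::finite torus measure" and \<theta> :: "nat => 'n torus => real"
 assumes \<mu>: "\<mu> \<in> prob_measures" and \<nu>: "\<nu> \<in> prob_measures"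
  and \<theta>m [measurable]: "\<And>k. \<theta> k \<in> borel_measurable borel" and \<theta>0: "\<And>k x. 0 \<le> \<theta> k x"
  and \<theta>1: "\<And>x. (\<Sum>k<N. \<theta> k x) = (1 :: real)"
  and close: "\<And>k x y. k < N ==> \<theta> k x * \<theta> k y \<noteq> 0 ==> dist x y \<le> e" and e: "e \<ge> 0"
 shows "wasserstein \<mu> \<nu> \<le> e + CARD('n) * (\<Sum>k<N. \<bar>(\<integral>x. \<theta> k x \<partial>\<mu>) - (\<integral>x. \<theta> k x \<partial>\<nu>)\<bar>)"
proof -
 define p where "p k = (\<integral>x. \<theta> k x \<partial>\<mu>)" for k
 define q where "q k = (\<integral>x. \<theta> k x \<partial>\<nu>)" for k
 interpret M: prob_space \<mu> by (rule prob_measuresD(1)[OF \<mu>])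
 interpret N: prob_space \<nu> by (rule prob_measuresD(1)[OF \<nu>])
 interpret P: pair_prob_space \<mu> \<nu> ..
 note [measurable_cong] = prob_measuresD(2)[OF \<mu>] prob_measuresD(2)[OF \<nu>]
 have \<theta>le: "\<theta> k x \<le> 1" if "k < N" for k x
  using member_le_sum[of k "{..<N}" "\<lambda>k. \<theta> k x"] \<theta>0 \<theta>1 that by simp
 have \<theta>i: "integrable \<mu> (\<theta> k)" "integrable \<nu> (\<theta> k)" if "k < N" for k
  by (rule prob_integrable_bounded[of _ _ 1]; use \<theta>0 \<theta>le[OF that] M.prob_space_axioms N.prob_space_axioms in simp)+
 have p0: "0 \<le> p k" and q0: "0 \<le> q k" for k
  unfolding p_def q_def by (rule Bochner_Integration.integral_nonneg; use \<theta>0 in simp)+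
 have sp: "(\<Sum>k<N. p k) = 1"
  unfolding p_def using \<theta>i \<theta>1 M.prob_space by (subst Bochner_Integration.integral_sum[symmetric]) auto
 have main: "wasserstein \<mu> \<nu> \<le> e + CARD('n) * (\<tau> + (\<Sum>k<N. \<bar>p k - q k\<bar>))" if \<tau>: "0 < \<tau>" "\<tau> < 1" for \<tau>
 proof -
  \<comment> \<open>The factor \<open>1 - \<tau>\<close> leaves positive densities \<open>u\<close>,
    \<open>v\<close> and a positive residual mass \<open>r\<close>, by which the independent part
    can be normalised.\<close>
  define m where "m k = (1 - \<tau>) * min (p k) (q k)" for k
  define \<alpha> where "\<alpha> k = m k / p k" for k
  define \<beta> where "\<beta> k = m k / q k" for k
  \<comment> \<open>If \<open>p k\<close> or \<open>q k\<close> vanishes then so does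
    \<open>m k\<close>, and division by 0 gives the correct value 0.\<close>
  define A where "A k = m k / (p k * q k)" for k
  define r where "r = 1 - (\<Sum>k<N. m k)"
  define u where "u x = 1 - (\<Sum>k<N. \<alpha> k * \<theta> k x)" for x
  define v where "v x = 1 - (\<Sum>k<N. \<beta> k * \<theta> k x)" for x
  have m0: "0 \<le> m k" for k using p0 q0 \<tau> by (simp add: m_def)
  have \<alpha>p: "\<alpha> k * p k = m k" and \<beta>q: "\<beta> k * q k = m k" for k
   using p0[of k] q0[of k] by (auto simp: \<alpha>_def \<beta>_def m_def)
  have Aq: "A k * q k = \<alpha> k" and Ap: "A k * p k = \<beta> k" for k
   using p0[of k] q0[of k] by (auto simp: \<alpha>_def \<beta>_def A_def m_def)
  have mp: "m k \<le> (1 - \<tau>) * p k" and mq: "m k \<le> (1 - \<tau>) * q k" for k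
   unfolding m_def using \<tau> by (auto intro!: mult_left_mono)
  have \<alpha>0: "0 \<le> \<alpha> k" and \<beta>0: "0 \<le> \<beta> k" and A0: "0 \<le> A k" for k
   using m0 p0 q0 by (auto simp: \<alpha>_def \<beta>_def A_def)
  have \<alpha>1: "\<alpha> k \<le> 1 - \<tau>" for k
  proof (cases "p k = 0")
   case False
   then show ?thesis using mp[of k] p0[of k] unfolding \<alpha>_def by (simp add: divide_le_eq)
  qed (use \<tau> in "simp add: \<alpha>_def")
  have \<beta>1: "\<beta> k \<le> 1 - \<tau>" for k
  proof (cases "q k = 0")
   case False
   then show ?thesis using mq[of k] q0[of k] unfolding \<beta>_def by (simp add: divide_le_eq)
  qed (use \<tau> in "simp add: \<beta>_def")
  have weight: "\<tau> \<le> 1 - (\<Sum>k<N. \<gamma> k * \<theta> k x)" "1 - (\<Sum>k<N. \<gamma> k * \<theta> k x) \<le> 1"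
   if "\<And>k. 0 \<le> \<gamma> k" "\<And>k. \<gamma> k \<le> 1 - \<tau>" for \<gamma> :: "nat => real" and x
  proof -
   have "(\<Sum>k<N. \<gamma> k * \<theta> k x) \<le> (\<Sum>k<N. (1 - \<tau>) * \<theta> k x)"
    by (intro sum_mono mult_right_mono that \<theta>0)
   also have "\<dots> = 1 - \<tau>" by (simp add: sum_distrib_left[symmetric] \<theta>1)
   finally show "\<tau> \<le> 1 - (\<Sum>k<N. \<gamma> k * \<theta> k x)" by simp
   have "0 \<le> (\<Sum>k<N. \<gamma> k * \<theta> k x)" by (intro sum_nonneg mult_nonneg_nonneg that \<theta>0)
   then show "1 - (\<Sum>k<N. \<gamma> k * \<theta> k x) \<le> 1" by simp
  qed
  have u: "\<tau> \<le> u x" "u x \<le> 1" for x unfolding u_def by (rule weight[of \<alpha>, OF \<alpha>0 \<alpha>1])+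
  have v: "\<tau> \<le> v x" "v x \<le> 1" for x unfolding v_def by (rule weight[of \<beta>, OF \<beta>0 \<beta>1])+
  have um [measurable]: "u \<in> borel_measurable borel" and vm [measurable]: "v \<in> borel_measurable borel"
   unfolding u_def v_def by measurable
  have iu: "(\<integral>x. u x \<partial>\<mu>) = r"
  proof -
   have "(\<integral>x. u x \<partial>\<mu>) = 1 - (\<Sum>k<N. \<alpha> k * p k)"
    unfolding u_def p_def by (rule prob_integral_one_minus_sum[OF M.prob_space_axioms \<theta>i(1)])
   then show ?thesis by (simp add: \<alpha>p r_def)
  qed
  have iv: "(\<integral>x. v x \<partial>\<nu>) = r"
  proof -
   have "(\<integral>x. v x \<partial>\<nu>) = 1 - (\<Sum>k<N. \<beta> k * q k)"
    unfolding v_def q_def by (rule prob_integral_one_minus_sum[OF N.prob_space_axioms \<theta>i(2)])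
   then show ?thesis by (simp add: \<beta>q r_def)
  qed
  have r: "r > 0"
  proof -
   have "(\<Sum>k<N. m k) \<le> (\<Sum>k<N. (1 - \<tau>) * p k)" by (intro sum_mono mp)
   then show ?thesis using \<tau> by (simp add: r_def sum_distrib_left[symmetric] sp)
  qed
  \<comment> \<open>The sum couples mass \<open>m k\<close> through the product of
    \<open>\<theta> k\<close> with itself; the last term is the normalised product of what is left
    of each marginal.\<close>
  define w where "w z = (\<Sum>k<N. A k * (\<theta> k (fst z) * \<theta> k (snd z))) + u (fst z) * v (snd z) / r" for z
  have wm [measurable]: "w \<in> borel_measurable (\<mu> \<Otimes>\<^sub>M \<nu>)" unfolding w_def by measurable
  have w0: "0 \<le> w z" for z
  proof -
   have "0 \<le> u (fst z) * v (snd z) / r" using u(1)[of "fst z"] v(1)[of "snd z"] \<tau> r by simp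
   moreover have "0 \<le> (\<Sum>k<N. A k * (\<theta> k (fst z) * \<theta> k (snd z)))"
    by (intro sum_nonneg mult_nonneg_nonneg A0 \<theta>0)
   ultimately show ?thesis by (simp add: w_def)
  qed
  have wB: "w z \<le> (\<Sum>k<N. A k * (1 * 1)) + 1 * 1 / r" for z
  proof -
   have "u (fst z) * v (snd z) / r \<le> 1 * 1 / r"
    using u[of "fst z"] v[of "snd z"] \<tau> r by (intro divide_right_mono mult_mono) auto
   moreover have "(\<Sum>k<N. A k * (\<theta> k (fst z) * \<theta> k (snd z))) \<le> (\<Sum>k<N. A k * (1 * 1))"
    by (intro sum_mono mult_left_mono mult_mono A0 \<theta>0 \<theta>le) auto
   ultimately show ?thesis unfolding w_def by (rule add_mono[rotated])
  qed
  have w1: "(\<integral>y. w (x, y) \<partial>\<nu>) = 1" for x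
  proof -
   have iv': "integrable \<nu> v" by (rule prob_integrable_bounded[of _ _ 1]) (use v \<tau> N.prob_space_axioms in "auto simp: abs_le_iff intro: order.trans[of _ 0] order.trans[OF _ v(1)]")
   have j: "integrable \<nu> (\<lambda>y. A k * (\<theta> k x * \<theta> k y))" if "k \<in> {..<N}" for k
    using \<theta>i(2) that by (intro integrable_mult_right) auto
   have "(\<integral>y. w (x, y) \<partial>\<nu>) = (\<integral>y. (\<Sum>k<N. A k * (\<theta> k x * \<theta> k y)) \<partial>\<nu>) + (\<integral>y. u x * v y / r \<partial>\<nu>)"
    unfolding w_def fst_conv snd_conv
    by (rule Bochner_Integration.integral_add) (use j iv' in "auto intro!: Bochner_Integration.integrable_sum")
   also have "(\<integral>y. (\<Sum>k<N. A k * (\<theta> k x * \<theta> k y)) \<partial>\<nu>) = (\<Sum>k<N. \<integral>y. A k * (\<theta> k x * \<theta> k y) \<partial>\<nu>)"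
    by (rule Bochner_Integration.integral_sum) (rule j)
   also have "(\<Sum>k<N. \<integral>y. A k * (\<theta> k x * \<theta> k y) \<partial>\<nu>) = (\<Sum>k<N. A k * (\<theta> k x * q k))" by (simp add: q_def)
   also have "(\<integral>y. u x * v y / r \<partial>\<nu>) = u x * r / r" by (simp add: iv)
   also have "(\<Sum>k<N. A k * (\<theta> k x * q k)) = (\<Sum>k<N. \<alpha> k * \<theta> k x)"
    by (rule sum.cong[OF refl]) (simp add: Aq[symmetric] mult_ac)
   finally show ?thesis using r by (simp add: u_def)
  qed
  have w2: "(\<integral>x. w (x, y) \<partial>\<mu>) = 1" for y
  proof -
   have iu': "integrable \<mu> u" by (rule prob_integrable_bounded[of _ _ 1]) (use u \<tau> M.prob_space_axioms in "auto simp: abs_le_iff intro: order.trans[of _ 0] order.trans[OF _ u(1)]")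
   have j: "integrable \<mu> (\<lambda>x. A k * (\<theta> k x * \<theta> k y))" if "k \<in> {..<N}" for k
    using \<theta>i(1) that by (intro integrable_mult_right integrable_mult_left) auto
   have "(\<integral>x. w (x, y) \<partial>\<mu>) = (\<integral>x. (\<Sum>k<N. A k * (\<theta> k x * \<theta> k y)) \<partial>\<mu>) + (\<integral>x. u x * v y / r \<partial>\<mu>)"
    unfolding w_def fst_conv snd_conv
    by (rule Bochner_Integration.integral_add) (use j iu' in "auto intro!: Bochner_Integration.integrable_sum")
   also have "(\<integral>x. (\<Sum>k<N. A k * (\<theta> k x * \<theta> k y)) \<partial>\<mu>) = (\<Sum>k<N. \<integral>x. A k * (\<theta> k x * \<theta> k y) \<partial>\<mu>)"
    by (rule Bochner_Integration.integral_sum) (rule j)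
   also have "(\<Sum>k<N. \<integral>x. A k * (\<theta> k x * \<theta> k y) \<partial>\<mu>) = (\<Sum>k<N. A k * (p k * \<theta> k y))" by (simp add: p_def)
   also have "(\<integral>x. u x * v y / r \<partial>\<mu>) = r * v y / r" by (simp add: iu)
   also have "(\<Sum>k<N. A k * (p k * \<theta> k y)) = (\<Sum>k<N. \<beta> k * \<theta> k y)"
    by (rule sum.cong[OF refl]) (simp add: Ap[symmetric] mult_ac)
   finally show ?thesis using r by (simp add: v_def)
  qed
  define \<pi> where "\<pi> = density (\<mu> \<Otimes>\<^sub>M \<nu>) (\<lambda>z. ennreal (w z))"
  have \<pi>: "\<pi> \<in> couplings \<mu> \<nu>" unfolding \<pi>_def by (rule density_coupling[OF \<mu> \<nu> wm w0 wB w1 w2])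
  have "wasserstein \<mu> \<nu> \<le> (\<integral>z. dist (fst z) (snd z) \<partial>\<pi>)"
   unfolding wasserstein_def
  proof (rule cINF_lower[OF _ \<pi>])
   show "bdd_below ((\<lambda>\<pi>. \<integral>z. dist (fst z) (snd z) \<partial>\<pi>) ` couplings \<mu> \<nu>)"
    by (intro bdd_belowI[of _ 0]) (auto intro!: Bochner_Integration.integral_nonneg)
  qed
  also have "\<dots> = (\<integral>z. w z * dist (fst z) (snd z) \<partial>(\<mu> \<Otimes>\<^sub>M \<nu>))"
   unfolding \<pi>_def using w0 by (subst integral_density) auto
  also have "\<dots> \<le> (\<integral>z. (\<Sum>k<N. A k * e * (\<theta> k (fst z) * \<theta> k (snd z))) + CARD('n) / r * (u (fst z) * v (snd z)) \<partial>(\<mu> \<Otimes>\<^sub>M \<nu>))"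
  proof (rule integral_mono)
   define B where "B = (\<Sum>k<N. A k * (1 * 1)) + 1 * 1 / r"
   have B0: "0 \<le> B" unfolding B_def using A0 r by (intro add_nonneg_nonneg sum_nonneg) auto
   have "\<bar>w z * dist (fst z) (snd z)\<bar> \<le> B * CARD('n)" for z
    unfolding abs_mult using w0[of z] wB[of z] B0 dist_torus_le[of "fst z" "snd z"] by (intro mult_mono) (auto simp: B_def)
   then show "integrable (\<mu> \<Otimes>\<^sub>M \<nu>) (\<lambda>z. w z * dist (fst z) (snd z))"
    by (intro prob_integrable_bounded[OF P.P.prob_space_axioms, of _ "B * CARD('n)"]) simp_all
   have "integrable (\<mu> \<Otimes>\<^sub>M \<nu>) (\<lambda>z. \<theta> k (fst z) * \<theta> k (snd z))" if "k < N" for k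
    by (rule prob_integral_product(1)[of _ _ _ _ 1 1]) (use \<theta>0 \<theta>le[OF that] M.prob_space_axioms N.prob_space_axioms in auto)
   moreover have "integrable (\<mu> \<Otimes>\<^sub>M \<nu>) (\<lambda>z. u (fst z) * v (snd z))"
    by (rule prob_integral_product(1)[of _ _ _ _ 1 1]) (use u v \<tau> M.prob_space_axioms N.prob_space_axioms in "auto simp: abs_le_iff intro: order.trans[of _ 0] order.trans[OF _ u(1)] order.trans[OF _ v(1)]")
   ultimately show "integrable (\<mu> \<Otimes>\<^sub>M \<nu>) (\<lambda>z. (\<Sum>k<N. A k * e * (\<theta> k (fst z) * \<theta> k (snd z))) + CARD('n) / r * (u (fst z) * v (snd z)))"
    by (intro Bochner_Integration.integrable_add Bochner_Integration.integrable_sum integrable_mult_right) auto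
   fix z
   have "A k * (\<theta> k (fst z) * \<theta> k (snd z)) * dist (fst z) (snd z) \<le> A k * e * (\<theta> k (fst z) * \<theta> k (snd z))" if "k < N" for k
   proof (cases "\<theta> k (fst z) * \<theta> k (snd z) = 0")
    case False
    have "A k * (\<theta> k (fst z) * \<theta> k (snd z)) * dist (fst z) (snd z) \<le> A k * (\<theta> k (fst z) * \<theta> k (snd z)) * e"
     by (intro mult_left_mono close[OF that False] mult_nonneg_nonneg A0 \<theta>0)
    then show ?thesis by (simp add: mult_ac)
   next
    case True
    then show ?thesis by (simp only: mult_zero_right mult_zero_left order_refl)
   qed
   then have "(\<Sum>k<N. A k * (\<theta> k (fst z) * \<theta> k (snd z))) * dist (fst z) (snd z) \<le> (\<Sum>k<N. A k * e * (\<theta> k (fst z) * \<theta> k (snd z)))"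
    unfolding sum_distrib_right by (intro sum_mono) auto
   moreover have "u (fst z) * v (snd z) / r * dist (fst z) (snd z) \<le> u (fst z) * v (snd z) / r * CARD('n)"
    using u(1)[of "fst z"] v(1)[of "snd z"] \<tau> r dist_torus_le by (intro mult_left_mono) auto
   moreover have "u (fst z) * v (snd z) / r * CARD('n) = CARD('n) / r * (u (fst z) * v (snd z))" by simp
   ultimately show "w z * dist (fst z) (snd z) \<le> (\<Sum>k<N. A k * e * (\<theta> k (fst z) * \<theta> k (snd z))) + CARD('n) / r * (u (fst z) * v (snd z))"
    unfolding w_def distrib_right by linarith
  qed
  also have "\<dots> = (\<Sum>k<N. A k * e * (p k * q k)) + CARD('n) / r * (r * r)"
  proof -
   have 1: "integrable (\<mu> \<Otimes>\<^sub>M \<nu>) (\<lambda>z. \<theta> k (fst z) * \<theta> k (snd z))"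
    "(\<integral>z. \<theta> k (fst z) * \<theta> k (snd z) \<partial>(\<mu> \<Otimes>\<^sub>M \<nu>)) = p k * q k" if "k < N" for k
    unfolding p_def q_def
    by (rule prob_integral_product[of _ _ _ _ 1 1]; use \<theta>0 \<theta>le[OF that] M.prob_space_axioms N.prob_space_axioms in simp)+
   have 2: "integrable (\<mu> \<Otimes>\<^sub>M \<nu>) (\<lambda>z. u (fst z) * v (snd z))"
    "(\<integral>z. u (fst z) * v (snd z) \<partial>(\<mu> \<Otimes>\<^sub>M \<nu>)) = (\<integral>x. u x \<partial>\<mu>) * (\<integral>y. v y \<partial>\<nu>)"
    by (rule prob_integral_product[of _ _ _ _ 1 1]; use u v \<tau> M.prob_space_axioms N.prob_space_axioms in "auto simp: abs_le_iff intro: order.trans[of _ 0] order.trans[OF _ u(1)] order.trans[OF _ v(1)]")+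
   have "(\<integral>z. (\<Sum>k<N. A k * e * (\<theta> k (fst z) * \<theta> k (snd z))) \<partial>(\<mu> \<Otimes>\<^sub>M \<nu>)) = (\<Sum>k<N. A k * e * (p k * q k))"
    using 1 by (subst Bochner_Integration.integral_sum) auto
   moreover have "integrable (\<mu> \<Otimes>\<^sub>M \<nu>) (\<lambda>z. \<Sum>k<N. A k * e * (\<theta> k (fst z) * \<theta> k (snd z)))"
    by (intro Bochner_Integration.integrable_sum integrable_mult_right) (use 1 in auto)
   ultimately show ?thesis using 2 by (simp add: iu iv)
  qed
  also have "\<dots> \<le> e * 1 + CARD('n) * (\<tau> + (\<Sum>k<N. \<bar>p k - q k\<bar>))"
  proof (rule add_mono)
   have am: "A k * e * (p k * q k) = e * m k" for k using \<beta>q[of k] by (simp add: Ap[symmetric] mult_ac)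
   then have "(\<Sum>k<N. A k * e * (p k * q k)) = e * (1 - r)" unfolding am by (simp add: r_def sum_distrib_left)
   also have "\<dots> \<le> e * 1" using e r by (intro mult_left_mono) auto
   finally show "(\<Sum>k<N. A k * e * (p k * q k)) \<le> e * 1" .
   \<comment> \<open>The residual mass exceeds the positive parts of \<open>p k - q k\<close> by at
     most \<tau>.\<close>
   have "r = (\<Sum>k<N. p k - m k)" by (simp add: r_def sum_subtractf sp)
   also have "\<dots> \<le> (\<Sum>k<N. \<tau> * p k + \<bar>p k - q k\<bar>)"
   proof (rule sum_mono)
    fix k
    have "p k - m k = \<tau> * p k + (1 - \<tau>) * (p k - min (p k) (q k))" by (simp add: m_def algebra_simps)
    also have "(1 - \<tau>) * (p k - min (p k) (q k)) \<le> 1 * \<bar>p k - q k\<bar>"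
     using \<tau> by (intro mult_mono) auto
    finally show "p k - m k \<le> \<tau> * p k + \<bar>p k - q k\<bar>" by simp
   qed
   also have "\<dots> = \<tau> + (\<Sum>k<N. \<bar>p k - q k\<bar>)" by (simp add: sum.distrib sum_distrib_left[symmetric] sp)
   finally have "CARD('n) * r \<le> CARD('n) * (\<tau> + (\<Sum>k<N. \<bar>p k - q k\<bar>))" by (intro mult_left_mono) auto
   then show "CARD('n) / r * (r * r) \<le> CARD('n) * (\<tau> + (\<Sum>k<N. \<bar>p k - q k\<bar>))" using r by simp
  qed
  finally show ?thesis by simp
 qed
 have "wasserstein \<mu> \<nu> \<le> e + CARD('n) * (\<Sum>k<N. \<bar>p k - q k\<bar>) + \<eta>" if "\<eta> > 0" for \<eta>
 proof -
  define \<tau> where "\<tau> = min (1/2) (\<eta> / CARD('n))"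
  have \<tau>: "0 < \<tau>" "\<tau> < 1" using that by (auto simp: \<tau>_def)
  have "CARD('n) * \<tau> \<le> CARD('n) * (\<eta> / CARD('n))" by (intro mult_left_mono) (auto simp: \<tau>_def)
  then have "CARD('n) * \<tau> \<le> \<eta>" by simp
  then show ?thesis using main[OF \<tau>] by (simp add: distrib_left)
 qed
 then have "wasserstein \<mu> \<nu> \<le> e + CARD('n) * (\<Sum>k<N. \<bar>p k - q k\<bar>)" by (rule field_le_epsilon)
 then show ?thesis by (simp add: p_def q_def)
qed

lemma wasserstein_le_card:
 fixes \<mu> \<nu> :: "'n::finite torus measure"
 assumes "\<mu> \<in> prob_measures" "\<nu> \<in> prob_measures"
 shows "wasserstein \<mu> \<nu> \<le> CARD('n)"
proof -
 have "(\<integral>x. 1 \<partial>\<mu>) = (1 :: real)" "(\<integral>x. 1 \<partial>\<nu>) = (1 :: real)"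
  using prob_space.prob_space[OF prob_measuresD(1)[OF assms(1)]] prob_space.prob_space[OF prob_measuresD(1)[OF assms(2)]] by simp_all
 then show ?thesis
  using wasserstein_le_partition_of_unity[OF assms, of "\<lambda>_ _. 1" "Suc 0" "CARD('n)"] dist_torus_le[where 'm = 'n] by simp
qed

text \<open>Tent functions of radius \<open>2 * \<delta>\<close> around a finite \<delta>-net,
  divided by their sum. Every point is within \<delta> of the net, so the sum is at least
  \<delta>.\<close>

lemma lipschitz_partition_of_unity:
 assumes \<delta>: "\<delta> > 0"
 obtains N \<Lambda> and \<theta> :: "nat => 'n::finite torus => real"
 where "N > 0" "\<Lambda> \<ge> 0" "\<And>k. \<theta> k \<in> borel_measurable borel" "\<And>k x. 0 \<le> \<theta> k x" "\<And>x. (\<Sum>k<N. \<theta> k x) = 1"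
  "\<And>k x y. \<bar>\<theta> k x - \<theta> k y\<bar> \<le> \<Lambda> * dist x y" "\<And>k x y. \<theta> k x * \<theta> k y \<noteq> 0 ==> dist x y \<le> 4 * \<delta>"
proof -
 obtain c where c: "finite c" "UNIV = (\<Union>x\<in>c. ball x \<delta> :: 'n torus set)"
 proof -
  have "UNIV \<subseteq> (\<Union>x\<in>UNIV. ball (x :: 'n torus) \<delta>)" using \<delta> by (auto intro: centre_in_ball[THEN iffD2])
  from compactE_image[OF compact_UNIV_torus _ this]
  obtain C' where "C' \<subseteq> UNIV" "finite C'" "UNIV \<subseteq> (\<Union>x\<in>C'. ball (x :: 'n torus) \<delta>)" by auto
  then show thesis by (intro that[of C']) auto
 qed
 obtain N :: nat and b where b: "c = b ` {i. i < N}"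
  using finite_imp_nat_seg_image_inj_on[OF c(1)] by blast
 have near: "\<exists>k<N. dist x (b k) < \<delta>" for x :: "'n torus"
 proof -
  have "x \<in> (\<Union>x\<in>c. ball x \<delta>)" using c(2) by blast
  then obtain k where "k < N" "x \<in> ball (b k) \<delta>" unfolding b by auto
  then show ?thesis by (auto simp: dist_commute)
 qed
 then have N: "N > 0" by (metis gr_zeroI not_less_zero)
 define h where "h k x = max 0 (2 * \<delta> - dist x (b k))" for k and x :: "'n torus"
 define S where "S x = (\<Sum>k<N. h k x)" for x
 define \<theta> where "\<theta> k x = h k x / S x" for k x
 have hm [measurable]: "h k \<in> borel_measurable borel" for k unfolding h_def by measurable
 have Sm [measurable]: "S \<in> borel_measurable borel" unfolding S_def by measurable
 have h0: "0 \<le> h k x" for k x by (simp add: h_def)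
 have S: "\<delta> \<le> S x" for x
 proof -
  obtain k where k: "k < N" "dist x (b k) < \<delta>" using near by blast
  have "\<delta> \<le> h k x" using k by (simp add: h_def)
  also have "\<dots> \<le> S x" unfolding S_def using k h0 by (intro member_le_sum) auto
  finally show ?thesis .
 qed
 have S0: "0 < S x" for x using S[of x] \<delta> by linarith
 have hl: "\<bar>h k x - h k y\<bar> \<le> dist x y" for k x y
  using dist_triangle[of x "b k" y] dist_triangle[of y "b k" x] by (auto simp: h_def dist_commute max_def abs_le_iff)
 have Sl: "\<bar>S x - S y\<bar> \<le> N * dist x y" for x y
 proof -
  have "\<bar>S x - S y\<bar> \<le> (\<Sum>k<N. \<bar>h k x - h k y\<bar>)" unfolding S_def sum_subtractf[symmetric] by (rule sum_abs)
  also have "\<dots> \<le> (\<Sum>k<N. dist x y)" by (intro sum_mono hl)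
  finally show ?thesis by simp
 qed
 show thesis
 proof (rule that[of N "((1 + 2 * real N) / \<delta>)" \<theta>])
  show "\<theta> k \<in> borel_measurable borel" for k unfolding \<theta>_def by measurable
  show "0 \<le> \<theta> k x" for k x using h0 S0[of x] by (simp add: \<theta>_def)
  show "(\<Sum>k<N. \<theta> k x) = 1" for x
   using S0[of x] by (simp add: \<theta>_def sum_divide_distrib[symmetric] S_def[symmetric])
  show "\<bar>\<theta> k x - \<theta> k y\<bar> \<le> (1 + 2 * real N) / \<delta> * dist x y" for k x y
  proof -
   have hS: "h k y / S y \<le> 2"
   proof -
    have "h k y \<le> 2 * \<delta>" using \<delta> by (simp add: h_def)
    also have "\<dots> \<le> 2 * S y" using S by simp
    finally show ?thesis using S0[of y] by (simp add: divide_le_eq)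
   qed
   have hS0: "0 \<le> h k y / S y" using h0 S0[of y] by simp
   \<comment> \<open>Quotient rule for differences; the coefficient \<open>h k y / S y\<close> is at
     most 2 because a tent is at most \<open>2 * \<delta>\<close> high.\<close>
   have "\<theta> k x - \<theta> k y = ((h k x - h k y) - (h k y / S y) * (S x - S y)) / S x"
    using S0[of x] S0[of y] by (simp add: \<theta>_def field_simps)
   then have "\<bar>\<theta> k x - \<theta> k y\<bar> = \<bar>(h k x - h k y) - (h k y / S y) * (S x - S y)\<bar> / S x"
    using S0[of x] by simp
   also have "\<dots> \<le> (dist x y + 2 * (N * dist x y)) / S x"
   proof (rule divide_right_mono)
    have "\<bar>(h k y / S y) * (S x - S y)\<bar> \<le> 2 * (N * dist x y)"
     unfolding abs_mult using hS hS0 Sl[of x y] by (intro mult_mono) auto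
    then show "\<bar>(h k x - h k y) - (h k y / S y) * (S x - S y)\<bar> \<le> dist x y + 2 * (N * dist x y)"
     using hl[of k x y] by linarith
   qed (use S0[of x] in simp)
   also have "\<dots> \<le> (dist x y + 2 * (N * dist x y)) / \<delta>"
    using S[of x] S0[of x] \<delta> by (intro divide_left_mono) auto
   also have "\<dots> = (1 + 2 * real N) / \<delta> * dist x y" by (simp add: distrib_right)
   finally show ?thesis .
  qed
  show "dist x y \<le> 4 * \<delta>" if "\<theta> k x * \<theta> k y \<noteq> 0" for k x y
  proof -
   have "h k x \<noteq> 0" "h k y \<noteq> 0" using that by (auto simp: \<theta>_def)
   then have "dist x (b k) < 2 * \<delta>" "dist y (b k) < 2 * \<delta>" by (auto simp: h_def max_def split: if_splits)
   then show ?thesis using dist_triangle[of x y "b k"] by (simp add: dist_commute)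
  qed
 qed (use N \<delta> in auto)
qed

text \<open>The tolerance and the Lipschitz constant depend only on \<epsilon> and the dimension,
  not on the measures. This uniformity allows all later parameters to be fixed before the system is
  given.\<close>

lemma wasserstein_le_lipschitz_tests:
 assumes \<epsilon>: "\<epsilon> > 0"
 obtains \<eta> \<Lambda> :: real where "\<eta> > 0" "\<Lambda> \<ge> 0"
  "\<And>\<mu> \<nu> :: 'n::finite torus measure. \<mu> \<in> prob_measures ==> \<nu> \<in> prob_measures ==>
   (\<And>\<psi> :: 'n torus => real. \<psi> \<in> borel_measurable borel ==> (\<And>x. 0 \<le> \<psi> x) ==> (\<And>x. \<psi> x \<le> 1) ==>
    (\<And>x y. \<bar>\<psi> x - \<psi> y\<bar> \<le> \<Lambda> * dist x y) ==> \<bar>(\<integral>x. \<psi> x \<partial>\<mu>) - (\<integral>x. \<psi> x \<partial>\<nu>)\<bar> \<le> \<eta>) ==>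
   wasserstein \<mu> \<nu> \<le> \<epsilon>"
proof -
 have "\<epsilon> / 8 > 0" using \<epsilon> by simp
 then obtain N \<Lambda> and \<theta> :: "nat => 'n torus => real" where \<theta>: "N > 0" "\<Lambda> \<ge> 0"
  "\<And>k. \<theta> k \<in> borel_measurable borel" "\<And>k x. 0 \<le> \<theta> k x" "\<And>x. (\<Sum>k<N. \<theta> k x) = 1"
  "\<And>k x y. \<bar>\<theta> k x - \<theta> k y\<bar> \<le> \<Lambda> * dist x y" "\<And>k x y. \<theta> k x * \<theta> k y \<noteq> 0 ==> dist x y \<le> 4 * (\<epsilon> / 8)"
  by (rule lipschitz_partition_of_unity) blast
 \<comment> \<open>Half of \<epsilon> is spent on the supports, of diameter
   \<open>4 * (\<epsilon> / 8)\<close>, the other half on the \<open>N\<close> tests.\<close>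
 define \<eta> where "\<eta> = \<epsilon> / (2 * CARD('n) * N)"
 show thesis
 proof (rule that[of \<eta> \<Lambda>])
  show "\<eta> > 0" using \<epsilon> \<theta>(1) by (simp add: \<eta>_def)
  fix \<mu> \<nu> :: "'n torus measure"
  assume P: "\<mu> \<in> prob_measures" "\<nu> \<in> prob_measures"
   and test: "\<And>\<psi> :: 'n torus => real. \<psi> \<in> borel_measurable borel ==> (\<And>x. 0 \<le> \<psi> x) ==> (\<And>x. \<psi> x \<le> 1) ==>
    (\<And>x y. \<bar>\<psi> x - \<psi> y\<bar> \<le> \<Lambda> * dist x y) ==> \<bar>(\<integral>x. \<psi> x \<partial>\<mu>) - (\<integral>x. \<psi> x \<partial>\<nu>)\<bar> \<le> \<eta>"
  have "wasserstein \<mu> \<nu> \<le> 4 * (\<epsilon> / 8) + CARD('n) * (\<Sum>k<N. \<bar>(\<integral>x. \<theta> k x \<partial>\<mu>) - (\<integral>x. \<theta> k x \<partial>\<nu>)\<bar>)"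
   by (rule wasserstein_le_partition_of_unity[OF P \<theta>(3,4,5)]) (use \<theta>(7) \<epsilon> in auto)
  also have "(\<Sum>k<N. \<bar>(\<integral>x. \<theta> k x \<partial>\<mu>) - (\<integral>x. \<theta> k x \<partial>\<nu>)\<bar>) \<le> (\<Sum>k<N. \<eta>)"
  proof (rule sum_mono)
   fix k assume "k \<in> {..<N}"
   then have "\<theta> k x \<le> 1" for x
    using member_le_sum[of k "{..<N}" "\<lambda>k. \<theta> k x"] \<theta>(4,5) by simp
   then show "\<bar>(\<integral>x. \<theta> k x \<partial>\<mu>) - (\<integral>x. \<theta> k x \<partial>\<nu>)\<bar> \<le> \<eta>"
    by (rule test[OF \<theta>(3,4) _ \<theta>(6)])
  qed
  also have "4 * (\<epsilon> / 8) + CARD('n) * (\<Sum>k<N. \<eta>) = \<epsilon>"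
   using \<theta>(1) by (simp add: \<eta>_def)
  finally show "wasserstein \<mu> \<nu> \<le> \<epsilon>" by simp
 qed (rule \<theta>(2))
qed

section \<open>Inverse branches\<close>

context expanding_lift
begin

lemma tproj_cube_cover: obtains z where "z \<in> unit_cube" "tproj z = \<o>"
proof -
 obtain n where n: "n \<in> int_vecs" "trep \<o> + n \<in> unit_cube" using unit_cube_unique_translate by blast
 then show thesis by (intro that[of "trep \<o> + n"]) simp_all
qed

lemma tproj_inj_cube: "x \<in> unit_cube ==> y \<in> unit_cube ==> tproj x = tproj y ==> x = y"
proof -
 assume *: "x \<in> unit_cube" "y \<in> unit_cube" "tproj x = tproj y"
 have "\<exists>!n. n \<in> int_vecs \<and> y + n \<in> unit_cube" by (rule unit_cube_unique_translate)
 moreover have "x - y \<in> int_vecs \<and> y + (x - y) \<in> unit_cube" "0 \<in> int_vecs \<and> y + 0 \<in> unit_cube"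
  using * by (auto simp: tproj_eq_iff[symmetric])
 ultimately have "x - y = 0" by blast
 then show "x = y" by simp
qed

lemma cont_torus_jac: "continuous_on UNIV (torus_jac g)"
 by (rule continuous_torusI) (simp add: torus_jac_tproj J_def continuous_on_rabs[OF cont_Jdet])

lemma torus_jac_pos: "torus_jac g \<o> > 0"
 using J_pos[of "trep \<o>"] torus_jac_tproj[of "trep \<o>"] by simp

lemma open_map_g: "open U ==> open (g ` U)"
proof -
 assume U: "open U"
 have "g ` U = tproj ` (H -` (tproj -` U))"
 proof (intro equalityI subsetI)
  fix y assume "y \<in> g ` U"
  then obtain v where v: "v \<in> U" "y = g v" by blast
  then show "y \<in> tproj ` (H -` (tproj -` U))"
   by (intro image_eqI[of _ _ "G (trep v)"]) (simp_all add: lift_eq[symmetric])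
 next
  fix y assume "y \<in> tproj ` (H -` (tproj -` U))"
  then obtain x where x: "tproj (H x) \<in> U" "y = tproj x" by blast
  then show "y \<in> g ` U" by (intro image_eqI[of _ _ "tproj (H x)"]) (simp_all add: lift_eq)
 qed
 then show "open (g ` U)"
  using U by (simp add: open_image_tproj open_vimage continuous_on_tproj contH)
qed

text \<open>Area formula with multiplicity. A point of the torus has one lift in the cube, so the
  sum over \<open>n\<close> counts the preimages under \<open>g\<close> that lie in
  \<open>S\<close>.\<close>

lemma nn_integral_jac:
 assumes [measurable]: "S \<in> sets borel" "\<phi> \<in> borel_measurable borel"
 shows "(\<integral>\<^sup>+v. indicator S v * ennreal (torus_jac g v) * \<phi> (g v) \<partial>haar)
  = (\<integral>\<^sup>+x. \<phi> (tproj x) * (\<integral>\<^sup>+n. indicator {n. H (x + n) \<in> unit_cube \<and> tproj (H (x + n)) \<in> S} n \<partial>count_space int_vecs)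
    * indicator unit_cube x \<partial>lborel)"
proof -
 have [measurable]: "torus_jac g \<in> borel_measurable borel" "H \<in> borel_measurable borel"
  by (rule borel_measurable_continuous_onI, rule cont_torus_jac, rule borel_measurable_continuous_onI, rule contH)
 define \<psi> where "\<psi> y = (indicator S (tproj (H y)) * indicator unit_cube (H y) :: ennreal)" for y
 have [measurable]: "\<psi> \<in> borel_measurable borel" unfolding \<psi>_def by measurable
 have "(\<integral>\<^sup>+v. indicator S v * ennreal (torus_jac g v) * \<phi> (g v) \<partial>haar)
   = (\<integral>\<^sup>+x. indicator S (tproj x) * ennreal (torus_jac g (tproj x)) * \<phi> (g (tproj x)) * indicator unit_cube x \<partial>lborel)"
  by (rule nn_integral_haar) measurable
 also have "\<dots> = (\<integral>\<^sup>+x. ennreal \<bar>det (matrix (DG x))\<bar> * (\<phi> (tproj (G x)) * \<psi> (G x)) \<partial>lborel)"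
  by (rule nn_integral_cong) (simp add: torus_jac_tproj J_def Jdet_def lift_eq \<psi>_def mult_ac)
 also have "\<dots> = (\<integral>\<^sup>+y. \<phi> (tproj y) * \<psi> y \<partial>lborel)"
  by (rule nn_integral_substitution_diffeo[OF derG HG GH contH]) (use cont_Jdet in "simp_all add: Jdet_def[abs_def]")
 also have "\<dots> = (\<integral>\<^sup>+x. \<phi> (tproj x) * (\<integral>\<^sup>+n. \<psi> (x + n) \<partial>count_space int_vecs) * indicator unit_cube x \<partial>lborel)"
  by (rule nn_integral_haar_unfold) measurable
 also have "(\<lambda>x n. \<psi> (x + n)) = (\<lambda>x n. indicator {n. H (x + n) \<in> unit_cube \<and> tproj (H (x + n)) \<in> S} n)"
  by (auto simp: \<psi>_def indicator_def fun_eq_iff)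
 finally show ?thesis .
qed

lemma nn_integral_jac_inj:
 assumes O: "open S" and inj: "inj_on g S" and \<phi> [measurable]: "\<phi> \<in> borel_measurable borel"
 shows "(\<integral>\<^sup>+v. indicator S v * ennreal (torus_jac g v) * \<phi> (g v) \<partial>haar) = (\<integral>\<^sup>+\<o>. \<phi> \<o> * indicator (g ` S) \<o> \<partial>haar)"
proof -
 have [measurable]: "S \<in> sets borel" "g ` S \<in> sets borel" using O open_map_g[OF O] by auto
 have "(\<integral>\<^sup>+n. indicator {n. H (x + n) \<in> unit_cube \<and> tproj (H (x + n)) \<in> S} n \<partial>count_space int_vecs) = (indicator (g ` S) (tproj x) :: ennreal)" for x
 proof (cases "tproj x \<in> g ` S")
  case True
  then obtain v where v: "v \<in> S" "g v = tproj x" by auto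
  obtain z where z: "z \<in> unit_cube" "tproj z = v" by (rule tproj_cube_cover)
  have "tproj (G z) = tproj x" using z(2) v(2) by (simp add: lift_eq[symmetric])
  then have Gz: "G z - x \<in> int_vecs" by (simp add: tproj_eq_iff)
  have "\<exists>!n. n \<in> int_vecs \<and> (H (x + n) \<in> unit_cube \<and> tproj (H (x + n)) \<in> S)"
  proof (rule ex1I[of _ "G z - x"])
   show "G z - x \<in> int_vecs \<and> H (x + (G z - x)) \<in> unit_cube \<and> tproj (H (x + (G z - x))) \<in> S"
    using Gz z v by simp
   fix n assume n: "n \<in> int_vecs \<and> H (x + n) \<in> unit_cube \<and> tproj (H (x + n)) \<in> S"
   have "g (tproj (H (x + n))) = g v" using n v(2) by (simp add: lift_eq)
   then have "tproj (H (x + n)) = v" using inj n v(1) by (simp add: inj_on_eq_iff)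
   then have "H (x + n) = z" using n z by (intro tproj_inj_cube) simp_all
   then show "n = G z - x" using GH[of "x + n"] by (simp add: algebra_simps)
  qed
  from nn_integral_count_space_unique[OF this] show ?thesis using True by simp
 next
  case False
  have "H (x + n) \<in> unit_cube \<and> tproj (H (x + n)) \<in> S \<longleftrightarrow> False" if "n \<in> int_vecs" for n
  proof -
   have "g (tproj (H (x + n))) = tproj x" using that by (simp add: lift_eq)
   then show ?thesis using False by (metis image_eqI)
  qed
  then have "(\<integral>\<^sup>+n. indicator {n. H (x + n) \<in> unit_cube \<and> tproj (H (x + n)) \<in> S} n \<partial>count_space int_vecs) = (\<integral>\<^sup>+n. 0 \<partial>(count_space int_vecs :: (real ^ 'm) measure))"
   by (intro nn_integral_cong) (simp add: indicator_def)
  then show ?thesis using False by simp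
 qed
 then show ?thesis
  by (subst nn_integral_jac) (simp_all add: nn_integral_haar)
qed

text \<open>\<open>g\<close> maps null sets to null sets: outside \<open>V\<close> the preimage
  count in \<open>N\<close> is at least 1, and its integral is the integral of the Jacobian over
  \<open>N\<close>. The image of \<open>N\<close> may fail to be Borel, so the statement is about
  the open set \<open>V\<close>.\<close>

lemma AE_image_null:
 assumes N: "N \<in> null_sets haar" and V: "open V" "- V \<subseteq> g ` N"
 shows "AE \<o> in haar. \<o> \<in> V"
proof -
 have [measurable]: "N \<in> sets borel" "V \<in> sets borel" using N V(1) by (auto simp: null_sets_def)
 have [measurable]: "torus_jac g \<in> borel_measurable borel" "H \<in> borel_measurable borel"
  by (rule borel_measurable_continuous_onI, rule cont_torus_jac, rule borel_measurable_continuous_onI, rule contH)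
 define k where "k x = (\<integral>\<^sup>+n. indicator {n. H (x + n) \<in> unit_cube \<and> tproj (H (x + n)) \<in> N} n \<partial>count_space int_vecs)" for x
 have k1: "k x \<ge> 1" if "tproj x \<notin> V" for x
 proof -
  have "tproj x \<in> g ` N" using that V(2) by blast
  then obtain v where v: "v \<in> N" "g v = tproj x" by (metis imageE)
  obtain z where z: "z \<in> unit_cube" "tproj z = v" by (rule tproj_cube_cover)
  have "tproj (G z) = tproj x" using z(2) v(2) by (simp add: lift_eq[symmetric])
  then have Gz: "G z - x \<in> int_vecs" by (simp add: tproj_eq_iff)
  have "(1 :: ennreal) = (\<integral>\<^sup>+n. indicator {G z - x} n \<partial>count_space int_vecs)"
   using Gz by (subst nn_integral_indicator) auto
  also have "\<dots> \<le> k x"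
   unfolding k_def by (rule nn_integral_mono) (use z v in "auto simp: indicator_def")
  finally show ?thesis .
 qed
 have "emeasure haar (- V) = (\<integral>\<^sup>+\<o>. indicator (- V) \<o> \<partial>haar)" by simp
 also have "\<dots> = (\<integral>\<^sup>+x. indicator (- V) (tproj x) * indicator unit_cube x \<partial>lborel)"
  by (rule nn_integral_haar) measurable
 also have "\<dots> \<le> (\<integral>\<^sup>+x. 1 * k x * indicator unit_cube x \<partial>lborel)"
  by (rule nn_integral_mono) (use k1 in "auto simp: indicator_def")
 also have "\<dots> = (\<integral>\<^sup>+v. indicator N v * ennreal (torus_jac g v) * 1 \<partial>haar)"
  unfolding k_def by (rule nn_integral_jac[of N "\<lambda>_. 1", symmetric]) measurable
 also have "\<dots> = 0"
 proof -
  have "AE v in haar. indicator N v * ennreal (torus_jac g v) * 1 = 0"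
   using AE_not_in[OF N] by eventually_elim simp
  then show ?thesis by (subst nn_integral_0_iff_AE) auto
 qed
 finally show ?thesis by (intro AE_I[of _ _ "- V"]) auto
qed

text \<open>A cell is only Lebesgue measurable, so its inverse branch need not be Borel. It agrees
  almost everywhere with a Borel map into the interior, because the points missed by the interior
  have their branch value in the null boundary.\<close>

lemma inverse_branch_facts:
 assumes part: "full_branch_partition g d I" and j: "j < d"
 shows "\<exists>h. h \<in> borel_measurable borel \<and> (AE \<o> in haar. h \<o> = inv_branch g I j \<o> \<and> h \<o> \<in> interior (I j)) \<and>
  (\<forall>q\<in>borel_measurable borel. (\<integral>\<^sup>+v. indicator (interior (I j)) v * q v \<partial>haar)
    = (\<integral>\<^sup>+\<o>. q (h \<o>) * ennreal (1 / torus_jac g (inv_branch g I j \<o>)) \<partial>haar))"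
proof -
 define S where "S = interior (I j)"
 have bij: "bij_betw g (I j) UNIV" and null: "I j - S \<in> null_sets (completion haar)"
  using part j by (auto simp: full_branch_partition_def S_def)
 have SI: "S \<subseteq> I j" by (simp add: S_def interior_subset)
 have S: "open S" by (simp add: S_def)
 have injI: "inj_on g (I j)" using bij by (simp add: bij_betw_def)
 then have inj: "inj_on g S" using SI by (rule inj_on_subset)
 have og: "open (g ` S)" by (rule open_map_g[OF S])
 note [measurable] = borel_open[OF og] borel_open[OF S]
 define b where "b = inv_branch g I j"
 have bg: "b (g v) = v" if "v \<in> I j" for v using injI that by (simp add: b_def inv_branch_def)
 have gb: "g (b \<o>) = \<o>" for \<o> using bij by (simp add: b_def inv_branch_def bij_betw_inv_into_right)
 \<comment> \<open>On the open image of the interior this is the branch. Preimages of open sets are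
   images of open sets under the open map \<open>g\<close>, up to the exceptional constant
   value.\<close>
 define h where "h = (\<lambda>\<o>. if \<o> \<in> g ` S then b \<o> else undefined)"
 have h: "h \<in> borel_measurable borel"
 proof (rule borel_measurableI)
  fix U :: "'m torus set" assume U: "open U"
  have "h -` U = g ` (S \<inter> U) \<union> (if undefined \<in> U then - g ` S else {})"
  proof (rule set_eqI)
   fix \<o>
   show "\<o> \<in> h -` U \<longleftrightarrow> \<o> \<in> g ` (S \<inter> U) \<union> (if undefined \<in> U then - g ` S else {})"
   proof (cases "\<o> \<in> g ` S")
    case True
    then obtain v where v: "v \<in> S" "\<o> = g v" by (metis imageE)
    have "b (g v) = v" using v(1) SI bg by blast
    then have "h \<o> = v" using True v by (simp add: h_def)
    moreover have "\<o> \<in> g ` (S \<inter> U) \<longleftrightarrow> v \<in> U"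
     unfolding v(2) using inj_on_image_mem_iff[OF inj v(1), of "S \<inter> U"] v(1) by simp
    ultimately show ?thesis using True by simp
   next
    case False
    then have "\<o> \<notin> g ` (S \<inter> U)" by blast
    with False show ?thesis by (simp add: h_def)
   qed
  qed
  moreover have "open (g ` (S \<inter> U))" by (intro open_map_g open_Int S U)
  ultimately show "h -` U \<inter> space borel \<in> sets borel" using og by auto
 qed
 obtain N where N: "N \<in> null_sets haar" "I j - S \<subseteq> N"
  using null by (auto simp: null_sets_completion_iff2)
 have "- (g ` S) \<subseteq> g ` N"
 proof
  fix \<o> assume \<o>: "\<o> \<in> - (g ` S)"
  have "b \<o> \<in> I j" using bij by (metis b_def inv_branch_def UNIV_I bij_betw_imp_surj_on inv_into_into)
  moreover have "b \<o> \<notin> S" using \<o> gb[of \<o>] by (metis ComplD image_eqI)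
  ultimately show "\<o> \<in> g ` N" using N(2) gb[of \<o>] by (metis DiffI image_eqI subsetD)
 qed
 from AE_image_null[OF N(1) og this] have ae: "AE \<o> in haar. \<o> \<in> g ` S" .
 have "AE \<o> in haar. h \<o> = b \<o> \<and> h \<o> \<in> S"
  using ae by eventually_elim (use bg SI in "auto simp: h_def")
 moreover have "(\<integral>\<^sup>+v. indicator S v * q v \<partial>haar) = (\<integral>\<^sup>+\<o>. q (h \<o>) * ennreal (1 / torus_jac g (b \<o>)) \<partial>haar)"
  if q [measurable]: "q \<in> borel_measurable borel" for q
 proof -
  note [measurable] = h borel_measurable_continuous_onI[OF cont_torus_jac]
  have "(\<integral>\<^sup>+v. indicator S v * q v \<partial>haar) = (\<integral>\<^sup>+v. indicator S v * ennreal (torus_jac g v) * (q (h (g v)) * ennreal (1 / torus_jac g (h (g v)))) \<partial>haar)"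
  proof (rule nn_integral_cong)
   fix v :: "'m torus"
   show "indicator S v * q v = indicator S v * ennreal (torus_jac g v) * (q (h (g v)) * ennreal (1 / torus_jac g (h (g v))))"
   proof (cases "v \<in> S")
    case True
    then have "h (g v) = v" using bg SI by (auto simp: h_def)
    moreover have "ennreal (torus_jac g v) * ennreal (1 / torus_jac g v) = 1"
     using torus_jac_pos[of v] by (simp add: ennreal_mult'[symmetric])
    ultimately show ?thesis using True by (simp add: mult.assoc mult.left_commute)
   qed simp
  qed
  also have "\<dots> = (\<integral>\<^sup>+\<o>. (q (h \<o>) * ennreal (1 / torus_jac g (h \<o>))) * indicator (g ` S) \<o> \<partial>haar)"
   by (rule nn_integral_jac_inj[OF S inj]) measurable
  also have "\<dots> = (\<integral>\<^sup>+\<o>. q (h \<o>) * ennreal (1 / torus_jac g (b \<o>)) \<partial>haar)"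
   by (rule nn_integral_cong_AE) (use ae in "eventually_elim, simp add: h_def")
  finally show ?thesis .
 qed
 ultimately show ?thesis using h unfolding S_def b_def by blast
qed

end

section \<open>Masses of the cells\<close>

text \<open>Used for integrands involving cells and inverse branches, which equal Borel functions
  only almost everywhere.\<close>

lemma borel_measurable_completion_AE:
 fixes u v :: "'a => real"
 assumes u: "u \<in> borel_measurable M" and ae: "AE x in M. v x = u x"
 shows "v \<in> borel_measurable (completion M)"
proof (rule borel_measurableI_greater)
 fix c
 define S where "S = space (completion M)"
 have e1: "AE x in M. \<not> (v x \<noteq> u x)" using ae by eventually_elim simp
 have e2: "AE x in M. \<not> (c < v x \<and> v x \<noteq> u x)" using ae by eventually_elim simp
 have "u -` {c<..} \<inter> S \<in> sets (completion M)"
  unfolding S_def by (rule measurable_sets[OF measurable_completion[OF u]]) simp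
 moreover have "{x \<in> S. v x \<noteq> u x} \<in> sets (completion M)"
  using sets_completion_AE[OF e1] by (simp only: pred_def S_def)
 moreover have "{x \<in> S. c < v x \<and> v x \<noteq> u x} \<in> sets (completion M)"
  using sets_completion_AE[OF e2] by (simp only: pred_def S_def)
 ultimately have "(u -` {c<..} \<inter> S - {x \<in> S. v x \<noteq> u x}) \<union> {x \<in> S. c < v x \<and> v x \<noteq> u x} \<in> sets (completion M)"
  by (intro sets.Un sets.Diff)
 moreover have "(u -` {c<..} \<inter> S - {x \<in> S. v x \<noteq> u x}) \<union> {x \<in> S. c < v x \<and> v x \<noteq> u x} = {x \<in> S. c < v x}"
  by (rule set_eqI) (simp only: Un_iff Diff_iff Int_iff vimage_eq greaterThan_iff mem_Collect_eq, metis)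
 ultimately show "{x \<in> space (completion M). c < v x} \<in> sets (completion M)" by (simp only: S_def)
qed

text \<open>The average densities of two nearby sets are comparable. Integrate over pairs consisting
  of a point of \<open>A\<close> and a translate of it in \<open>B\<close>: only translations of
  length at most \<open>r\<close> contribute, and for these \<open>acip_shift_le\<close> moves the
  density from the first point to the second.\<close>

lemma (in lifted_rotations) acip_cell_le:
 assumes ac: "acip_density g \<rho>" and [measurable]: "A \<in> sets borel" "B \<in> sets borel"
  and near: "\<And>x y. x \<in> A ==> y \<in> B ==> dist x y \<le> r"
 shows "measure (density haar \<rho>) A * measure haar B \<le> exp (a * r) * (measure haar A * measure (density haar \<rho>) B)"
proof -
 have [measurable]: "\<rho> \<in> borel_measurable borel" and \<rho>0: "\<And>\<o>. 0 \<le> \<rho> \<o>" and P: "prob_space (density haar \<rho>)"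
  using ac by (auto simp: acip_density_def)
 interpret P: prob_space "density haar \<rho>" by (rule P)
 interpret uc: prob_space "ucube :: (real ^ 'm) measure" by (rule prob_ucube)
 interpret pair_sigma_finite "haar :: 'm torus measure" "ucube :: (real ^ 'm) measure" ..
 have emP: "emeasure (density haar \<rho>) S = (\<integral>\<^sup>+\<o>. ennreal (\<rho> \<o>) * indicator S \<o> \<partial>haar)" if "S \<in> sets borel" for S
  by (rule emeasure_density) (use that in auto)
 have int: "(\<integral>\<^sup>+\<o>. ennreal (\<rho> \<o> * h \<o>) \<partial>haar) = ennreal (\<integral>\<o>. \<rho> \<o> * h \<o> \<partial>haar)"
  if [measurable]: "h \<in> borel_measurable borel" and h: "\<And>\<o>. 0 \<le> h \<o>" "\<And>\<o>. h \<o> \<le> 1" for h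
 proof (rule nn_integral_eq_integral)
  show "integrable haar (\<lambda>\<o>. \<rho> \<o> * h \<o>)"
   by (rule Bochner_Integration.integrable_bound[OF acip_density_integrable(1)[OF ac]])
    (use \<rho>0 h in "auto simp: abs_mult mult_left_le")
 qed (use \<rho>0 h in auto)
 have inner: "(\<integral>\<^sup>+\<o>. ennreal (\<rho> \<o>) * indicator A \<o> * indicator B (tshift w \<o>) \<partial>haar)
   \<le> ennreal (exp (a * r)) * (\<integral>\<^sup>+\<o>. ennreal (\<rho> (tshift w \<o>)) * indicator A \<o> * indicator B (tshift w \<o>) \<partial>haar)"
  for w :: "real ^ 'm"
 proof (cases "torus_norm w \<le> r")
  case True
  obtain w' where w': "tshift w = tshift w'" "norm w' = torus_norm w" by (rule torus_norm_representative)
  define h :: "'m torus => real" where "h = (\<lambda>\<o>. indicator A (tshift (- w) \<o>) * indicator B \<o>)"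
  have [measurable]: "h \<in> borel_measurable borel" unfolding h_def by measurable
  have h: "0 \<le> h \<o>" "h \<o> \<le> 1" for \<o> by (auto simp: h_def indicator_def)
  have hs: "h (tshift w \<o>) = indicator A \<o> * indicator B (tshift w \<o>)" for \<o> by (simp add: h_def tshift_add)
  have e: "ennreal (\<rho> u * h (tshift w \<o>)) = ennreal (\<rho> u) * indicator A \<o> * indicator B (tshift w \<o>)" for u \<o>
   unfolding hs by (simp add: indicator_def)
  have "(\<integral>\<o>. \<rho> \<o> * h (tshift w \<o>) \<partial>haar) \<le> exp (a * norm w') * (\<integral>\<o>. \<rho> \<o> * h \<o> \<partial>haar)"
   unfolding w'(1) by (rule acip_shift_le[OF ac _ h]) measurable
  also have "\<dots> \<le> exp (a * r) * (\<integral>\<o>. \<rho> \<o> * h \<o> \<partial>haar)"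
   using True w'(2) a_nonneg \<rho>0 h by (intro mult_right_mono Bochner_Integration.integral_nonneg) (auto simp: mult_left_mono)
  finally have le: "(\<integral>\<o>. \<rho> \<o> * h (tshift w \<o>) \<partial>haar) \<le> exp (a * r) * (\<integral>\<o>. \<rho> \<o> * h \<o> \<partial>haar)" .
  have "(\<integral>\<^sup>+\<o>. ennreal (\<rho> \<o>) * indicator A \<o> * indicator B (tshift w \<o>) \<partial>haar) = (\<integral>\<^sup>+\<o>. ennreal (\<rho> \<o> * h (tshift w \<o>)) \<partial>haar)"
   by (simp only: e)
  also have "\<dots> = ennreal (\<integral>\<o>. \<rho> \<o> * h (tshift w \<o>) \<partial>haar)" by (rule int) (use h in auto)
  also have "\<dots> \<le> ennreal (exp (a * r) * (\<integral>\<o>. \<rho> \<o> * h \<o> \<partial>haar))" by (rule ennreal_leI[OF le])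
  also have "\<dots> = ennreal (exp (a * r)) * (\<integral>\<^sup>+\<o>. ennreal (\<rho> \<o> * h \<o>) \<partial>haar)"
   by (subst int) (use h in "auto simp: ennreal_mult'")
  also have "(\<integral>\<^sup>+\<o>. ennreal (\<rho> \<o> * h \<o>) \<partial>haar) = (\<integral>\<^sup>+\<o>. ennreal (\<rho> (tshift w \<o>) * h (tshift w \<o>)) \<partial>haar)"
   by (rule nn_integral_haar_tshift(1)[symmetric]) measurable
  finally show ?thesis by (simp only: e)
 next
  case False
  have "indicator A \<o> * indicator B (tshift w \<o>) = (0 :: ennreal)" for \<o>
  proof -
   have "\<not> (\<o> \<in> A \<and> tshift w \<o> \<in> B)" using near[of \<o> "tshift w \<o>"] False by (auto simp: torus_norm_eq)
   then show ?thesis by (auto simp: indicator_def)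
  qed
  then have "(\<integral>\<^sup>+\<o>. ennreal (\<rho> \<o>) * indicator A \<o> * indicator B (tshift w \<o>) \<partial>haar) = (\<integral>\<^sup>+\<o>. 0 \<partial>(haar :: 'm torus measure))"
   by (intro nn_integral_cong) (simp only: mult.assoc mult_zero_right)
  then show ?thesis by simp
 qed
 have "emeasure (density haar \<rho>) A * emeasure haar B
   = (\<integral>\<^sup>+\<o>. ennreal (\<rho> \<o>) * indicator A \<o> * emeasure haar B \<partial>haar)"
  by (subst emP) (auto simp: nn_integral_multc)
 also have "\<dots> = (\<integral>\<^sup>+\<o>. \<integral>\<^sup>+w. ennreal (\<rho> \<o>) * indicator A \<o> * indicator B (tshift w \<o>) \<partial>ucube \<partial>haar)"
 proof (rule nn_integral_cong)
  fix \<o> :: "'m torus"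
  have "emeasure haar B = (\<integral>\<^sup>+w. indicator B (tshift w \<o>) \<partial>ucube)" by (simp add: nn_integral_ucube_tshift)
  then show "ennreal (\<rho> \<o>) * indicator A \<o> * emeasure haar B = (\<integral>\<^sup>+w. ennreal (\<rho> \<o>) * indicator A \<o> * indicator B (tshift w \<o>) \<partial>ucube)"
   by (simp add: nn_integral_cmult)
 qed
 also have "\<dots> = (\<integral>\<^sup>+w. \<integral>\<^sup>+\<o>. ennreal (\<rho> \<o>) * indicator A \<o> * indicator B (tshift w \<o>) \<partial>haar \<partial>ucube)"
  by (rule Fubini'[symmetric]) measurable
 also have "\<dots> \<le> (\<integral>\<^sup>+w. ennreal (exp (a * r)) * (\<integral>\<^sup>+\<o>. ennreal (\<rho> (tshift w \<o>)) * indicator A \<o> * indicator B (tshift w \<o>) \<partial>haar) \<partial>ucube)"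
  by (rule nn_integral_mono) (rule inner)
 also have "\<dots> = ennreal (exp (a * r)) * (\<integral>\<^sup>+w. \<integral>\<^sup>+\<o>. ennreal (\<rho> (tshift w \<o>)) * indicator A \<o> * indicator B (tshift w \<o>) \<partial>haar \<partial>ucube)"
  by (rule nn_integral_cmult) measurable
 also have "(\<integral>\<^sup>+w. \<integral>\<^sup>+\<o>. ennreal (\<rho> (tshift w \<o>)) * indicator A \<o> * indicator B (tshift w \<o>) \<partial>haar \<partial>ucube)
   = (\<integral>\<^sup>+\<o>. \<integral>\<^sup>+w. ennreal (\<rho> (tshift w \<o>)) * indicator A \<o> * indicator B (tshift w \<o>) \<partial>ucube \<partial>haar)"
  by (rule Fubini') measurable
 also have "\<dots> = (\<integral>\<^sup>+\<o>. indicator A \<o> * emeasure (density haar \<rho>) B \<partial>haar)"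
 proof (rule nn_integral_cong)
  fix \<o> :: "'m torus"
  have "emeasure (density haar \<rho>) B = (\<integral>\<^sup>+w. ennreal (\<rho> (tshift w \<o>)) * indicator B (tshift w \<o>) \<partial>ucube)"
   unfolding emP[OF assms(3)] by (rule nn_integral_ucube_tshift[symmetric]) measurable
  then show "(\<integral>\<^sup>+w. ennreal (\<rho> (tshift w \<o>)) * indicator A \<o> * indicator B (tshift w \<o>) \<partial>ucube) = indicator A \<o> * emeasure (density haar \<rho>) B"
   by (simp add: nn_integral_cmult[symmetric] mult_ac)
 qed
 also have "\<dots> = emeasure haar A * emeasure (density haar \<rho>) B" by (simp add: nn_integral_multc)
 finally have "ennreal (measure (density haar \<rho>) A * measure haar B) \<le> ennreal (exp (a * r) * (measure haar A * measure (density haar \<rho>) B))"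
  by (simp add: P.emeasure_eq_measure haar.emeasure_eq_measure ennreal_mult'[symmetric])
 then show ?thesis by (subst (asm) ennreal_le_iff) auto
qed

text \<open>\<kappa> bounds the diameters of the cells and becomes \<open>K / \<sigma>\<close>. The
  last assumption supplies, for each branch, a Borel version together with its change of
  variables.\<close>

locale branch_system = skew_system g \<sigma> a f L
 for g :: "'m::finite torus => 'm torus" and \<sigma> a :: real
  and f :: "'m torus \<times> 'n::finite torus => 'n torus" and L :: real +
 fixes \<rho> :: "'m torus => real" and d :: nat and I :: "nat => 'm torus set" and D \<kappa> :: real
 assumes ac: "acip_density g \<rho>" and part: "full_branch_partition g d I" and bd: "bounded_distortion D g d I"
  and D_nonneg: "D \<ge> 0" and jac_pos: "\<And>\<o>. torus_jac g \<o> > 0"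
  and diam: "\<And>i x y. i < d ==> x \<in> I i ==> y \<in> I i ==> dist x y \<le> \<kappa>"
  and branch: "\<And>j. j < d ==> \<exists>h. h \<in> borel_measurable borel \<and>
   (AE \<o> in haar. h \<o> = inv_branch g I j \<o> \<and> h \<o> \<in> interior (I j)) \<and>
   (\<forall>q\<in>borel_measurable borel. (\<integral>\<^sup>+v. indicator (interior (I j)) v * q v \<partial>haar)
     = (\<integral>\<^sup>+\<o>. q (h \<o>) * ennreal (1 / torus_jac g (inv_branch g I j \<o>)) \<partial>haar))"
begin

abbreviation cell :: "nat => 'm torus set" where "cell j \<equiv> interior (I j)"

abbreviation P :: "'m torus measure" where "P \<equiv> density haar \<rho>"

abbreviation mass :: "nat => real" where "mass \<equiv> cell_mass \<rho> I"

abbreviation weight :: "nat => nat => real" where "weight \<equiv> cell_weight g \<rho> I"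

definition jac_inv :: "nat => 'm torus => real" where "jac_inv j \<o> = torus_jac g (inv_branch g I j \<o>)"

lemma rho_meas [measurable]: "\<rho> \<in> borel_measurable borel" and rho_ge_0: "0 \<le> \<rho> \<o>" and prob_P: "prob_space P"
 and P_invariant: "distr P borel g = P"
 using ac unfolding acip_density_def by blast+

sublocale P: prob_space P by (rule prob_P)

lemma cell_measurable [measurable]: "cell j \<in> sets borel" by simp

lemma jac_inv_pos: "jac_inv j \<o> > 0" by (simp add: jac_inv_def jac_pos)

lemma jac_inv_le: "j < d ==> jac_inv j \<o> \<le> exp (D * dist \<o> \<o>') * jac_inv j \<o>'"
 using bd jac_inv_pos[of j \<o>'] unfolding bounded_distortion_def jac_inv_def[symmetric] by (simp add: divide_le_eq)

lemma jac_inv_measurable: "j < d ==> jac_inv j \<in> borel_measurable borel"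
proof -
 assume "j < d"
 then have "jac_inv j \<in> log_lipschitz D"
  using bd jac_inv_pos unfolding bounded_distortion_def log_lipschitz_def jac_inv_def by simp
 then show ?thesis by (rule log_lipschitz_facts(3)[OF _ D_nonneg])
qed

lemma inv_branch_right: "j < d ==> g (inv_branch g I j \<o>) = \<o>"
 using part by (auto simp: full_branch_partition_def inv_branch_def bij_betw_inv_into_right)

lemma nn_integral_branch:
 assumes j: "j < d" and [measurable]: "\<phi> \<in> borel_measurable borel"
 shows "(\<integral>\<^sup>+v. indicator (cell j) v * \<phi> (g v) \<partial>haar) = (\<integral>\<^sup>+\<o>. \<phi> \<o> * ennreal (1 / jac_inv j \<o>) \<partial>haar)"
proof -
 obtain h where h: "AE \<o> in haar. h \<o> = inv_branch g I j \<o> \<and> h \<o> \<in> cell j"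
  "\<And>q. q \<in> borel_measurable borel ==> (\<integral>\<^sup>+v. indicator (cell j) v * q v \<partial>haar) = (\<integral>\<^sup>+\<o>. q (h \<o>) * ennreal (1 / jac_inv j \<o>) \<partial>haar)"
  using branch[OF j] unfolding jac_inv_def by blast
 have "(\<integral>\<^sup>+v. indicator (cell j) v * \<phi> (g v) \<partial>haar) = (\<integral>\<^sup>+\<o>. \<phi> (g (h \<o>)) * ennreal (1 / jac_inv j \<o>) \<partial>haar)"
  by (rule h(2)) measurable
 also have "\<dots> = (\<integral>\<^sup>+\<o>. \<phi> \<o> * ennreal (1 / jac_inv j \<o>) \<partial>haar)"
  by (rule nn_integral_cong_AE) (use h(1) in "eventually_elim, simp add: inv_branch_right[OF j]")
 finally show ?thesis .
qed

lemma d_pos: "d > 0"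
 using part by (auto simp: full_branch_partition_def intro: gr_zeroI)

lemma cell_subset: "cell j \<subseteq> I j" by (rule interior_subset)

lemma disjoint_cells: "disjoint_family_on cell {..<d}"
 using part cell_subset unfolding full_branch_partition_def disjoint_family_on_def by blast

lemma null_boundary: "i < d ==> I i - cell i \<in> null_sets (completion haar)"
 using part by (simp add: full_branch_partition_def)

lemma AE_cells: "AE \<o> in haar. \<o> \<in> (\<Union>i<d. cell i)"
proof -
 have "AE \<o> in completion haar. \<forall>i\<in>{..<d}. \<o> \<notin> I i - cell i"
  by (intro AE_finite_allI finite_lessThan AE_not_in null_boundary) simp
 then have "AE \<o> in haar. \<forall>i\<in>{..<d}. \<o> \<notin> I i - cell i" by (simp add: AE_completion_iff)
 then show ?thesis
 proof eventually_elim
  case (elim \<o>)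
  have "\<o> \<in> (\<Union>i<d. I i)" using part by (simp add: full_branch_partition_def)
  then obtain i where "i < d" "\<o> \<in> I i" by blast
  then show ?case using elim by blast
 qed
qed

lemma nn_integral_cells:
 assumes [measurable]: "h \<in> borel_measurable borel"
 shows "(\<integral>\<^sup>+\<o>. h \<o> \<partial>haar) = (\<Sum>i<d. \<integral>\<^sup>+\<o>. indicator (cell i) \<o> * h \<o> \<partial>haar)"
proof -
 have "(\<Sum>i<d. indicator (cell i) \<o> * h \<o>) = h \<o>" if m: "\<o> \<in> (\<Union>i<d. cell i)" for \<o>
 proof -
  obtain i where i: "i < d" "\<o> \<in> cell i" using m by blast
  have "k \<noteq> i ==> k < d ==> \<o> \<notin> cell k" for k
   using disjoint_cells i unfolding disjoint_family_on_def by blast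
  then have "(\<Sum>k<d. indicator (cell k) \<o> * h \<o>) = (\<Sum>k<d. if k = i then h \<o> else 0)"
   using i by (intro sum.cong) auto
  then show ?thesis using i by simp
 qed
 then have "(\<integral>\<^sup>+\<o>. h \<o> \<partial>haar) = (\<integral>\<^sup>+\<o>. (\<Sum>i<d. indicator (cell i) \<o> * h \<o>) \<partial>haar)"
  by (intro nn_integral_cong_AE) (use AE_cells in eventually_elim, simp)
 also have "\<dots> = (\<Sum>i<d. \<integral>\<^sup>+\<o>. indicator (cell i) \<o> * h \<o> \<partial>haar)" by (rule nn_integral_sum) measurable
 finally show ?thesis .
qed

text \<open>The interior is nonempty because the Borel branch takes values in it almost everywhere;
  open nonempty sets have positive mass.\<close>

lemma haar_cell_pos: "j < d ==> measure haar (cell j) > 0"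
proof -
 assume j: "j < d"
 obtain h where "AE \<o> in haar. h \<o> = inv_branch g I j \<o> \<and> h \<o> \<in> cell j" using branch[OF j] by blast
 then have ae: "AE \<o> in (haar :: 'm torus measure). \<not> cell j = {}" by eventually_elim blast
 have "cell j \<noteq> {}"
 proof
  assume "cell j = {}"
  then have "emeasure (haar :: 'm torus measure) {\<o> \<in> space haar. cell j = {}} = 0" using ae by (intro emeasure_eq_0_AE)
  then show False using \<open>cell j = {}\<close> emeasure_haar_UNIV[where 'm = 'm] by simp
 qed
 then have "emeasure haar (cell j) > 0" by (intro emeasure_haar_open_pos) auto
 then show ?thesis by (simp add: haar.emeasure_eq_measure)
qed

lemma cell_mass_eq: "i < d ==> mass i = measure P (cell i)"
proof -
 assume i: "i < d"
 obtain N where N: "N \<in> null_sets haar" "I i - cell i \<subseteq> N"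
  using null_boundary[OF i] by (auto simp: null_sets_completion_iff2)
 have "AE \<o> in haar. \<o> \<in> N \<longrightarrow> ennreal (\<rho> \<o>) = 0" using AE_not_in[OF N(1)] by eventually_elim simp
 moreover have "N \<in> sets haar" using N(1) by blast
 moreover have "(\<lambda>\<o>. ennreal (\<rho> \<o>)) \<in> borel_measurable haar" by measurable
 ultimately have "N \<in> null_sets P" using null_sets_density_iff by blast
 then have null: "I i - cell i \<in> null_sets (completion P)"
  using N(2) null_sets_completion_iff2 by blast
 have "mass i = measure (completion P) (cell i \<union> (I i - cell i))"
  using cell_subset[of i] by (simp add: cell_mass_def Un_absorb1)
 also have "\<dots> = measure (completion P) (cell i)"
  by (rule measure_Un_null_set[OF _ null]) simp
 finally show ?thesis by simp
qed

text \<open>Comparing the cell with the whole torus shows that the invariant density cannot vanish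
  on it; this legitimises all divisions by \<open>mass i\<close>.\<close>

lemma cell_mass_pos: "i < d ==> mass i > 0"
proof -
 assume i: "i < d"
 have "measure P UNIV * measure haar (cell i) \<le> exp (a * CARD('m)) * (measure haar (UNIV :: 'm torus set) * measure P (cell i))"
  by (rule acip_cell_le[OF ac]) (auto simp: dist_torus_le)
 moreover have "measure haar (UNIV :: 'm torus set) = 1" using emeasure_haar_UNIV[where 'm = 'm] by (simp add: measure_def)
 moreover have "measure P UNIV = 1" using P.prob_space by simp
 ultimately have "0 < exp (a * CARD('m)) * measure P (cell i)" using haar_cell_pos[OF i] by simp
 then show ?thesis by (simp add: cell_mass_eq[OF i] zero_less_mult_iff)
qed

lemma AE_P: "(AE \<o> in haar. Q \<o>) ==> AE \<o> in P. Q \<o>"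
 by (subst AE_density) (auto elim: eventually_mono)

lemma sum_measure_P:
 assumes [measurable]: "S \<in> sets borel" and t: "t \<in> borel_measurable borel" and ae: "AE \<o> in P. t \<o> \<in> (\<Union>i<d. cell i)"
 shows "(\<Sum>i<d. measure P (S \<inter> t -` cell i)) = measure P S"
proof -
 note [measurable] = t
 have m: "S \<inter> t -` cell i \<in> sets P" for i
  using measurable_sets_borel[OF t, of "cell i"] by (simp add: sets.Int)
 have "(\<Sum>i<d. measure P (S \<inter> t -` cell i)) = measure P (\<Union>i<d. S \<inter> t -` cell i)"
  by (rule P.finite_measure_finite_Union[symmetric]) (use m disjoint_cells in "auto simp: disjoint_family_on_def")
 also have "\<dots> = measure P S"
 proof (rule P.finite_measure_eq_AE)
  show "AE \<o> in P. (\<o> \<in> (\<Union>i<d. S \<inter> t -` cell i)) = (\<o> \<in> S)" using ae by eventually_elim auto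
  show "(\<Union>i<d. S \<inter> t -` cell i) \<in> sets P" using m by blast
 qed simp
 finally show ?thesis .
qed

lemma sum_cell_mass: "(\<Sum>i<d. mass i) = 1"
proof -
 have "(\<Sum>i<d. measure P (UNIV \<inter> (\<lambda>\<o>. \<o>) -` cell i)) = measure P UNIV"
  by (rule sum_measure_P) (use AE_P[OF AE_cells] in auto)
 then show ?thesis using P.prob_space by (simp add: cell_mass_eq)
qed

lemma vimage_g_cell [measurable]: "g -` cell i \<in> sets borel"
 using measurable_sets_borel[OF g_meas, of "cell i"] by simp

text \<open>Almost every point is sent into the interior of some cell; by invariance this follows
  from the same statement for the point itself.\<close>

lemma sum_transition: "j < d ==> (\<Sum>i<d. measure P (cell j \<inter> g -` cell i)) = mass j"
proof -
 assume j: "j < d"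
 have "AE \<o> in distr P borel g. \<o> \<in> (\<Union>i<d. cell i)" unfolding P_invariant by (rule AE_P[OF AE_cells])
 then have "AE \<o> in P. g \<o> \<in> (\<Union>i<d. cell i)" by (subst (asm) AE_distr_iff) auto
 from sum_measure_P[OF _ g_meas this, of "cell j"] show ?thesis by (simp add: cell_mass_eq[OF j])
qed

text \<open>The change of variables along branch \<open>j\<close> identifies the weights with
  conditional probabilities of the previous cell given the present one. Together with
  \<open>sum_transition\<close> this makes the vector of masses stationary.\<close>

lemma cell_weight_eq:
 assumes i: "i < d" and j: "j < d"
 shows "mass i * weight i j = measure P (cell j \<inter> g -` cell i)"
proof -
 obtain h where hm [measurable]: "h \<in> borel_measurable borel"
  and h: "AE \<o> in haar. h \<o> = inv_branch g I j \<o> \<and> h \<o> \<in> cell j"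
  "\<And>q. q \<in> borel_measurable borel ==> (\<integral>\<^sup>+v. indicator (cell j) v * q v \<partial>haar) = (\<integral>\<^sup>+\<o>. q (h \<o>) * ennreal (1 / jac_inv j \<o>) \<partial>haar)"
  using branch[OF j] unfolding jac_inv_def by blast
 note [measurable] = jac_inv_measurable[OF j]
 define u where "u \<o> = indicator (cell i) \<o> * (\<rho> (h \<o>) / jac_inv j \<o>)" for \<o>
 have [measurable]: "u \<in> borel_measurable borel" unfolding u_def by measurable
 have u0: "0 \<le> u \<o>" for \<o> using rho_ge_0 jac_inv_pos[of j \<o>] by (simp add: u_def)
 have ae: "AE \<o> in completion haar. indicator (I i) \<o> *\<^sub>R (\<rho> (inv_branch g I j \<o>) / torus_jac g (inv_branch g I j \<o>)) = u \<o>"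
  using AE_completion[OF h(1)] AE_not_in[OF null_boundary[OF i]]
 proof eventually_elim
  case (elim \<o>)
  then have "indicator (I i) \<o> = (indicator (cell i) \<o> :: real)" using cell_subset[of i] by (auto simp: indicator_def)
  then show ?case using elim by (simp add: u_def jac_inv_def)
 qed
 have um: "u \<in> borel_measurable (completion haar)" by (rule measurable_completion) simp
 have vm: "(\<lambda>\<o>. indicator (I i) \<o> *\<^sub>R (\<rho> (inv_branch g I j \<o>) / torus_jac g (inv_branch g I j \<o>))) \<in> borel_measurable (completion haar)"
  by (rule borel_measurable_completion_AE[of u]) (use ae in "simp_all add: AE_completion_iff")
 have "(LINT \<o>:I i|completion haar. \<rho> (inv_branch g I j \<o>) / torus_jac g (inv_branch g I j \<o>)) = (\<integral>\<o>. u \<o> \<partial>completion haar)"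
  unfolding set_lebesgue_integral_def by (rule integral_cong_AE[OF vm um ae])
 also have "\<dots> = (\<integral>\<o>. u \<o> \<partial>haar)" by (rule integral_completion) simp
 also have "\<dots> = enn2real (\<integral>\<^sup>+\<o>. ennreal (u \<o>) \<partial>haar)" by (rule integral_eq_nn_integral) (use u0 in auto)
 also have "(\<integral>\<^sup>+\<o>. ennreal (u \<o>) \<partial>haar) = (\<integral>\<^sup>+\<o>. (ennreal (\<rho> (h \<o>)) * indicator (cell i) (g (h \<o>))) * ennreal (1 / jac_inv j \<o>) \<partial>haar)"
 proof (rule nn_integral_cong_AE)
  show "AE \<o> in haar. ennreal (u \<o>) = (ennreal (\<rho> (h \<o>)) * indicator (cell i) (g (h \<o>))) * ennreal (1 / jac_inv j \<o>)"
   using h(1)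
  proof eventually_elim
   case (elim \<o>)
   then have "g (h \<o>) = \<o>" by (simp add: inv_branch_right[OF j])
   then show ?case using rho_ge_0[of "h \<o>"] jac_inv_pos[of j \<o>]
    by (auto simp: u_def indicator_def ennreal_mult'[symmetric])
  qed
 qed
 also have "\<dots> = (\<integral>\<^sup>+v. indicator (cell j) v * (ennreal (\<rho> v) * indicator (cell i) (g v)) \<partial>haar)"
  by (rule h(2)[symmetric]) measurable
 also have "\<dots> = emeasure P (cell j \<inter> g -` cell i)"
  by (subst emeasure_density) (auto intro!: nn_integral_cong simp: indicator_def)
 finally show ?thesis
  using cell_mass_pos[OF i] by (simp add: cell_weight_def measure_def)
qed

text \<open>Consider the part of cell \<open>j\<close> that \<open>g\<close> sends into cell
  \<open>i\<close>. By (D) its Haar measure is the measure of cell \<open>i\<close> times a nearly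
  constant inverse Jacobian, and by \<open>acip_cell_le\<close> its share of cell \<open>j\<close>
  is nearly the same for Haar measure and for \<open>P\<close>.\<close>

lemma kernel_comparison:
 assumes i: "i < d" and j: "j < d" and \<o>: "\<o> \<in> cell i"
 shows "measure haar (cell i) * mass j / jac_inv j \<o>
  \<le> exp ((a + D) * \<kappa>) * (mass i * weight i j * measure haar (cell j))"
proof -
 define B where "B = cell j \<inter> g -` cell i"
 have [measurable]: "B \<in> sets borel" unfolding B_def by measurable
 note [measurable] = jac_inv_measurable[OF j]
 have "ennreal (measure haar (cell i) * (exp (- (D * \<kappa>)) / jac_inv j \<o>)) = (\<integral>\<^sup>+\<o>'. indicator (cell i) \<o>' * ennreal (exp (- (D * \<kappa>)) / jac_inv j \<o>) \<partial>haar)"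
  using jac_inv_pos[of j \<o>] by (simp add: nn_integral_multc haar.emeasure_eq_measure ennreal_mult'[symmetric])
 also have "\<dots> \<le> (\<integral>\<^sup>+\<o>'. indicator (cell i) \<o>' * ennreal (1 / jac_inv j \<o>') \<partial>haar)"
 proof (rule nn_integral_mono)
  fix \<o>'
  have "exp (- (D * \<kappa>)) / jac_inv j \<o> \<le> 1 / jac_inv j \<o>'" if \<o>': "\<o>' \<in> cell i"
  proof -
   have "dist \<o>' \<o> \<le> \<kappa>" using \<o> \<o>' cell_subset[of i] diam[OF i] by blast
   then have "exp (D * dist \<o>' \<o>) * jac_inv j \<o> \<le> exp (D * \<kappa>) * jac_inv j \<o>"
    using D_nonneg jac_inv_pos[of j \<o>] by (intro mult_right_mono) (auto simp: mult_left_mono)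
   with jac_inv_le[OF j, of \<o>' \<o>] have "jac_inv j \<o>' \<le> exp (D * \<kappa>) * jac_inv j \<o>" by linarith
   then show ?thesis using jac_inv_pos[of j \<o>] jac_inv_pos[of j \<o>'] by (simp add: exp_minus field_simps)
  qed
  then show "indicator (cell i) \<o>' * ennreal (exp (- (D * \<kappa>)) / jac_inv j \<o>) \<le> indicator (cell i) \<o>' * ennreal (1 / jac_inv j \<o>')"
   by (cases "\<o>' \<in> cell i") (auto intro: ennreal_leI)
 qed
 also have "\<dots> = (\<integral>\<^sup>+v. indicator (cell j) v * indicator (cell i) (g v) \<partial>haar)"
  by (rule nn_integral_branch[OF j, symmetric]) measurable
 also have "\<dots> = emeasure haar B"
 proof -
  have "(\<integral>\<^sup>+v. indicator (cell j) v * indicator (cell i) (g v) \<partial>haar) = (\<integral>\<^sup>+v. indicator B v \<partial>haar)"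
   by (rule nn_integral_cong) (auto simp: B_def indicator_def)
  then show ?thesis by simp
 qed
 finally have 1: "measure haar (cell i) * (exp (- (D * \<kappa>)) / jac_inv j \<o>) \<le> measure haar B"
  by (simp add: haar.emeasure_eq_measure)
 have 2: "measure P (cell j) * measure haar B \<le> exp (a * \<kappa>) * (measure haar (cell j) * measure P B)"
  by (rule acip_cell_le[OF ac]) (use cell_subset[of j] diam[OF j] in "auto simp: B_def")
 have "measure P (cell j) * (measure haar (cell i) * (exp (- (D * \<kappa>)) / jac_inv j \<o>)) \<le> measure P (cell j) * measure haar B"
  by (rule mult_left_mono[OF 1]) simp
 with 2 have 3: "measure P (cell j) * (measure haar (cell i) * (exp (- (D * \<kappa>)) / jac_inv j \<o>)) \<le> exp (a * \<kappa>) * (measure haar (cell j) * measure P B)"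
  by linarith
 have "measure haar (cell i) * mass j / jac_inv j \<o>
   = exp (D * \<kappa>) * (measure P (cell j) * (measure haar (cell i) * (exp (- (D * \<kappa>)) / jac_inv j \<o>)))"
  by (simp add: cell_mass_eq[OF j] exp_minus field_simps)
 also have "\<dots> \<le> exp (D * \<kappa>) * (exp (a * \<kappa>) * (measure haar (cell j) * measure P B))"
  by (rule mult_left_mono[OF 3]) simp
 also have "\<dots> = exp ((a + D) * \<kappa>) * (mass i * weight i j * measure haar (cell j))"
 proof -
  have "exp ((a + D) * \<kappa>) = exp (D * \<kappa>) * exp (a * \<kappa>)" by (simp add: exp_add[symmetric] distrib_right add.commute)
  then show ?thesis unfolding cell_weight_eq[OF i j] B_def by (simp only: mult_ac)
 qed
 finally show ?thesis .
qed

end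

section \<open>The fixed point of the cell operator\<close>

text \<open>The weighted sum is the bind of a finite point measure with the family, from which
  countable additivity and the formula for integrals are inherited.\<close>

lemma weighted_sum_facts:
 fixes M :: "nat => 'b::topological_space measure"
 assumes d: "d > 0" and M: "\<And>j. j < d ==> M j \<in> prob_measures"
 shows "sets (weighted_sum d c M) = sets borel"
  and "q \<in> borel_measurable borel ==> (\<integral>\<^sup>+x. q x \<partial>weighted_sum d c M) = (\<Sum>j<d. ennreal (c j) * (\<integral>\<^sup>+x. q x \<partial>M j))"
proof -
 define N where "N = point_measure {..<d} (\<lambda>j. ennreal (c j))"
 have sN: "space N = {..<d}" by (simp add: N_def space_point_measure)
 have K: "M \<in> N \<rightarrow>\<^sub>M subprob_algebra borel"
  unfolding N_def measurable_point_measure_eq1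
  using M by (auto simp: space_subprob_algebra prob_measures_def prob_space_imp_subprob_space)
 have sB: "sets (N \<bind> M) = sets borel"
  by (rule sets_bind) (use d M sN in "auto simp: prob_measuresD(2)")
 have nn: "(\<integral>\<^sup>+x. q x \<partial>(N \<bind> M)) = (\<Sum>j<d. ennreal (c j) * (\<integral>\<^sup>+x. q x \<partial>M j))" if q: "q \<in> borel_measurable borel" for q
  unfolding nn_integral_bind[OF q K] unfolding N_def by (rule nn_integral_point_measure_finite) simp
 have em: "emeasure (N \<bind> M) A = (\<Sum>j<d. ennreal (c j) * emeasure (M j) A)" if A: "A \<in> sets borel" for A
 proof -
  have "emeasure (N \<bind> M) A = (\<integral>\<^sup>+x. indicator A x \<partial>(N \<bind> M))" using A sB by simp
  also have "\<dots> = (\<Sum>j<d. ennreal (c j) * (\<integral>\<^sup>+x. indicator A x \<partial>M j))" by (rule nn) (use A in simp)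
  also have "\<dots> = (\<Sum>j<d. ennreal (c j) * emeasure (M j) A)"
   by (rule sum.cong[OF refl]) (use A M in "simp add: prob_measuresD(2)")
  finally show ?thesis .
 qed
 have "weighted_sum d c M = measure_of UNIV (sets borel) (emeasure (N \<bind> M))"
  unfolding weighted_sum_def
  by (rule measure_of_eq) (use em sets.sigma_sets_eq[of "borel :: 'b measure"] in auto)
 also have "\<dots> = N \<bind> M"
  using measure_of_of_measure[of "N \<bind> M"] sB sets_eq_imp_space_eq[OF sB] by simp
 finally have eq: "weighted_sum d c M = N \<bind> M" .
 show "sets (weighted_sum d c M) = sets borel" unfolding eq by (rule sB)
 show "q \<in> borel_measurable borel ==> (\<integral>\<^sup>+x. q x \<partial>weighted_sum d c M) = (\<Sum>j<d. ennreal (c j) * (\<integral>\<^sup>+x. q x \<partial>M j))"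
  unfolding eq by (rule nn)
qed

lemma wasserstein_self_le:
 fixes \<mu> :: "'n::finite torus measure"
 assumes "\<mu> \<in> prob_measures" shows "wasserstein \<mu> \<mu> \<le> 0"
proof (rule field_le_epsilon)
 fix e :: real assume "e > 0"
 then obtain \<eta> \<Lambda> :: real where "\<eta> > 0" and t: "\<And>\<mu> \<nu> :: 'n torus measure. \<mu> \<in> prob_measures ==> \<nu> \<in> prob_measures ==>
   (\<And>\<psi> :: 'n torus => real. \<psi> \<in> borel_measurable borel ==> (\<And>x. 0 \<le> \<psi> x) ==> (\<And>x. \<psi> x \<le> 1) ==>
    (\<And>x y. \<bar>\<psi> x - \<psi> y\<bar> \<le> \<Lambda> * dist x y) ==> \<bar>(\<integral>x. \<psi> x \<partial>\<mu>) - (\<integral>x. \<psi> x \<partial>\<nu>)\<bar> \<le> \<eta>) ==>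
   wasserstein \<mu> \<nu> \<le> e"
  by (rule wasserstein_le_lipschitz_tests) blast
 have "wasserstein \<mu> \<mu> \<le> e" by (rule t[OF assms assms]) (use \<open>\<eta> > 0\<close> in simp)
 then show "wasserstein \<mu> \<mu> \<le> 0 + e" by simp
qed

context branch_system
begin

text \<open>Off a null set the cell is its interior, so the completion disappears from the integral
  formula; \<open>mass j\<close> is exactly the normalisation.\<close>

lemma cell_op_facts:
 assumes j: "j < d" and \<mu>: "\<mu> \<in> prob_measures"
 shows "cell_op \<rho> I f j \<mu> \<in> prob_measures"
  and "q \<in> borel_measurable borel ==> (\<integral>\<^sup>+y. q y \<partial>cell_op \<rho> I f j \<mu>)
   = (\<integral>\<^sup>+u. indicator (cell j) u * ennreal (\<rho> u / mass j) * (\<integral>\<^sup>+x. q (f (u, x)) \<partial>\<mu>) \<partial>haar)"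
proof -
 define w where "w = (\<lambda>\<o>. indicator (I j) \<o> * \<rho> \<o> / mass j)"
 define \<nu> where "\<nu> = density (completion haar) (\<lambda>\<o>. ennreal (w \<o>))"
 have ae: "AE \<o> in haar. w \<o> = indicator (cell j) \<o> * \<rho> \<o> / mass j"
  using AE_not_in[OF null_boundary[OF j]] unfolding AE_completion_iff
 proof eventually_elim
  case (elim \<o>)
  then have "indicator (I j) \<o> = (indicator (cell j) \<o> :: real)" using cell_subset[of j] by (auto simp: indicator_def)
  then show ?case by (simp add: w_def)
 qed
 have wm: "(\<lambda>\<o>. ennreal (w \<o>)) \<in> borel_measurable (completion haar)"
  using borel_measurable_completion_AE[OF _ ae] by simp
 note [measurable_cong] = prob_measuresD(2)[OF \<mu>]
 have prob\<mu>: "prob_space \<mu>" by (rule prob_measuresD(1)[OF \<mu>])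
 interpret \<mu>: prob_space \<mu> by (rule prob\<mu>)
 define K where "K = (\<lambda>\<o>. distr \<mu> borel (\<lambda>x. f (\<o>, x)))"
 have "\<mu> \<in> space (subprob_algebra borel)"
  using \<mu> by (simp add: space_subprob_algebra prob_measures_def prob_space_imp_subprob_space)
 then have "(\<lambda>_. \<mu>) \<in> haar \<rightarrow>\<^sub>M subprob_algebra borel" by (rule measurable_const)
 then have "K \<in> haar \<rightarrow>\<^sub>M subprob_algebra borel"
  unfolding K_def by (rule measurable_distr2[rotated]) (simp, measurable)
 then have "K \<in> completion haar \<rightarrow>\<^sub>M subprob_algebra borel" by (rule measurable_completion)
 then have K: "K \<in> \<nu> \<rightarrow>\<^sub>M subprob_algebra borel" by (simp add: \<nu>_def)
 have eq: "cell_op \<rho> I f j \<mu> = \<nu> \<bind> K"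
  by (simp add: cell_op_def fibre_average_def \<nu>_def K_def w_def)
 have fm: "(\<lambda>x. f (\<o>, x)) \<in> borel_measurable \<mu>" for \<o> by measurable
 have nn: "(\<integral>\<^sup>+y. h y \<partial>cell_op \<rho> I f j \<mu>) = (\<integral>\<^sup>+u. indicator (cell j) u * ennreal (\<rho> u / mass j) * (\<integral>\<^sup>+x. h (f (u, x)) \<partial>\<mu>) \<partial>haar)"
  if h [measurable]: "h \<in> borel_measurable borel" for h
 proof -
  have hm: "(\<lambda>\<o>. \<integral>\<^sup>+x. h (f (\<o>, x)) \<partial>\<mu>) \<in> borel_measurable (completion haar)"
   by (rule measurable_completion) measurable
  have "(\<integral>\<^sup>+y. h y \<partial>cell_op \<rho> I f j \<mu>) = (\<integral>\<^sup>+\<o>. \<integral>\<^sup>+x. h (f (\<o>, x)) \<partial>\<mu> \<partial>\<nu>)"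
   unfolding eq nn_integral_bind[OF h K] unfolding K_def by (simp add: nn_integral_distr fm)
  also have "\<dots> = (\<integral>\<^sup>+\<o>. ennreal (w \<o>) * (\<integral>\<^sup>+x. h (f (\<o>, x)) \<partial>\<mu>) \<partial>completion haar)"
   unfolding \<nu>_def by (rule nn_integral_density[OF wm hm])
  also have "\<dots> = (\<integral>\<^sup>+\<o>. ennreal (w \<o>) * (\<integral>\<^sup>+x. h (f (\<o>, x)) \<partial>\<mu>) \<partial>haar)" by (rule nn_integral_completion)
  also have "\<dots> = (\<integral>\<^sup>+u. indicator (cell j) u * ennreal (\<rho> u / mass j) * (\<integral>\<^sup>+x. h (f (u, x)) \<partial>\<mu>) \<partial>haar)"
   by (rule nn_integral_cong_AE) (use ae in "eventually_elim, simp add: indicator_def")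
  finally show ?thesis .
 qed
 have sets: "sets (cell_op \<rho> I f j \<mu>) = sets borel"
  unfolding eq by (rule sets_bind) (simp_all add: K_def \<nu>_def)
 have "emeasure (cell_op \<rho> I f j \<mu>) (space (cell_op \<rho> I f j \<mu>)) = (\<integral>\<^sup>+y. 1 \<partial>cell_op \<rho> I f j \<mu>)" by simp
 also have "\<dots> = (\<integral>\<^sup>+u. (ennreal (\<rho> u) * indicator (cell j) u) * ennreal (1 / mass j) \<partial>haar)"
  unfolding nn[OF borel_measurable_const] using \<mu>.emeasure_space_1 rho_ge_0
  by (intro nn_integral_cong) (simp add: indicator_def ennreal_mult'[symmetric])
 also have "\<dots> = emeasure P (cell j) * ennreal (1 / mass j)"
  by (subst nn_integral_multc) (auto simp: emeasure_density)
 also have "\<dots> = 1"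
  using cell_mass_pos[OF j] by (simp add: P.emeasure_eq_measure cell_mass_eq[OF j, symmetric] ennreal_mult'[symmetric])
 finally have "prob_space (cell_op \<rho> I f j \<mu>)" by (rule prob_spaceI)
 then show "cell_op \<rho> I f j \<mu> \<in> prob_measures" using sets by (simp add: prob_measures_def)
 show "q \<in> borel_measurable borel ==> (\<integral>\<^sup>+y. q y \<partial>cell_op \<rho> I f j \<mu>)
   = (\<integral>\<^sup>+u. indicator (cell j) u * ennreal (\<rho> u / mass j) * (\<integral>\<^sup>+x. q (f (u, x)) \<partial>\<mu>) \<partial>haar)"
  by (rule nn)
qed

text \<open>Density of the image under \<open>g\<close> of normalised Haar measure on cell
  \<open>j\<close>. Starting from Haar measure rather than from \<open>P\<close> makes it a multiple
  of an inverse Jacobian, hence pointwise log-Lipschitz with constant \<open>D\<close>.\<close>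

definition kern :: "nat => 'm torus => real" where
 "kern j \<o> = 1 / (measure haar (cell j) * jac_inv j \<o>)"

lemma kern_pos: "j < d ==> kern j \<o> > 0"
 using haar_cell_pos[of j] jac_inv_pos[of j \<o>] by (simp add: kern_def)

lemma kern_measurable: "j < d ==> kern j \<in> borel_measurable borel"
proof -
 assume j: "j < d"
 note [measurable] = jac_inv_measurable[OF j]
 show ?thesis unfolding kern_def by measurable
qed

lemma nn_integral_kern:
 assumes j: "j < d" and [measurable]: "\<phi> \<in> borel_measurable borel"
 shows "(\<integral>\<^sup>+\<o>. ennreal (kern j \<o>) * \<phi> \<o> \<partial>haar) = ennreal (1 / measure haar (cell j)) * (\<integral>\<^sup>+v. indicator (cell j) v * \<phi> (g v) \<partial>haar)"
proof -
 note [measurable] = jac_inv_measurable[OF j]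
 have "(\<integral>\<^sup>+\<o>. ennreal (kern j \<o>) * \<phi> \<o> \<partial>haar) = (\<integral>\<^sup>+\<o>. ennreal (1 / measure haar (cell j)) * (\<phi> \<o> * ennreal (1 / jac_inv j \<o>)) \<partial>haar)"
 proof (rule nn_integral_cong)
  fix \<o>
  have "ennreal (kern j \<o>) = ennreal (1 / measure haar (cell j)) * ennreal (1 / jac_inv j \<o>)"
   using haar_cell_pos[OF j] jac_inv_pos[of j \<o>] by (simp add: kern_def ennreal_mult'[symmetric])
  then show "ennreal (kern j \<o>) * \<phi> \<o> = ennreal (1 / measure haar (cell j)) * (\<phi> \<o> * ennreal (1 / jac_inv j \<o>))"
   by (simp only: mult_ac)
 qed
 also have "\<dots> = ennreal (1 / measure haar (cell j)) * (\<integral>\<^sup>+v. indicator (cell j) v * \<phi> (g v) \<partial>haar)"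
  unfolding nn_integral_branch[OF j assms(2)] by (rule nn_integral_cmult) measurable
 finally show ?thesis .
qed

definition kern_meas :: "nat => 'm torus measure" where
 "kern_meas j = density haar (\<lambda>\<o>. ennreal (kern j \<o>))"

lemma kern_meas_prob: "j < d ==> kern_meas j \<in> prob_measures"
proof -
 assume j: "j < d"
 have "emeasure (kern_meas j) (space (kern_meas j)) = (\<integral>\<^sup>+\<o>. ennreal (kern j \<o>) * 1 \<partial>haar)"
  using kern_measurable[OF j] by (simp add: kern_meas_def emeasure_density)
 also have "\<dots> = ennreal (1 / measure haar (cell j)) * (\<integral>\<^sup>+v. indicator (cell j) v * 1 \<partial>haar)"
  by (rule nn_integral_kern[OF j]) simp
 also have "\<dots> = 1"
  using haar_cell_pos[OF j] by (simp add: haar.emeasure_eq_measure ennreal_mult'[symmetric])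
 finally have "prob_space (kern_meas j)" by (rule prob_spaceI)
 then show ?thesis by (simp add: prob_measures_def kern_meas_def)
qed

context
 fixes \<eta> :: "nat => 'n torus measure"
 assumes \<eta>: "L_fixed_point g \<rho> d I f \<eta>"
begin

abbreviation \<xi> :: "nat => 'n torus measure" where "\<xi> j \<equiv> cell_op \<rho> I f j (\<eta> j)"

lemma eta_prob: "j < d ==> \<eta> j \<in> prob_measures"
 and eta_fixed: "j < d ==> weighted_sum d (weight j) \<xi> = \<eta> j"
 using \<eta> unfolding L_fixed_point_def L_op_def by blast+

lemma xi_prob: "j < d ==> \<xi> j \<in> prob_measures"
 by (rule cell_op_facts(1)[OF _ eta_prob])

lemma nn_integral_eta:
 assumes i: "i < d" and q: "q \<in> borel_measurable borel"
 shows "(\<integral>\<^sup>+x. q x \<partial>\<eta> i) = (\<Sum>j<d. ennreal (weight i j) * (\<integral>\<^sup>+x. q x \<partial>\<xi> j))"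
 using weighted_sum_facts(2)[where M = \<xi> and c = "weight i", OF d_pos xi_prob q] eta_fixed[OF i] by simp

text \<open>The product measures \<open>block j\<close> and the weights \<open>mass j\<close> give a nearly invariant measure
 whose vertical marginal is the one of the fixed point.\<close>

definition block :: "nat => ('m torus \<times> 'n torus) measure" where
 "block j = kern_meas j \<Otimes>\<^sub>M \<xi> j"

lemma block_prob: "j < d ==> block j \<in> prob_measures"
proof -
 assume j: "j < d"
 interpret A: prob_space "kern_meas j" by (rule prob_measuresD(1)[OF kern_meas_prob[OF j]])
 interpret B: prob_space "\<xi> j" by (rule prob_measuresD(1)[OF xi_prob[OF j]])
 interpret AB: pair_prob_space "kern_meas j" "\<xi> j" ..
 have "sets (kern_meas j \<Otimes>\<^sub>M \<xi> j) = sets (borel \<Otimes>\<^sub>M borel)"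
  by (rule sets_pair_measure_cong[OF prob_measuresD(2)[OF kern_meas_prob[OF j]] prob_measuresD(2)[OF xi_prob[OF j]]])
 then show ?thesis using AB.P.prob_space_axioms unfolding borel_prod by (simp add: prob_measures_def block_def)
qed

lemma nn_integral_block:
 assumes j: "j < d" and [measurable]: "\<Phi> \<in> borel_measurable borel"
 shows "(\<integral>\<^sup>+p. \<Phi> p \<partial>block j) = (\<integral>\<^sup>+y. \<integral>\<^sup>+\<o>. ennreal (kern j \<o>) * \<Phi> (\<o>, y) \<partial>haar \<partial>\<xi> j)"
proof -
 interpret A: prob_space "kern_meas j" by (rule prob_measuresD(1)[OF kern_meas_prob[OF j]])
 interpret B: prob_space "\<xi> j" by (rule prob_measuresD(1)[OF xi_prob[OF j]])
 interpret AB: pair_prob_space "kern_meas j" "\<xi> j" ..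
 note [measurable_cong] = prob_measuresD(2)[OF kern_meas_prob[OF j]] prob_measuresD(2)[OF xi_prob[OF j]]
 note [measurable] = kern_measurable[OF j]
 have "\<Phi> \<in> borel_measurable (borel \<Otimes>\<^sub>M borel)" unfolding borel_prod by simp
 then have "\<Phi> \<in> borel_measurable (kern_meas j \<Otimes>\<^sub>M \<xi> j)" by measurable
 then have "(\<integral>\<^sup>+p. \<Phi> p \<partial>block j) = (\<integral>\<^sup>+y. \<integral>\<^sup>+\<o>. \<Phi> (\<o>, y) \<partial>kern_meas j \<partial>\<xi> j)"
  unfolding block_def by (rule AB.nn_integral_snd[symmetric])
 also have "\<dots> = (\<integral>\<^sup>+y. \<integral>\<^sup>+\<o>. ennreal (kern j \<o>) * \<Phi> (\<o>, y) \<partial>haar \<partial>\<xi> j)"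
  unfolding kern_meas_def by (intro nn_integral_cong nn_integral_density) measurable
 finally show ?thesis .
qed

text \<open>A product measure has a constant disintegration, so the Lipschitz constant is 0, and (D)
  controls the base density.\<close>

lemma block_Gamma: "j < d ==> block j \<in> Gamma_meas 0 D"
proof -
 assume j: "j < d"
 interpret A: prob_space "kern_meas j" by (rule prob_measuresD(1)[OF kern_meas_prob[OF j]])
 interpret B: prob_space "\<xi> j" by (rule prob_measuresD(1)[OF xi_prob[OF j]])
 interpret AB: pair_prob_space "kern_meas j" "\<xi> j" ..
 have s: "sets (kern_meas j) = sets borel" by (rule prob_measuresD(2)[OF kern_meas_prob[OF j]])
 have "distr (block j) borel fst = distr (block j) (kern_meas j) fst"
  by (rule distr_cong) (simp_all add: s)
 also have "\<dots> = kern_meas j" unfolding block_def by (rule B.distr_pair_fst)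
 finally have fst: "distr (block j) borel fst = kern_meas j" .
 have "disintegration (block j) (\<lambda>_. \<xi> j)"
  unfolding disintegration_def fst
 proof (intro conjI allI ballI)
  fix A :: "('m torus \<times> 'n torus) set" assume A: "A \<in> sets borel"
  then have "A \<in> sets (kern_meas j \<Otimes>\<^sub>M \<xi> j)" using prob_measuresD(2)[OF block_prob[OF j]] by (simp add: block_def)
  then show "emeasure (block j) A = (\<integral>\<^sup>+\<o>. emeasure (\<xi> j) (Pair \<o> -` A) \<partial>kern_meas j)"
   unfolding block_def by (rule B.emeasure_pair_measure_alt)
 qed (use xi_prob[OF j] in auto)
 moreover have "kern j \<in> log_lipschitz D"
  unfolding log_lipschitz_def
 proof (intro CollectI conjI allI kern_pos[OF j])
  fix \<o> \<o>'
  have "kern j \<o> / kern j \<o>' = jac_inv j \<o>' / jac_inv j \<o>"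
   using haar_cell_pos[OF j] by (simp add: kern_def)
  also have "\<dots> \<le> exp (D * dist \<o> \<o>')"
   using jac_inv_le[OF j, of \<o>' \<o>] jac_inv_pos[of j \<o>] by (simp add: divide_le_eq dist_commute)
  finally show "kern j \<o> / kern j \<o>' \<le> exp (D * dist \<o> \<o>')" .
 qed
 ultimately show ?thesis
  using block_prob[OF j] wasserstein_self_le[OF xi_prob[OF j]] fst
  unfolding Gamma_meas_def kern_meas_def by (intro CollectI conjI) (auto intro!: exI[of _ "\<lambda>_. \<xi> j"] bexI[of _ "kern j"])
qed

lemma nn_integral_cell_measure:
 assumes i: "i < d" and q [measurable]: "q \<in> borel_measurable borel"
 shows "(\<integral>\<^sup>+x. (\<integral>\<^sup>+u. indicator (cell i) u * ennreal (\<rho> u) * q (f (u, x)) \<partial>haar) \<partial>\<eta> i) = ennreal (mass i) * (\<integral>\<^sup>+y. q y \<partial>\<xi> i)"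
proof -
 interpret E: prob_space "\<eta> i" by (rule prob_measuresD(1)[OF eta_prob[OF i]])
 interpret pair_sigma_finite "\<eta> i" "haar :: 'm torus measure" ..
 note [measurable_cong] = prob_measuresD(2)[OF eta_prob[OF i]]
 have "(\<integral>\<^sup>+x. (\<integral>\<^sup>+u. indicator (cell i) u * ennreal (\<rho> u) * q (f (u, x)) \<partial>haar) \<partial>\<eta> i)
   = (\<integral>\<^sup>+u. (\<integral>\<^sup>+x. indicator (cell i) u * ennreal (\<rho> u) * q (f (u, x)) \<partial>\<eta> i) \<partial>haar)"
  by (rule Fubini'[symmetric]) measurable
 also have "\<dots> = (\<integral>\<^sup>+u. ennreal (mass i) * (indicator (cell i) u * ennreal (\<rho> u / mass i) * (\<integral>\<^sup>+x. q (f (u, x)) \<partial>\<eta> i)) \<partial>haar)"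
 proof (rule nn_integral_cong)
  fix u
  have "ennreal (\<rho> u) = ennreal (mass i) * ennreal (\<rho> u / mass i)"
   using cell_mass_pos[OF i] rho_ge_0[of u] by (simp add: ennreal_mult'[symmetric])
  moreover have "(\<integral>\<^sup>+x. indicator (cell i) u * ennreal (\<rho> u) * q (f (u, x)) \<partial>\<eta> i) = indicator (cell i) u * ennreal (\<rho> u) * (\<integral>\<^sup>+x. q (f (u, x)) \<partial>\<eta> i)"
   by (rule nn_integral_cmult) measurable
  ultimately show "(\<integral>\<^sup>+x. indicator (cell i) u * ennreal (\<rho> u) * q (f (u, x)) \<partial>\<eta> i)
    = ennreal (mass i) * (indicator (cell i) u * ennreal (\<rho> u / mass i) * (\<integral>\<^sup>+x. q (f (u, x)) \<partial>\<eta> i))"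
   by (simp only: mult_ac)
 qed
 also have "\<dots> = ennreal (mass i) * (\<integral>\<^sup>+y. q y \<partial>\<xi> i)"
  unfolding cell_op_facts(2)[OF i eta_prob[OF i] q] by (rule nn_integral_cmult) measurable
 finally show ?thesis .
qed

text \<open>Within one cell the base points are \<kappa>-close, so the point driving the fibre may
  be decoupled from the point driving the base at a cost of
  \<open>\<Lambda> * (L * \<kappa>)\<close>. With the fibre driven by \<rho> and the base by Haar
  measure, one step from the product of the cell with \<open>\<eta> i\<close> is the product
  \<open>block i\<close>.\<close>

lemma block_fibre_bound:
 assumes i: "i < d" and [measurable]: "\<Psi> \<in> borel_measurable borel"
  and lip: "\<And>\<o> x x'. \<Psi> (\<o>, x) \<le> \<Psi> (\<o>, x') + ennreal (\<Lambda> * dist x x')" and \<Lambda>: "\<Lambda> \<ge> 0"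
 shows "ennreal (mass i / measure haar (cell i)) * (\<integral>\<^sup>+x. \<integral>\<^sup>+v. indicator (cell i) v * \<Psi> (F (v, x)) \<partial>haar \<partial>\<eta> i)
  \<le> ennreal (mass i) * ((\<integral>\<^sup>+p. \<Psi> p \<partial>block i) + ennreal (\<Lambda> * (L * \<kappa>)))"
proof -
 define V where "V = measure haar (cell i)"
 define R where "R = mass i"
 have V: "V > 0" and R: "R > 0" using haar_cell_pos[OF i] cell_mass_pos[OF i] by (simp_all add: V_def R_def)
 note [measurable_cong] = prob_measuresD(2)[OF eta_prob[OF i]] prob_measuresD(2)[OF xi_prob[OF i]]
 note [measurable] = kern_measurable[OF i]
 define Q where "Q y = (\<integral>\<^sup>+\<o>. ennreal (kern i \<o>) * \<Psi> (\<o>, y) \<partial>haar)" for y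
 have [measurable]: "Q \<in> borel_measurable borel" unfolding Q_def by measurable
 have intR: "(\<integral>\<^sup>+u. indicator (cell i) u * ennreal (\<rho> u) \<partial>haar) = ennreal R"
  using emeasure_density[of "\<lambda>u. ennreal (\<rho> u)" haar "cell i"]
  by (simp add: mult.commute R_def cell_mass_eq[OF i] P.emeasure_eq_measure)
 have pt: "ennreal (R / V) * (\<integral>\<^sup>+v. indicator (cell i) v * \<Psi> (F (v, x)) \<partial>haar)
   \<le> (\<integral>\<^sup>+u. indicator (cell i) u * ennreal (\<rho> u) * (Q (f (u, x)) + ennreal (\<Lambda> * (L * \<kappa>))) \<partial>haar)" for x
 proof -
  have "ennreal (R / V) * (\<integral>\<^sup>+v. indicator (cell i) v * \<Psi> (F (v, x)) \<partial>haar)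
    = ennreal R * (ennreal (1 / V) * (\<integral>\<^sup>+v. indicator (cell i) v * \<Psi> (F (v, x)) \<partial>haar))"
   using V R by (simp add: mult.assoc[symmetric] ennreal_mult'[symmetric])
  also have "\<dots> = (\<integral>\<^sup>+u. indicator (cell i) u * ennreal (\<rho> u) * (ennreal (1 / V) * (\<integral>\<^sup>+v. indicator (cell i) v * \<Psi> (F (v, x)) \<partial>haar)) \<partial>haar)"
   unfolding intR[symmetric] by (rule nn_integral_multc[symmetric]) measurable
  also have "\<dots> \<le> (\<integral>\<^sup>+u. indicator (cell i) u * ennreal (\<rho> u) * (Q (f (u, x)) + ennreal (\<Lambda> * (L * \<kappa>))) \<partial>haar)"
  proof (rule nn_integral_mono)
   fix u
   have "ennreal (1 / V) * (\<integral>\<^sup>+v. indicator (cell i) v * \<Psi> (F (v, x)) \<partial>haar) \<le> Q (f (u, x)) + ennreal (\<Lambda> * (L * \<kappa>))" if u: "u \<in> cell i"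
   proof -
    have le: "indicator (cell i) v * \<Psi> (F (v, x)) \<le> indicator (cell i) v * \<Psi> (g v, f (u, x)) + indicator (cell i) v * ennreal (\<Lambda> * (L * \<kappa>))" for v
    proof (cases "v \<in> cell i")
     case True
     have "dist v u \<le> \<kappa>" using True u cell_subset[of i] diam[OF i] by blast
     then have "\<Lambda> * dist (f (v, x)) (f (u, x)) \<le> \<Lambda> * (L * \<kappa>)"
      using f_lip_le[of "(v, x)" "(u, x)"] L_pos \<Lambda> by (intro mult_left_mono) (auto intro: order.trans)
     then have "ennreal (\<Lambda> * dist (f (v, x)) (f (u, x))) \<le> ennreal (\<Lambda> * (L * \<kappa>))" by (rule ennreal_leI)
     then have "\<Psi> (F (v, x)) \<le> \<Psi> (g v, f (u, x)) + ennreal (\<Lambda> * (L * \<kappa>))"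
      using lip[of "g v" "f (v, x)" "f (u, x)"] unfolding skew_product_def by (auto intro: order.trans add_left_mono)
     then show ?thesis using True by simp
    qed simp
    have "(\<integral>\<^sup>+v. indicator (cell i) v * \<Psi> (F (v, x)) \<partial>haar)
      \<le> (\<integral>\<^sup>+v. indicator (cell i) v * \<Psi> (g v, f (u, x)) + indicator (cell i) v * ennreal (\<Lambda> * (L * \<kappa>)) \<partial>haar)"
     by (rule nn_integral_mono) (rule le)
    also have "\<dots> = (\<integral>\<^sup>+v. indicator (cell i) v * \<Psi> (g v, f (u, x)) \<partial>haar) + ennreal V * ennreal (\<Lambda> * (L * \<kappa>))"
     by (subst nn_integral_add) (auto simp: nn_integral_multc haar.emeasure_eq_measure V_def)
    finally have "ennreal (1 / V) * (\<integral>\<^sup>+v. indicator (cell i) v * \<Psi> (F (v, x)) \<partial>haar)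
      \<le> ennreal (1 / V) * ((\<integral>\<^sup>+v. indicator (cell i) v * \<Psi> (g v, f (u, x)) \<partial>haar) + ennreal V * ennreal (\<Lambda> * (L * \<kappa>)))"
     by (rule mult_left_mono) simp
    also have "\<dots> = Q (f (u, x)) + ennreal (1 / V) * ennreal V * ennreal (\<Lambda> * (L * \<kappa>))"
     unfolding Q_def V_def by (subst nn_integral_kern[OF i]) (auto simp: distrib_left mult.assoc)
    also have "ennreal (1 / V) * ennreal V = 1" using V by (simp add: ennreal_mult'[symmetric])
    finally show ?thesis by simp
   qed
   then show "indicator (cell i) u * ennreal (\<rho> u) * (ennreal (1 / V) * (\<integral>\<^sup>+v. indicator (cell i) v * \<Psi> (F (v, x)) \<partial>haar))
     \<le> indicator (cell i) u * ennreal (\<rho> u) * (Q (f (u, x)) + ennreal (\<Lambda> * (L * \<kappa>)))"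
    by (cases "u \<in> cell i") (auto intro: mult_left_mono)
  qed
  finally show ?thesis .
 qed
 have "ennreal (R / V) * (\<integral>\<^sup>+x. \<integral>\<^sup>+v. indicator (cell i) v * \<Psi> (F (v, x)) \<partial>haar \<partial>\<eta> i)
   = (\<integral>\<^sup>+x. ennreal (R / V) * (\<integral>\<^sup>+v. indicator (cell i) v * \<Psi> (F (v, x)) \<partial>haar) \<partial>\<eta> i)"
  by (rule nn_integral_cmult[symmetric]) measurable
 also have "\<dots> \<le> (\<integral>\<^sup>+x. (\<integral>\<^sup>+u. indicator (cell i) u * ennreal (\<rho> u) * (Q (f (u, x)) + ennreal (\<Lambda> * (L * \<kappa>))) \<partial>haar) \<partial>\<eta> i)"
  by (rule nn_integral_mono) (rule pt)
 also have "\<dots> = ennreal R * (\<integral>\<^sup>+y. Q y + ennreal (\<Lambda> * (L * \<kappa>)) \<partial>\<xi> i)"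
  unfolding R_def by (rule nn_integral_cell_measure[OF i]) measurable
 also have "(\<integral>\<^sup>+y. Q y + ennreal (\<Lambda> * (L * \<kappa>)) \<partial>\<xi> i) = (\<integral>\<^sup>+p. \<Psi> p \<partial>block i) + ennreal (\<Lambda> * (L * \<kappa>))"
  using prob_space.emeasure_space_1[OF prob_measuresD(1)[OF xi_prob[OF i]]]
  by (subst nn_integral_add) (auto simp: nn_integral_block[OF i] Q_def[abs_def])
 finally show ?thesis by (simp add: R_def V_def)
qed

text \<open>\<open>kernel_comparison\<close> solved for the density: on cell \<open>i\<close> the
  mixture weight times \<open>kern j\<close> is at most the constant dictated by the cell operator,
  up to the distortion factor.\<close>

lemma kern_le:
 assumes i: "i < d" and j: "j < d" and \<o>: "\<o> \<in> cell i"
 shows "mass j * kern j \<o> \<le> exp ((a + D) * \<kappa>) * (mass i / measure haar (cell i) * weight i j)"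
 using kernel_comparison[OF i j \<o>] haar_cell_pos[OF i] haar_cell_pos[OF j] jac_inv_pos[of j \<o>]
 by (simp add: kern_def field_simps)

text \<open>Split the base of each block into cells and replace \<open>kern j\<close> by its
  constant bound there. Summed over \<open>j\<close>, the fibre measures combine to
  \<open>\<eta> i\<close> by the fixed point equation, and \<open>block_fibre_bound\<close> turns
  one step from there back into \<open>block i\<close>.\<close>

lemma near_invariance_nn:
 assumes [measurable]: "\<Psi> \<in> borel_measurable borel"
  and lip: "\<And>\<o> x x'. \<Psi> (\<o>, x) \<le> \<Psi> (\<o>, x') + ennreal (\<Lambda> * dist x x')" and \<Lambda>: "\<Lambda> \<ge> 0"
 shows "(\<Sum>j<d. ennreal (mass j) * (\<integral>\<^sup>+p. \<Psi> (F p) \<partial>block j))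
  \<le> ennreal (exp ((a + D) * \<kappa>)) * (\<Sum>i<d. ennreal (mass i) * ((\<integral>\<^sup>+p. \<Psi> p \<partial>block i) + ennreal (\<Lambda> * (L * \<kappa>))))"
proof -
 define e where "e = ennreal (exp ((a + D) * \<kappa>))"
 define W where "W i j = ennreal (weight i j)" for i j
 define c where "c i = ennreal (mass i / measure haar (cell i))" for i
 define S where "S i y = (\<integral>\<^sup>+\<o>. indicator (cell i) \<o> * \<Psi> (F (\<o>, y)) \<partial>haar)" for i y
 have Sm [measurable]: "S i \<in> borel_measurable borel" for i unfolding S_def by measurable
 have one: "ennreal (mass j) * (\<integral>\<^sup>+p. \<Psi> (F p) \<partial>block j) \<le> (\<Sum>i<d. e * (c i * (W i j * (\<integral>\<^sup>+y. S i y \<partial>\<xi> j))))"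
  if j: "j < d" for j
 proof -
  note [measurable_cong] = prob_measuresD(2)[OF xi_prob[OF j]]
  note [measurable] = kern_measurable[OF j]
  have k0: "0 \<le> mass j" "0 \<le> kern j \<o>" for \<o> using cell_mass_pos[OF j] kern_pos[OF j, of \<o>] by simp_all
  have "(\<integral>\<^sup>+\<o>. ennreal (kern j \<o>) * \<Psi> (F (\<o>, y)) \<partial>haar) = (\<Sum>i<d. \<integral>\<^sup>+\<o>. indicator (cell i) \<o> * (ennreal (kern j \<o>) * \<Psi> (F (\<o>, y))) \<partial>haar)" for y
   by (rule nn_integral_cells) measurable
  then have "ennreal (mass j) * (\<integral>\<^sup>+p. \<Psi> (F p) \<partial>block j)
    = ennreal (mass j) * (\<integral>\<^sup>+y. (\<Sum>i<d. \<integral>\<^sup>+\<o>. indicator (cell i) \<o> * (ennreal (kern j \<o>) * \<Psi> (F (\<o>, y))) \<partial>haar) \<partial>\<xi> j)"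
   by (subst nn_integral_block[OF j]) simp_all
  also have "\<dots> = (\<integral>\<^sup>+y. (\<Sum>i<d. ennreal (mass j) * (\<integral>\<^sup>+\<o>. indicator (cell i) \<o> * (ennreal (kern j \<o>) * \<Psi> (F (\<o>, y))) \<partial>haar)) \<partial>\<xi> j)"
   by (simp add: nn_integral_cmult[symmetric] sum_distrib_left)
  also have "\<dots> \<le> (\<integral>\<^sup>+y. (\<Sum>i<d. e * (c i * (W i j * S i y))) \<partial>\<xi> j)"
  proof (intro nn_integral_mono sum_mono)
   fix y i assume "i \<in> {..<d}"
   then have i: "i < d" by simp
   have "ennreal (mass j) * (\<integral>\<^sup>+\<o>. indicator (cell i) \<o> * (ennreal (kern j \<o>) * \<Psi> (F (\<o>, y))) \<partial>haar)
     = (\<integral>\<^sup>+\<o>. ennreal (mass j) * (indicator (cell i) \<o> * (ennreal (kern j \<o>) * \<Psi> (F (\<o>, y)))) \<partial>haar)"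
    by (rule nn_integral_cmult[symmetric]) measurable
   also have "\<dots> \<le> (\<integral>\<^sup>+\<o>. (e * (c i * W i j)) * (indicator (cell i) \<o> * \<Psi> (F (\<o>, y))) \<partial>haar)"
   proof (rule nn_integral_mono)
    fix \<o>
    show "ennreal (mass j) * (indicator (cell i) \<o> * (ennreal (kern j \<o>) * \<Psi> (F (\<o>, y))))
      \<le> (e * (c i * W i j)) * (indicator (cell i) \<o> * \<Psi> (F (\<o>, y)))"
    proof (cases "\<o> \<in> cell i")
     case True
     have "ennreal (mass j) * ennreal (kern j \<o>) = ennreal (mass j * kern j \<o>)"
      using k0 by (simp add: ennreal_mult')
     also have "\<dots> \<le> ennreal (exp ((a + D) * \<kappa>) * (mass i / measure haar (cell i) * weight i j))"
      by (rule ennreal_leI[OF kern_le[OF i j True]])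
     also have "\<dots> = e * (c i * W i j)"
     proof -
      have "0 \<le> mass i / measure haar (cell i)" using cell_mass_pos[OF i] by simp
      then show ?thesis unfolding e_def c_def W_def by (simp only: ennreal_mult' exp_ge_zero)
     qed
     finally have "ennreal (mass j) * ennreal (kern j \<o>) * \<Psi> (F (\<o>, y)) \<le> e * (c i * W i j) * \<Psi> (F (\<o>, y))"
      by (rule mult_right_mono) simp
     then show ?thesis using True by (simp add: mult.assoc)
    qed simp
   qed
   also have "\<dots> = (e * (c i * W i j)) * S i y" unfolding S_def by (rule nn_integral_cmult) measurable
   finally show "ennreal (mass j) * (\<integral>\<^sup>+\<o>. indicator (cell i) \<o> * (ennreal (kern j \<o>) * \<Psi> (F (\<o>, y))) \<partial>haar) \<le> e * (c i * (W i j * S i y))"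
    by (simp only: mult.assoc)
  qed
  also have "\<dots> = (\<Sum>i<d. e * (c i * (W i j * (\<integral>\<^sup>+y. S i y \<partial>\<xi> j))))"
   by (subst nn_integral_sum) (auto simp: nn_integral_cmult)
  finally show ?thesis .
 qed
 have "(\<Sum>j<d. ennreal (mass j) * (\<integral>\<^sup>+p. \<Psi> (F p) \<partial>block j)) \<le> (\<Sum>j<d. \<Sum>i<d. e * (c i * (W i j * (\<integral>\<^sup>+y. S i y \<partial>\<xi> j))))"
  by (rule sum_mono) (use one in simp)
 also have "\<dots> = (\<Sum>i<d. \<Sum>j<d. e * (c i * (W i j * (\<integral>\<^sup>+y. S i y \<partial>\<xi> j))))" by (rule sum.swap)
 \<comment> \<open>The fixed point equation recombines the images \<open>\<xi> j\<close> with
   weights \<open>W i j\<close> into \<open>\<eta> i\<close>.\<close>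
 also have "\<dots> = e * (\<Sum>i<d. c i * (\<integral>\<^sup>+x. S i x \<partial>\<eta> i))"
  unfolding sum_distrib_left
  by (rule sum.cong[OF refl]) (simp add: nn_integral_eta[OF _ Sm] W_def sum_distrib_left)
 also have "\<dots> \<le> e * (\<Sum>i<d. ennreal (mass i) * ((\<integral>\<^sup>+p. \<Psi> p \<partial>block i) + ennreal (\<Lambda> * (L * \<kappa>))))"
  unfolding c_def S_def using block_fibre_bound[OF _ assms]
  by (intro mult_left_mono sum_mono) simp_all
 finally show ?thesis by (simp add: e_def)
qed

end

end

section \<open>Convergence of the vertical marginals\<close>

lemma log_lipschitz_mono: "b \<le> b' ==> log_lipschitz b \<subseteq> (log_lipschitz b' :: ('a::metric_space => real) set)"
proof
 fix \<phi> :: "'a => real" assume b: "b \<le> b'" and \<phi>: "\<phi> \<in> log_lipschitz b"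
 have "\<phi> \<o> / \<phi> \<o>' \<le> exp (b' * dist \<o> \<o>')" for \<o> \<o>'
 proof -
  have "\<phi> \<o> / \<phi> \<o>' \<le> exp (b * dist \<o> \<o>')" using \<phi> by (simp add: log_lipschitz_def)
  also have "\<dots> \<le> exp (b' * dist \<o> \<o>')" using b by (simp add: mult_right_mono)
  finally show ?thesis .
 qed
 then show "\<phi> \<in> log_lipschitz b'" using \<phi> by (simp add: log_lipschitz_def)
qed

lemma Gamma_meas_mono:
 assumes l: "l \<le> l'" and b: "b \<le> b'"
 shows "Gamma_meas l b \<subseteq> (Gamma_meas l' b' :: ('m::finite torus \<times> 'b::metric_space) measure set)"
proof
 fix \<mu> :: "('m torus \<times> 'b) measure" assume \<mu>: "\<mu> \<in> Gamma_meas l b"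
 then obtain \<kappa> \<phi> where \<kappa>: "disintegration \<mu> \<kappa>"
  "\<And>\<o>\<^sub>1 \<o>\<^sub>2. wasserstein (\<kappa> \<o>\<^sub>1) (\<kappa> \<o>\<^sub>2) \<le> l * dist \<o>\<^sub>1 \<o>\<^sub>2"
  and \<phi>: "\<phi> \<in> log_lipschitz b" "distr \<mu> borel fst = density haar \<phi>" and P: "\<mu> \<in> prob_measures"
  by (auto simp: Gamma_meas_def)
 have "wasserstein (\<kappa> \<o>\<^sub>1) (\<kappa> \<o>\<^sub>2) \<le> l' * dist \<o>\<^sub>1 \<o>\<^sub>2" for \<o>\<^sub>1 \<o>\<^sub>2
 proof -
  have "l * dist \<o>\<^sub>1 \<o>\<^sub>2 \<le> l' * dist \<o>\<^sub>1 \<o>\<^sub>2" using l by (rule mult_right_mono) simp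
  then show ?thesis using \<kappa>(2)[of \<o>\<^sub>1 \<o>\<^sub>2] by linarith
 qed
 moreover have "\<phi> \<in> log_lipschitz b'" using \<phi>(1) log_lipschitz_mono[OF b] by blast
 ultimately show "\<mu> \<in> Gamma_meas l' b'" unfolding Gamma_meas_def using P \<kappa>(1) \<phi>(2) by blast
qed

lemma integral_vertical_marginal:
 fixes \<mu> :: "('a::second_countable_topology \<times> 'b::second_countable_topology) measure" and \<psi> :: "'b => real"
 assumes \<mu>: "\<mu> \<in> prob_measures" and \<psi>: "\<psi> \<in> borel_measurable borel"
 shows "vertical_marginal \<mu> \<in> prob_measures" "(\<integral>x. \<psi> x \<partial>vertical_marginal \<mu>) = (\<integral>p. \<psi> (snd p) \<partial>\<mu>)"
proof -
 have snd: "snd \<in> borel_measurable (borel :: ('a \<times> 'b) measure)" unfolding borel_prod[symmetric] by (rule measurable_snd)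
 show "vertical_marginal \<mu> \<in> prob_measures" unfolding vertical_marginal_def by (rule distr_prob_measures[OF \<mu> snd])
 show "(\<integral>x. \<psi> x \<partial>vertical_marginal \<mu>) = (\<integral>p. \<psi> (snd p) \<partial>\<mu>)"
  unfolding vertical_marginal_def by (rule integral_distr_prob[OF \<mu> snd \<psi>])
qed

context skew_system
begin

definition reg_const :: "real => real => real" where "reg_const l b = 1 + l + (a + b) * exp (a + b)"

definition step_error :: "real => real => real" where "step_error Cr \<Lambda> = Cr * (1 + L * \<Lambda>) + L * \<Lambda>"

text \<open>The number \<open>lo\<close> depends neither on \<open>k\<close> nor on \<mu>: after
  \<open>T\<close> steps \<open>avg_op\<close> has made the test nearly constant, so all measures of
  the class give it nearly the same integral at every time from \<open>T\<close> on.\<close>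

lemma contraction_estimate:
 assumes ac: "acip_density g \<rho>" and \<delta>: "0 < \<delta>" "\<delta> \<le> 1"
  and half: "ball_mass TYPE('m) \<delta> / 2 \<le> ball_mass TYPE('m) (\<delta> - CARD('m) / \<sigma>)"
  and tv: "tv_contracting C lam \<rho> f" and n: "n \<ge> 1" and Cn: "C * lam ^ n \<le> 1/2"
  and l: "l \<ge> 0" and b: "b \<ge> 0"
  and \<psi>: "\<psi> \<in> borel_measurable borel" "\<And>x. 0 \<le> \<psi> x" "\<And>x. \<psi> x \<le> 1"
  and lip: "\<And>x x'. \<bar>\<psi> x - \<psi> x'\<bar> \<le> \<Lambda> * dist x x'" and \<Lambda>: "\<Lambda> \<ge> 0" "\<Lambda> * max 1 L ^ T \<le> \<Lambda>s" and T: "T = Suc n * j"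
 obtains lo where "\<And>k \<mu>. \<mu> \<in> Gamma_meas l b ==> lo - T * (step_error (reg_const l b) \<Lambda>s * \<delta>) \<le> (\<integral>p. \<psi> (snd p) \<partial>push_iter F (k + T) \<mu>)"
  "\<And>k \<mu>. \<mu> \<in> Gamma_meas l b ==> (\<integral>p. \<psi> (snd p) \<partial>push_iter F (k + T) \<mu>) \<le> lo + (1 - minor_const n / 2) ^ j + T * (step_error (reg_const l b) \<Lambda>s * \<delta>)"
proof -
 define \<Psi> :: "'m torus \<times> 'n torus => real" where "\<Psi> = (\<lambda>p. \<psi> (snd p))"
 have \<Psi>: "\<Psi> \<in> borel_measurable borel" "\<And>p. 0 \<le> \<Psi> p" "\<And>p. \<Psi> p \<le> 1"
  unfolding \<Psi>_def using measurable_compose[OF measurable_snd_borel \<psi>(1)] \<psi>(2,3) by auto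
 have lip': "\<bar>\<Psi> (\<o>, x) - \<Psi> (\<o>, x')\<bar> \<le> \<Lambda> * dist x x'" for \<o> x x' using lip by (simp add: \<Psi>_def)
 obtain lo where lo: "\<And>p. lo \<le> (avg_op \<delta> ^^ T) \<Psi> p" "\<And>p. (avg_op \<delta> ^^ T) \<Psi> p \<le> lo + (1 - minor_const n / 2) ^ j"
  using avg_op_contraction_iter[OF ac \<delta>(1) half tv n Cn \<Psi>, of j] unfolding T by blast
 have Um: "(avg_op \<delta> ^^ T) \<Psi> \<in> borel_measurable borel" by (rule funpow_avg_op_bounds(1)[OF \<Psi> \<delta>(1)])
 have U01: "0 \<le> (avg_op \<delta> ^^ T) \<Psi> p" "(avg_op \<delta> ^^ T) \<Psi> p \<le> 1" for p by (rule funpow_avg_op_bounds(2,3)[OF \<Psi> \<delta>(1)])+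
 have C0: "reg_const l b \<ge> 0" unfolding reg_const_def using l b a_nonneg by simp
 have *: "lo - T * (step_error (reg_const l b) \<Lambda>s * \<delta>) \<le> (\<integral>p. \<psi> (snd p) \<partial>push_iter F (k + T) \<mu>) \<and>
  (\<integral>p. \<psi> (snd p) \<partial>push_iter F (k + T) \<mu>) \<le> lo + (1 - minor_const n / 2) ^ j + T * (step_error (reg_const l b) \<Lambda>s * \<delta>)"
  if \<mu>: "\<mu> \<in> Gamma_meas l b" for k \<mu>
 proof -
  have P: "\<mu> \<in> prob_measures" using \<mu> by (simp add: Gamma_meas_def)
  have reg: "regular (reg_const l b) (push_iter F k \<mu>)" for k
   unfolding reg_const_def by (rule Gamma_regular[OF \<mu> l b])
  have PP: "push_iter F k \<mu> \<in> prob_measures" by (rule push_iter_eq(3)[OF F_meas P])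
  have tel: "\<bar>(\<integral>p. \<Psi> p \<partial>push_iter F (k + T) \<mu>) - (\<integral>p. (avg_op \<delta> ^^ T) \<Psi> p \<partial>push_iter F k \<mu>)\<bar> \<le> T * (step_error (reg_const l b) \<Lambda>s * \<delta>)"
   unfolding step_error_def by (rule avg_op_telescope[OF P reg C0 \<delta> \<Psi> lip' \<Lambda>])
  have i: "integrable (push_iter F k \<mu>) ((avg_op \<delta> ^^ T) \<Psi>)"
   by (rule prob_measures_integrable[OF PP Um, of 1]) (use U01 in "simp add: abs_of_nonneg")
  have "lo \<le> (\<integral>p. (avg_op \<delta> ^^ T) \<Psi> p \<partial>push_iter F k \<mu>)"
   by (rule prob_integral_ge_const[OF prob_measuresD(1)[OF PP] i]) (rule lo(1))
  moreover have "(\<integral>p. (avg_op \<delta> ^^ T) \<Psi> p \<partial>push_iter F k \<mu>) \<le> lo + (1 - minor_const n / 2) ^ j"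
   by (rule prob_integral_le_const[OF prob_measuresD(1)[OF PP] i]) (rule lo(2))
  moreover have "(\<integral>p. \<psi> (snd p) \<partial>push_iter F (k + T) \<mu>) = (\<integral>p. \<Psi> p \<partial>push_iter F (k + T) \<mu>)" by (simp add: \<Psi>_def)
  ultimately show ?thesis using tel by linarith
 qed
 show thesis by (rule that[of lo]) (use * in blast)+
qed

end

context branch_system
begin

lemma kappa_nonneg: "0 \<le> \<kappa>"
proof -
 have "cell 0 \<noteq> {}" using haar_cell_pos[OF d_pos] by auto
 then obtain x where "x \<in> I 0" using cell_subset by blast
 then show ?thesis using diam[OF d_pos, of x x] by simp
qed

context
 fixes \<eta> :: "nat => 'n torus measure"
 assumes \<eta>: "L_fixed_point g \<rho> d I f \<eta>"
begin

text \<open>Integral against the mixture of the blocks, kept as an operation on functions.\<close>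

definition mean :: "('m torus \<times> 'n torus => real) => real" where
 "mean \<Psi> = (\<Sum>j<d. mass j * (\<integral>p. \<Psi> p \<partial>block \<eta> j))"

lemma nn_integral_block_real:
 assumes j: "j < d" and \<Psi>: "\<Psi> \<in> borel_measurable borel" "\<And>p. 0 \<le> \<Psi> p" "\<And>p. \<Psi> p \<le> 1"
 shows "(\<integral>\<^sup>+p. ennreal (\<Psi> p) \<partial>block \<eta> j) = ennreal (\<integral>p. \<Psi> p \<partial>block \<eta> j)" "0 \<le> (\<integral>p. \<Psi> p \<partial>block \<eta> j)"
  "integrable (block \<eta> j) \<Psi>"
proof -
 show i: "integrable (block \<eta> j) \<Psi>"
  by (rule prob_measures_integrable[OF block_prob[OF \<eta> j] \<Psi>(1), of 1]) (use \<Psi> in "simp add: abs_of_nonneg")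
 show "(\<integral>\<^sup>+p. ennreal (\<Psi> p) \<partial>block \<eta> j) = ennreal (\<integral>p. \<Psi> p \<partial>block \<eta> j)"
  by (rule nn_integral_eq_integral[OF i]) (simp add: \<Psi>)
 show "0 \<le> (\<integral>p. \<Psi> p \<partial>block \<eta> j)" by (rule Bochner_Integration.integral_nonneg) (rule \<Psi>(2))
qed

lemma mean_bounds:
 assumes "\<And>j. j < d ==> lo \<le> x j" "\<And>j. j < d ==> x j \<le> hi"
 shows "lo \<le> (\<Sum>j<d. mass j * x j)" "(\<Sum>j<d. mass j * x j) \<le> hi"
proof -
 have "(\<Sum>j<d. mass j * lo) \<le> (\<Sum>j<d. mass j * x j)"
  by (intro sum_mono mult_left_mono assms(1)) (auto intro: less_imp_le cell_mass_pos)
 then show "lo \<le> (\<Sum>j<d. mass j * x j)" by (simp add: sum_distrib_right[symmetric] sum_cell_mass)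
 have "(\<Sum>j<d. mass j * x j) \<le> (\<Sum>j<d. mass j * hi)"
  by (intro sum_mono mult_left_mono assms(2)) (auto intro: less_imp_le cell_mass_pos)
 then show "(\<Sum>j<d. mass j * x j) \<le> hi" by (simp add: sum_distrib_right[symmetric] sum_cell_mass)
qed

text \<open>The first part is the distortion loss in \<open>kernel_comparison\<close>, the second
  the decoupling cost of \<open>block_fibre_bound\<close>; both vanish as the cells shrink.\<close>

definition inv_error :: "real => real" where
 "inv_error \<Lambda> = exp ((a + D) * \<kappa>) - 1 + exp ((a + D) * \<kappa>) * (\<Lambda> * (L * \<kappa>))"

lemma near_invariance_le:
 assumes \<Psi>: "\<Psi> \<in> borel_measurable borel" "\<And>p. 0 \<le> \<Psi> p" "\<And>p. \<Psi> p \<le> 1"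
  and lip: "\<And>\<o> x x'. \<bar>\<Psi> (\<o>, x) - \<Psi> (\<o>, x')\<bar> \<le> \<Lambda> * dist x x'" and \<Lambda>: "\<Lambda> \<ge> 0"
 shows "mean (\<lambda>p. \<Psi> (F p)) \<le> mean \<Psi> + inv_error \<Lambda>"
proof -
 define c where "c = \<Lambda> * (L * \<kappa>)"
 define e where "e = exp ((a + D) * \<kappa>)"
 have c0: "0 \<le> c" unfolding c_def using \<Lambda> L_pos kappa_nonneg by simp
 have e1: "1 \<le> e" unfolding e_def using a_nonneg D_nonneg kappa_nonneg by simp
 have R: "0 \<le> mass j" if "j < d" for j using cell_mass_pos[OF that] by simp
 note [measurable] = \<Psi>(1)
 have \<Psi>F: "(\<lambda>p. \<Psi> (F p)) \<in> borel_measurable borel" by (rule measurable_compose[OF F_meas \<Psi>(1)])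
 have lip': "ennreal (\<Psi> (\<o>, x)) \<le> ennreal (\<Psi> (\<o>, x')) + ennreal (\<Lambda> * dist x x')" for \<o> x x'
 proof -
  have "\<Psi> (\<o>, x) \<le> \<Psi> (\<o>, x') + \<Lambda> * dist x x'" using lip[of \<o> x x'] by linarith
  then have "ennreal (\<Psi> (\<o>, x)) \<le> ennreal (\<Psi> (\<o>, x') + \<Lambda> * dist x x')" by (rule ennreal_leI)
  also have "\<dots> = ennreal (\<Psi> (\<o>, x')) + ennreal (\<Lambda> * dist x x')" using \<Psi>(2) \<Lambda> by (intro ennreal_plus) auto
  finally show ?thesis .
 qed
 have "(\<Sum>j<d. ennreal (mass j) * (\<integral>\<^sup>+p. ennreal (\<Psi> (F p)) \<partial>block \<eta> j))
  \<le> ennreal e * (\<Sum>j<d. ennreal (mass j) * ((\<integral>\<^sup>+p. ennreal (\<Psi> p) \<partial>block \<eta> j) + ennreal c))"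
  unfolding e_def c_def by (rule near_invariance_nn[OF \<eta>, of "\<lambda>p. ennreal (\<Psi> p)", OF _ lip' \<Lambda>]) measurable
 also have "(\<Sum>j<d. ennreal (mass j) * ((\<integral>\<^sup>+p. ennreal (\<Psi> p) \<partial>block \<eta> j) + ennreal c))
   = (\<Sum>j<d. ennreal (mass j * ((\<integral>p. \<Psi> p \<partial>block \<eta> j) + c)))"
 proof (rule sum.cong[OF refl])
  fix j assume "j \<in> {..<d}"
  then have j: "j < d" by simp
  show "ennreal (mass j) * ((\<integral>\<^sup>+p. ennreal (\<Psi> p) \<partial>block \<eta> j) + ennreal c) = ennreal (mass j * ((\<integral>p. \<Psi> p \<partial>block \<eta> j) + c))"
   using nn_integral_block_real[OF j \<Psi>] R[OF j] c0 by (simp add: ennreal_mult' ennreal_plus)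
 qed
 also have "(\<Sum>j<d. ennreal (mass j) * (\<integral>\<^sup>+p. ennreal (\<Psi> (F p)) \<partial>block \<eta> j)) = (\<Sum>j<d. ennreal (mass j * (\<integral>p. \<Psi> (F p) \<partial>block \<eta> j)))"
 proof (rule sum.cong[OF refl])
  fix j assume "j \<in> {..<d}"
  then have j: "j < d" by simp
  show "ennreal (mass j) * (\<integral>\<^sup>+p. ennreal (\<Psi> (F p)) \<partial>block \<eta> j) = ennreal (mass j * (\<integral>p. \<Psi> (F p) \<partial>block \<eta> j))"
   using nn_integral_block_real[OF j \<Psi>F] \<Psi> R[OF j] by (simp add: ennreal_mult')
 qed
 finally have le: "(\<Sum>j<d. ennreal (mass j * (\<integral>p. \<Psi> (F p) \<partial>block \<eta> j))) \<le> ennreal e * (\<Sum>j<d. ennreal (mass j * ((\<integral>p. \<Psi> p \<partial>block \<eta> j) + c)))" .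
 have n1: "0 \<le> mass j * (\<integral>p. \<Psi> (F p) \<partial>block \<eta> j)" "0 \<le> mass j * ((\<integral>p. \<Psi> p \<partial>block \<eta> j) + c)"
  if "j \<in> {..<d}" for j
  using R nn_integral_block_real(2)[OF _ \<Psi>, of j] nn_integral_block_real(2)[OF _ \<Psi>F, of j] \<Psi>(2,3) c0 that by auto
 have s: "(\<Sum>j<d. mass j * ((\<integral>p. \<Psi> p \<partial>block \<eta> j) + c)) = mean \<Psi> + c"
  by (simp add: mean_def distrib_left sum.distrib sum_distrib_right[symmetric] sum_cell_mass)
 have "0 \<le> (\<Sum>j<d. mass j * ((\<integral>p. \<Psi> p \<partial>block \<eta> j) + c))" by (rule sum_nonneg) (rule n1(2))
 moreover have "ennreal (mean (\<lambda>p. \<Psi> (F p))) \<le> ennreal (e * (mean \<Psi> + c))"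
 proof -
  have s1: "(\<Sum>j<d. ennreal (mass j * (\<integral>p. \<Psi> (F p) \<partial>block \<eta> j))) = ennreal (mean (\<lambda>p. \<Psi> (F p)))"
   unfolding mean_def by (rule sum_ennreal[OF n1(1)])
  have s2: "(\<Sum>j<d. ennreal (mass j * ((\<integral>p. \<Psi> p \<partial>block \<eta> j) + c))) = ennreal (mean \<Psi> + c)"
   unfolding s[symmetric] by (rule sum_ennreal[OF n1(2)])
  show ?thesis using le unfolding s1 s2 using e1 by (simp add: ennreal_mult')
 qed
 ultimately have "mean (\<lambda>p. \<Psi> (F p)) \<le> e * (mean \<Psi> + c)"
  unfolding s using e1 by (subst (asm) ennreal_le_iff) auto
 moreover have b01: "0 \<le> (\<integral>p. \<Psi> p \<partial>block \<eta> j)" "(\<integral>p. \<Psi> p \<partial>block \<eta> j) \<le> 1" if j: "j < d" for j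
  by (rule nn_integral_block_real(2)[OF j \<Psi>])
   (rule prob_integral_le_const[OF prob_measuresD(1)[OF block_prob[OF \<eta> j]] nn_integral_block_real(3)[OF j \<Psi>] \<Psi>(3)])
 have "mean \<Psi> \<le> 1" unfolding mean_def by (rule mean_bounds(2)[OF b01])
 \<comment> \<open>Turns the multiplicative loss into an additive one.\<close>
 then have "(e - 1) * mean \<Psi> \<le> (e - 1) * 1" using e1 by (intro mult_left_mono) auto
 ultimately show ?thesis unfolding inv_error_def e_def[symmetric] c_def[symmetric] by (simp add: algebra_simps)
qed

text \<open>The opposite bound is the same inequality for \<open>1 - \<Psi>\<close>.\<close>

lemma near_invariance:
 assumes \<Psi>: "\<Psi> \<in> borel_measurable borel" "\<And>p. 0 \<le> \<Psi> p" "\<And>p. \<Psi> p \<le> 1"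
  and lip: "\<And>\<o> x x'. \<bar>\<Psi> (\<o>, x) - \<Psi> (\<o>, x')\<bar> \<le> \<Lambda> * dist x x'" and \<Lambda>: "\<Lambda> \<ge> 0"
 shows "\<bar>mean (\<lambda>p. \<Psi> (F p)) - mean \<Psi>\<bar> \<le> inv_error \<Lambda>"
proof -
 have compl: "mean (\<lambda>p. 1 - \<Phi> p) = 1 - mean \<Phi>" if \<Phi>: "\<Phi> \<in> borel_measurable borel" "\<And>p. 0 \<le> \<Phi> p" "\<And>p. \<Phi> p \<le> 1" for \<Phi>
 proof -
  have "(\<integral>p. 1 - \<Phi> p \<partial>block \<eta> j) = 1 - (\<integral>p. \<Phi> p \<partial>block \<eta> j)" if j: "j < d" for j
  proof -
   interpret prob_space "block \<eta> j" by (rule prob_measuresD(1)[OF block_prob[OF \<eta> j]])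
   show ?thesis using nn_integral_block_real(3)[OF j \<Phi>] prob_space by simp
  qed
  then have "mean (\<lambda>p. 1 - \<Phi> p) = (\<Sum>j<d. mass j * (1 - (\<integral>p. \<Phi> p \<partial>block \<eta> j)))" unfolding mean_def by simp
  also have "\<dots> = 1 - mean \<Phi>" by (simp add: mean_def right_diff_distrib sum_subtractf sum_cell_mass)
  finally show ?thesis .
 qed
 have \<Psi>F: "(\<lambda>p. \<Psi> (F p)) \<in> borel_measurable borel" by (rule measurable_compose[OF F_meas \<Psi>(1)])
 have "mean (\<lambda>p. 1 - \<Psi> (F p)) \<le> mean (\<lambda>p. 1 - \<Psi> p) + inv_error \<Lambda>"
  by (rule near_invariance_le[where \<Psi> = "\<lambda>p. 1 - \<Psi> p"]) (use \<Psi> lip \<Lambda> in "auto simp: abs_minus_commute")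
 then have "mean \<Psi> - inv_error \<Lambda> \<le> mean (\<lambda>p. \<Psi> (F p))"
  unfolding compl[OF \<Psi>] compl[OF \<Psi>F \<Psi>(2,3)] by linarith
 then show ?thesis using near_invariance_le[OF assms] by linarith
qed

text \<open>Composition with \<open>F\<close> multiplies the fibre Lipschitz constant by
  \<open>L\<close> and leaves measurability in the base untouched, so near-invariance can be applied
  \<open>T\<close> times under the common bound \<open>\<Lambda>s\<close>.\<close>

lemma near_invariance_iter:
 assumes "\<Psi> \<in> borel_measurable borel" "\<And>p. 0 \<le> \<Psi> p" "\<And>p. \<Psi> p \<le> 1"
  and "\<And>\<o> x x'. \<bar>\<Psi> (\<o>, x) - \<Psi> (\<o>, x')\<bar> \<le> \<Lambda> * dist x x'" and "\<Lambda> \<ge> 0" "\<Lambda> * max 1 L ^ T \<le> \<Lambda>s"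
 shows "\<bar>mean (\<lambda>p. \<Psi> ((F ^^ T) p)) - mean \<Psi>\<bar> \<le> T * inv_error \<Lambda>s"
 using assms
proof (induction T arbitrary: \<Psi> \<Lambda>)
 case (Suc T)
 note \<Psi> = Suc.prems(1-3) and lip = Suc.prems(4) and \<Lambda> = Suc.prems(5,6)
 have m1: "1 \<le> max 1 L ^ T" by (rule one_le_power) simp
 have "\<Lambda> * 1 \<le> \<Lambda> * (max 1 L * max 1 L ^ T)"
  using \<Lambda>(1) one_le_power[of "max 1 L" "Suc T"] by (intro mult_left_mono) auto
 then have \<Lambda>s: "\<Lambda> \<le> \<Lambda>s" using \<Lambda>(2) by simp
 have "\<bar>mean (\<lambda>p. \<Psi> (F p)) - mean \<Psi>\<bar> \<le> inv_error \<Lambda>" by (rule near_invariance[OF \<Psi> lip \<Lambda>(1)])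
 also have "\<dots> \<le> inv_error \<Lambda>s"
  unfolding inv_error_def using \<Lambda>s L_pos kappa_nonneg by (intro add_left_mono mult_left_mono mult_right_mono) auto
 finally have 1: "\<bar>mean (\<lambda>p. \<Psi> (F p)) - mean \<Psi>\<bar> \<le> inv_error \<Lambda>s" .
 have 2: "\<bar>mean (\<lambda>p. \<Psi> (F ((F ^^ T) p))) - mean (\<lambda>p. \<Psi> (F p))\<bar> \<le> T * inv_error \<Lambda>s"
 proof (rule Suc.IH[of "\<lambda>p. \<Psi> (F p)" "\<Lambda> * L"])
  show "(\<lambda>p. \<Psi> (F p)) \<in> borel_measurable borel" by (rule measurable_compose[OF F_meas \<Psi>(1)])
  show "0 \<le> \<Lambda> * L" using \<Lambda>(1) L_pos by simp
  have "\<Lambda> * L * max 1 L ^ T \<le> \<Lambda> * (max 1 L * max 1 L ^ T)"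
   unfolding mult.assoc using \<Lambda>(1) m1 by (intro mult_left_mono mult_right_mono) auto
  then show "\<Lambda> * L * max 1 L ^ T \<le> \<Lambda>s" using \<Lambda>(2) by simp
  fix \<o> x x'
  have "\<bar>\<Psi> (F (\<o>, x)) - \<Psi> (F (\<o>, x'))\<bar> \<le> \<Lambda> * dist (f (\<o>, x)) (f (\<o>, x'))"
   unfolding skew_product_def using lip by simp
  also have "\<dots> \<le> \<Lambda> * (L * dist x x')" by (intro mult_left_mono f_lip_snd \<Lambda>(1))
  finally show "\<bar>\<Psi> (F (\<o>, x)) - \<Psi> (F (\<o>, x'))\<bar> \<le> \<Lambda> * L * dist x x'" by (simp add: mult_ac)
 qed (rule \<Psi>)+
 have "(\<lambda>p. \<Psi> ((F ^^ Suc T) p)) = (\<lambda>p. \<Psi> (F ((F ^^ T) p)))" by simp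
 then show ?case using 1 2 by (simp add: distrib_right del: funpow.simps)
qed simp

text \<open>Insert the fixed point equation and exchange the sums: since the masses are stationary
  under the weights, the mixture of the \<open>\<eta> i\<close> equals the mixture of the
  \<open>\<xi> j\<close>, which are the fibre marginals of the blocks.\<close>

lemma fixed_point_marginal:
 shows "weighted_sum d mass \<eta> \<in> prob_measures"
  and "\<psi> \<in> borel_measurable borel ==> (\<And>x. 0 \<le> \<psi> x) ==> (\<And>x. \<psi> x \<le> 1) ==>
   (\<integral>x. \<psi> x \<partial>weighted_sum d mass \<eta>) = mean (\<lambda>p. \<psi> (snd p))"
proof -
 define W where "W = weighted_sum d mass \<eta>"
 have sW: "sets W = sets borel" unfolding W_def by (rule weighted_sum_facts(1)[OF d_pos eta_prob[OF \<eta>]])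
 have nn: "(\<integral>\<^sup>+x. q x \<partial>W) = (\<Sum>j<d. ennreal (mass j) * (\<integral>\<^sup>+p. q (snd p) \<partial>block \<eta> j))"
  if q [measurable]: "q \<in> borel_measurable borel" for q
 proof -
  have "(\<integral>\<^sup>+x. q x \<partial>W) = (\<Sum>i<d. ennreal (mass i) * (\<integral>\<^sup>+x. q x \<partial>\<eta> i))"
   unfolding W_def by (rule weighted_sum_facts(2)[OF d_pos eta_prob[OF \<eta>] q])
  also have "\<dots> = (\<Sum>i<d. \<Sum>j<d. ennreal (measure P (cell j \<inter> g -` cell i)) * (\<integral>\<^sup>+x. q x \<partial>cell_op \<rho> I f j (\<eta> j)))"
  proof (rule sum.cong[OF refl])
   fix i assume "i \<in> {..<d}"
   then have i: "i < d" by simp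
   have w: "ennreal (mass i) * ennreal (weight i j) = ennreal (measure P (cell j \<inter> g -` cell i))" if j: "j < d" for j
    using cell_mass_pos[OF i] unfolding cell_weight_eq[OF i j, symmetric] by (simp add: ennreal_mult')
   show "ennreal (mass i) * (\<integral>\<^sup>+x. q x \<partial>\<eta> i) = (\<Sum>j<d. ennreal (measure P (cell j \<inter> g -` cell i)) * (\<integral>\<^sup>+x. q x \<partial>cell_op \<rho> I f j (\<eta> j)))"
    unfolding nn_integral_eta[OF \<eta> i q] sum_distrib_left
    by (rule sum.cong[OF refl]) (simp add: mult.assoc[symmetric] w)
  qed
  also have "\<dots> = (\<Sum>j<d. \<Sum>i<d. ennreal (measure P (cell j \<inter> g -` cell i)) * (\<integral>\<^sup>+x. q x \<partial>cell_op \<rho> I f j (\<eta> j)))" by (rule sum.swap)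
  also have "\<dots> = (\<Sum>j<d. ennreal (mass j) * (\<integral>\<^sup>+p. q (snd p) \<partial>block \<eta> j))"
  proof (rule sum.cong[OF refl])
   fix j assume "j \<in> {..<d}"
   then have j: "j < d" by simp
   have V: "ennreal (1 / measure haar (cell j)) * ennreal (measure haar (cell j)) = 1"
    using haar_cell_pos[OF j] by (simp add: ennreal_mult'[symmetric])
   have k: "(\<integral>\<^sup>+\<o>. ennreal (kern j \<o>) * c \<partial>haar) = c" for c
    by (subst nn_integral_kern[OF j]) (simp_all add: nn_integral_multc haar.emeasure_eq_measure mult.assoc[symmetric] V)
   have "(\<integral>\<^sup>+p. q (snd p) \<partial>block \<eta> j) = (\<integral>\<^sup>+y. q y \<partial>cell_op \<rho> I f j (\<eta> j))"
    by (subst nn_integral_block[OF \<eta> j]) (simp_all add: k)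
   moreover have "(\<Sum>i<d. ennreal (measure P (cell j \<inter> g -` cell i))) = ennreal (mass j)"
    by (simp add: sum_transition[OF j])
   ultimately show "(\<Sum>i<d. ennreal (measure P (cell j \<inter> g -` cell i)) * (\<integral>\<^sup>+x. q x \<partial>cell_op \<rho> I f j (\<eta> j))) = ennreal (mass j) * (\<integral>\<^sup>+p. q (snd p) \<partial>block \<eta> j)"
    by (simp only: sum_distrib_right[symmetric])
  qed
  finally show ?thesis .
 qed
 have R: "0 \<le> mass j" if "j \<in> {..<d}" for j using cell_mass_pos[of j] that by simp
 have one: "emeasure W (space W) = 1"
 proof -
  have "emeasure W (space W) = (\<integral>\<^sup>+x. 1 \<partial>W)" by simp
  also have "\<dots> = (\<Sum>j<d. ennreal (mass j) * (\<integral>\<^sup>+p. 1 \<partial>block \<eta> j))" by (rule nn) simp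
  also have "\<dots> = (\<Sum>j<d. ennreal (mass j))"
   using prob_space.emeasure_space_1[OF prob_measuresD(1)[OF block_prob[OF \<eta>]]] by simp
  also have "\<dots> = ennreal (\<Sum>j<d. mass j)" by (rule sum_ennreal[OF R])
  also have "\<dots> = 1" by (simp add: sum_cell_mass)
  finally show ?thesis .
 qed
 then have PW: "W \<in> prob_measures" using sW by (simp add: prob_measures_def prob_spaceI)
 then show "weighted_sum d mass \<eta> \<in> prob_measures" by (simp add: W_def)
 assume \<psi>: "\<psi> \<in> borel_measurable borel" "\<And>x. 0 \<le> \<psi> x" "\<And>x. \<psi> x \<le> 1"
 have \<psi>s: "(\<lambda>p :: 'm torus \<times> 'n torus. \<psi> (snd p)) \<in> borel_measurable borel" by (rule measurable_compose[OF measurable_snd_borel \<psi>(1)])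
 note b = nn_integral_block_real[OF _ \<psi>s \<psi>(2,3)]
 have "integrable W \<psi>" by (rule prob_measures_integrable[OF PW \<psi>(1), of 1]) (use \<psi> in "simp add: abs_of_nonneg")
 then have "ennreal (\<integral>x. \<psi> x \<partial>W) = (\<integral>\<^sup>+x. ennreal (\<psi> x) \<partial>W)" using \<psi>(2) by (simp add: nn_integral_eq_integral)
 also have "\<dots> = (\<Sum>j<d. ennreal (mass j) * (\<integral>\<^sup>+p. ennreal (\<psi> (snd p)) \<partial>block \<eta> j))" by (rule nn) (use \<psi>(1) in measurable)
 also have "\<dots> = (\<Sum>j<d. ennreal (mass j * (\<integral>p. \<psi> (snd p) \<partial>block \<eta> j)))"
  by (rule sum.cong[OF refl]) (simp add: b R ennreal_mult')
 also have "\<dots> = ennreal (mean (\<lambda>p. \<psi> (snd p)))"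
  unfolding mean_def by (rule sum_ennreal) (use R b(2) in auto)
 finally have "ennreal (\<integral>x. \<psi> x \<partial>W) = ennreal (mean (\<lambda>p. \<psi> (snd p)))" .
 moreover have "0 \<le> (\<integral>x. \<psi> x \<partial>W)" by (rule Bochner_Integration.integral_nonneg) (rule \<psi>(2))
 moreover have "0 \<le> mean (\<lambda>p. \<psi> (snd p))" unfolding mean_def by (rule sum_nonneg) (use R b(2) in auto)
 ultimately show "(\<integral>x. \<psi> x \<partial>weighted_sum d mass \<eta>) = mean (\<lambda>p. \<psi> (snd p))" by (simp add: W_def)
qed

text \<open>Because \<open>b\<close> is at least \<open>D\<close>, the blocks belong to the class,
  so at time \<open>T\<close> their mean lies in the same short interval as the integral for \<mu>;
  near-invariance then brings the mean back to time 0, where it is the integral of the fixed point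
  marginal.\<close>

lemma marginal_near_fixed_point:
 assumes \<delta>: "0 < \<delta>" "\<delta> \<le> 1"
  and half: "ball_mass TYPE('m) \<delta> / 2 \<le> ball_mass TYPE('m) (\<delta> - CARD('m) / \<sigma>)"
  and tv: "tv_contracting C lam \<rho> f" and n: "n \<ge> 1" and Cn: "C * lam ^ n \<le> 1/2"
  and l: "l \<ge> 0" and b: "b \<ge> D"
  and \<psi>: "\<psi> \<in> borel_measurable borel" "\<And>x. 0 \<le> \<psi> x" "\<And>x. \<psi> x \<le> 1"
  and lip: "\<And>x x'. \<bar>\<psi> x - \<psi> x'\<bar> \<le> \<Lambda> * dist x x'" and \<Lambda>: "\<Lambda> \<ge> 0" "\<Lambda> * max 1 L ^ T \<le> \<Lambda>s" and T: "T = Suc n * j"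
  and \<mu>: "\<mu> \<in> Gamma_meas l b"
 shows "\<bar>(\<integral>x. \<psi> x \<partial>vertical_marginal (push_iter F (k + T) \<mu>)) - (\<integral>x. \<psi> x \<partial>weighted_sum d mass \<eta>)\<bar>
  \<le> (1 - minor_const n / 2) ^ j + 2 * (T * (step_error (reg_const l b) \<Lambda>s * \<delta>)) + T * inv_error \<Lambda>s"
proof -
 define e where "e = T * (step_error (reg_const l b) \<Lambda>s * \<delta>)"
 define s where "s = (1 - minor_const n / 2) ^ j"
 have b0: "b \<ge> 0" using b D_nonneg by simp
 obtain lo where lo: "\<And>k \<mu>. \<mu> \<in> Gamma_meas l b ==> lo - e \<le> (\<integral>p. \<psi> (snd p) \<partial>push_iter F (k + T) \<mu>)"
  "\<And>k \<mu>. \<mu> \<in> Gamma_meas l b ==> (\<integral>p. \<psi> (snd p) \<partial>push_iter F (k + T) \<mu>) \<le> lo + s + e"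
  unfolding e_def s_def by (rule contraction_estimate[OF ac \<delta> half tv n Cn l b0 \<psi> lip \<Lambda> T]) blast
 have bG: "block \<eta> j \<in> Gamma_meas l b" if "j < d" for j
  using block_Gamma[OF \<eta> that] Gamma_meas_mono[OF l b] by blast
 have \<psi>s: "(\<lambda>p :: 'm torus \<times> 'n torus. \<psi> (snd p)) \<in> borel_measurable borel" by (rule measurable_compose[OF measurable_snd_borel \<psi>(1)])
 have eq: "(\<integral>p. \<psi> (snd p) \<partial>push_iter F (0 + T) (block \<eta> j)) = (\<integral>p. \<psi> (snd ((F ^^ T) p)) \<partial>block \<eta> j)" if "j < d" for j
  unfolding push_iter_eq(1)[OF F_meas block_prob[OF \<eta> that]]
  using integral_distr_prob[OF block_prob[OF \<eta> that] push_iter_eq(2)[OF F_meas block_prob[OF \<eta> that]] \<psi>s] by simp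
 have lo0: "lo - e \<le> (\<integral>p. \<psi> (snd ((F ^^ T) p)) \<partial>block \<eta> j)" "(\<integral>p. \<psi> (snd ((F ^^ T) p)) \<partial>block \<eta> j) \<le> lo + s + e"
  if "j < d" for j
  unfolding eq[OF that, symmetric] by (rule lo(1)[OF bG[OF that]], rule lo(2)[OF bG[OF that]])
 have "lo - e \<le> mean (\<lambda>p. \<psi> (snd ((F ^^ T) p)))" "mean (\<lambda>p. \<psi> (snd ((F ^^ T) p))) \<le> lo + s + e"
  unfolding mean_def by (rule mean_bounds[OF lo0], assumption, assumption)+
 moreover have "\<bar>mean (\<lambda>p. \<psi> (snd ((F ^^ T) p))) - mean (\<lambda>p. \<psi> (snd p))\<bar> \<le> T * inv_error \<Lambda>s"
  by (rule near_invariance_iter[of "\<lambda>p. \<psi> (snd p)", OF \<psi>s \<psi>(2,3) _ \<Lambda>]) (simp add: lip)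
 moreover have "(\<integral>x. \<psi> x \<partial>weighted_sum d mass \<eta>) = mean (\<lambda>p. \<psi> (snd p))" by (rule fixed_point_marginal(2)[OF \<psi>])
 moreover have "(\<integral>x. \<psi> x \<partial>vertical_marginal (push_iter F (k + T) \<mu>)) = (\<integral>p. \<psi> (snd p) \<partial>push_iter F (k + T) \<mu>)"
  using \<mu> by (intro integral_vertical_marginal push_iter_eq(3) F_meas \<psi>(1)) (simp add: Gamma_meas_def)
 ultimately show ?thesis using lo(1)[OF \<mu>, of k] lo(2)[OF \<mu>, of k] unfolding e_def[symmetric] s_def[symmetric] by linarith
qed

end

end

section \<open>Choice of the constants\<close>

text \<open>The constant \<open>2 * D\<close> dominates \<open>a0_const D \<sigma>\<close> once
  \<sigma> is at least 2, so the abstract setting has parameters independent of \<sigma>.\<close>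

lemma system_of_maps:
 fixes g :: "'m::finite torus => 'm torus" and f :: "'m torus \<times> 'n::finite torus => 'n torus"
 assumes g: "torus_C2_local_diffeo g" and part: "full_branch_partition g d I" and ex: "expanding_map \<sigma> g"
  and bd: "bounded_distortion D g d I" and f: "L-lipschitz_on UNIV f"
  and D: "D > 0" and L: "L > 0" and \<sigma>: "\<sigma> \<ge> 2" "2 * L \<le> \<sigma>"
 shows "skew_system g \<sigma> (2 * D) f L"
  and "acip_density g \<rho> ==> (\<And>i. i < d ==> diameter (I i) \<le> \<kappa>) ==> branch_system g \<sigma> (2 * D) f L \<rho> d I D \<kappa>"
proof -
 obtain G where G: "torus_lift G g" "C2_local_diffeo G" using g unfolding torus_C2_local_diffeo_def by blast
 interpret diffeo_lift g G by unfold_locales (fact G)+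
 obtain H where H: "continuous_on UNIV H" "\<And>x. H (G x) = x" "\<And>y. G (H y) = y" by (rule homeomorphism_lift) blast
 interpret expanding_lift g G H \<sigma> by unfold_locales (fact H ex)+
 have a0: "a0_const D \<sigma> \<le> 2 * D"
 proof -
  have "1 / 2 \<le> 1 - inverse \<sigma>" using \<sigma>(1) by (simp add: field_simps)
  then have "D / (1 - inverse \<sigma>) \<le> D / (1 / 2)" using D by (intro divide_left_mono) auto
  then show ?thesis by (simp add: a0_const_def)
 qed
 show sk: "skew_system g \<sigma> (2 * D) f L"
 proof
  show "g \<in> borel_measurable borel" by (rule measurable_g)
  show "\<sigma> > 1" "0 \<le> 2 * D" using \<sigma> D by auto
  show "L-lipschitz_on UNIV f" "L > 0" "2 * L \<le> \<sigma>" by fact+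
  fix k and w :: "real ^ 'm"
  obtain \<theta> where \<theta>: "\<theta> \<in> borel_measurable borel" "\<And>\<o>. (g ^^ k) (\<theta> \<o>) = tshift w ((g ^^ k) \<o>)"
   "\<And>\<o> j. j \<le> k ==> dist ((g ^^ j) (\<theta> \<o>)) ((g ^^ j) \<o>) \<le> norm w / \<sigma> ^ (k - j)"
   "\<And>\<phi>. \<phi> \<in> borel_measurable borel ==>
    (\<integral>\<^sup>+\<o>. \<phi> (\<theta> \<o>) \<partial>haar) \<le> ennreal (exp (a0_const D \<sigma> * norm w)) * (\<integral>\<^sup>+\<o>. \<phi> \<o> \<partial>haar)"
   using lifted_rotation[OF ln_J_distortion[OF part bd] less_imp_le[OF D], of k w] D by auto
  have "ennreal (exp (a0_const D \<sigma> * norm w)) \<le> ennreal (exp (2 * D * norm w))"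
   using a0 by (intro ennreal_leI) (simp add: mult_right_mono)
  then have "(\<integral>\<^sup>+\<o>. \<phi> (\<theta> \<o>) \<partial>haar) \<le> ennreal (exp (2 * D * norm w)) * (\<integral>\<^sup>+\<o>. \<phi> \<o> \<partial>haar)"
   if "\<phi> \<in> borel_measurable borel" for \<phi>
   using \<theta>(4)[OF that] by (meson mult_right_mono order.trans zero_le)
  then show "\<exists>\<theta>. \<theta> \<in> borel_measurable borel \<and> (\<forall>\<o>. (g ^^ k) (\<theta> \<o>) = tshift w ((g ^^ k) \<o>)) \<and>
   (\<forall>\<o> j. j \<le> k \<longrightarrow> dist ((g ^^ j) (\<theta> \<o>)) ((g ^^ j) \<o>) \<le> norm w / \<sigma> ^ (k - j)) \<and>
   (\<forall>\<phi> \<in> borel_measurable borel.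
    (\<integral>\<^sup>+\<o>. \<phi> (\<theta> \<o>) \<partial>haar) \<le> ennreal (exp (2 * D * norm w)) * (\<integral>\<^sup>+\<o>. \<phi> \<o> \<partial>haar))"
   using \<theta>(1-3) by (intro exI[of _ \<theta>] conjI allI impI ballI) simp_all
 qed
 assume ac: "acip_density g \<rho>" and diam: "\<And>i. i < d ==> diameter (I i) \<le> \<kappa>"
 interpret skew_system g \<sigma> "2 * D" f L by (rule sk)
 show "branch_system g \<sigma> (2 * D) f L \<rho> d I D \<kappa>"
 proof
  show "acip_density g \<rho>" "full_branch_partition g d I" "bounded_distortion D g d I" by fact+
  show "0 \<le> D" using D by simp
  show "torus_jac g \<o> > 0" for \<o> by (rule torus_jac_pos)
  show "dist x y \<le> \<kappa>" if "i < d" "x \<in> I i" "y \<in> I i" for i x y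
  proof -
   have "bounded (I i)" using compact_imp_bounded[OF compact_UNIV_torus] bounded_subset by blast
   from diameter_bounded_bound[OF this that(2,3)] diam[OF that(1)] show ?thesis by linarith
  qed
 qed (rule inverse_branch_facts[OF part])
qed

text \<open>Places all classes \<open>Gamma_meas\<close> of the statement in one fixed class,
  whatever \<sigma>; both denominators are at least 1/2.\<close>

lemma l0_const_le:
 assumes D: "D > 0" and L: "L > 0" and c: "c\<^sub>1 \<ge> 0" and \<sigma>: "\<sigma> \<ge> 2" "2 * L \<le> \<sigma>"
 shows "a0_const D \<sigma> \<le> 2 * D" "l0_const c\<^sub>1 D L \<sigma> \<le> 1 + 2 * (exp (4 * D * c\<^sub>1) * (1 + D))"
proof -
 have i: "0 < inverse \<sigma>" "inverse \<sigma> \<le> 1 / 2" using \<sigma>(1) by (auto simp: field_simps)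
 have "D / (1 - inverse \<sigma>) \<le> D / (1 / 2)" using D i by (intro divide_left_mono) auto
 then show a0: "a0_const D \<sigma> \<le> 2 * D" by (simp add: a0_const_def)
 have a0p: "0 \<le> a0_const D \<sigma>" using D i by (simp add: a0_const_def)
 have "inverse \<sigma> * a0_const D \<sigma> \<le> (1 / 2) * (2 * D)" using i a0 a0p by (intro mult_mono) auto
 then have "(a0_const D \<sigma> + inverse \<sigma> * a0_const D \<sigma> + D) * c\<^sub>1 \<le> (4 * D) * c\<^sub>1"
  using a0 c by (intro mult_right_mono) auto
 then have Ca: "Ca_const c\<^sub>1 D \<sigma> (a0_const D \<sigma>) \<le> exp (4 * D * c\<^sub>1)" by (simp add: Ca_const_def)
 have iL: "inverse \<sigma> * L \<le> 1 / 2" using \<sigma> by (simp add: field_simps)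
 have iL0: "0 \<le> inverse \<sigma> * L" using i L by simp
 have Ca0: "0 \<le> Ca_const c\<^sub>1 D \<sigma> (a0_const D \<sigma>)" by (simp add: Ca_const_def)
 have "l0_const c\<^sub>1 D L \<sigma> \<le> (1 / 2 + exp (4 * D * c\<^sub>1) * (1 + D)) / (1 / 2)"
  unfolding l0_const_def using Ca Ca0 iL iL0 D
  by (intro frac_le add_mono mult_right_mono) auto
 then show "l0_const c\<^sub>1 D L \<sigma> \<le> 1 + 2 * (exp (4 * D * c\<^sub>1) * (1 + D))" by simp
qed

text \<open>A lower bound on the rate: over a bounded number of steps its powers stay away from 0,
  so the exponential term can absorb the diameter of the fibre.\<close>

lemma lambda_L_ge_half:
 assumes "c\<^sub>1 \<ge> 0" "D > 0" "\<sigma> \<ge> 2" "n\<^sub>0 > 1"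
 shows "1 / 2 \<le> lambda_L c\<^sub>1 D \<sigma> n\<^sub>0"
proof -
 have "0 < 1 - inverse \<sigma>" using assms(3) by (simp add: field_simps)
 then have "0 \<le> c\<^sub>1 * D * (3 / (1 - inverse \<sigma>) + 1)" using assms by (intro mult_nonneg_nonneg add_nonneg_nonneg) auto
 then have p: "0 \<le> p_const c\<^sub>1 D \<sigma>" "p_const c\<^sub>1 D \<sigma> \<le> 1" by (auto simp: p_const_def)
 define x where "x = 1 - 1/2 * p_const c\<^sub>1 D \<sigma> ^ n\<^sub>0"
 have "p_const c\<^sub>1 D \<sigma> ^ n\<^sub>0 \<le> 1" "0 \<le> p_const c\<^sub>1 D \<sigma> ^ n\<^sub>0" using p by (auto intro: power_le_one)
 then have x: "1 / 2 \<le> x" "x \<le> 1" by (auto simp: x_def)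
 have "x powr 1 \<le> x powr (1 / real n\<^sub>0)" using x assms(4) by (intro powr_mono') auto
 then show ?thesis unfolding lambda_L_def x_def[symmetric] using x by simp
qed

text \<open>A cell of a \<open>full_branch_partition\<close> may consist of scattered pieces, so
  expansion alone does not bound its diameter. Part (ii) states the bound
  \<open>K / \<sigma>\<close> explicitly, with \<open>K\<close> fixed before the other
  constants.\<close>

theorem proposition4p5:
  fixes D L C lam K \<epsilon> :: real and c\<^sub>1 :: real and n\<^sub>0 :: nat
  assumes "c\<^sub>1 = diameter (UNIV :: 'm::finite torus set)"
    and "D > 0" "L > 0" "C > 0" "0 < lam" "lam < 1"
    and "n\<^sub>0 > 1" "C * lam ^ (n\<^sub>0 - 1) \<le> 1/2"
    and "K > 0" "\<epsilon> > 0"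
  shows "\<exists>C\<^sub>2>0. \<exists>\<sigma>\<^sub>0>L. \<forall>\<sigma>>\<sigma>\<^sub>0.
    \<forall>(g :: 'm torus \<Rightarrow> 'm torus) (d :: nat) (I :: nat \<Rightarrow> 'm torus set)
      (\<rho> :: 'm torus \<Rightarrow> real) (f :: 'm torus \<times> 'n::finite torus \<Rightarrow> 'n torus).
      torus_C2_local_diffeo g \<and> full_branch_partition g d I \<and>
      expanding_map \<sigma> g \<and> bounded_distortion D g d I \<and> acip_density g \<rho> \<and>
      L-lipschitz_on UNIV f \<and> tv_contracting C lam \<rho> f
      \<longrightarrow>
      (\<forall>t. \<forall>\<mu>\<^sub>1 \<in> Gamma_meas (l0_const c\<^sub>1 D L \<sigma>) (a0_const D \<sigma>).
           \<forall>\<mu>\<^sub>2 \<in> Gamma_meas (l0_const c\<^sub>1 D L \<sigma>) (a0_const D \<sigma>).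
        wasserstein (vertical_marginal (push_iter (skew_product g f) t \<mu>\<^sub>1))
                    (vertical_marginal (push_iter (skew_product g f) t \<mu>\<^sub>2))
          \<le> C\<^sub>2 * lambda_L c\<^sub>1 D \<sigma> n\<^sub>0 ^ t + \<epsilon>)
      \<and>
      ((\<forall>i<d. diameter (I i) \<le> K / \<sigma>) \<longrightarrow>
        (\<forall>\<eta>. L_fixed_point g \<rho> d I f \<eta> \<longrightarrow>
          (\<forall>t. \<forall>\<mu> \<in> Gamma_meas (l0_const c\<^sub>1 D L \<sigma>) (a0_const D \<sigma>).
            wasserstein (vertical_marginal (push_iter (skew_product g f) t \<mu>))
                        (weighted_sum d (cell_mass \<rho> I) \<eta>)
              \<le> C\<^sub>2 * lambda_L c\<^sub>1 D \<sigma> n\<^sub>0 ^ t + \<epsilon>)))"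
proof -
 \<comment> \<open>The minorization uses \<open>n\<close> steps of \<open>koop\<close> and
   \<open>n + 1\<close> steps of \<open>avg_op\<close>.\<close>
 define n where "n = n\<^sub>0 - 1"
 have n: "n \<ge> 1" and Cn: "C * lam ^ n \<le> 1/2" using assms by (auto simp: n_def)
 have c1: "c\<^sub>1 \<ge> 0" unfolding assms(1) by (rule diameter_ge_0[OF compact_imp_bounded[OF compact_UNIV_torus]])
 \<comment> \<open>\<open>q\<close> is \<open>minor_const n\<close> for \<open>a = 2 * D\<close>,
   written out before any system is available.\<close>
 define E where "E = exp (- (2 * D * CARD('m)))"
 define q where "q = E / 2 * (E / 2 * E) ^ n"
 have E: "0 < E" "E \<le> 1" using \<open>D > 0\<close> by (auto simp: E_def)
 have q0: "0 < q" using E by (simp add: q_def)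
 obtain \<eta>\<^sub>0 \<Lambda> :: real where \<eta>\<^sub>0: "\<eta>\<^sub>0 > 0" and \<Lambda>: "\<Lambda> \<ge> 0" and tests: "\<And>\<mu> \<nu> :: 'n torus measure. \<mu> \<in> prob_measures ==> \<nu> \<in> prob_measures ==>
   (\<And>\<psi> :: 'n torus => real. \<psi> \<in> borel_measurable borel ==> (\<And>x. 0 \<le> \<psi> x) ==> (\<And>x. \<psi> x \<le> 1) ==>
    (\<And>x y. \<bar>\<psi> x - \<psi> y\<bar> \<le> \<Lambda> * dist x y) ==> \<bar>(\<integral>x. \<psi> x \<partial>\<mu>) - (\<integral>x. \<psi> x \<partial>\<nu>)\<bar> \<le> \<eta>\<^sub>0) ==>
   wasserstein \<mu> \<nu> \<le> \<epsilon>"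
  by (rule wasserstein_le_lipschitz_tests[OF \<open>\<epsilon> > 0\<close>]) blast
 \<comment> \<open>The tolerance is divided into quarters: one for the remaining oscillation, one
   for the two telescoping errors, one for the defect of invariance in (ii).\<close>
 obtain j where j: "(1 - q / 2) ^ j < \<eta>\<^sub>0 / 4"
  using real_arch_pow_inv[of "\<eta>\<^sub>0 / 4" "1 - q / 2"] \<eta>\<^sub>0 q0 by auto
 define T where "T = Suc n * j"
 define \<Lambda>s where "\<Lambda>s = \<Lambda> * max 1 L ^ T"
 have \<Lambda>s: "0 \<le> \<Lambda>s" using \<Lambda> by (simp add: \<Lambda>s_def)
 define l where "l = 1 + 2 * (exp (4 * D * c\<^sub>1) * (1 + D))"
 define b where "b = 2 * D"
 have l0: "l \<ge> 0" and b0: "b \<ge> D" using \<open>D > 0\<close> by (auto simp: l_def b_def intro!: add_nonneg_nonneg mult_nonneg_nonneg)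
 define Cr where "Cr = 1 + l + (2 * D + b) * exp (2 * D + b)"
 define S where "S = Cr * (1 + L * \<Lambda>s) + L * \<Lambda>s"
 have S0: "S \<ge> 0"
  unfolding S_def Cr_def b_def using l0 \<open>D > 0\<close> \<open>L > 0\<close> \<Lambda>s by (intro add_nonneg_nonneg mult_nonneg_nonneg) auto
 \<comment> \<open>Keeps twice the telescoping error \<open>T * S * \<delta>\<close> below a quarter
   of the tolerance; the summand 1 guards against a zero denominator.\<close>
 define \<delta> where "\<delta> = min 1 (\<eta>\<^sub>0 / (8 * (T * S + 1)))"
 have TS: "0 \<le> T * S" using S0 by simp
 have \<delta>: "0 < \<delta>" "\<delta> \<le> 1" using \<eta>\<^sub>0 TS by (auto simp: \<delta>_def intro!: divide_pos_pos)
 have err: "2 * (T * (S * \<delta>)) \<le> \<eta>\<^sub>0 / 4"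
 proof -
  have "T * S * \<delta> \<le> (T * S + 1) * (\<eta>\<^sub>0 / (8 * (T * S + 1)))"
   using TS \<delta>(1) \<eta>\<^sub>0 by (intro mult_mono) (auto simp: \<delta>_def)
  also have "\<dots> = \<eta>\<^sub>0 / 8" using TS by (simp add: field_simps)
  finally show ?thesis by (simp add: mult.assoc)
 qed
 \<comment> \<open>The displacement \<open>CARD('m) / \<sigma>\<close> must not exceed
   \<open>s\<close> if the shrunken ball is to keep half of its mass.\<close>
 obtain s where s: "0 < s" "s < \<delta>" "ball_mass TYPE('m) (\<delta> - s) \<ge> ball_mass TYPE('m) \<delta> / 2"
  by (rule ball_mass_half[OF \<delta>(1), where 'm = 'm])
 \<comment> \<open>The total defect of invariance over \<open>T\<close> steps as a function of the
   cell diameter. It is continuous and vanishes at 0, so a small diameter meets the budget.\<close>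
 define h where "h \<kappa> = T * (exp ((2 * D + D) * \<kappa>) - 1 + exp ((2 * D + D) * \<kappa>) * (\<Lambda>s * (L * \<kappa>)))" for \<kappa> :: real
 have "isCont h 0" unfolding h_def by (intro continuous_intros)
 moreover have h0: "h 0 = 0" by (simp add: h_def)
 moreover have "\<eta>\<^sub>0 / 4 > 0" using \<eta>\<^sub>0 by simp
 ultimately have "\<exists>r>0. \<forall>\<kappa>. dist \<kappa> 0 < r \<longrightarrow> dist (h \<kappa>) (h 0) < \<eta>\<^sub>0 / 4"
  unfolding continuous_at_eps_delta by blast
 then obtain r where r: "r > 0" "\<And>\<kappa>. dist \<kappa> 0 < r ==> \<bar>h \<kappa>\<bar> < \<eta>\<^sub>0 / 4"
  unfolding h0 dist_real_def by auto
 \<comment> \<open>The entries secure, in turn, the bound on \<open>a0_const\<close>, the shadowing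
   of fibres, \<open>\<sigma>\<^sub>0 > L\<close>, the mass of the shrunken ball, and small
   cells.\<close>
 define \<sigma>\<^sub>0 where "\<sigma>\<^sub>0 = Max {2, 2 * L, L + 1, CARD('m) / s, K / r}"
 have \<sigma>\<^sub>0: "2 \<le> \<sigma>\<^sub>0" "2 * L \<le> \<sigma>\<^sub>0" "L + 1 \<le> \<sigma>\<^sub>0" "CARD('m) / s \<le> \<sigma>\<^sub>0" "K / r \<le> \<sigma>\<^sub>0"
  by (auto simp: \<sigma>\<^sub>0_def)
 \<comment> \<open>The powers of the rate are at least \<open>(1/2) ^ T\<close> before time
   \<open>T\<close>, so the factor \<open>2 ^ T\<close> lets the first term cover the diameter of
   the fibre torus.\<close>
 define C\<^sub>2 where "C\<^sub>2 = real CARD('n) * 2 ^ T"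
 have C\<^sub>2: "C\<^sub>2 > 0" by (simp add: C\<^sub>2_def)
 have \<sigma>\<^sub>0L: "\<sigma>\<^sub>0 > L" using \<sigma>\<^sub>0(3) by simp
 show ?thesis
 proof (rule exI[of _ C\<^sub>2], rule conjI[OF C\<^sub>2], rule exI[of _ \<sigma>\<^sub>0], rule conjI[OF \<sigma>\<^sub>0L], intro allI impI conjI ballI)
  fix \<sigma> and g :: "'m torus => 'm torus" and d I \<rho> and f :: "'m torus \<times> 'n torus => 'n torus"
  assume \<sigma>: "\<sigma> > \<sigma>\<^sub>0" and A: "torus_C2_local_diffeo g \<and> full_branch_partition g d I \<and>
   expanding_map \<sigma> g \<and> bounded_distortion D g d I \<and> acip_density g \<rho> \<and>
   L-lipschitz_on UNIV f \<and> tv_contracting C lam \<rho> f"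
  have g: "torus_C2_local_diffeo g" "full_branch_partition g d I" "expanding_map \<sigma> g" "bounded_distortion D g d I" "L-lipschitz_on UNIV f"
   and ac: "acip_density g \<rho>" and tv: "tv_contracting C lam \<rho> f" using A by blast+
  have \<sigma>2: "\<sigma> \<ge> 2" "2 * L \<le> \<sigma>" and \<sigma>pos: "\<sigma> > 0" using \<sigma> \<sigma>\<^sub>0 by linarith+
  interpret sk: skew_system g \<sigma> "2 * D" f L by (rule system_of_maps(1)[OF g \<open>D > 0\<close> \<open>L > 0\<close> \<sigma>2])
  have half: "ball_mass TYPE('m) \<delta> / 2 \<le> ball_mass TYPE('m) (\<delta> - CARD('m) / \<sigma>)"
  proof -
   have "CARD('m) / s < \<sigma>" using \<sigma> \<sigma>\<^sub>0(4) by linarith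
   then have "CARD('m) / \<sigma> \<le> s" using s(1) \<sigma>pos by (simp add: field_simps)
   then have "ball_mass TYPE('m) (\<delta> - s) \<le> ball_mass TYPE('m) (\<delta> - CARD('m) / \<sigma>)" by (intro ball_mass_mono) simp
   then show ?thesis using s(3) by linarith
  qed
  have sub: "Gamma_meas (l0_const c\<^sub>1 D L \<sigma>) (a0_const D \<sigma>) \<subseteq> (Gamma_meas l b :: ('m torus \<times> 'n torus) measure set)"
   unfolding l_def b_def by (rule Gamma_meas_mono[OF l0_const_le(2,1)[OF \<open>D > 0\<close> \<open>L > 0\<close> c1 \<sigma>2]])
  have mc: "sk.minor_const n = q" by (simp add: sk.minor_const_def[OF ac] q_def E_def)
  have rc: "sk.step_error (sk.reg_const l b) \<Lambda>s = S" by (simp add: sk.step_error_def sk.reg_const_def S_def Cr_def)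
  have Ts: "\<Lambda> * max 1 L ^ T \<le> \<Lambda>s" by (simp add: \<Lambda>s_def)
  have lam: "1 / 2 \<le> lambda_L c\<^sub>1 D \<sigma> n\<^sub>0" by (rule lambda_L_ge_half[OF c1 \<open>D > 0\<close> \<sigma>2(1) \<open>n\<^sub>0 > 1\<close>])
  have lam_pos: "0 \<le> C\<^sub>2 * lambda_L c\<^sub>1 D \<sigma> n\<^sub>0 ^ t" for t using lam by (simp add: C\<^sub>2_def)
  have early: "CARD('n) \<le> C\<^sub>2 * lambda_L c\<^sub>1 D \<sigma> n\<^sub>0 ^ t" if "t < T" for t
  proof -
   have "(1 / 2) ^ T \<le> (1 / 2 :: real) ^ t" using that by (intro power_decreasing) auto
   also have "\<dots> \<le> lambda_L c\<^sub>1 D \<sigma> n\<^sub>0 ^ t" by (rule power_mono[OF lam]) simp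
   finally have "C\<^sub>2 * (1 / 2) ^ T \<le> C\<^sub>2 * lambda_L c\<^sub>1 D \<sigma> n\<^sub>0 ^ t" by (rule mult_left_mono) (simp add: C\<^sub>2_def)
   moreover have "C\<^sub>2 * (1 / 2) ^ T = CARD('n)" by (simp add: C\<^sub>2_def power_one_over)
   ultimately show ?thesis by simp
  qed
  have push: "vertical_marginal (push_iter (skew_product g f) t \<mu>) \<in> prob_measures"
   if "\<mu> \<in> Gamma_meas l b" for t and \<mu> :: "('m torus \<times> 'n torus) measure"
  proof -
   have "\<mu> \<in> prob_measures" using that by (simp add: Gamma_meas_def)
   then show ?thesis
    by (intro integral_vertical_marginal(1)[where \<psi> = "\<lambda>_. 0"] push_iter_eq(3) sk.F_meas) simp_all
  qed
  \<comment> \<open>Before time \<open>T\<close> the diameter bound suffices; from time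
    \<open>T\<close> on the Lipschitz tests give \<epsilon> without any help from the exponential
    term.\<close>
  have conclude: "wasserstein (vertical_marginal (push_iter (skew_product g f) t \<mu>)) \<nu> \<le> C\<^sub>2 * lambda_L c\<^sub>1 D \<sigma> n\<^sub>0 ^ t + \<epsilon>"
   if \<mu>: "\<mu> \<in> Gamma_meas l b" and \<nu>: "\<nu> \<in> prob_measures"
    and late: "\<And>k \<psi>. t = k + T ==> \<psi> \<in> borel_measurable borel ==> (\<And>x. 0 \<le> \<psi> x) ==> (\<And>x. \<psi> x \<le> 1) ==>
     (\<And>x y. \<bar>\<psi> x - \<psi> y\<bar> \<le> \<Lambda> * dist x y) ==>
     \<bar>(\<integral>x. \<psi> x \<partial>vertical_marginal (push_iter (skew_product g f) t \<mu>)) - (\<integral>x. \<psi> x \<partial>\<nu>)\<bar> \<le> \<eta>\<^sub>0"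
   for t \<mu> and \<nu> :: "'n torus measure"
  proof (cases "t < T")
   case True
   show ?thesis using wasserstein_le_card[OF push[OF \<mu>] \<nu>, of t] early[OF True] \<open>\<epsilon> > 0\<close> by linarith
  next
   case False
   then have "t = (t - T) + T" by simp
   then have "wasserstein (vertical_marginal (push_iter (skew_product g f) t \<mu>)) \<nu> \<le> \<epsilon>"
    by (intro tests push[OF \<mu>] \<nu> late)
   then show ?thesis using lam_pos[of t] by linarith
  qed
  {
   fix t and \<mu>\<^sub>1 \<mu>\<^sub>2 :: "('m torus \<times> 'n torus) measure"
   assume "\<mu>\<^sub>1 \<in> Gamma_meas (l0_const c\<^sub>1 D L \<sigma>) (a0_const D \<sigma>)" "\<mu>\<^sub>2 \<in> Gamma_meas (l0_const c\<^sub>1 D L \<sigma>) (a0_const D \<sigma>)"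
   then have \<mu>: "\<mu>\<^sub>1 \<in> Gamma_meas l b" "\<mu>\<^sub>2 \<in> Gamma_meas l b" using sub by blast+
   show "wasserstein (vertical_marginal (push_iter (skew_product g f) t \<mu>\<^sub>1)) (vertical_marginal (push_iter (skew_product g f) t \<mu>\<^sub>2))
     \<le> C\<^sub>2 * lambda_L c\<^sub>1 D \<sigma> n\<^sub>0 ^ t + \<epsilon>"
   proof (rule conclude[OF \<mu>(1) push[OF \<mu>(2)]])
    fix k and \<psi> :: "'n torus => real"
    assume t: "t = k + T" and \<psi>: "\<psi> \<in> borel_measurable borel" "\<And>x. 0 \<le> \<psi> x" "\<And>x. \<psi> x \<le> 1"
     and lip: "\<And>x y. \<bar>\<psi> x - \<psi> y\<bar> \<le> \<Lambda> * dist x y"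
    have b00: "0 \<le> b" using \<open>D > 0\<close> by (simp add: b_def)
    obtain lo where lo: "\<And>k \<mu>. \<mu> \<in> Gamma_meas l b ==> lo - T * (S * \<delta>) \<le> (\<integral>p. \<psi> (snd p) \<partial>push_iter (skew_product g f) (k + T) \<mu>)"
     "\<And>k \<mu>. \<mu> \<in> Gamma_meas l b ==> (\<integral>p. \<psi> (snd p) \<partial>push_iter (skew_product g f) (k + T) \<mu>) \<le> lo + (1 - q / 2) ^ j + T * (S * \<delta>)"
     by (rule sk.contraction_estimate[OF ac \<delta> half tv n Cn l0 b00 \<psi> lip \<Lambda> Ts T_def, unfolded rc mc]) blast
    have e: "(\<integral>x. \<psi> x \<partial>vertical_marginal (push_iter (skew_product g f) t \<mu>)) = (\<integral>p. \<psi> (snd p) \<partial>push_iter (skew_product g f) (k + T) \<mu>)"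
     if "\<mu> \<in> Gamma_meas l b" for \<mu>
    proof -
     have "\<mu> \<in> prob_measures" using that by (simp add: Gamma_meas_def)
     then show ?thesis unfolding t by (intro integral_vertical_marginal(2) push_iter_eq(3) sk.F_meas \<psi>(1))
    qed
    show "\<bar>(\<integral>x. \<psi> x \<partial>vertical_marginal (push_iter (skew_product g f) t \<mu>\<^sub>1)) - (\<integral>x. \<psi> x \<partial>vertical_marginal (push_iter (skew_product g f) t \<mu>\<^sub>2))\<bar> \<le> \<eta>\<^sub>0"
     unfolding e[OF \<mu>(1)] e[OF \<mu>(2)]
     using lo(1)[OF \<mu>(1), of k] lo(2)[OF \<mu>(1), of k] lo(1)[OF \<mu>(2), of k] lo(2)[OF \<mu>(2), of k] err j \<eta>\<^sub>0 by linarith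
   qed
  next
   fix \<eta> t and \<mu> :: "('m torus \<times> 'n torus) measure"
   assume dm: "\<forall>i<d. diameter (I i) \<le> K / \<sigma>" and \<eta>: "L_fixed_point g \<rho> d I f \<eta>"
    and "\<mu> \<in> Gamma_meas (l0_const c\<^sub>1 D L \<sigma>) (a0_const D \<sigma>)"
   then have \<mu>: "\<mu> \<in> Gamma_meas l b" using sub by blast
   interpret br: branch_system g \<sigma> "2 * D" f L \<rho> d I D "K / \<sigma>"
    by (rule system_of_maps(2)[OF g \<open>D > 0\<close> \<open>L > 0\<close> \<sigma>2 ac]) (use dm in blast)
   have "K / r < \<sigma>" using \<sigma> \<sigma>\<^sub>0(5) by linarith
   then have "dist (K / \<sigma>) 0 < r" using r(1) \<sigma>pos \<open>K > 0\<close> by (simp add: field_simps)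
   from r(2)[OF this] have "h (K / \<sigma>) < \<eta>\<^sub>0 / 4" by linarith
   moreover have "h (K / \<sigma>) = T * br.inv_error \<Lambda>s" by (simp only: h_def br.inv_error_def[OF \<eta>])
   ultimately have ie: "T * br.inv_error \<Lambda>s < \<eta>\<^sub>0 / 4" by simp
   show "wasserstein (vertical_marginal (push_iter (skew_product g f) t \<mu>)) (weighted_sum d (cell_mass \<rho> I) \<eta>)
     \<le> C\<^sub>2 * lambda_L c\<^sub>1 D \<sigma> n\<^sub>0 ^ t + \<epsilon>"
   proof (rule conclude[OF \<mu> br.fixed_point_marginal(1)[OF \<eta>]])
    fix k and \<psi> :: "'n torus => real"
    assume t: "t = k + T" and \<psi>: "\<psi> \<in> borel_measurable borel" "\<And>x. 0 \<le> \<psi> x" "\<And>x. \<psi> x \<le> 1"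
     and lip: "\<And>x y. \<bar>\<psi> x - \<psi> y\<bar> \<le> \<Lambda> * dist x y"
    have "\<bar>(\<integral>x. \<psi> x \<partial>vertical_marginal (push_iter (skew_product g f) (k + T) \<mu>)) - (\<integral>x. \<psi> x \<partial>weighted_sum d (cell_mass \<rho> I) \<eta>)\<bar>
     \<le> (1 - q / 2) ^ j + 2 * (T * (S * \<delta>)) + T * br.inv_error \<Lambda>s"
     by (rule br.marginal_near_fixed_point[OF \<eta> \<delta> half tv n Cn l0 b0 \<psi> lip \<Lambda> Ts T_def \<mu>, unfolded rc mc])
    then show "\<bar>(\<integral>x. \<psi> x \<partial>vertical_marginal (push_iter (skew_product g f) t \<mu>)) - (\<integral>x. \<psi> x \<partial>weighted_sum d (cell_mass \<rho> I) \<eta>)\<bar> \<le> \<eta>\<^sub>0"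
     unfolding t using err j ie \<eta>\<^sub>0 by linarith
   qed
  }
 qed
qed



end
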